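(* Let $\mathcal{H}$ be an arrangement over $\mathbb{R}$, $\widetilde{\mathcal{H}}$ a simplification of $\mathcal{H}$, $\pi\colon L_{\widetilde{\mathcal{H}}}\to L_{\mathcal{H}}$ the canonical surjection of posets of flats, and $\mathcal{E}=\pi_*\mathcal{A}_{\widetilde{\mathcal{H}}}$, regarded as an $\mathcal{A}_{\mathcal{H}}$-module. Then for any flat $F$ of $\mathcal{H}$, we have the following three facts. (a) $\mathcal{E}(F,\partial F)$ is a free $\mathcal{A}_{\mathcal{H}}(F)$-module generated in degree $2\operatorname{rk}F$, with a natural basis in one-to-one correspondence with $\pi^{-1}(F)$. (b) The map $\overline{\mathcal{E}(F,\partial F)}\to\overline{\mathcal{E}(F)}$ is surjective in degree $2\operatorname{rk}F$ (the top nonzero degree). (c) There is an isomorphism $$\mathcal{E}\cong\bigoplus_{F\in L_{\mathcal{H}}}\overline{\mathcal{E}(F)}_{2\operatorname{rk}F}\otimes_{\mathbb{R}}\mathcal{L}_F,$$ where we consider $\overline{\mathcal{E}(F)}_{2\operatorname{rk}F}$ as a graded vector space concentrated in degree $2\operatorname{rk}F$.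
   Context: **Arrangements.** $I$ is a finite set and $V\subset\mathbb{R}^I$ is an affine subspace not contained in any translate of a coordinate subspace $\mathbb{R}^J$, $J\subsetneq I$. The arrangement $\mathcal{H}$ is the multiset of hyperplanes $H_i=V\cap\{x_i=0\}$, $i\in I$. A flat is a subset of $I$ of the form $\{i: x\in H_i\}$ with $x\in V$; $H_F=\bigcap_{i\in F}H_i$; $L_{\mathcal{H}}$ is the poset of flats ordered by inclusion; $\operatorname{rk}F=\operatorname{codim}_VH_F$. $V_0\subset\mathbb{R}^I$ is the linear subspace parallel to $V$, and $V(F)$ is the image of $V_0$ under $\mathbb{R}^I\to\mathbb{R}^F$. **Simplification.** $\mathcal{H}$ is simple if $|F|=\operatorname{codim}H_F$ for every flat $F$. A simplification $\widetilde{\mathcal{H}}$ of $\mathcal{H}$ is a simple arrangement defined by a translate $\widetilde V$ of $V$ in $\mathbb{R}^I$. The map $\pi\colon L_{\widetilde{\mathcal{H}}}\to L_{\mathcal{H}}$ takes each flat of $\widetilde{\mathcal{H}}$ to the minimal flat of $\mathcal{H}$ containing it; one has $\pi^*\mathcal{A}_{\mathcal{H}}=\mathcal{A}_{\widetilde{\mathcal{H}}}$, so $\pi_*$ takes $\mathcal{A}_{\widetilde{\mathcal{H}}}$-modules to $\mathcal{A}_{\mathcal{H}}$-modules. **Sheaves on posets.** A finite poset $P$ has the topology in which $U$ is open iff $y\le x\in U$ implies $y\in U$; $U_x=\{y\le x\}$, $\partial x=\{y<x\}$. A sheaf is given by $\mathcal{S}(x)=\mathcal{S}(U_x)$ and compatible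 maps $\mathcal{S}(y)\to\mathcal{S}(x)$ for $x\le y$; $\mathcal{S}(U)=\varprojlim_{x\in U}\mathcal{S}(x)$; $\mathcal{S}(x,\partial x)=\ker(\mathcal{S}(x)\to\mathcal{S}(\partial x))$. $\mathcal{A}_{\mathcal{H}}$ is the sheaf of graded rings on $L_{\mathcal{H}}$ with $\mathcal{A}_{\mathcal{H}}(F)=\operatorname{Sym}V(F)$ ($V(F)$ in degree 2), restrictions induced by $V(F)\to V(E)$, $E\le F$. For a graded module $M$ over $\operatorname{Sym}W$, $\overline{M}=M/WM$; here the bars are taken over $\mathcal{A}_{\mathcal{H}}(F)$. Modules are finitely generated and graded. An $\mathcal{A}$-module is pure if its stalks $\mathcal{M}(x)$ are free over $\mathcal{A}(x)$ and it is flabby (global sections surject onto sections over every open set). $\mathcal{L}_F$ is the minimal extension sheaf: the unique (up to isomorphism) indecomposable pure $\mathcal{A}_{\mathcal{H}}$-module with $\mathcal{L}_F(E)=0$ if $F\not\le E$ and $\mathcal{L}_F(F)\cong\mathcal{A}_{\mathcal{H}}(F)$.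
   Formalization: In (b), "the top nonzero degree" is stated as vanishing of the bar of E(F) in all degrees above 2 rk F; that bar can be zero in degree 2 rk F itself (e.g. one hyperplane {0} in the line R, with F that hyperplane), so non-vanishing there is not claimed. *)

theory Defs
  imports
    "HOL-Analysis.Analysis"
    "HOL-Algebra.Module"
    "HOL-Algebra.AbelCoset"
    "HOL-Algebra.Generated_Groups"
    "HOL-Algebra.Free_Abelian_Groups"
    "HOL-Library.Poly_Mapping"
    "HOL-Library.FuncSet"
begin

section \<open>Hyperplane arrangements\<close>

text \<open>
  For a finite index set \<open>I :: 'i set\<close> the space of real vectors indexed by \<open>I\<close> is the coordinate
  subspace \<open>coord_subspace I\<close> of \<open>real ^ 'i\<close>; carrying \<open>I\<close> along (instead of taking \<open>I = UNIV\<close>)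
  includes the case of an empty \<open>I\<close> and lets all the spaces \<open>V(F)\<close>, \<open>F \<subseteq> I\<close>, live in one type.
\<close>

definition coord_subspace :: "'i::finite set \<Rightarrow> (real ^ 'i) set" where
  "coord_subspace J = {x. \<forall>i. i \<notin> J \<longrightarrow> x $ i = 0}"

definition arrangement :: "'i::finite set \<Rightarrow> (real ^ 'i) set \<Rightarrow> bool" where
  "arrangement I V \<longleftrightarrow>
     affine V \<and> V \<noteq> {} \<and> V \<subseteq> coord_subspace I \<and>
     (\<forall>J a. J \<subset> I \<longrightarrow> a \<in> coord_subspace I \<longrightarrow> \<not> V \<subseteq> (+) a ` coord_subspace J)"

definition hyperplane :: "(real ^ 'i::finite) set \<Rightarrow> 'i \<Rightarrow> (real ^ 'i) set" where
  "hyperplane V i = V \<inter> {x. x $ i = 0}"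

definition flats :: "'i::finite set \<Rightarrow> (real ^ 'i) set \<Rightarrow> 'i set set" where
  "flats I V = {{i \<in> I. x \<in> hyperplane V i} | x. x \<in> V}"

definition flat_space :: "(real ^ 'i::finite) set \<Rightarrow> 'i set \<Rightarrow> (real ^ 'i) set" where
  "flat_space V F = V \<inter> (\<Inter>i\<in>F. hyperplane V i)"

definition rk :: "(real ^ 'i::finite) set \<Rightarrow> 'i set \<Rightarrow> int" where
  "rk V F = aff_dim V - aff_dim (flat_space V F)"

definition simple_arrangement :: "'i::finite set \<Rightarrow> (real ^ 'i) set \<Rightarrow> bool" where
  "simple_arrangement I V \<longleftrightarrow> arrangement I V \<and> (\<forall>F\<in>flats I V. int (card F) = rk V F)"

definition simplification :: "'i::finite set \<Rightarrow> (real ^ 'i) set \<Rightarrow> (real ^ 'i) set \<Rightarrow> bool" where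
  "simplification I V V' \<longleftrightarrow>
     (\<exists>a\<in>coord_subspace I. V' = (+) a ` V) \<and> simple_arrangement I V'"

text \<open>The map \<open>\<pi>\<close>; \<open>LEAST\<close> refers to inclusion of sets.\<close>

definition flat_closure :: "'i::finite set \<Rightarrow> (real ^ 'i) set \<Rightarrow> 'i set \<Rightarrow> 'i set" where
  "flat_closure I V G = (LEAST F. F \<in> flats I V \<and> G \<subseteq> F)"

definition direction :: "(real ^ 'i::finite) set \<Rightarrow> (real ^ 'i) set" where
  "direction V = {x - y | x y. x \<in> V \<and> y \<in> V}"

definition coord_proj :: "'i::finite set \<Rightarrow> real ^ 'i \<Rightarrow> real ^ 'i" where
  "coord_proj F x = (\<chi> i. if i \<in> F then x $ i else 0)"

definition local_space :: "(real ^ 'i::finite) set \<Rightarrow> 'i set \<Rightarrow> (real ^ 'i) set" where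
  "local_space V F = coord_proj F ` direction V"


section \<open>Graded rings and graded modules\<close>

text \<open>
  The fields \<open>mult\<close> and \<open>one\<close> of a module record play no role; they are left undefined in the
  modules constructed below.
\<close>

record 'a graded_ring = "'a ring" +
  rgr :: "int \<Rightarrow> 'a set"

record ('a, 'm) gr_module = "('a, 'm) module" +
  gr :: "int \<Rightarrow> 'm set"

definition graded_module :: "'a graded_ring \<Rightarrow> ('a, 'm) gr_module \<Rightarrow> bool" where
  "graded_module R M \<longleftrightarrow>
     Module.module R M \<and>
     (\<forall>d. additive_subgroup (gr M d) M) \<and>
     (\<forall>d e. \<forall>a\<in>rgr R d. \<forall>m\<in>gr M e. a \<odot>\<^bsub>M\<^esub> m \<in> gr M (d + e)) \<and>
     (\<forall>m\<in>carrier M. \<exists>!f. (\<forall>d. f d \<in> gr M d) \<and> finite {d. f d \<noteq> \<zero>\<^bsub>M\<^esub>} \<and>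
        m = (\<Oplus>\<^bsub>M\<^esub>d\<in>{d. f d \<noteq> \<zero>\<^bsub>M\<^esub>}. f d))"

definition finitely_generated :: "'a graded_ring \<Rightarrow> ('a, 'm) gr_module \<Rightarrow> bool" where
  "finitely_generated R M \<longleftrightarrow>
     (\<exists>B. finite B \<and> B \<subseteq> carrier M \<and>
        (\<forall>m\<in>carrier M. \<exists>c\<in>B \<rightarrow> carrier R. m = (\<Oplus>\<^bsub>M\<^esub>b\<in>B. c b \<odot>\<^bsub>M\<^esub> b)))"

definition is_basis :: "'a graded_ring \<Rightarrow> ('a, 'm) gr_module \<Rightarrow> 'm set \<Rightarrow> bool" where
  "is_basis R M B \<longleftrightarrow>
     B \<subseteq> carrier M \<and>
     (\<forall>m\<in>carrier M. \<exists>!c. c \<in> B \<rightarrow>\<^sub>E carrier R \<and> finite {b \<in> B. c b \<noteq> \<zero>\<^bsub>R\<^esub>} \<and>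
        m = (\<Oplus>\<^bsub>M\<^esub>b\<in>{b \<in> B. c b \<noteq> \<zero>\<^bsub>R\<^esub>}. c b \<odot>\<^bsub>M\<^esub> b))"

text \<open>Free as a graded module: a direct sum of shifted copies of the ring.\<close>

definition free_graded :: "'a graded_ring \<Rightarrow> ('a, 'm) gr_module \<Rightarrow> bool" where
  "free_graded R M \<longleftrightarrow> (\<exists>B. is_basis R M B \<and> (\<forall>b\<in>B. \<exists>d. b \<in> gr M d))"

definition graded_iso ::
    "'a graded_ring \<Rightarrow> ('a, 'm) gr_module \<Rightarrow> ('a, 'n) gr_module \<Rightarrow> ('m \<Rightarrow> 'n) \<Rightarrow> bool" where
  "graded_iso R M N h \<longleftrightarrow>
     bij_betw h (carrier M) (carrier N) \<and>
     (\<forall>m\<in>carrier M. \<forall>n\<in>carrier M. h (m \<oplus>\<^bsub>M\<^esub> n) = h m \<oplus>\<^bsub>N\<^esub> h n) \<and>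
     (\<forall>a\<in>carrier R. \<forall>m\<in>carrier M. h (a \<odot>\<^bsub>M\<^esub> m) = a \<odot>\<^bsub>N\<^esub> h m) \<and>
     (\<forall>d. h ` gr M d = gr N d)"

definition ring_as_module :: "'a graded_ring \<Rightarrow> ('a, 'a) gr_module" where
  "ring_as_module R =
     \<lparr>carrier = carrier R, mult = undefined, one = undefined, ring.zero = \<zero>\<^bsub>R\<^esub>, add = add R,
      smult = mult R, gr = rgr R\<rparr>"

definition induced_module :: "('a, 'm) gr_module \<Rightarrow> 'm set \<Rightarrow> ('a, 'm) gr_module" where
  "induced_module M N = M\<lparr>carrier := N, gr := \<lambda>d. gr M d \<inter> N\<rparr>"

definition graded_submodule :: "'a graded_ring \<Rightarrow> ('a, 'm) gr_module \<Rightarrow> 'm set \<Rightarrow> bool" where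
  "graded_submodule R M N \<longleftrightarrow> N \<subseteq> carrier M \<and> graded_module R (induced_module M N)"

definition quotient_module :: "('a, 'm) gr_module \<Rightarrow> 'm set \<Rightarrow> ('a, 'm set) gr_module" where
  "quotient_module M N =
     \<lparr>carrier = a_rcosets\<^bsub>M\<^esub> N, mult = undefined, one = undefined, ring.zero = N, add = set_add M,
      smult = \<lambda>a X. (\<Union>x\<in>X. N +>\<^bsub>M\<^esub> (a \<odot>\<^bsub>M\<^esub> x)),
      gr = \<lambda>d. (\<lambda>m. N +>\<^bsub>M\<^esub> m) ` gr M d\<rparr>"


section \<open>Symmetric algebras\<close>

text \<open>
  The symmetric algebra of \<open>real ^ 'i\<close> is the polynomial ring in variables indexed by \<open>'i\<close>. For a
  linear subspace \<open>W\<close>, the algebra map from Sym \<open>W\<close> into it is injective (\<open>W\<close> has a linear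
  complement), so Sym \<open>W\<close> is the subalgebra generated by the linear forms from \<open>W\<close>.
\<close>

type_synonym 'i mpoly = "('i \<Rightarrow>\<^sub>0 nat) \<Rightarrow>\<^sub>0 real"

definition const_poly :: "real \<Rightarrow> 'i mpoly" where
  "const_poly r = Poly_Mapping.single 0 r"

definition var_poly :: "'i \<Rightarrow> 'i mpoly" where
  "var_poly i = Poly_Mapping.single (Poly_Mapping.single i 1) 1"

definition linear_form :: "real ^ 'i::finite \<Rightarrow> 'i mpoly" where
  "linear_form w = (\<Sum>i\<in>UNIV. const_poly (w $ i) * var_poly i)"

inductive_set Sym :: "(real ^ 'i::finite) set \<Rightarrow> 'i mpoly set" for W where
  Sym_const: "const_poly r \<in> Sym W"
| Sym_linear: "w \<in> W \<Longrightarrow> linear_form w \<in> Sym W"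
| Sym_add: "p \<in> Sym W \<Longrightarrow> q \<in> Sym W \<Longrightarrow> p + q \<in> Sym W"
| Sym_mult: "p \<in> Sym W \<Longrightarrow> q \<in> Sym W \<Longrightarrow> p * q \<in> Sym W"

text \<open>Linear forms have degree 2.\<close>

definition Sym_degree :: "(real ^ 'i::finite) set \<Rightarrow> int \<Rightarrow> 'i mpoly set" where
  "Sym_degree W d =
     {p \<in> Sym W. \<forall>m\<in>Poly_Mapping.keys p. 2 * int (\<Sum>i\<in>UNIV. Poly_Mapping.lookup m i) = d}"

definition Sym_ring :: "(real ^ 'i::finite) set \<Rightarrow> 'i mpoly graded_ring" where
  "Sym_ring W =
     \<lparr>carrier = Sym W, mult = (*), one = 1, ring.zero = 0, add = (+), rgr = Sym_degree W\<rparr>"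

text \<open>
  The algebra map induced by the coordinate projection onto \<open>F\<close>: it kills the variables outside
  \<open>F\<close>.
\<close>

definition poly_proj :: "'i set \<Rightarrow> 'i mpoly \<Rightarrow> 'i mpoly" where
  "poly_proj F p =
     (\<Sum>m\<in>{m \<in> Poly_Mapping.keys p. Poly_Mapping.keys m \<subseteq> F}.
        Poly_Mapping.single m (Poly_Mapping.lookup p m))"

text \<open>For a module over \<open>Sym_ring W\<close>: the submodule \<open>W M\<close> and the quotient \<open>M / W M\<close>.\<close>

definition irrelevant_part ::
    "(real ^ 'i::finite) set \<Rightarrow> ('i mpoly, 'm) gr_module \<Rightarrow> 'm set" where
  "irrelevant_part W M =
     generate (add_monoid M) {linear_form w \<odot>\<^bsub>M\<^esub> m | w m. w \<in> W \<and> m \<in> carrier M}"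

definition bar :: "(real ^ 'i::finite) set \<Rightarrow> ('i mpoly, 'm) gr_module \<Rightarrow> ('i mpoly, 'm set) gr_module"
  where "bar W M = quotient_module M (irrelevant_part W M)"

text \<open>The map of bars induced by the inclusion of a submodule of \<open>M\<close>.\<close>

definition bar_inclusion ::
    "(real ^ 'i::finite) set \<Rightarrow> ('i mpoly, 'm) gr_module \<Rightarrow> 'm set \<Rightarrow> 'm set" where
  "bar_inclusion W M X = (\<Union>x\<in>X. irrelevant_part W M +>\<^bsub>M\<^esub> x)"


section \<open>Tensor products over the reals\<close>

definition degree_space :: "('i mpoly, 'm) gr_module \<Rightarrow> int \<Rightarrow> (real, 'm) module" where
  "degree_space M d =
     \<lparr>carrier = gr M d, mult = undefined, one = undefined, ring.zero = \<zero>\<^bsub>M\<^esub>, add = add M,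
      smult = \<lambda>r m. const_poly r \<odot>\<^bsub>M\<^esub> m\<rparr>"

definition tensor_relators ::
    "(real, 'w) module \<Rightarrow> ('i mpoly, 'm) gr_module \<Rightarrow> (('w \<times> 'm) \<Rightarrow>\<^sub>0 int) set" where
  "tensor_relators W M =
     {frag_of (w \<oplus>\<^bsub>W\<^esub> w', m) - frag_of (w, m) - frag_of (w', m) | w w' m.
        w \<in> carrier W \<and> w' \<in> carrier W \<and> m \<in> carrier M} \<union>
     {frag_of (w, m \<oplus>\<^bsub>M\<^esub> m') - frag_of (w, m) - frag_of (w, m') | w m m'.
        w \<in> carrier W \<and> m \<in> carrier M \<and> m' \<in> carrier M} \<union>
     {frag_of (r \<odot>\<^bsub>W\<^esub> w, m) - frag_of (w, const_poly r \<odot>\<^bsub>M\<^esub> m) | r w m.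
        w \<in> carrier W \<and> m \<in> carrier M}"

definition tensor_group ::
    "(real, 'w) module \<Rightarrow> ('i mpoly, 'm) gr_module \<Rightarrow> (('w \<times> 'm) \<Rightarrow>\<^sub>0 int) monoid" where
  "tensor_group W M = free_Abelian_group (carrier W \<times> carrier M)"

definition tensor_null ::
    "(real, 'w) module \<Rightarrow> ('i mpoly, 'm) gr_module \<Rightarrow> (('w \<times> 'm) \<Rightarrow>\<^sub>0 int) set" where
  "tensor_null W M = generate (tensor_group W M) (tensor_relators W M)"

text \<open>The map \<open>id \<otimes> h\<close> from \<open>W \<otimes> M\<close> (for any \<open>M\<close>) to \<open>W \<otimes> N\<close>.\<close>

definition tensor_map ::
    "(real, 'w) module \<Rightarrow> ('i mpoly, 'n) gr_module \<Rightarrow> ('m \<Rightarrow> 'n) \<Rightarrow>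
     (('w \<times> 'm) \<Rightarrow>\<^sub>0 int) set \<Rightarrow> (('w \<times> 'n) \<Rightarrow>\<^sub>0 int) set" where
  "tensor_map W N h X =
     (\<Union>c\<in>X. tensor_null W N #>\<^bsub>tensor_group W N\<^esub> frag_extend (\<lambda>(w, m). frag_of (w, h m)) c)"

text \<open>\<open>W \<otimes> M\<close> where the vector space \<open>W\<close> is concentrated in degree \<open>d\<close>.\<close>

definition tensor_module ::
    "int \<Rightarrow> (real, 'w) module \<Rightarrow> ('i mpoly, 'm) gr_module \<Rightarrow>
     ('i mpoly, (('w \<times> 'm) \<Rightarrow>\<^sub>0 int) set) gr_module" where
  "tensor_module d W M =
     \<lparr>carrier = rcosets\<^bsub>tensor_group W M\<^esub> (tensor_null W M),
      mult = undefined, one = undefined,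
      ring.zero = tensor_null W M,
      add = set_mult (tensor_group W M),
      smult = \<lambda>a. tensor_map W M (\<lambda>m. a \<odot>\<^bsub>M\<^esub> m),
      gr = \<lambda>e. (\<lambda>c. tensor_null W M #>\<^bsub>tensor_group W M\<^esub> c) `
        carrier (free_Abelian_group (carrier W \<times> gr M (e - d)))\<rparr>"


section \<open>Sheaves on finite posets\<close>

text \<open>
  The poset is a finite set \<open>P\<close> of elements of an ordered type. A sheaf is given by its stalks and,
  for \<open>y \<le> x\<close>, restriction maps from the stalk at \<open>x\<close> to the stalk at \<open>y\<close>; these are
  \<open>rres A x y\<close> for a sheaf of rings and \<open>res M x y\<close> for a sheaf of modules.
\<close>

record ('x, 'a) ring_sheaf =
  rstalk :: "'x \<Rightarrow> 'a graded_ring"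
  rres :: "'x \<Rightarrow> 'x \<Rightarrow> 'a \<Rightarrow> 'a"

record ('x, 'a, 'm) module_sheaf =
  stalk :: "'x \<Rightarrow> ('a, 'm) gr_module"
  res :: "'x \<Rightarrow> 'x \<Rightarrow> 'm \<Rightarrow> 'm"

definition sheaf_of_modules ::
    "'x::order set \<Rightarrow> ('x, 'a) ring_sheaf \<Rightarrow> ('x, 'a, 'm) module_sheaf \<Rightarrow> bool" where
  "sheaf_of_modules P A M \<longleftrightarrow>
     (\<forall>x\<in>P. graded_module (rstalk A x) (stalk M x) \<and> finitely_generated (rstalk A x) (stalk M x)) \<and>
     (\<forall>x\<in>P. \<forall>y\<in>P. y \<le> x \<longrightarrow>
        res M x y \<in> carrier (stalk M x) \<rightarrow> carrier (stalk M y) \<and>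
        (\<forall>m\<in>carrier (stalk M x). \<forall>n\<in>carrier (stalk M x).
           res M x y (m \<oplus>\<^bsub>stalk M x\<^esub> n) = res M x y m \<oplus>\<^bsub>stalk M y\<^esub> res M x y n) \<and>
        (\<forall>a\<in>carrier (rstalk A x). \<forall>m\<in>carrier (stalk M x).
           res M x y (a \<odot>\<^bsub>stalk M x\<^esub> m) = rres A x y a \<odot>\<^bsub>stalk M y\<^esub> res M x y m) \<and>
        (\<forall>d. res M x y ` gr (stalk M x) d \<subseteq> gr (stalk M y) d)) \<and>
     (\<forall>x\<in>P. \<forall>m\<in>carrier (stalk M x). res M x x m = m) \<and>
     (\<forall>x\<in>P. \<forall>y\<in>P. \<forall>z\<in>P. z \<le> y \<longrightarrow> y \<le> x \<longrightarrow>
        (\<forall>m\<in>carrier (stalk M x). res M y z (res M x y m) = res M x z m))"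

definition open_in :: "'x::order set \<Rightarrow> 'x set \<Rightarrow> bool" where
  "open_in P U \<longleftrightarrow> U \<subseteq> P \<and> (\<forall>x\<in>U. \<forall>y\<in>P. y \<le> x \<longrightarrow> y \<in> U)"

definition sections :: "('x::order, 'a, 'm) module_sheaf \<Rightarrow> 'x set \<Rightarrow> ('x \<Rightarrow> 'm) set" where
  "sections M U =
     {s \<in> (\<Pi>\<^sub>E x\<in>U. carrier (stalk M x)). \<forall>x\<in>U. \<forall>y\<in>U. y \<le> x \<longrightarrow> res M x y (s x) = s y}"

definition flabby :: "'x::order set \<Rightarrow> ('x, 'a, 'm) module_sheaf \<Rightarrow> bool" where
  "flabby P M \<longleftrightarrow> (\<forall>U. open_in P U \<longrightarrow> (\<lambda>s. restrict s U) ` sections M P = sections M U)"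

text \<open>\<open>M(x, \<partial>x)\<close>, the kernel of the map from \<open>M(x)\<close> to the limit of the \<open>M(y)\<close>, \<open>y < x\<close>.\<close>

definition rel_sections ::
    "'x::order set \<Rightarrow> ('x, 'a, 'm) module_sheaf \<Rightarrow> 'x \<Rightarrow> ('a, 'm) gr_module" where
  "rel_sections P M x =
     induced_module (stalk M x)
       {m \<in> carrier (stalk M x). \<forall>y\<in>P. y < x \<longrightarrow> res M x y m = \<zero>\<^bsub>stalk M y\<^esub>}"

text \<open>
  The sections over \<open>U\<close> as a module over a ring that acts on the stalk at \<open>x\<close> through the ring
  map \<open>\<phi> x\<close>.
\<close>

definition section_module ::
    "('x \<Rightarrow> 'r \<Rightarrow> 'a) \<Rightarrow> ('x::order, 'a, 'm) module_sheaf \<Rightarrow> 'x set \<Rightarrow> ('r, 'x \<Rightarrow> 'm) gr_module" where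
  "section_module \<phi> M U =
     \<lparr>carrier = sections M U, mult = undefined, one = undefined,
      ring.zero = (\<lambda>x\<in>U. \<zero>\<^bsub>stalk M x\<^esub>),
      add = (\<lambda>s t. \<lambda>x\<in>U. s x \<oplus>\<^bsub>stalk M x\<^esub> t x),
      smult = (\<lambda>a s. \<lambda>x\<in>U. \<phi> x a \<odot>\<^bsub>stalk M x\<^esub> s x),
      gr = (\<lambda>d. {s \<in> sections M U. \<forall>x\<in>U. s x \<in> gr (stalk M x) d})\<rparr>"

text \<open>
  Push-forward along \<open>\<pi>\<close> from the poset \<open>Q\<close>: the stalk at \<open>x\<close> is the module of sections over the
  preimage of \<open>U\<^sub>x\<close>. The ring map \<open>\<phi> x q\<close>, defined for \<open>\<pi> q \<le> x\<close>, goes from the stalk at \<open>x\<close> of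
  the structure sheaf on the target to the stalk at \<open>q\<close> of the structure sheaf on \<open>Q\<close>.
\<close>

definition pushforward ::
    "'q::order set \<Rightarrow> ('q \<Rightarrow> 'x::order) \<Rightarrow> ('x \<Rightarrow> 'q \<Rightarrow> 'r \<Rightarrow> 'a) \<Rightarrow> ('q, 'a, 'm) module_sheaf \<Rightarrow>
     ('x, 'r, 'q \<Rightarrow> 'm) module_sheaf" where
  "pushforward Q \<pi> \<phi> M =
     \<lparr>stalk = (\<lambda>x. section_module (\<phi> x) M {q \<in> Q. \<pi> q \<le> x}),
      res = (\<lambda>x y s. restrict s {q \<in> Q. \<pi> q \<le> y})\<rparr>"

definition structure_module :: "('x, 'a) ring_sheaf \<Rightarrow> ('x, 'a, 'a) module_sheaf" where
  "structure_module A = \<lparr>stalk = \<lambda>x. ring_as_module (rstalk A x), res = rres A\<rparr>"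

definition sheaf_iso ::
    "'x::order set \<Rightarrow> ('x, 'a) ring_sheaf \<Rightarrow> ('x, 'a, 'm) module_sheaf \<Rightarrow>
     ('x, 'a, 'n) module_sheaf \<Rightarrow> bool" where
  "sheaf_iso P A M N \<longleftrightarrow>
     (\<exists>h. (\<forall>x\<in>P. graded_iso (rstalk A x) (stalk M x) (stalk N x) (h x)) \<and>
          (\<forall>x\<in>P. \<forall>y\<in>P. y \<le> x \<longrightarrow>
             (\<forall>m\<in>carrier (stalk M x). h y (res M x y m) = res N x y (h x m))))"

text \<open>Direct sum over a finite index set.\<close>

definition direct_sum ::
    "'j set \<Rightarrow> ('j \<Rightarrow> ('x, 'a, 'm) module_sheaf) \<Rightarrow> ('x, 'a, 'j \<Rightarrow> 'm) module_sheaf" where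
  "direct_sum J M =
     \<lparr>stalk = (\<lambda>x.
        \<lparr>carrier = (\<Pi>\<^sub>E j\<in>J. carrier (stalk (M j) x)), mult = undefined, one = undefined,
         ring.zero = (\<lambda>j\<in>J. \<zero>\<^bsub>stalk (M j) x\<^esub>),
         add = (\<lambda>s t. \<lambda>j\<in>J. s j \<oplus>\<^bsub>stalk (M j) x\<^esub> t j),
         smult = (\<lambda>a s. \<lambda>j\<in>J. a \<odot>\<^bsub>stalk (M j) x\<^esub> s j),
         gr = (\<lambda>d. \<Pi>\<^sub>E j\<in>J. gr (stalk (M j) x) d)\<rparr>),
      res = (\<lambda>x y s. \<lambda>j\<in>J. res (M j) x y (s j))\<rparr>"

definition tensor_sheaf ::
    "int \<Rightarrow> (real, 'w) module \<Rightarrow> ('x, 'i mpoly, 'm) module_sheaf \<Rightarrow>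
     ('x, 'i mpoly, (('w \<times> 'm) \<Rightarrow>\<^sub>0 int) set) module_sheaf" where
  "tensor_sheaf d W M =
     \<lparr>stalk = (\<lambda>x. tensor_module d W (stalk M x)),
      res = (\<lambda>x y. tensor_map W (stalk M y) (res M x y))\<rparr>"

definition subsheaf ::
    "'x::order set \<Rightarrow> ('x, 'a) ring_sheaf \<Rightarrow> ('x, 'a, 'm) module_sheaf \<Rightarrow> ('x \<Rightarrow> 'm set) \<Rightarrow> bool" where
  "subsheaf P A M N \<longleftrightarrow>
     (\<forall>x\<in>P. graded_submodule (rstalk A x) (stalk M x) (N x)) \<and>
     (\<forall>x\<in>P. \<forall>y\<in>P. y \<le> x \<longrightarrow> res M x y ` N x \<subseteq> N y)"

text \<open>Indecomposability refers to direct sum decompositions into graded submodule sheaves.\<close>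

definition indecomposable ::
    "'x::order set \<Rightarrow> ('x, 'a) ring_sheaf \<Rightarrow> ('x, 'a, 'm) module_sheaf \<Rightarrow> bool" where
  "indecomposable P A M \<longleftrightarrow>
     (\<exists>x\<in>P. carrier (stalk M x) \<noteq> {\<zero>\<^bsub>stalk M x\<^esub>}) \<and>
     (\<forall>N N'. subsheaf P A M N \<longrightarrow> subsheaf P A M N' \<longrightarrow>
        (\<forall>x\<in>P. N x \<inter> N' x = {\<zero>\<^bsub>stalk M x\<^esub>} \<and>
               N x <+>\<^bsub>stalk M x\<^esub> N' x = carrier (stalk M x)) \<longrightarrow>
        (\<forall>x\<in>P. N x = {\<zero>\<^bsub>stalk M x\<^esub>}) \<or> (\<forall>x\<in>P. N' x = {\<zero>\<^bsub>stalk M x\<^esub>}))"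

definition pure :: "'x::order set \<Rightarrow> ('x, 'a) ring_sheaf \<Rightarrow> ('x, 'a, 'm) module_sheaf \<Rightarrow> bool" where
  "pure P A M \<longleftrightarrow>
     sheaf_of_modules P A M \<and> (\<forall>x\<in>P. free_graded (rstalk A x) (stalk M x)) \<and> flabby P M"

definition minimal_extension_sheaf ::
    "'x::order set \<Rightarrow> ('x, 'a) ring_sheaf \<Rightarrow> 'x \<Rightarrow> ('x, 'a, 'm) module_sheaf \<Rightarrow> bool" where
  "minimal_extension_sheaf P A F L \<longleftrightarrow>
     pure P A L \<and> indecomposable P A L \<and>
     (\<forall>E\<in>P. \<not> F \<le> E \<longrightarrow> carrier (stalk L E) = {\<zero>\<^bsub>stalk L E\<^esub>}) \<and>
     (\<exists>h. graded_iso (rstalk A F) (stalk L F) (ring_as_module (rstalk A F)) h)"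


section \<open>The sheaves of an arrangement\<close>

definition arr_sheaf :: "(real ^ 'i::finite) set \<Rightarrow> ('i set, 'i mpoly) ring_sheaf" where
  "arr_sheaf V = \<lparr>rstalk = \<lambda>F. Sym_ring (local_space V F), rres = \<lambda>F E. poly_proj E\<rparr>"

text \<open>
  For a flat \<open>G\<close> of the simplification and a flat \<open>F\<close> with \<open>\<pi>(G) \<le> F\<close>, the ring \<open>Sym V(F)\<close> acts on
  the stalk at \<open>G\<close> through its restriction to \<open>Sym V(\<pi>(G))\<close> followed by the identification of
  \<open>Sym V(\<pi>(G))\<close> with \<open>Sym V(G)\<close> induced by the coordinate projection; as \<open>G \<subseteq> \<pi>(G) \<subseteq> F\<close>, the
  composite is \<open>poly_proj G\<close>.
\<close>

definition push_sheaf ::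
    "'i::finite set \<Rightarrow> (real ^ 'i) set \<Rightarrow> (real ^ 'i) set \<Rightarrow>
     ('i set, 'i mpoly, 'i set \<Rightarrow> 'i mpoly) module_sheaf" where
  "push_sheaf I V V' =
     pushforward (flats I V') (flat_closure I V) (\<lambda>F G. poly_proj G)
       (structure_module (arr_sheaf V'))"

text \<open>The fibre of \<open>\<pi>\<close> over \<open>F\<close>.\<close>

definition flat_fibre ::
    "'i::finite set \<Rightarrow> (real ^ 'i) set \<Rightarrow> (real ^ 'i) set \<Rightarrow> 'i set \<Rightarrow> 'i set set" where
  "flat_fibre I V V' F = {G \<in> flats I V'. flat_closure I V G = F}"

text \<open>
  The element of \<open>\<E>(F, \<partial>F)\<close> attached to a flat \<open>G\<close> in the fibre over \<open>F\<close>: on \<open>G\<close> it is the product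
  of the coordinates, which generates the polynomials in the coordinates of \<open>G\<close> that vanish on
  all proper subsets of \<open>G\<close>; on all other flats it is 0.
\<close>

definition fibre_element ::
    "'i::finite set \<Rightarrow> (real ^ 'i) set \<Rightarrow> (real ^ 'i) set \<Rightarrow> 'i set \<Rightarrow> 'i set \<Rightarrow>
     ('i set \<Rightarrow> 'i mpoly)" where
  "fibre_element I V V' F G =
     (\<lambda>G'\<in>{G' \<in> flats I V'. flat_closure I V G' \<le> F}. if G' = G then \<Prod>i\<in>G. var_poly i else 0)"

end

(*
  Over a flat F, the sections of the structure sheaf of the simplification are the polynomials all of
  whose monomials are supported on independent subsets of F. Deletion and contraction provide a basis
  of square-free monomials of this module over Sym V(F); their degrees are at most 2 rk F, and those of
  degree 2 rk F belong to the fibre of pi over F, whose monomials span the sections vanishing on the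
  boundary of F. Hence E is pure, and the top degree part of its reduced stalk at F lifts to sections
  that vanish on the boundary. As E is flabby, each such lift extends to a morphism from L_F to E.
  As L_F is indecomposable, Fitting's lemma shows that its sections vanishing on the boundary of a flat
  larger than F lie in the irrelevant part. By induction along the poset, a comparison of degrees and
  Nakayama's lemma, the sum of these morphisms is then an isomorphism on every stalk.
*)
theory Submission
  imports Defs "HOL-Library.Function_Algebras"
begin

section \<open>Polynomials\<close>

text \<open>The ring acting on E(F) is Sym V(F), whose generating linear forms need not be
  coordinates, whereas the module is described by monomials. The two fit together because V(F) maps
  onto R^G for every independent subset G of F: these forms are a linear system of parameters of the
  face ring of a matroid complex, and freeness with an explicit monomial basis is its Cohen-Macaulay
  property.

  The sheaves L_F are arbitrary solutions of their defining conditions, so minimality has to be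
  extracted from indecomposability. Fitting's lemma requires finite dimension, which is available
  only within one degree, and the exponents at which iterates stabilise may vary with the degree;
  the two summands are therefore described without a fixed exponent.

  Push-forwards, minimal extension sheaves and tensor products are records over unrelated types.
  Choosing homogeneous bases turns every stalk into a set of polynomial-valued functions, on which
  addition is that of the type. Both sides of the decomposition are parametrised by the same
  families of such functions, and the isomorphism passes through these.\<close>

lemma mpoly_induct [case_names single add]:
  fixes p :: "'a \<Rightarrow>\<^sub>0 'b::comm_monoid_add"
  assumes single: "\<And>m c. P (Poly_Mapping.single m c)"
    and add: "\<And>p q. P p \<Longrightarrow> P q \<Longrightarrow> P (p + q)"
  shows "P p"
proof -
  have P0: "P 0" using single[of undefined 0] by simp
  have "P (\<Sum>m\<in>S. Poly_Mapping.single m (Poly_Mapping.lookup p m))" if "finite S" for S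
    using that by induction (auto intro: assms P0)
  moreover have "p = (\<Sum>m\<in>Poly_Mapping.keys p. Poly_Mapping.single m (Poly_Mapping.lookup p m))"
    by (rule poly_mapping_eqI)
      (auto simp: lookup_sum lookup_single when_def in_keys_iff cong: if_cong)
  ultimately show ?thesis by (metis finite_keys)
qed

lemma keys_add_nat: "Poly_Mapping.keys (m + n :: 'a \<Rightarrow>\<^sub>0 nat) = Poly_Mapping.keys m \<union> Poly_Mapping.keys n"
  by (auto simp: in_keys_iff lookup_add)

section \<open>Truncation of polynomials by the supports of their monomials\<close>

definition trunc :: "'i set set \<Rightarrow> 'i mpoly \<Rightarrow> 'i mpoly" where
  "trunc C p = (\<Sum>m\<in>{m \<in> Poly_Mapping.keys p. Poly_Mapping.keys m \<in> C}.
     Poly_Mapping.single m (Poly_Mapping.lookup p m))"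

text \<open>For a simplicial complex \<open>C\<close> this is the span of the standard monomials of
  its face ring, and \<open>trunc C\<close> computes normal forms modulo the Stanley-Reisner ideal.
  No closure condition is imposed on \<open>C\<close>, so that differences of complexes are covered
  as well.\<close>

definition supported :: "'i set set \<Rightarrow> 'i mpoly set" where
  "supported C = {p. \<forall>m\<in>Poly_Mapping.keys p. Poly_Mapping.keys m \<in> C}"

lemma poly_proj_eq_trunc: "poly_proj F = trunc (Pow F)"
  by (rule ext) (simp add: poly_proj_def trunc_def)

lemma lookup_trunc:
  "Poly_Mapping.lookup (trunc C p) m = (if Poly_Mapping.keys m \<in> C then Poly_Mapping.lookup p m else 0)"
  unfolding trunc_def by (auto simp: lookup_sum lookup_single when_def in_keys_iff cong: if_cong)

lemma trunc_add: "trunc C (p + q) = trunc C p + trunc C q"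
  by (rule poly_mapping_eqI) (simp add: lookup_trunc lookup_add)

lemma trunc_diff: "trunc C (p - q) = trunc C p - trunc C q"
  by (rule poly_mapping_eqI) (simp add: lookup_trunc lookup_minus)

lemma trunc_zero [simp]: "trunc C 0 = 0"
  by (rule poly_mapping_eqI) (simp add: lookup_trunc)

lemma trunc_sum: "trunc C (sum f S) = (\<Sum>x\<in>S. trunc C (f x))"
  by (rule poly_mapping_eqI) (simp add: lookup_trunc lookup_sum)

lemma trunc_trunc: "trunc C (trunc D p) = trunc (C \<inter> D) p"
  by (rule poly_mapping_eqI) (simp add: lookup_trunc)

lemma trunc_single:
  "trunc C (Poly_Mapping.single m c) = (if Poly_Mapping.keys m \<in> C then Poly_Mapping.single m c else 0)"
  by (rule poly_mapping_eqI) (auto simp: lookup_trunc lookup_single when_def)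

lemma supported_iff_trunc: "p \<in> supported C \<longleftrightarrow> trunc C p = p"
  unfolding supported_def poly_mapping_eq_iff fun_eq_iff lookup_trunc
  by (auto simp: in_keys_iff)

lemma trunc_supported: "trunc C p \<in> supported C"
  by (simp add: supported_iff_trunc trunc_trunc)

lemma supported_zero [simp]: "0 \<in> supported C"
  by (simp add: supported_iff_trunc)

text \<open>The support of a product of monomials is the union of the supports, and a union lies in
  \<open>F\<close> exactly when both parts do. For a general family \<open>C\<close> only linearity
  of \<open>trunc C\<close> remains.\<close>

lemma trunc_Pow_mult: "trunc (Pow F) (p * q) = trunc (Pow F) p * trunc (Pow F) q"
proof (induction p rule: mpoly_induct)
  case (single m c)
  show ?case
  proof (induction q rule: mpoly_induct)
    case (single n d)
    show ?case by (auto simp: trunc_single mult_single keys_add_nat)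
  qed (simp add: distrib_left trunc_add)
qed (simp add: trunc_add distrib_right)

lemma trunc_Pow_const [simp]: "trunc (Pow F) (const_poly r) = const_poly r"
  by (simp add: const_poly_def trunc_single)

lemma trunc_one [simp]: "{} \<in> C \<Longrightarrow> trunc C 1 = 1"
  using trunc_single[of C 0 1] by simp

lemma linear_form_alt: "linear_form w = (\<Sum>i\<in>UNIV. Poly_Mapping.single (Poly_Mapping.single i 1) (w $ i))"
  by (simp add: linear_form_def const_poly_def var_poly_def mult_single)

lemma trunc_Pow_linear_form: "trunc (Pow F) (linear_form w) = linear_form (coord_proj F w)"
  unfolding linear_form_alt trunc_sum
  by (rule sum.cong) (auto simp: trunc_single coord_proj_def)

lemma linear_form_add: "linear_form (v + w) = linear_form v + linear_form w"
  by (simp add: linear_form_alt single_add sum.distrib)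

lemma const_poly_zero [simp]: "const_poly 0 = 0" and const_poly_one [simp]: "const_poly 1 = 1"
  by (simp_all add: const_poly_def)

lemma const_poly_add: "const_poly (a + b) = const_poly a + const_poly b"
  by (simp add: const_poly_def single_add)

lemma const_poly_mult: "const_poly (a * b) = const_poly a * const_poly b"
  by (simp add: const_poly_def mult_single)

lemma const_poly_uminus: "const_poly (- a) = - const_poly a"
  by (simp add: const_poly_def single_uminus)

lemma linear_form_scaleR: "linear_form (r *\<^sub>R w) = const_poly r * linear_form w"
  by (simp add: linear_form_def const_poly_mult sum_distrib_left mult.assoc)

lemma linear_form_zero [simp]: "linear_form 0 = 0"
  by (simp add: linear_form_alt)

lemma linear_form_sum: "linear_form (sum f S) = (\<Sum>x\<in>S. linear_form (f x))"
  by (induction S rule: infinite_finite_induct) (auto simp: linear_form_add)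

subsection \<open>Square-free monomials\<close>

definition sqfree_exp :: "'i set \<Rightarrow> 'i \<Rightarrow>\<^sub>0 nat" where
  "sqfree_exp G = (\<Sum>i\<in>G. Poly_Mapping.single i 1)"

abbreviation sqfree_mon :: "'i set \<Rightarrow> 'i mpoly" where
  "sqfree_mon G \<equiv> Poly_Mapping.single (sqfree_exp G) 1"

lemma lookup_sqfree_exp: "finite G \<Longrightarrow> Poly_Mapping.lookup (sqfree_exp G) i = (if i \<in> G then 1 else 0)"
  by (simp add: sqfree_exp_def lookup_sum lookup_single when_def cong: if_cong)

lemma keys_sqfree_exp [simp]: "finite G \<Longrightarrow> Poly_Mapping.keys (sqfree_exp G) = G"
  by (rule Set.set_eqI)
    (simp add: in_keys_iff lookup_sqfree_exp del: lookup_not_eq_zero_eq_in_keys)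

lemma prod_var_poly: "finite G \<Longrightarrow> (\<Prod>i\<in>G. var_poly i) = sqfree_mon G"
  by (induction G rule: finite_induct) (auto simp: sqfree_exp_def var_poly_def mult_single)

lemma sqfree_exp_insert: "finite G \<Longrightarrow> i \<notin> G \<Longrightarrow> sqfree_exp (insert i G) = sqfree_exp G + Poly_Mapping.single i 1"
  by (simp add: sqfree_exp_def add.commute)

lemma lookup_mult_single_add:
  fixes p :: "'i mpoly"
  shows "Poly_Mapping.lookup (p * Poly_Mapping.single n c) (m + n) = Poly_Mapping.lookup p m * c"
  by (induction p rule: mpoly_induct)
    (auto simp: mult_single lookup_single when_def lookup_add distrib_right)

lemma keys_mult_singleE:
  fixes p :: "'i mpoly"
  assumes "m \<in> Poly_Mapping.keys (p * Poly_Mapping.single n c)"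
  obtains m' where "m' \<in> Poly_Mapping.keys p" "m = m' + n"
  using keys_mult[of p "Poly_Mapping.single n c"] assms by (auto split: if_splits)

lemma mult_single_cancel:
  fixes p q :: "'i mpoly"
  assumes "p * Poly_Mapping.single n 1 = q * Poly_Mapping.single n 1"
  shows "p = q"
  using assms lookup_mult_single_add[of p n 1] lookup_mult_single_add[of q n 1]
  by (auto intro!: poly_mapping_eqI)

text \<open>A monomial times x_A has support at least \<open>A\<close>; since \<open>A\<close> is
  maximal in \<open>C\<close>, it survives only if its own support lies in \<open>A\<close>. On such
  a generator the action thus factors through the polynomial ring in the variables of
  \<open>A\<close>.\<close>

lemma trunc_mult_sqfree_mon:
  assumes "finite A" "A \<in> C" and "\<And>G. G \<in> C \<Longrightarrow> A \<subseteq> G \<Longrightarrow> G = A"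
  shows "trunc C (a * sqfree_mon A) = trunc (Pow A) a * sqfree_mon A"
proof (induction a rule: mpoly_induct)
  case (single m c)
  have "Poly_Mapping.keys m \<union> A \<in> C \<longleftrightarrow> Poly_Mapping.keys m \<subseteq> A"
    using assms by (metis sup.absorb2 sup.cobounded2 sup.cobounded1)
  then show ?case using assms by (auto simp: mult_single trunc_single keys_add_nat)
qed (simp add: distrib_right trunc_add)

text \<open>The hypothesis says that a monomial has support in \<open>C\<close> exactly when its
  product with x_i has support in \<open>D\<close>. This is the situation of a coloop i.\<close>

lemma trunc_mult_var:
  assumes "\<And>G. insert i G \<in> D \<longleftrightarrow> G \<in> C"
  shows "trunc D (p * Poly_Mapping.single (Poly_Mapping.single i 1) 1)
    = trunc C p * Poly_Mapping.single (Poly_Mapping.single i 1) 1"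
proof (induction p rule: mpoly_induct)
  case (single m c)
  show ?case using assms by (auto simp: mult_single trunc_single keys_add_nat)
qed (simp add: distrib_right trunc_add)

subsection \<open>Degrees\<close>

definition mdeg :: "('i::finite \<Rightarrow>\<^sub>0 nat) \<Rightarrow> int" where
  "mdeg m = 2 * int (\<Sum>i\<in>UNIV. Poly_Mapping.lookup m i)"

definition homog :: "int \<Rightarrow> 'i::finite mpoly \<Rightarrow> bool" where
  "homog d p \<longleftrightarrow> (\<forall>m\<in>Poly_Mapping.keys p. mdeg m = d)"

definition hcomp :: "int \<Rightarrow> 'i::finite mpoly \<Rightarrow> 'i mpoly" where
  "hcomp d p = (\<Sum>m\<in>{m \<in> Poly_Mapping.keys p. mdeg m = d}. Poly_Mapping.single m (Poly_Mapping.lookup p m))"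

lemma Sym_degree_eq: "Sym_degree W d = {p \<in> Sym W. homog d p}"
  by (simp add: Sym_degree_def homog_def mdeg_def)

lemma mdeg_add: "mdeg (m + n) = mdeg m + mdeg n"
  by (simp add: mdeg_def lookup_add sum.distrib)

lemma mdeg_nonneg: "mdeg m \<ge> 0"
  by (simp add: mdeg_def sum_nonneg)

lemma mdeg_eq_0_iff: "mdeg m = 0 \<longleftrightarrow> m = 0"
  by (auto simp: mdeg_def poly_mapping_eq_iff fun_eq_iff simp del: of_nat_sum)

lemma mdeg_single [simp]: "mdeg (Poly_Mapping.single i k) = 2 * int k"
  by (simp add: mdeg_def lookup_single when_def flip: of_nat_sum cong: if_cong)

lemma mdeg_sqfree_exp [simp]: "mdeg (sqfree_exp G) = 2 * int (card G)"
proof -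
  have "(\<Sum>i\<in>UNIV. if i \<in> G then 1 else 0) = card G"
    by (subst sum.inter_restrict[symmetric]) auto
  then show ?thesis by (simp add: mdeg_def lookup_sqfree_exp del: of_nat_sum)
qed

lemma finite_mdeg: "finite {m :: 'i::finite \<Rightarrow>\<^sub>0 nat. mdeg m = d}"
proof -
  have "Poly_Mapping.lookup ` {m :: 'i \<Rightarrow>\<^sub>0 nat. mdeg m = d} \<subseteq> (\<Pi>\<^sub>E i\<in>UNIV. {..nat d})"
  proof clarify
    fix m :: "'i \<Rightarrow>\<^sub>0 nat" assume "d = mdeg m"
    moreover have "Poly_Mapping.lookup m i \<le> (\<Sum>i\<in>UNIV. Poly_Mapping.lookup m i)" for i
      by (rule member_le_sum) auto
    ultimately show "Poly_Mapping.lookup m \<in> (\<Pi>\<^sub>E i\<in>UNIV. {..nat (mdeg m)})"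
      by (auto simp: mdeg_def le_nat_iff simp del: of_nat_sum)
        (smt (verit) of_nat_0_le_iff of_nat_mono)
  qed
  then have "finite (Poly_Mapping.lookup ` {m :: 'i \<Rightarrow>\<^sub>0 nat. mdeg m = d})"
    by (rule finite_subset) (intro finite_PiE; simp)
  then show ?thesis
    by (rule finite_imageD) (simp add: inj_on_def lookup_inject)
qed

lemma lookup_hcomp: "Poly_Mapping.lookup (hcomp d p) m = (if mdeg m = d then Poly_Mapping.lookup p m else 0)"
  unfolding hcomp_def by (auto simp: lookup_sum lookup_single when_def in_keys_iff cong: if_cong)

lemma hcomp_add: "hcomp d (p + q) = hcomp d p + hcomp d q"
  by (rule poly_mapping_eqI) (simp add: lookup_hcomp lookup_add)

lemma hcomp_zero [simp]: "hcomp d 0 = 0"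
  by (rule poly_mapping_eqI) (simp add: lookup_hcomp)

lemma hcomp_single: "hcomp d (Poly_Mapping.single m c) = (if mdeg m = d then Poly_Mapping.single m c else 0)"
  by (rule poly_mapping_eqI) (auto simp: lookup_hcomp lookup_single when_def)

lemma homog_iff_hcomp: "homog d p \<longleftrightarrow> hcomp d p = p"
  unfolding homog_def poly_mapping_eq_iff fun_eq_iff lookup_hcomp by (auto simp: in_keys_iff)

lemma hcomp_hcomp: "hcomp d (hcomp e p) = (if d = e then hcomp d p else 0)"
  by (rule poly_mapping_eqI) (auto simp: lookup_hcomp)

lemma homog_hcomp [simp]: "homog d (hcomp d p)"
  by (simp add: homog_iff_hcomp hcomp_hcomp)

lemma hcomp_homog: "homog d p \<Longrightarrow> hcomp e p = (if e = d then p else 0)"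
  by (metis homog_iff_hcomp hcomp_hcomp)

lemma homog_zero [simp]: "homog d 0"
  by (simp add: homog_iff_hcomp)

lemma homog_add: "homog d p \<Longrightarrow> homog d q \<Longrightarrow> homog d (p + q)"
  by (simp add: homog_iff_hcomp hcomp_add)

lemma homog_sum: "(\<And>x. x \<in> S \<Longrightarrow> homog d (f x)) \<Longrightarrow> homog d (sum f S)"
  by (induction S rule: infinite_finite_induct) (auto simp: homog_add)

lemma homog_mult: "homog d p \<Longrightarrow> homog e q \<Longrightarrow> homog (d + e) (p * q)"
  unfolding homog_def using keys_mult[of p q] by (fastforce simp: mdeg_add)

lemma homog_const [simp]: "homog 0 (const_poly r)"
  by (auto simp: homog_def const_poly_def mdeg_def split: if_splits)

lemma homog_one [simp]: "homog 0 1"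
  using homog_const[of 1] by simp

lemma homog_single: "homog (mdeg m) (Poly_Mapping.single m c)"
  by (auto simp: homog_def split: if_splits)

lemma homog_linear_form [simp]: "homog 2 (linear_form w)"
  unfolding linear_form_alt by (rule homog_sum) (metis homog_single mdeg_single mult.right_neutral of_nat_1)

lemma homog_trunc: "homog d p \<Longrightarrow> homog d (trunc C p)"
  unfolding homog_def by (auto simp: in_keys_iff lookup_trunc split: if_splits)

lemma hcomp_trunc: "hcomp d (trunc C p) = trunc C (hcomp d p)"
  by (rule poly_mapping_eqI) (auto simp: lookup_hcomp lookup_trunc)

lemma hcomp_mult_homog: "homog d a \<Longrightarrow> hcomp (d + e) (a * p) = a * hcomp e p"
proof (induction p rule: mpoly_induct)
  case (single m c)
  have h: "homog (d + mdeg m) (a * Poly_Mapping.single m c)"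
    using single by (simp add: homog_mult homog_single)
  show ?case using hcomp_homog[OF h] by (auto simp: hcomp_single)
qed (simp add: hcomp_add distrib_left)

lemma finite_hcomp_nonzero: "finite {d. hcomp d p \<noteq> 0}"
proof (rule finite_subset)
  have "hcomp d p = 0" if "d \<notin> mdeg ` Poly_Mapping.keys p" for d
  proof (rule poly_mapping_eqI)
    fix m show "Poly_Mapping.lookup (hcomp d p) m = Poly_Mapping.lookup 0 m"
      using that by (cases "m \<in> Poly_Mapping.keys p") (auto simp: lookup_hcomp in_keys_iff)
  qed
  then show "{d. hcomp d p \<noteq> 0} \<subseteq> mdeg ` Poly_Mapping.keys p" by blast
qed simp

lemma sum_hcomp: "finite D \<Longrightarrow> {d. hcomp d p \<noteq> 0} \<subseteq> D \<Longrightarrow> (\<Sum>d\<in>D. hcomp d p) = p"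
proof (rule poly_mapping_eqI)
  fix m assume D: "finite D" "{d. hcomp d p \<noteq> 0} \<subseteq> D"
  have "Poly_Mapping.lookup (\<Sum>d\<in>D. hcomp d p) m = (if mdeg m \<in> D then Poly_Mapping.lookup p m else 0)"
    using D(1) by (simp add: lookup_sum lookup_hcomp cong: if_cong)
  moreover have "Poly_Mapping.lookup p m = 0" if "mdeg m \<notin> D"
  proof -
    have "hcomp (mdeg m) p = 0" using D that by auto
    then show ?thesis by (metis lookup_hcomp lookup_zero)
  qed
  ultimately show "Poly_Mapping.lookup (\<Sum>d\<in>D. hcomp d p) m = Poly_Mapping.lookup p m" by auto
qed

abbreviation const_term :: "'i mpoly \<Rightarrow> real" where
  "const_term p \<equiv> Poly_Mapping.lookup p 0"

lemma homog_0_const: "homog 0 p \<Longrightarrow> p = const_poly (const_term p)"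
  unfolding homog_def const_poly_def
  by (rule poly_mapping_eqI) (auto simp: lookup_single when_def in_keys_iff mdeg_eq_0_iff)

lemma homog_neg: "homog d p \<Longrightarrow> d < 0 \<Longrightarrow> p = 0"
  unfolding homog_def using mdeg_nonneg keys_eq_empty by (metis equals0I linorder_not_less)

lemma const_term_homog: "homog d p \<Longrightarrow> d \<noteq> 0 \<Longrightarrow> const_term p = 0"
  unfolding homog_def by (metis in_keys_iff mdeg_eq_0_iff)

text \<open>Degrees are nonnegative, so a product of monomials is constant only if both factors are.
  The constant term is the residue map modulo the irrelevant ideal, used wherever a quotient by that
  ideal is computed.\<close>

lemma const_term_mult: 
  fixes p q :: "'i::finite mpoly"
  shows "const_term (p * q) = const_term p * const_term q"
proof (induction p rule: mpoly_induct)
  case (single m c)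
  show ?case
  proof (induction q rule: mpoly_induct)
    case (single n d)
    have "m + n = 0 \<longleftrightarrow> m = 0 \<and> n = 0"
      using mdeg_eq_0_iff[of m] mdeg_eq_0_iff[of n] mdeg_eq_0_iff[of "m+n"] mdeg_nonneg[of m] mdeg_nonneg[of n]
      by (auto simp: mdeg_add)
    then show ?case by (auto simp: mult_single lookup_single when_def)
  qed (simp add: distrib_left lookup_add)
qed (simp add: distrib_right lookup_add)

lemma const_term_const [simp]: "const_term (const_poly r) = r"
  by (simp add: const_poly_def)

subsection \<open>Symmetric algebras of subspaces\<close>

lemma Sym_0 [simp]: "0 \<in> Sym W" using Sym_const[of 0 W] by simp

lemma Sym_1 [simp]: "1 \<in> Sym W" using Sym_const[of 1 W] by simp

lemma Sym_uminus: "p \<in> Sym W \<Longrightarrow> - p \<in> Sym W"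
  using Sym_mult[OF Sym_const[of "-1" W]] by (simp add: const_poly_uminus)

lemma Sym_diff: "p \<in> Sym W \<Longrightarrow> q \<in> Sym W \<Longrightarrow> p - q \<in> Sym W"
  using Sym_add Sym_uminus by (metis add_uminus_conv_diff)

lemma Sym_sum: "(\<And>x. x \<in> S \<Longrightarrow> f x \<in> Sym W) \<Longrightarrow> sum f S \<in> Sym W"
  by (induction S rule: infinite_finite_induct) (auto intro: Sym_add)

inductive homog_sum_of :: "'i::finite mpoly set \<Rightarrow> 'i mpoly \<Rightarrow> bool" for S where
  homog_part: "p \<in> S \<Longrightarrow> homog d p \<Longrightarrow> homog_sum_of S p"
| homog_plus: "homog_sum_of S p \<Longrightarrow> homog_sum_of S q \<Longrightarrow> homog_sum_of S (p + q)"

text \<open>Constants and linear forms are homogeneous, and products of sums of homogeneous elements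
  are again such sums. A homogeneous component of such a sum is a partial sum, hence again in
  \<open>Sym W\<close>.\<close>

lemma Sym_hcomp:
  assumes "p \<in> Sym W"
  shows "hcomp d p \<in> Sym W"
proof -
  have mult: "homog_sum_of (Sym W) (p * q)" if p: "homog_sum_of (Sym W) p" and q: "homog_sum_of (Sym W) q" for p q
    using p
  proof induction
    case (homog_part p d)
    from q show ?case
    proof induction
      case (homog_part q e)
      then show ?case using \<open>p \<in> Sym W\<close> \<open>homog d p\<close>
        by (meson homog_mult Sym_mult homog_sum_of.homog_part)
    qed (simp add: distrib_left homog_sum_of.homog_plus)
  qed (simp add: distrib_right homog_sum_of.homog_plus)
  have "homog_sum_of (Sym W) p"
    using assms
  proof induction
    case (Sym_const r) show ?case by (rule homog_part[OF Sym.Sym_const homog_const])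
  next
    case (Sym_linear w) then show ?case by (intro homog_part[OF Sym.Sym_linear homog_linear_form])
  qed (auto intro: mult homog_plus)
  then show ?thesis
    by induction (auto simp: hcomp_homog hcomp_add Sym_add)
qed

lemma Sym_trunc_Pow: "p \<in> Sym W \<Longrightarrow> trunc (Pow F) p \<in> Sym (coord_proj F ` W)"
  by (induction rule: Sym.induct)
    (auto simp: trunc_add trunc_Pow_mult trunc_Pow_linear_form intro: Sym.intros)

lemma Sym_trunc_image: "trunc (Pow F) ` Sym W = Sym (coord_proj F ` W)"
proof
  show "Sym (coord_proj F ` W) \<subseteq> trunc (Pow F) ` Sym W"
  proof
    fix p assume "p \<in> Sym (coord_proj F ` W)"
    then show "p \<in> trunc (Pow F) ` Sym W"
    proof induction
      case (Sym_const r)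
      then show ?case by (metis Sym.Sym_const image_eqI trunc_Pow_const)
    next
      case (Sym_linear w)
      then show ?case by (metis (no_types, lifting) Sym.Sym_linear image_iff trunc_Pow_linear_form)
    next
      case (Sym_add p q)
      then show ?case by (smt (verit) Sym.Sym_add image_iff trunc_add)
    next
      case (Sym_mult p q)
      then show ?case by (smt (verit) Sym.Sym_mult image_iff trunc_Pow_mult)
    qed
  qed
qed (auto intro: Sym_trunc_Pow)

text \<open>The unit vectors in the subspace give the variables indexed by \<open>A\<close>, and
  monomials are products of these; conversely the generators involve no other variables.\<close>

lemma Sym_coord_subspace: "Sym (coord_subspace A) = supported (Pow A)"
proof
  have *: "trunc (Pow A) p = p" if "p \<in> Sym (coord_subspace A)" for p
    using that
  proof induction
    case (Sym_linear w)
    then have "coord_proj A w = w" by (auto simp: coord_proj_def coord_subspace_def vec_eq_iff)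
    then show ?case by (simp add: trunc_Pow_linear_form)
  qed (auto simp: trunc_add trunc_Pow_mult)
  then show "Sym (coord_subspace A) \<subseteq> supported (Pow A)" by (auto simp: supported_iff_trunc)
next
  have v: "Poly_Mapping.single (Poly_Mapping.single i 1) 1 \<in> Sym (coord_subspace A)" if "i \<in> A" for i
  proof -
    have "axis i 1 \<in> coord_subspace A" using that by (auto simp: coord_subspace_def axis_def)
    moreover have "linear_form (axis i 1) = Poly_Mapping.single (Poly_Mapping.single i 1) 1"
      unfolding linear_form_alt
      by (rule poly_mapping_eqI) (simp add: lookup_sum lookup_single axis_def if_distrib[of "\<lambda>x. _ x"] when_def cong: if_cong)
    ultimately show ?thesis using Sym_linear by metis
  qed
  have m: "Poly_Mapping.single m 1 \<in> Sym (coord_subspace A)" if "Poly_Mapping.keys m \<subseteq> A" for m :: "'a \<Rightarrow>\<^sub>0 nat"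
    using that
  \<comment> \<open>Exponents are finitely supported maps too, so the induction principle for
    polynomials applies to them with natural numbers as coefficients.\<close>
  proof (induction m rule: mpoly_induct)
    case (single i k)
    then show ?case
    proof (induction k)
      case (Suc k)
      have "Poly_Mapping.single (Poly_Mapping.single i (Suc k)) (1::real)
        = Poly_Mapping.single (Poly_Mapping.single i 1) 1 * Poly_Mapping.single (Poly_Mapping.single i k) 1"
        by (simp add: mult_single flip: single_add)
      moreover have "Poly_Mapping.single (Poly_Mapping.single i k) 1 \<in> Sym (coord_subspace A)"
        using Suc by (cases "k = 0") auto
      moreover have "i \<in> A" using Suc.prems by auto
      ultimately show ?case by (metis v Sym_mult)
    qed simp
  next
    case (add m n)
    have "Poly_Mapping.single (m + n) (1::real) = Poly_Mapping.single m 1 * Poly_Mapping.single n 1"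
      by (simp add: mult_single)
    then show ?case using add by (simp add: keys_add_nat Sym_mult)
  qed
  show "supported (Pow A) \<subseteq> Sym (coord_subspace A)"
  proof
    fix p assume p: "p \<in> supported (Pow A)"
    have "trunc (Pow A) p \<in> Sym (coord_subspace A)"
      unfolding trunc_def
    proof (rule Sym_sum)
      fix x assume "x \<in> {m \<in> Poly_Mapping.keys p. Poly_Mapping.keys m \<in> Pow A}"
      then have "Poly_Mapping.single x 1 \<in> Sym (coord_subspace A)" by (auto intro: m)
      from Sym_mult[OF Sym_const this] show "Poly_Mapping.single x (Poly_Mapping.lookup p x) \<in> Sym (coord_subspace A)"
        by (simp add: const_poly_def mult_single)
    qed
    with p show "p \<in> Sym (coord_subspace A)" by (simp add: supported_iff_trunc)
  qed
qed

section \<open>Substitution homomorphisms and Sym W as a polynomial ring\<close>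

definition poly_subst :: "('i \<Rightarrow> 'i mpoly) \<Rightarrow> 'i::finite mpoly \<Rightarrow> 'i mpoly" where
  "poly_subst g p = (\<Sum>m\<in>Poly_Mapping.keys p. const_poly (Poly_Mapping.lookup p m) *
     (\<Prod>i\<in>UNIV. g i ^ Poly_Mapping.lookup m i))"

lemma poly_subst_single:
  "poly_subst g (Poly_Mapping.single m c) = const_poly c * (\<Prod>i\<in>UNIV. g i ^ Poly_Mapping.lookup m i)"
  by (simp add: poly_subst_def)

lemma poly_subst_add: "poly_subst g (p + q) = poly_subst g p + poly_subst g q"
  unfolding poly_subst_def
  by (rule setsum_keys_plus_distrib) (auto simp: const_poly_add distrib_right)

lemma poly_subst_mult: "poly_subst g (p * q) = poly_subst g p * poly_subst g q"
proof (induction p rule: mpoly_induct)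
  case (single m c)
  show ?case
  proof (induction q rule: mpoly_induct)
    case (single n d)
    show ?case by (simp add: mult_single poly_subst_single const_poly_mult lookup_add power_add prod.distrib ac_simps)
  qed (simp add: distrib_left poly_subst_add)
qed (simp add: poly_subst_add distrib_right)

lemma poly_subst_const: "poly_subst g (const_poly r) = const_poly r"
  unfolding const_poly_def[of r] poly_subst_single by (simp add: const_poly_def)

lemma poly_subst_linear_form: "poly_subst g (linear_form w) = (\<Sum>i\<in>UNIV. const_poly (w $ i) * g i)"
proof -
  have s: "poly_subst g (sum f S) = (\<Sum>x\<in>S. poly_subst g (f x))" for f and S :: "'a set"
    by (induction S rule: infinite_finite_induct) (auto simp: poly_subst_add poly_subst_def[of g 0])
  have "(\<Prod>j\<in>UNIV. g j ^ Poly_Mapping.lookup (Poly_Mapping.single i 1) j) = g i" for i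
  proof -
    have "(\<Prod>j\<in>UNIV. g j ^ Poly_Mapping.lookup (Poly_Mapping.single i 1) j) = (\<Prod>j\<in>UNIV. if j = i then g j else 1)"
      by (intro prod.cong) (auto simp: lookup_single when_def)
    then show ?thesis by simp
  qed
  then show ?thesis unfolding linear_form_alt s poly_subst_single by simp
qed

lemma linear_coord_proj: "linear (coord_proj A)"
  by (rule linearI) (auto simp: coord_proj_def vec_eq_iff)

text \<open>The projection identifies W with R^A. Substituting the inverse linear map for the
  variables gives a left inverse of the truncation, which takes the place of the universal property
  of the symmetric algebra.\<close>

lemma Sym_trunc_bij:
  fixes W :: "(real ^ 'i::finite) set"
  assumes W: "subspace W" and onto: "coord_proj A ` W = coord_subspace A"
    and inj: "\<And>w. w \<in> W \<Longrightarrow> coord_proj A w = 0 \<Longrightarrow> w = 0"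
  shows "bij_betw (trunc (Pow A)) (Sym W) (supported (Pow A))"
proof -
  have "inj_on (coord_proj A) W"
    using linear_inj_on_iff_eq_0[OF linear_coord_proj W] inj by blast
  from linear_exists_left_inverse_on[OF linear_coord_proj W this]
  obtain l where l: "linear l" "\<And>w. w \<in> W \<Longrightarrow> l (coord_proj A w) = w" by auto
  \<comment> \<open>For i in \<open>A\<close> the variable x_i goes to the linear form of the vector
    of \<open>W\<close> that projects to the i-th unit vector.\<close>
  define g where "g i = linear_form (l (axis i 1))" for i
  have "poly_subst g (trunc (Pow A) p) = p" if "p \<in> Sym W" for p
    using that
  proof induction
    case (Sym_linear w)
    define v where "v = coord_proj A w"
    have "v = (\<Sum>i\<in>UNIV. (v $ i) *\<^sub>R axis i 1)"
      using basis_expansion[of v] by (simp add: scalar_mult_eq_scaleR)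
    then have "l v = (\<Sum>i\<in>UNIV. (v $ i) *\<^sub>R l (axis i 1))"
      using l(1) by (metis (no_types, lifting) linear_sum linear_scale sum.cong)
    then have "linear_form (l v) = (\<Sum>i\<in>UNIV. const_poly (v $ i) * g i)"
      by (simp add: linear_form_sum linear_form_scaleR g_def)
    with l(2)[OF Sym_linear] show ?case
      unfolding trunc_Pow_linear_form poly_subst_linear_form v_def by simp
  qed (auto simp: trunc_add trunc_Pow_mult poly_subst_add poly_subst_mult poly_subst_const)
  then have "inj_on (trunc (Pow A)) (Sym W)" by (metis inj_onI)
  moreover have "trunc (Pow A) ` Sym W = supported (Pow A)"
    unfolding Sym_trunc_image onto Sym_coord_subspace ..
  ultimately show ?thesis by (simp add: bij_betw_def)
qed

section \<open>Square-free bases of the face rings of matroids\<close>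

text \<open>This is the matroid represented by the coordinate functionals on \<open>W\<close>: they
  are linearly independent on \<open>W\<close> for i in \<open>G\<close> exactly when
  \<open>W\<close> maps onto R^G.\<close>

definition indep :: "(real ^ 'i::finite) set \<Rightarrow> 'i set \<Rightarrow> bool" where
  "indep W G \<longleftrightarrow> coord_proj G ` W = coord_subspace G"

lemma coord_proj_coord_proj: "coord_proj G (coord_proj H v) = coord_proj (G \<inter> H) v"
  by (auto simp: coord_proj_def vec_eq_iff)

lemma coord_proj_in: "coord_proj G v \<in> coord_subspace G"
  by (auto simp: coord_proj_def coord_subspace_def)

lemma indepI:
  assumes "\<And>v. v \<in> coord_subspace G \<Longrightarrow> \<exists>w\<in>W. \<forall>i\<in>G. w $ i = v $ i"
  shows "indep W G"
  unfolding indep_def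
proof (intro equalityI subsetI)
  fix v assume v: "v \<in> coord_subspace G"
  with assms obtain w where "w \<in> W" "\<forall>i\<in>G. w $ i = v $ i" by blast
  moreover from this v have "coord_proj G w = v"
    by (auto simp: coord_proj_def coord_subspace_def vec_eq_iff)
  ultimately show "v \<in> coord_proj G ` W" by blast
qed (auto intro: coord_proj_in)

lemma indepD:
  assumes "indep W G"
  obtains w where "w \<in> W" "\<And>i. i \<in> G \<Longrightarrow> w $ i = v $ i"
proof -
  have "coord_proj G v \<in> coord_proj G ` W"
    using assms coord_proj_in unfolding indep_def by blast
  then obtain w where "w \<in> W" "coord_proj G w = coord_proj G v" by auto
  then show thesis by (intro that[of w]) (auto simp: coord_proj_def vec_eq_iff split: if_splits)
qed

lemma indep_subset: "indep W G \<Longrightarrow> H \<subseteq> G \<Longrightarrow> indep W H"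
  by (rule indepI) (metis indepD subsetD)

text \<open>A vector of \<open>W\<close> that vanishes on \<open>A\<close> but not at i can correct
  the value at i without disturbing the values on \<open>A\<close>.\<close>

lemma indep_insert:
  assumes W: "subspace W" and A: "indep W A"
    and w: "w \<in> W" "\<And>j. j \<in> A \<Longrightarrow> w $ j = 0" "w $ i \<noteq> 0"
  shows "indep W (insert i A)"
proof (rule indepI)
  fix v :: "real ^ 'a" assume "v \<in> coord_subspace (insert i A)"
  obtain u where u: "u \<in> W" "\<And>j. j \<in> A \<Longrightarrow> u $ j = v $ j" using indepD[OF A] by metis
  define u' where "u' = u + ((v $ i - u $ i) / w $ i) *\<^sub>R w"
  have "u' \<in> W" using W u w by (simp add: u'_def subspace_add subspace_scale)
  moreover have "\<forall>j\<in>insert i A. u' $ j = v $ j" using u w by (auto simp: u'_def)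
  ultimately show "\<exists>w\<in>W. \<forall>j\<in>insert i A. w $ j = v $ j" by blast
qed

text \<open>Scalars from \<open>Sym W\<close> act by multiplication followed by
  \<open>trunc C\<close>. Generation and linear independence are stated through coefficients, so
  that no module structure on \<open>supported C\<close> has to be set up.\<close>

definition sqfree_basis :: "(real ^ 'i::finite) set \<Rightarrow> 'i set set \<Rightarrow> 'i set set \<Rightarrow> bool" where
  "sqfree_basis W C B \<longleftrightarrow> B \<subseteq> C \<and>
     (\<forall>p\<in>supported C. \<exists>a. (\<forall>G\<in>B. a G \<in> Sym W) \<and> p = (\<Sum>G\<in>B. trunc C (a G * sqfree_mon G))) \<and>
     (\<forall>a. (\<forall>G\<in>B. a G \<in> Sym W) \<longrightarrow> (\<Sum>G\<in>B. trunc C (a G * sqfree_mon G)) = 0 \<longrightarrow> (\<forall>G\<in>B. a G = 0))"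

text \<open>The lower bound \<open>A\<close> replaces contraction: instead of passing to a
  contracted matroid on a smaller ground set, the contracted elements are kept inside every
  set.\<close>

definition indep_between :: "(real ^ 'i::finite) set \<Rightarrow> 'i set \<Rightarrow> 'i set \<Rightarrow> 'i set set" where
  "indep_between W A K = {G. indep W G \<and> A \<subseteq> G \<and> G \<subseteq> K}"

text \<open>Here \<open>A\<close> is independent and spanning, so \<open>Sym W\<close> becomes the
  polynomial ring in the variables of \<open>A\<close>, and \<open>supported {A}\<close> is its
  principal ideal generated by x_A.\<close>

lemma sqfree_basis_singleton:
  fixes W :: "(real ^ 'i::finite) set"
  assumes W: "subspace W" and A: "indep W A" and sp: "\<And>w. w \<in> W \<Longrightarrow> (\<And>i. i \<in> A \<Longrightarrow> w $ i = 0) \<Longrightarrow> w = 0"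
  shows "sqfree_basis W {A} {A}"
proof -
  have "w = 0" if "w \<in> W" "coord_proj A w = 0" for w
  proof (rule sp[OF that(1)])
    fix i assume "i \<in> A" then show "w $ i = 0" using that(2) by (auto simp: coord_proj_def vec_eq_iff split: if_splits)
  qed
  from Sym_trunc_bij[OF W A[unfolded indep_def] this]
  have bij: "bij_betw (trunc (Pow A)) (Sym W) (supported (Pow A))" .
  have t: "trunc {A} (a * sqfree_mon A) = trunc (Pow A) a * sqfree_mon A" for a
    by (rule trunc_mult_sqfree_mon) auto
  show ?thesis
    unfolding sqfree_basis_def
  proof (intro conjI allI ballI impI)
    fix p assume p: "p \<in> supported {A}"
    \<comment> \<open>Every monomial of \<open>p\<close> has support exactly \<open>A\<close> and is
      therefore divisible by x_A; the truncated subtraction of exponents is exact.\<close>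
    obtain q where q: "p = q * sqfree_mon A"
    proof
      show "p = (\<Sum>m\<in>Poly_Mapping.keys p. Poly_Mapping.single (m - sqfree_exp A) (Poly_Mapping.lookup p m)) * sqfree_mon A"
      proof -
        have m: "m - sqfree_exp A + sqfree_exp A = m" if "m \<in> Poly_Mapping.keys p" for m
        proof (rule poly_mapping_eqI)
          fix i
          have "Poly_Mapping.keys m = A" using p that by (auto simp: supported_def)
          then have "i \<in> A \<Longrightarrow> Poly_Mapping.lookup m i \<noteq> 0" by (metis in_keys_iff)
          then show "Poly_Mapping.lookup (m - sqfree_exp A + sqfree_exp A) i = Poly_Mapping.lookup m i"
            by (auto simp: lookup_add lookup_minus lookup_sqfree_exp)
        qed
        have "(\<Sum>m\<in>Poly_Mapping.keys p. Poly_Mapping.single (m - sqfree_exp A) (Poly_Mapping.lookup p m)) * sqfree_mon A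
          = (\<Sum>m\<in>Poly_Mapping.keys p. Poly_Mapping.single m (Poly_Mapping.lookup p m))"
          by (simp add: sum_distrib_right mult_single m cong: sum.cong)
        also have "\<dots> = trunc UNIV p" by (simp add: trunc_def)
        also have "\<dots> = p" by (rule poly_mapping_eqI) (simp add: lookup_trunc)
        finally show ?thesis by simp
      qed
    qed
    obtain a where a: "a \<in> Sym W" "trunc (Pow A) a = trunc (Pow A) q"
      using bij trunc_supported[of "Pow A" q] unfolding bij_betw_def by force
    have "p = trunc {A} p" using p by (simp add: supported_iff_trunc)
    also have "\<dots> = trunc {A} (a * sqfree_mon A)" unfolding q t a(2) ..
    finally show "\<exists>a. (\<forall>G\<in>{A}. a G \<in> Sym W) \<and> p = (\<Sum>G\<in>{A}. trunc {A} (a G * sqfree_mon G))"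
      using a(1) by (intro exI[of _ "\<lambda>_. a"]) simp
  next
    fix a :: "'i set \<Rightarrow> 'i mpoly" and G
    assume a: "\<forall>G\<in>{A}. a G \<in> Sym W" "(\<Sum>G\<in>{A}. trunc {A} (a G * sqfree_mon G)) = 0" "G \<in> {A}"
    then have "trunc (Pow A) (a A) * sqfree_mon A = 0 * sqfree_mon A" by (simp add: t)
    from mult_single_cancel[OF this] have "trunc (Pow A) (a A) = trunc (Pow A) 0" by simp
    then show "a G = 0" using a bij unfolding bij_betw_def by (metis Sym_0 inj_onD singletonD singletonI)
  qed simp
qed

text \<open>The sets containing i span a submodule, because multiplication cannot remove x_i, and
  truncation to \<open>C2\<close> is the quotient map. A basis of the submodule together with lifts
  of a basis of the quotient is a basis; the square-free monomials serve as their own lifts.\<close>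

lemma sqfree_basis_union:
  fixes W :: "(real ^ 'i::finite) set"
  assumes 1: "sqfree_basis W C1 B1" and 2: "sqfree_basis W C2 B2"
    and C: "C = C1 \<union> C2" and 3: "\<And>G. G \<in> C1 \<Longrightarrow> i \<in> G" "\<And>G. G \<in> C2 \<Longrightarrow> i \<notin> G"
  shows "sqfree_basis W C (B1 \<union> B2)"
proof -
  have B: "B1 \<subseteq> C1" "B2 \<subseteq> C2" using 1 2 by (auto simp: sqfree_basis_def)
  have disj: "B1 \<inter> B2 = {}" using B 3 by blast
  \<comment> \<open>x_i divides the generator, hence every monomial of the product, so no support in
    \<open>C2\<close> can occur and the two truncations agree.\<close>
  have t1: "trunc C (a * sqfree_mon G) = trunc C1 (a * sqfree_mon G)" if "G \<in> B1" for a G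
  proof (rule poly_mapping_eqI)
    fix m
    have "Poly_Mapping.lookup (a * sqfree_mon G) m = 0" if "Poly_Mapping.keys m \<in> C2"
    proof (rule ccontr)
      assume "Poly_Mapping.lookup (a * sqfree_mon G) m \<noteq> 0"
      then have "m \<in> Poly_Mapping.keys (a * sqfree_mon G)" by (metis in_keys_iff)
      then obtain m' where "m = m' + sqfree_exp G" by (rule keys_mult_singleE)
      then have "G \<subseteq> Poly_Mapping.keys m" by (simp add: keys_add_nat)
      with that \<open>G \<in> B1\<close> B 3 show False by blast
    qed
    then show "Poly_Mapping.lookup (trunc C (a * sqfree_mon G)) m = Poly_Mapping.lookup (trunc C1 (a * sqfree_mon G)) m"
      by (auto simp: lookup_trunc C)
  qed
  have C12: "C2 \<inter> C1 = {}" using 3 by auto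
  have t21: "trunc C2 (trunc C (a * sqfree_mon G)) = 0" if "G \<in> B1" for a G
    unfolding t1[OF that] trunc_trunc C12 by (rule poly_mapping_eqI) (simp add: lookup_trunc)
  have t22: "trunc C2 (trunc C p) = trunc C2 p" for p by (simp add: trunc_trunc C Int_Un_distrib C12)
  have sum: "(\<Sum>G\<in>B1 \<union> B2. trunc C (a G * sqfree_mon G))
     = (\<Sum>G\<in>B1. trunc C1 (a G * sqfree_mon G)) + (\<Sum>G\<in>B2. trunc C (a G * sqfree_mon G))" for a
    using disj by (simp add: sum.union_disjoint t1)
  have sum2: "trunc C2 (\<Sum>G\<in>B1 \<union> B2. trunc C (a G * sqfree_mon G)) = (\<Sum>G\<in>B2. trunc C2 (a G * sqfree_mon G))" for a
    using disj by (simp only: sum.union_disjoint[OF finite finite disj] trunc_add trunc_sum t21 sum.neutral_const cong: sum.cong) (simp add: t22)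
  show ?thesis
    unfolding sqfree_basis_def
  proof (intro conjI allI ballI impI)
    show "B1 \<union> B2 \<subseteq> C" using B C by blast
  next
    fix p assume p: "p \<in> supported C"
    obtain a2 where a2: "\<forall>G\<in>B2. a2 G \<in> Sym W" "trunc C2 p = (\<Sum>G\<in>B2. trunc C2 (a2 G * sqfree_mon G))"
      using 2 trunc_supported unfolding sqfree_basis_def by blast
    \<comment> \<open>Once the lift of the quotient coordinates is subtracted, no monomial avoiding
      x_i is left.\<close>
    define q where "q = p - (\<Sum>G\<in>B2. trunc C (a2 G * sqfree_mon G))"
    have "trunc C q = q" using p by (simp add: q_def trunc_diff trunc_sum trunc_trunc supported_iff_trunc)
    moreover have "trunc C2 q = 0" by (simp add: q_def trunc_diff trunc_sum t22 a2(2))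
    ultimately have "Poly_Mapping.lookup (trunc C1 q) m = Poly_Mapping.lookup q m" for m
      using lookup_trunc[of C q m] lookup_trunc[of C2 q m] by (auto simp: lookup_trunc C split: if_splits)
    then have "trunc C1 q = q" by (rule poly_mapping_eqI)
    then obtain a1 where a1: "\<forall>G\<in>B1. a1 G \<in> Sym W" "q = (\<Sum>G\<in>B1. trunc C1 (a1 G * sqfree_mon G))"
      using 1 unfolding sqfree_basis_def supported_iff_trunc[symmetric] by blast
    define a where "a G = (if G \<in> B1 then a1 G else a2 G)" for G
    have "(\<Sum>G\<in>B2. trunc C (a G * sqfree_mon G)) = (\<Sum>G\<in>B2. trunc C (a2 G * sqfree_mon G))"
      using disj by (intro sum.cong) (auto simp: a_def)
    then have "p = (\<Sum>G\<in>B1 \<union> B2. trunc C (a G * sqfree_mon G))"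
      unfolding sum using a1(2) by (simp add: a_def q_def algebra_simps)
    then show "\<exists>a. (\<forall>G\<in>B1 \<union> B2. a G \<in> Sym W) \<and> p = (\<Sum>G\<in>B1 \<union> B2. trunc C (a G * sqfree_mon G))"
      using a1(1) a2(1) by (intro exI[of _ a]) (auto simp: a_def)
  next
    fix a G assume a: "\<forall>G\<in>B1 \<union> B2. a G \<in> Sym W" "(\<Sum>G\<in>B1 \<union> B2. trunc C (a G * sqfree_mon G)) = 0" "G \<in> B1 \<union> B2"
    have "(\<Sum>G\<in>B2. trunc C2 (a G * sqfree_mon G)) = 0" using sum2[of a] a(2) by simp
    then have z: "\<forall>G\<in>B2. a G = 0" using 2 a(1) unfolding sqfree_basis_def by blast
    then have "(\<Sum>G\<in>B1. trunc C1 (a G * sqfree_mon G)) = 0" using sum[of a] a(2) by simp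
    then have "\<forall>G\<in>B1. a G = 0" using 1 a(1) unfolding sqfree_basis_def by blast
    with z a(3) show "a G = 0" by blast
  qed
qed

text \<open>Multiplication by x_i is injective, takes \<open>supported C\<close> into
  \<open>supported C1\<close> and commutes with the truncations. Dividing the basis monomials of the
  target by x_i therefore gives a basis of the source.\<close>

lemma sqfree_basis_cone:
  fixes W :: "(real ^ 'i::finite) set"
  assumes 1: "sqfree_basis W C1 B1" and C: "\<And>G. insert i G \<in> C1 \<longleftrightarrow> G \<in> C" and i: "\<And>G. G \<in> C1 \<Longrightarrow> i \<in> G"
  shows "sqfree_basis W C ((\<lambda>G. G - {i}) ` B1)"
proof -
  let ?x = "Poly_Mapping.single (Poly_Mapping.single i 1) 1 :: 'i mpoly"
  have B: "B1 \<subseteq> C1" using 1 by (auto simp: sqfree_basis_def)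
  have inj: "inj_on (\<lambda>G. G - {i}) B1" using B i by (auto simp: inj_on_def)
  have tx: "trunc C1 (p * ?x) = trunc C p * ?x" for p by (rule trunc_mult_var) (rule C)
  have m: "sqfree_mon (G - {i}) * ?x = sqfree_mon G" if "G \<in> B1" for G
  proof -
    have "i \<in> G" using that B i by blast
    then show ?thesis using sqfree_exp_insert[of "G - {i}" i] by (simp add: mult_single insert_absorb)
  qed
  have t: "trunc C1 (a * sqfree_mon G) = trunc C (a * sqfree_mon (G - {i})) * ?x" if "G \<in> B1" for a G
    using tx[of "a * sqfree_mon (G - {i})"] m[OF that] by (simp add: mult.assoc)
  have sum: "(\<Sum>G\<in>B1. trunc C1 (a (G - {i}) * sqfree_mon G)) = (\<Sum>G\<in>(\<lambda>G. G - {i}) ` B1. trunc C (a G * sqfree_mon G)) * ?x" for a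
    by (simp add: sum.reindex[OF inj] sum_distrib_right t)
  show ?thesis
    unfolding sqfree_basis_def
  proof (intro conjI allI ballI impI)
    show "(\<lambda>G. G - {i}) ` B1 \<subseteq> C"
    proof clarify
      fix G assume "G \<in> B1"
      then have "insert i (G - {i}) \<in> C1" using B i by (auto simp: insert_absorb)
      then show "G - {i} \<in> C" using C by blast
    qed
  next
    fix p assume p: "p \<in> supported C"
    then have "p * ?x \<in> supported C1" using tx[of p] by (simp add: supported_iff_trunc)
    then obtain a where a: "\<forall>G\<in>B1. a G \<in> Sym W" "p * ?x = (\<Sum>G\<in>B1. trunc C1 (a G * sqfree_mon G))"
      using 1 unfolding sqfree_basis_def by blast
    have ia: "insert i (G - {i}) = G" if "G \<in> B1" for G using that B i by auto
    have ia': "insert i G = G" if "G \<in> B1" for G using that B i by auto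
    have "p * ?x = (\<Sum>G\<in>(\<lambda>G. G - {i}) ` B1. trunc C (a (insert i G) * sqfree_mon G)) * ?x"
      unfolding sum[symmetric] a(2) by (intro sum.cong) (auto simp: ia')
    then have "p = (\<Sum>G\<in>(\<lambda>G. G - {i}) ` B1. trunc C (a (insert i G) * sqfree_mon G))"
      by (rule mult_single_cancel)
    then show "\<exists>a. (\<forall>G\<in>(\<lambda>G. G - {i}) ` B1. a G \<in> Sym W) \<and> p = (\<Sum>G\<in>(\<lambda>G. G - {i}) ` B1. trunc C (a G * sqfree_mon G))"
      using a(1) by (intro exI[of _ "\<lambda>G. a (insert i G)"]) (auto simp: ia ia')
  next
    fix a G
    assume a: "\<forall>G\<in>(\<lambda>G. G - {i}) ` B1. a G \<in> Sym W"
      "(\<Sum>G\<in>(\<lambda>G. G - {i}) ` B1. trunc C (a G * sqfree_mon G)) = 0" "G \<in> (\<lambda>G. G - {i}) ` B1"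
    have "(\<Sum>G\<in>B1. trunc C1 (a (G - {i}) * sqfree_mon G)) = 0" unfolding sum a(2) by simp
    moreover have "\<forall>G\<in>B1. a (G - {i}) \<in> Sym W" using a(1) by blast
    ultimately have "\<forall>G\<in>B1. a (G - {i}) = 0"
      using 1 unfolding sqfree_basis_def by (auto dest!: spec[of _ "\<lambda>G. a (G - {i})"])
    with a(3) show "a G = 0" by blast
  qed
qed

text \<open>Deletion and contraction: the sets containing \<open>i\<close> and those avoiding \<open>i\<close> give an exact
  sequence, except that for a coloop \<open>i\<close> multiplication by \<open>x\<^sub>i\<close> is an isomorphism.\<close>

lemma sqfree_basis_exists:
  fixes W :: "(real ^ 'i::finite) set"
  assumes W: "subspace W" and A: "indep W A" "A \<subseteq> K" and sp: "\<And>w. w \<in> W \<Longrightarrow> (\<And>i. i \<in> K \<Longrightarrow> w $ i = 0) \<Longrightarrow> w = 0"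
  shows "\<exists>B. sqfree_basis W (indep_between W A K) B"
  using A sp
\<comment> \<open>Contraction enlarges \<open>A\<close> and deletion shrinks \<open>K\<close>; both
  decrease the difference.\<close>
proof (induction "card (K - A)" arbitrary: A K rule: less_induct)
  case less
  show ?case
  proof (cases "K \<subseteq> A")
    case True
    then have "K = A" using less.prems by blast
    then have "indep_between W A K = {A}" using less.prems by (auto simp: indep_between_def)
    then show ?thesis using sqfree_basis_singleton[OF W less.prems(1)] less.prems(3) \<open>K = A\<close> by auto
  next
    case False
    then obtain i where i: "i \<in> K" "i \<notin> A" by blast
    let ?C1 = "indep_between W (insert i A) K" and ?C2 = "indep_between W A (K - {i})"
    have dec1: "card (K - insert i A) < card (K - A)" using i by (intro psubset_card_mono) auto
    have dec2: "card (K - {i} - A) < card (K - A)" using i by (intro psubset_card_mono) auto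
    have C: "indep_between W A K = ?C1 \<union> ?C2" by (auto simp: indep_between_def)
    show ?thesis
    proof (cases "indep W (insert i A)")
      \<comment> \<open>Modulo \<open>A\<close> the element i is a loop. No set in the family
        contains it, and a vector vanishing on the other coordinates of \<open>K\<close> vanishes at
        i too, so i can be deleted.\<close>
      case dep: False
      have "?C1 = {}" using dep indep_subset[of W _ "insert i A"] unfolding indep_between_def by blast
      moreover have "\<exists>B. sqfree_basis W ?C2 B"
      proof (rule less.hyps[OF dec2 less.prems(1)])
        fix w assume w: "w \<in> W" "\<And>j. j \<in> K - {i} \<Longrightarrow> w $ j = 0"
        have "w $ i = 0"
        proof (rule ccontr)
          assume "w $ i \<noteq> 0"
          with w less.prems i have "indep W (insert i A)" by (intro indep_insert[OF W]) auto
          with dep show False by contradiction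
        qed
        with w show "w = 0" by (intro less.prems(3)) auto
      qed (use less.prems i in auto)
      ultimately show ?thesis using C by simp
    next
      case ind: True
      obtain B1 where B1: "sqfree_basis W ?C1 B1"
        using less.hyps[OF dec1 ind] less.prems i by auto
      have iC1: "i \<in> G" if "G \<in> ?C1" for G using that by (auto simp: indep_between_def)
      show ?thesis
      \<comment> \<open>The alternative to deletion and contraction is a coloop: a nonzero vector of
        \<open>W\<close> whose only nonzero coordinate in \<open>K\<close> is i. Adjoining i then
        never destroys independence.\<close>
      proof (cases "\<forall>w\<in>W. (\<forall>j\<in>K - {i}. w $ j = 0) \<longrightarrow> w = 0")
        case True
        have "\<exists>B. sqfree_basis W ?C2 B"
        proof (rule less.hyps[OF dec2 less.prems(1)])
          show "A \<subseteq> K - {i}" using less.prems i by blast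
        qed (use True in auto)
        then obtain B2 where B2: "sqfree_basis W ?C2 B2" by blast
        have "i \<notin> G" if "G \<in> ?C2" for G using that by (auto simp: indep_between_def)
        from sqfree_basis_union[OF B1 B2 C iC1 this] show ?thesis by blast
      next
        case False
        then obtain w where w: "w \<in> W" "\<And>j. j \<in> K - {i} \<Longrightarrow> w $ j = 0" "w \<noteq> 0" by auto
        then have wi: "w $ i \<noteq> 0" using less.prems(3)[of w] i by auto
        have "indep W (insert i G) \<longleftrightarrow> indep W G" if "G \<subseteq> K" for G
        proof
          assume G: "indep W G"
          show "indep W (insert i G)"
          proof (cases "i \<in> G")
            case False
            with G w wi that show ?thesis by (intro indep_insert[OF W]) auto
          qed (use G in \<open>simp add: insert_absorb\<close>)
        qed (auto intro: indep_subset)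
        then have "insert i G \<in> ?C1 \<longleftrightarrow> G \<in> indep_between W A K" for G
          using i by (auto simp: indep_between_def)
        from sqfree_basis_cone[OF B1 this iC1] show ?thesis by blast
      qed
    qed
  qed
qed

section \<open>Flats of an arrangement and of its simplification\<close>

lemma dim_coord_subspace: "dim (coord_subspace G) = card G"
  unfolding coord_subspace_def using dim_substandard_cart[of G, where 'a = real] by (simp add: dim_vec_eq)

lemma subspace_coord_subspace: "subspace (coord_subspace G)"
  by (auto simp: subspace_def coord_subspace_def)

text \<open>The orthogonal complement of the kernel inside \<open>S\<close> maps isomorphically onto
  the image.\<close>

lemma dim_image_kernel:
  fixes f :: "'a::euclidean_space \<Rightarrow> 'b::euclidean_space"
  assumes f: "linear f" and S: "subspace S"
  shows "dim (f ` S) + dim {x \<in> S. f x = 0} = dim S"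
proof -
  let ?K = "{x \<in> S. f x = 0}" let ?T = "{y \<in> S. \<forall>x\<in>?K. orthogonal x y}"
  have K: "subspace ?K" using S f by (auto simp: subspace_def linear_0 linear_add linear_scale)
  have T: "subspace ?T" using S by (auto simp: subspace_def orthogonal_clauses)
  have image: "f ` S = f ` ?T"
  proof (intro equalityI subsetI)
    fix y assume "y \<in> f ` S"
    then obtain x where x: "x \<in> S" "y = f x" by blast
    obtain k t where kt: "k \<in> span ?K" "\<And>w. w \<in> span ?K \<Longrightarrow> orthogonal t w" "x = k + t"
      by (rule orthogonal_subspace_decomp_exists[of ?K x]) blast
    have k: "k \<in> ?K" using kt(1) K by (simp add: span_eq_iff[THEN iffD2])
    have "t = x - k" using kt by simp
    then have "t \<in> S" using x k S by (simp add: subspace_diff)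
    moreover have "orthogonal w t" if "w \<in> ?K" for w
      using kt(2)[OF span_base[OF that]] by (simp add: orthogonal_commute)
    moreover have "f x = f t" using k kt f by (simp add: linear_add)
    ultimately show "y \<in> f ` ?T" using x by blast
  qed auto
  have "inj_on f (span ?T)"
    unfolding span_eq_iff[THEN iffD2, OF T]
  proof (subst linear_inj_on_iff_eq_0[OF f T], intro ballI impI)
    fix t assume "t \<in> ?T" "f t = 0"
    then have "orthogonal t t" by blast
    then show "t = 0" by (simp add: orthogonal_self)
  qed
  from dim_image_eq[OF f this] have "dim (f ` ?T) = dim ?T" .
  with image have "dim (f ` S) = dim ?T" by simp
  moreover have "dim ?T + dim ?K = dim S" by (rule dim_subspace_orthogonal_to_vectors[OF K S]) auto
  ultimately show ?thesis by simp
qed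

lemma direction_eq: "affine V \<Longrightarrow> a \<in> V \<Longrightarrow> direction V = (\<lambda>x. x - a) ` V"
proof (intro equalityI subsetI)
  fix v assume V: "affine V" "a \<in> V" and "v \<in> direction V"
  then obtain x y where xy: "x \<in> V" "y \<in> V" "v = x - y" by (auto simp: direction_def)
  have "1 *\<^sub>R x + (-1) *\<^sub>R y + 1 *\<^sub>R a \<in> V" by (rule mem_affine_3) (use V xy in auto)
  then have "v + a \<in> V" using xy by simp
  then show "v \<in> (\<lambda>x. x - a) ` V" by force
qed (auto simp: direction_def)

lemma subspace_direction: "affine V \<Longrightarrow> V \<noteq> {} \<Longrightarrow> subspace (direction V)"
  using direction_eq affine_diffs_subspace_subtract by (metis ex_in_conv)

lemma add_direction: "affine V \<Longrightarrow> x \<in> V \<Longrightarrow> v \<in> direction V \<Longrightarrow> x + v \<in> V"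
  using direction_eq[of V x] by auto

lemma diff_direction: "x \<in> V \<Longrightarrow> y \<in> V \<Longrightarrow> x - y \<in> direction V"
  by (auto simp: direction_def)

lemma direction_translation: "direction ((+) a ` V) = direction V"
proof -
  have "direction ((+) a ` V) = {(a + x) - (a + y) | x y. x \<in> V \<and> y \<in> V}"
    unfolding direction_def by blast
  then show ?thesis by (simp add: direction_def)
qed

section \<open>Generic points of affine subspaces, closures and ranks\<close>

definition zeros :: "'i::finite set \<Rightarrow> real ^ 'i \<Rightarrow> 'i set" where
  "zeros I x = {i \<in> I. x $ i = 0}"

lemma flats_eq: "flats I V = zeros I ` V"
  unfolding flats_def zeros_def hyperplane_def by auto

text \<open>A generic multiple of \<open>v\<close> added to \<open>x\<close> leaves only those zeros
  of \<open>x\<close> at which \<open>v\<close> vanishes and creates no new ones, because each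
  coordinate rules out at most one value of the parameter besides 0.\<close>

lemma exists_perturbation:
  assumes "affine V" "x \<in> V" "v \<in> direction V"
  shows "\<exists>y\<in>V. zeros I y = {i \<in> zeros I x. v $ i = 0}"
proof -
  \<comment> \<open>The value 0 is excluded so that zeros of \<open>x\<close> with nonzero
    \<open>v\<close> are really left; where \<open>v\<close> vanishes, the quotient is 0 by
    convention and excludes nothing more.\<close>
  let ?bad = "insert 0 ((\<lambda>i. - x $ i / v $ i) ` UNIV)"
  have "finite ?bad" by simp
  then obtain e where e: "e \<notin> ?bad" using ex_new_if_finite[OF infinite_UNIV_char_0] by blast
  have "x + e *\<^sub>R v \<in> V"
    using assms by (intro add_direction) (auto intro: subspace_scale[OF subspace_direction])
  moreover have "zeros I (x + e *\<^sub>R v) = {i \<in> zeros I x. v $ i = 0}"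
  proof -
    have "x $ i + e * v $ i \<noteq> 0" if "x $ i \<noteq> 0 \<or> v $ i \<noteq> 0" for i
    proof
      assume *: "x $ i + e * v $ i = 0"
      with that e have "v $ i \<noteq> 0" by auto
      then have "e = - x $ i / v $ i" using * by (simp add: field_simps add_eq_0_iff2)
      with e show False by blast
    qed
    then show ?thesis by (auto simp: zeros_def)
  qed
  ultimately show ?thesis by blast
qed

text \<open>Among the points of \<open>V\<close> vanishing on \<open>G\<close>, take one with the
  fewest zeros: a direction violating the conclusion would perturb it to a point with fewer. Its
  zero set is the least flat containing \<open>G\<close>.\<close>

lemma exists_generic_point:
  assumes V: "affine V" and x: "x \<in> V" "G \<subseteq> zeros I x"
  shows "\<exists>y\<in>V. G \<subseteq> zeros I y \<and>
    (\<forall>v\<in>direction V. (\<forall>i\<in>G. v $ i = 0) \<longrightarrow> (\<forall>i\<in>zeros I y. v $ i = 0))"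
proof -
  let ?P = "\<lambda>y. y \<in> V \<and> G \<subseteq> zeros I y"
  obtain y where y: "?P y" "\<And>z. ?P z \<Longrightarrow> card (zeros I y) \<le> card (zeros I z)"
    using ex_has_least_nat[of ?P x "\<lambda>y. card (zeros I y)"] x by blast
  have "v $ i = 0" if v: "v \<in> direction V" "\<forall>i\<in>G. v $ i = 0" "i \<in> zeros I y" for v i
  proof (rule ccontr)
    assume vi: "v $ i \<noteq> 0"
    obtain z where z: "z \<in> V" "zeros I z = {i \<in> zeros I y. v $ i = 0}"
      using exists_perturbation[OF V] y v by blast
    then have "?P z" using y v by auto
    moreover have "card (zeros I z) < card (zeros I y)"
      using z vi v(3) by (intro psubset_card_mono) auto
    ultimately show False using y(2) by force
  qed
  with y(1) show ?thesis by blast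
qed

lemma coord_proj_zero_iff: "coord_proj F v = 0 \<longleftrightarrow> (\<forall>i\<in>F. v $ i = 0)"
  by (auto simp: coord_proj_def vec_eq_iff)

lemma subspace_local_space: "affine V \<Longrightarrow> V \<noteq> {} \<Longrightarrow> subspace (local_space V F)"
  unfolding local_space_def
  by (intro linear_subspace_image linear_coord_proj subspace_direction)

lemma local_space_proj: "G \<subseteq> F \<Longrightarrow> coord_proj G ` local_space V F = local_space V G"
  by (simp add: local_space_def image_image coord_proj_coord_proj Int_absorb2)

lemma indep_local_space: "G \<subseteq> F \<Longrightarrow> indep (local_space V F) G \<longleftrightarrow> indep (direction V) G"
  using local_space_proj[of G F V] by (simp add: indep_def local_space_def)

text \<open>The affine space of the flat is a translate of the kernel of the projection of
  \<open>direction V\<close> to R^F, so its codimension is the rank of that projection.\<close>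

lemma rk_eq_dim:
  assumes V: "affine V" and x: "x \<in> V" "F \<subseteq> zeros I x"
  shows "rk V F = int (dim (local_space V F))"
proof -
  let ?K = "{v \<in> direction V. coord_proj F v = 0}"
  have "V \<noteq> {}" using x by blast
  note sub = subspace_direction[OF V this]
  have V_eq: "V = (+) x ` direction V"
    using direction_eq[OF V x(1)] by (auto simp: image_image)
  have "flat_space V F = (+) x ` ?K"
  proof (intro equalityI subsetI)
    fix y assume y: "y \<in> flat_space V F"
    then have "y - x \<in> ?K"
      using x diff_direction[of y V x]
      by (auto simp: flat_space_def hyperplane_def zeros_def coord_proj_zero_iff split: if_splits)
    then show "y \<in> (+) x ` ?K" by force
  next
    fix y assume "y \<in> (+) x ` ?K"
    then show "y \<in> flat_space V F"
      using x add_direction[OF V x(1)] by (auto simp: flat_space_def hyperplane_def zeros_def coord_proj_zero_iff)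
  qed
  moreover have "subspace ?K"
    using sub linear_coord_proj[of F] by (auto simp: subspace_def linear_0 linear_add linear_scale)
  ultimately have "aff_dim (flat_space V F) = int (dim ?K)"
    by (simp add: aff_dim_translation_eq aff_dim_subspace)
  moreover have "aff_dim V = int (dim (direction V))"
    by (subst V_eq) (simp add: aff_dim_translation_eq aff_dim_subspace[OF sub])
  ultimately show ?thesis
    using dim_image_kernel[OF linear_coord_proj[of F] sub] by (simp add: rk_def local_space_def)
qed

lemma dim_local_space_indep: "indep (direction V) G \<Longrightarrow> dim (local_space V G) = card G"
  by (simp add: indep_def local_space_def dim_coord_subspace)

section \<open>The flats of an arrangement and of its simplification\<close>

locale simplified_arrangement =
  fixes I :: "'i::finite set" and V V' :: "(real ^ 'i) set"
  assumes arrangement: "arrangement I V" and simplification: "simplification I V V'"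
begin

lemma V: "affine V" "V \<noteq> {}" and V': "affine V'" "V' \<noteq> {}" and direction_V': "direction V' = direction V"
proof -
  show V: "affine V" "V \<noteq> {}" using arrangement by (auto simp: arrangement_def)
  obtain a where a: "V' = (+) a ` V" using simplification by (auto simp: simplification_def)
  show "affine V'" "V' \<noteq> {}" using V affine_translation a by auto
  show "direction V' = direction V" unfolding a by (rule direction_translation)
qed

text \<open>Simplicity forces V(F) = R^F on flats of the simplification by a dimension count.
  Conversely, independence of \<open>G\<close> produces a point of \<open>V'\<close> vanishing on
  \<open>G\<close>; a generic such point has no further zeros, because its zero set is itself
  independent.\<close>

lemma flats_V': "flats I V' = {G. G \<subseteq> I \<and> indep (direction V) G}"
proof -
  have simp: "int (card G) = rk V' G" if "G \<in> flats I V'" for G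
    using simplification that by (auto simp: simplification_def simple_arrangement_def)
  have ind: "indep (direction V) (zeros I x)" if x: "x \<in> V'" for x
  proof -
    have "dim (local_space V' (zeros I x)) = card (zeros I x)"
      using simp[of "zeros I x"] rk_eq_dim[OF V'(1) x, of "zeros I x" I] x by (auto simp: flats_eq)
    moreover have "local_space V' (zeros I x) \<subseteq> coord_subspace (zeros I x)"
      by (auto simp: local_space_def intro: coord_proj_in)
    ultimately have "local_space V' (zeros I x) = coord_subspace (zeros I x)"
      using subspace_local_space[OF V'] by (intro subspace_dim_equal) (auto simp: dim_coord_subspace subspace_coord_subspace)
    then show ?thesis by (simp add: indep_def local_space_def direction_V')
  qed
  show ?thesis
  proof (intro equalityI subsetI)
    fix G assume "G \<in> flats I V'"
    then show "G \<in> {G. G \<subseteq> I \<and> indep (direction V) G}" using ind by (auto simp: flats_eq zeros_def)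
  next
    fix G assume "G \<in> {G. G \<subseteq> I \<and> indep (direction V) G}"
    then have G: "G \<subseteq> I" "indep (direction V) G" by auto
    obtain x0 where x0: "x0 \<in> V'" using V' by blast
    obtain v where v: "v \<in> direction V" "\<And>i. i \<in> G \<Longrightarrow> v $ i = (- x0) $ i" using indepD[OF G(2), of "- x0"] by blast
    have x1: "x0 + v \<in> V'" using add_direction[OF V'(1) x0] v by (simp add: direction_V')
    have G1: "G \<subseteq> zeros I (x0 + v)" using v(2) G(1) by (auto simp: zeros_def)
    obtain y where y: "y \<in> V'" "G \<subseteq> zeros I y"
      and y3: "\<forall>v\<in>direction V. (\<forall>i\<in>G. v $ i = 0) \<longrightarrow> (\<forall>i\<in>zeros I y. v $ i = 0)"
      using exists_generic_point[OF V'(1) x1 G1, unfolded direction_V'] by (elim bexE conjE)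
    have "zeros I y \<subseteq> G"
    proof
      fix i assume i: "i \<in> zeros I y"
      show "i \<in> G"
      proof (rule ccontr)
        assume "i \<notin> G"
        \<comment> \<open>Independence of the whole zero set yields a direction that is 1 at i and 0
          on \<open>G\<close>, which genericity of y forbids.\<close>
        obtain w where w: "w \<in> direction V" "\<And>j. j \<in> zeros I y \<Longrightarrow> w $ j = axis i 1 $ j"
          using indepD[OF ind[OF y(1)], of "axis i 1"] by blast
        have "w $ j = 0" if "j \<in> G" for j
          using w(2)[of j] that y(2) \<open>i \<notin> G\<close> by (auto simp: axis_def)
        then have "w $ i = 0" using y3 w(1) i by blast
        with w(2)[OF i] show False by (simp add: axis_def)
      qed
    qed
    with y show "G \<in> flats I V'" by (auto simp: flats_eq)
  qed
qed

lemma subset_flats_V': "G \<in> flats I V' \<Longrightarrow> H \<subseteq> G \<Longrightarrow> H \<in> flats I V'"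
  unfolding flats_V' by (blast intro: indep_subset)

lemma flat_subset: "F \<in> flats I V \<Longrightarrow> F \<subseteq> I"
  by (auto simp: flats_eq zeros_def)

text \<open>Independence of \<open>G\<close> is what provides a point of \<open>V\<close> vanishing
  on \<open>G\<close>; a generic one has the least flat above \<open>G\<close> as zero set. A
  direction vanishing on \<open>G\<close> vanishes on that flat, so the projections to both have the
  same kernel and hence the same rank.\<close>

lemma flat_closure:
  assumes G: "G \<in> flats I V'"
  shows "flat_closure I V G \<in> flats I V"
    and "F \<in> flats I V \<Longrightarrow> flat_closure I V G \<subseteq> F \<longleftrightarrow> G \<subseteq> F"
    and "v \<in> direction V \<Longrightarrow> (\<And>i. i \<in> G \<Longrightarrow> v $ i = 0) \<Longrightarrow> i \<in> flat_closure I V G \<Longrightarrow> v $ i = 0"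
    and "G \<subseteq> flat_closure I V G"
    and "rk V (flat_closure I V G) = int (card G)"
proof -
  have ind: "indep (direction V) G" "G \<subseteq> I" using G by (auto simp: flats_V')
  obtain x0 where x0: "x0 \<in> V" using V by blast
  obtain u where u: "u \<in> direction V" "\<And>i. i \<in> G \<Longrightarrow> u $ i = (- x0) $ i" using indepD[OF ind(1), of "- x0"] by blast
  have x1: "x0 + u \<in> V" using add_direction[OF V(1) x0] u by simp
  have G1: "G \<subseteq> zeros I (x0 + u)" using u(2) ind by (auto simp: zeros_def)
  obtain y where y: "y \<in> V" "G \<subseteq> zeros I y"
    "\<forall>v\<in>direction V. (\<forall>i\<in>G. v $ i = 0) \<longrightarrow> (\<forall>i\<in>zeros I y. v $ i = 0)"
    using exists_generic_point[OF V(1) x1 G1] by (elim bexE conjE)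
  have least: "zeros I y \<subseteq> F" if F: "F \<in> flats I V" "G \<subseteq> F" for F
  proof -
    obtain z where z: "z \<in> V" "F = zeros I z" using F by (auto simp: flats_eq)
    have "(z - y) $ i = 0" if "i \<in> zeros I y" for i
      by (rule y(3)[rule_format, OF diff_direction _ that])
        (use z(1) y(1) subsetD[OF y(2)] subsetD[OF F(2)[unfolded z(2)]] in \<open>auto simp: zeros_def\<close>)
    then show ?thesis using z by (auto simp: zeros_def)
  qed
  have cl: "flat_closure I V G = zeros I y"
    unfolding flat_closure_def
    by (rule Least_equality) (use y least in \<open>auto simp: flats_eq\<close>)
  show "flat_closure I V G \<in> flats I V" using cl y by (auto simp: flats_eq)
  show "G \<subseteq> flat_closure I V G" using cl y by simp
  show "F \<in> flats I V \<Longrightarrow> flat_closure I V G \<subseteq> F \<longleftrightarrow> G \<subseteq> F" using cl least y(2) by auto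
  show "v \<in> direction V \<Longrightarrow> (\<And>i. i \<in> G \<Longrightarrow> v $ i = 0) \<Longrightarrow> i \<in> flat_closure I V G \<Longrightarrow> v $ i = 0"
    using y(3) cl by blast
  have "rk V (zeros I y) = int (dim (local_space V (zeros I y)))" by (rule rk_eq_dim[OF V(1) y(1) order_refl])
  moreover have "dim (local_space V (zeros I y)) + dim {v \<in> direction V. coord_proj (zeros I y) v = 0} = dim (direction V)"
    unfolding local_space_def by (rule dim_image_kernel[OF linear_coord_proj subspace_direction[OF V]])
  moreover have "dim (local_space V G) + dim {v \<in> direction V. coord_proj G v = 0} = dim (direction V)"
    unfolding local_space_def by (rule dim_image_kernel[OF linear_coord_proj subspace_direction[OF V]])
  moreover have "{v \<in> direction V. coord_proj (zeros I y) v = 0} = {v \<in> direction V. coord_proj G v = 0}"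
    using y(2,3) by (auto simp: coord_proj_zero_iff)
  ultimately show "rk V (flat_closure I V G) = int (card G)"
    using dim_local_space_indep[OF ind(1)] cl by simp
qed

lemma rk_flat: "F \<in> flats I V \<Longrightarrow> rk V F = int (dim (local_space V F))"
  by (auto simp: flats_eq intro: rk_eq_dim[OF V(1)])

lemma card_le_rk:
  assumes "F \<in> flats I V" "G \<in> flats I V'" "G \<subseteq> F"
  shows "int (card G) \<le> rk V F"
proof -
  have "local_space V G = coord_proj G ` local_space V F" using local_space_proj assms by metis
  then have "dim (local_space V G) \<le> dim (local_space V F)" using dim_image_le[OF linear_coord_proj] by metis
  moreover have "dim (local_space V G) = card G"
    using assms(2) by (intro dim_local_space_indep) (simp add: flats_V')
  ultimately show ?thesis using rk_flat[OF assms(1)] by simp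
qed

text \<open>Equality of ranks makes the surjection from V(F) to V(G) injective. Points with zero
  sets \<open>F\<close> and the closure of \<open>G\<close> differ by a vector vanishing on
  \<open>G\<close>, hence on \<open>F\<close>.\<close>

lemma flat_closure_eq:
  assumes F: "F \<in> flats I V" and G: "G \<in> flats I V'" "G \<subseteq> F" "int (card G) = rk V F"
  shows "flat_closure I V G = F"
proof
  show "flat_closure I V G \<subseteq> F" using flat_closure(2)[OF G(1) F] G by simp
  obtain x y where x: "x \<in> V" "F = zeros I x" and y: "y \<in> V" "flat_closure I V G = zeros I y"
    using F flat_closure(1)[OF G(1)] by (auto simp: flats_eq)
  have "G \<subseteq> zeros I y" using flat_closure(4)[OF G(1)] y by simp
  let ?K = "{v \<in> local_space V F. coord_proj G v = 0}"
  have "dim (coord_proj G ` local_space V F) + dim ?K = dim (local_space V F)"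
    by (rule dim_image_kernel[OF linear_coord_proj subspace_local_space[OF V]])
  moreover have "dim (local_space V G) = card G"
    using G(1) by (intro dim_local_space_indep) (simp add: flats_V')
  ultimately have "dim ?K = 0"
    using G(3) local_space_proj[OF G(2), of V] rk_flat[OF F] by simp
  then have K: "?K \<subseteq> {0}" by simp
  have "coord_proj F (x - y) \<in> ?K"
    using diff_direction[OF x(1) y(1)] G(2) \<open>G \<subseteq> zeros I y\<close> x
    by (auto simp: local_space_def coord_proj_zero_iff zeros_def) (auto simp: coord_proj_def)
  then have "coord_proj F (x - y) = 0" using K by blast
  then show "F \<subseteq> flat_closure I V G" using x y by (auto simp: coord_proj_zero_iff zeros_def)
qed

text \<open>In matroid terms the fibre consists of the bases of the restriction to \<open>F\<close>,
  and membership becomes a condition on cardinality.\<close>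

lemma flat_fibre_eq:
  assumes "F \<in> flats I V"
  shows "flat_fibre I V V' F = {G \<in> flats I V'. G \<subseteq> F \<and> int (card G) = rk V F}"
proof (intro equalityI subsetI)
  fix G assume "G \<in> flat_fibre I V V' F"
  then have G: "G \<in> flats I V'" and F: "F = flat_closure I V G" by (auto simp: flat_fibre_def)
  from G flat_closure(4,5)[OF G]
  show "G \<in> {G \<in> flats I V'. G \<subseteq> F \<and> int (card G) = rk V F}"
    unfolding F by (intro CollectI conjI) simp_all
next
  fix G assume "G \<in> {G \<in> flats I V'. G \<subseteq> F \<and> int (card G) = rk V F}"
  then have "G \<in> flats I V'" "G \<subseteq> F" "int (card G) = rk V F" by auto
  from this(1) flat_closure_eq[OF assms this] show "G \<in> flat_fibre I V V' F"
    unfolding flat_fibre_def by (intro CollectI conjI)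
qed

end

section \<open>Sheaves with free stalks in coordinates\<close>

text \<open>Coordinate vectors are total functions vanishing off \<open>B\<close>. Addition is then
  the pointwise addition of the function type, shared by all modules whose bases have labels of the
  same type.\<close>

definition free_mod :: "(real ^ 'i::finite) set \<Rightarrow> 'b set \<Rightarrow> ('b \<Rightarrow> 'i mpoly) set" where
  "free_mod W B = {f. (\<forall>b\<in>B. f b \<in> Sym W) \<and> (\<forall>b. b \<notin> B \<longrightarrow> f b = 0)}"

definition smul :: "'i mpoly \<Rightarrow> ('b \<Rightarrow> 'i mpoly) \<Rightarrow> 'b \<Rightarrow> 'i mpoly" where
  "smul a f = (\<lambda>b. a * f b)"

definition unitv :: "'b \<Rightarrow> 'b \<Rightarrow> 'i mpoly" where
  "unitv b = (\<lambda>b'. if b' = b then 1 else 0)"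

definition fhom :: "('b \<Rightarrow> int) \<Rightarrow> int \<Rightarrow> ('b \<Rightarrow> 'i::finite mpoly) \<Rightarrow> bool" where
  "fhom dg d f \<longleftrightarrow> (\<forall>b. homog (d - dg b) (f b))"

definition homcomp :: "('b \<Rightarrow> int) \<Rightarrow> int \<Rightarrow> ('b \<Rightarrow> 'i::finite mpoly) \<Rightarrow> 'b \<Rightarrow> 'i mpoly" where
  "homcomp dg d f = (\<lambda>b. hcomp (d - dg b) (f b))"

lemma sum_fun_apply [simp]: "(sum f S) x = (\<Sum>s\<in>S. f s x)"
  by (induction S rule: infinite_finite_induct) auto

lemma smul_apply [simp]: "smul a f b = a * f b"
  by (simp add: smul_def)

lemma smul_simps [simp]:
  "smul 0 f = 0" "smul 1 f = f" "smul a 0 = 0" "smul a (smul c f) = smul (a * c) f"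
  by (auto simp: fun_eq_iff mult.assoc)

lemma smul_distrib:
  "smul a (f + g) = smul a f + smul a g" "smul (a + c) f = smul a f + smul c f"
  "smul a (f - g) = smul a f - smul a g" "smul (a - c) f = smul a f - smul c f"
  by (auto simp: fun_eq_iff algebra_simps)

lemma smul_sum: "smul a (sum f S) = (\<Sum>x\<in>S. smul a (f x))" "smul (sum g S) h = (\<Sum>x\<in>S. smul (g x) h)"
  by (auto simp: fun_eq_iff sum_distrib_left sum_distrib_right)

lemma free_mod_closed:
  "0 \<in> free_mod W B"
  "f \<in> free_mod W B \<Longrightarrow> g \<in> free_mod W B \<Longrightarrow> f + g \<in> free_mod W B"
  "f \<in> free_mod W B \<Longrightarrow> g \<in> free_mod W B \<Longrightarrow> f - g \<in> free_mod W B"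
  "a \<in> Sym W \<Longrightarrow> f \<in> free_mod W B \<Longrightarrow> smul a f \<in> free_mod W B"
  "f \<in> free_mod W B \<Longrightarrow> homcomp dg d f \<in> free_mod W B"
  "b \<in> B \<Longrightarrow> unitv b \<in> free_mod W B"
  by (auto simp: free_mod_def homcomp_def unitv_def intro: Sym_add Sym_diff Sym_mult Sym_hcomp)

lemma free_mod_sum: "(\<And>x. x \<in> S \<Longrightarrow> f x \<in> free_mod W B) \<Longrightarrow> sum f S \<in> free_mod W B"
  by (induction S rule: infinite_finite_induct) (auto intro: free_mod_closed)

lemma free_mod_Sym: "f \<in> free_mod W B \<Longrightarrow> f b \<in> Sym W"
  by (cases "b \<in> B") (auto simp: free_mod_def)

lemma free_mod_expand: "finite B \<Longrightarrow> f \<in> free_mod W B \<Longrightarrow> f = (\<Sum>b\<in>B. smul (f b) (unitv b))"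
  by (auto simp: fun_eq_iff free_mod_def unitv_def if_distrib[of "\<lambda>x. _ * x"] cong: if_cong)

lemma unitv_neq_0: "unitv b \<noteq> 0"
  by (auto simp: unitv_def fun_eq_iff)

lemma fhom_iff_homcomp: "fhom dg d f \<longleftrightarrow> homcomp dg d f = f"
  by (auto simp: fhom_def homcomp_def fun_eq_iff homog_iff_hcomp)

lemma fhom_homcomp [simp]: "fhom dg d (homcomp dg d f)"
  by (simp add: fhom_def homcomp_def)

lemma homcomp_fhom:
  "fhom dg d f \<Longrightarrow> homcomp dg e f = (if e = d then f else 0)"
proof
  fix b assume "fhom dg d f"
  then have "homog (d - dg b) (f b)" by (simp add: fhom_def)
  from hcomp_homog[OF this] show "homcomp dg e f b = (if e = d then f else 0) b"
    by (simp add: homcomp_def)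
qed

lemma homcomp_add: "homcomp dg d (f + g) = homcomp dg d f + homcomp dg d g"
  by (auto simp: homcomp_def fun_eq_iff hcomp_add)

lemma hcomp_diff: "hcomp d (p - q) = hcomp d p - hcomp d q"
  by (rule poly_mapping_eqI) (simp add: lookup_hcomp lookup_minus)

lemma homcomp_diff: "homcomp dg d (f - g) = homcomp dg d f - homcomp dg d g"
  by (auto simp: homcomp_def fun_eq_iff hcomp_diff)

lemma homcomp_0 [simp]: "homcomp dg d 0 = 0"
  by (auto simp: homcomp_def fun_eq_iff)

lemma hcomp_sum: "hcomp d (sum f S) = (\<Sum>x\<in>S. hcomp d (f x))"
  by (induction S rule: infinite_finite_induct) (auto simp: hcomp_add)

lemma homcomp_sum: "homcomp dg d (sum f S) = (\<Sum>x\<in>S. homcomp dg d (f x))"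
  by (rule ext) (simp add: homcomp_def hcomp_sum)

lemma fhom_0 [simp]: "fhom dg d 0" by (simp add: fhom_def)

lemma fhom_add: "fhom dg d f \<Longrightarrow> fhom dg d g \<Longrightarrow> fhom dg d (f + g)"
  by (simp add: fhom_iff_homcomp homcomp_add)

lemma fhom_diff: "fhom dg d f \<Longrightarrow> fhom dg d g \<Longrightarrow> fhom dg d (f - g)"
  by (simp add: fhom_iff_homcomp homcomp_diff)

lemma fhom_sum: "(\<And>x. x \<in> S \<Longrightarrow> fhom dg d (f x)) \<Longrightarrow> fhom dg d (sum f S)"
  by (induction S rule: infinite_finite_induct) (auto intro: fhom_add)

lemma fhom_smul: "homog e a \<Longrightarrow> fhom dg d f \<Longrightarrow> fhom dg (e + d) (smul a f)"
  unfolding fhom_def by (metis add_diff_eq homog_mult smul_apply)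

lemma fhom_smul': "homog e a \<Longrightarrow> fhom dg d f \<Longrightarrow> k = e + d \<Longrightarrow> fhom dg k (smul a f)"
  using fhom_smul by blast

lemma fhom_unitv: "fhom dg (dg b) (unitv b)"
  by (auto simp: fhom_def unitv_def)

lemma homcomp_finite:
  assumes "finite B" "f \<in> free_mod W B"
  shows "finite {d. homcomp dg d f \<noteq> 0}"
proof (rule finite_subset)
  show "{d. homcomp dg d f \<noteq> 0} \<subseteq> (\<Union>b\<in>B. (\<lambda>e. e + dg b) ` {e. hcomp e (f b) \<noteq> 0})"
  proof
    fix d assume "d \<in> {d. homcomp dg d f \<noteq> 0}"
    then obtain b where "hcomp (d - dg b) (f b) \<noteq> 0" by (auto simp: homcomp_def fun_eq_iff)
    moreover from this have "b \<in> B" using assms by (auto simp: free_mod_def)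
    ultimately show "d \<in> (\<Union>b\<in>B. (\<lambda>e. e + dg b) ` {e. hcomp e (f b) \<noteq> 0})"
      by (auto intro!: bexI[of _ b] image_eqI[of _ _ "d - dg b"])
  qed
qed (use assms finite_hcomp_nonzero in auto)

lemma sum_homcomp:
  assumes "finite D" "{d. homcomp dg d f \<noteq> 0} \<subseteq> D"
  shows "(\<Sum>d\<in>D. homcomp dg d f) = f"
proof
  fix b
  have "{e. hcomp e (f b) \<noteq> 0} \<subseteq> (\<lambda>d. d - dg b) ` D"
  proof
    fix e assume "e \<in> {e. hcomp e (f b) \<noteq> 0}"
    then have "homcomp dg (e + dg b) f b \<noteq> 0" by (simp add: homcomp_def)
    then have "homcomp dg (e + dg b) f \<noteq> 0" by (metis zero_fun_apply)
    then have "e + dg b \<in> D" using assms by blast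
    then show "e \<in> (\<lambda>d. d - dg b) ` D" by force
  qed
  then have "(\<Sum>e\<in>(\<lambda>d. d - dg b) ` D. hcomp e (f b)) = f b"
    using assms by (intro sum_hcomp) auto
  then show "(\<Sum>d\<in>D. homcomp dg d f) b = f b"
    by (simp add: homcomp_def sum.reindex inj_on_def)
qed

text \<open>An additive map that shifts degrees by k sends the homogeneous decomposition of f to
  that of its image, so it commutes with extracting components.\<close>

lemma homcomp_commute:
  assumes f: "finite B" "f \<in> free_mod W B"
    and add: "\<And>f g. f \<in> free_mod W B \<Longrightarrow> g \<in> free_mod W B \<Longrightarrow> \<phi> (f + g) = \<phi> f + \<phi> g"
    and hom: "\<And>d f. f \<in> free_mod W B \<Longrightarrow> fhom dg d f \<Longrightarrow> fhom dg' (d + k) (\<phi> f)"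
  shows "\<phi> (homcomp dg d f) = homcomp dg' (d + k) (\<phi> f)"
proof -
  have z: "\<phi> 0 = 0" using add[of 0 0] free_mod_closed(1) by auto
  have s: "\<phi> (sum g S) = (\<Sum>x\<in>S. \<phi> (g x))" if "\<And>x. x \<in> S \<Longrightarrow> g x \<in> free_mod W B" for g and S :: "int set"
    using that by (induction S rule: infinite_finite_induct) (auto simp: z add free_mod_sum)
  \<comment> \<open>The degree d is inserted so that the sum over \<open>D\<close> has a term in
    degree d even if that component is 0.\<close>
  define D where "D = insert d {d. homcomp dg d f \<noteq> 0}"
  have D: "finite D" "{d. homcomp dg d f \<noteq> 0} \<subseteq> D" "d \<in> D"
    using homcomp_finite[OF f] by (auto simp: D_def)
  have "\<phi> f = (\<Sum>e\<in>D. \<phi> (homcomp dg e f))"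
    using sum_homcomp[OF D(1,2)] s[of D "\<lambda>e. homcomp dg e f"] f by (metis free_mod_closed(5))
  then have "homcomp dg' (d + k) (\<phi> f) = (\<Sum>e\<in>D. homcomp dg' (d + k) (\<phi> (homcomp dg e f)))"
    by (simp add: homcomp_sum)
  also have "\<dots> = (\<Sum>e\<in>D. if e = d then \<phi> (homcomp dg d f) else 0)"
    by (rule sum.cong) (auto simp: homcomp_fhom[OF hom[OF free_mod_closed(5)[OF f(2)] fhom_homcomp]])
  also have "\<dots> = \<phi> (homcomp dg d f)" using D by simp
  finally show ?thesis by simp
qed

section \<open>Sheaves with free stalks and the extension of morphisms\<close>

lemmas fun_apply = plus_fun_apply zero_fun_apply sum_fun_apply minus_apply smul_apply

declare fun_apply [simp del]

text \<open>The stalk at x is the free module on the labels \<open>B x\<close>, graded by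
  \<open>dg x\<close>. Flabbiness is required in its local form only, as extension from the boundary
  of one element at a time, which is the form that an induction along the poset consumes.\<close>

locale framed_sheaf =
  fixes P :: "'i::finite set set" and W :: "'i set \<Rightarrow> (real ^ 'i) set"
    and B :: "'i set \<Rightarrow> 'b set" and dg :: "'i set \<Rightarrow> 'b \<Rightarrow> int"
    and r :: "'i set \<Rightarrow> 'i set \<Rightarrow> ('b \<Rightarrow> 'i mpoly) \<Rightarrow> ('b \<Rightarrow> 'i mpoly)"
  assumes trunc_Sym: "x \<in> P \<Longrightarrow> y \<in> P \<Longrightarrow> y \<subseteq> x \<Longrightarrow> a \<in> Sym (W x) \<Longrightarrow> trunc (Pow y) a \<in> Sym (W y)"
    and fin: "x \<in> P \<Longrightarrow> finite (B x)"
    and r_in: "x \<in> P \<Longrightarrow> y \<in> P \<Longrightarrow> y \<subseteq> x \<Longrightarrow> f \<in> free_mod (W x) (B x) \<Longrightarrow> r x y f \<in> free_mod (W y) (B y)"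
    and r_add: "x \<in> P \<Longrightarrow> y \<in> P \<Longrightarrow> y \<subseteq> x \<Longrightarrow> f \<in> free_mod (W x) (B x) \<Longrightarrow> g \<in> free_mod (W x) (B x) \<Longrightarrow>
      r x y (f + g) = r x y f + r x y g"
    and r_smul: "x \<in> P \<Longrightarrow> y \<in> P \<Longrightarrow> y \<subseteq> x \<Longrightarrow> a \<in> Sym (W x) \<Longrightarrow> f \<in> free_mod (W x) (B x) \<Longrightarrow>
      r x y (smul a f) = smul (trunc (Pow y) a) (r x y f)"
    and r_hom: "x \<in> P \<Longrightarrow> y \<in> P \<Longrightarrow> y \<subseteq> x \<Longrightarrow> f \<in> free_mod (W x) (B x) \<Longrightarrow> fhom (dg x) d f \<Longrightarrow>
      fhom (dg y) d (r x y f)"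
    and r_id: "x \<in> P \<Longrightarrow> f \<in> free_mod (W x) (B x) \<Longrightarrow> r x x f = f"
    and r_comp: "x \<in> P \<Longrightarrow> y \<in> P \<Longrightarrow> z \<in> P \<Longrightarrow> z \<subseteq> y \<Longrightarrow> y \<subseteq> x \<Longrightarrow> f \<in> free_mod (W x) (B x) \<Longrightarrow>
      r y z (r x y f) = r x z f"
    and flab: "x \<in> P \<Longrightarrow> (\<And>y. y \<in> P \<Longrightarrow> y \<subset> x \<Longrightarrow> t y \<in> free_mod (W y) (B y)) \<Longrightarrow>
      (\<And>y z. y \<in> P \<Longrightarrow> z \<in> P \<Longrightarrow> y \<subset> x \<Longrightarrow> z \<subseteq> y \<Longrightarrow> r y z (t y) = t z) \<Longrightarrow>
      \<exists>f\<in>free_mod (W x) (B x). \<forall>y\<in>P. y \<subset> x \<longrightarrow> r x y f = t y"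
begin

abbreviation "fm x \<equiv> free_mod (W x) (B x)"

lemma r_zero: "x \<in> P \<Longrightarrow> y \<in> P \<Longrightarrow> y \<subseteq> x \<Longrightarrow> r x y 0 = 0"
  using r_add[of x y 0 0] free_mod_closed(1) by auto

lemma r_diff:
  assumes "x \<in> P" "y \<in> P" "y \<subseteq> x" "f \<in> fm x" "g \<in> fm x"
  shows "r x y (f - g) = r x y f - r x y g"
  using r_add[OF assms(1-3), of "f - g" g] assms by (simp add: free_mod_closed)

lemma r_sum:
  assumes "x \<in> P" "y \<in> P" "y \<subseteq> x" "\<And>s. s \<in> S \<Longrightarrow> f s \<in> fm x"
  shows "r x y (sum f S) = (\<Sum>s\<in>S. r x y (f s))"
  using assms(4) by (induction S rule: infinite_finite_induct) (auto simp: r_zero r_add free_mod_sum assms)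

lemma r_homcomp:
  assumes "x \<in> P" "y \<in> P" "y \<subseteq> x" "f \<in> fm x"
  shows "r x y (homcomp (dg x) d f) = homcomp (dg y) d (r x y f)"
  using homcomp_commute[OF fin[OF assms(1)] assms(4), of "r x y" "dg x" "dg y" 0 d] r_add r_hom assms by simp

text \<open>Restriction preserves degrees, so the degree d component of any extension of homogeneous
  data is again an extension.\<close>

lemma flab_hom:
  assumes x: "x \<in> P" and t: "\<And>y. y \<in> P \<Longrightarrow> y \<subset> x \<Longrightarrow> t y \<in> fm y"
    and c: "\<And>y z. y \<in> P \<Longrightarrow> z \<in> P \<Longrightarrow> y \<subset> x \<Longrightarrow> z \<subseteq> y \<Longrightarrow> r y z (t y) = t z"
    and h: "\<And>y. y \<in> P \<Longrightarrow> y \<subset> x \<Longrightarrow> fhom (dg y) d (t y)"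
  shows "\<exists>f\<in>fm x. fhom (dg x) d f \<and> (\<forall>y\<in>P. y \<subset> x \<longrightarrow> r x y f = t y)"
proof -
  obtain f where f: "f \<in> fm x" "\<And>y. y \<in> P \<Longrightarrow> y \<subset> x \<Longrightarrow> r x y f = t y"
    using flab[OF x t c] by blast
  have "r x y (homcomp (dg x) d f) = t y" if "y \<in> P" "y \<subset> x" for y
    using r_homcomp[OF x that(1) _ f(1)] that f h[OF that] by (auto simp: fhom_iff_homcomp)
  then show ?thesis using f by (intro bexI[of _ "homcomp (dg x) d f"]) (auto intro: free_mod_closed)
qed

end

text \<open>The domain \<open>U\<close> is a parameter because morphisms are constructed one element
  of the poset at a time; \<open>k\<close> is the degree shift.\<close>

definition framed_mor ::
  "('i::finite set \<Rightarrow> (real ^ 'i) set) \<Rightarrow> ('i set \<Rightarrow> 'b set) \<Rightarrow> ('i set \<Rightarrow> 'b \<Rightarrow> int) \<Rightarrow>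
   ('i set \<Rightarrow> 'i set \<Rightarrow> ('b \<Rightarrow> 'i mpoly) \<Rightarrow> ('b \<Rightarrow> 'i mpoly)) \<Rightarrow> ('i set \<Rightarrow> 'c set) \<Rightarrow> ('i set \<Rightarrow> 'c \<Rightarrow> int) \<Rightarrow>
   ('i set \<Rightarrow> 'i set \<Rightarrow> ('c \<Rightarrow> 'i mpoly) \<Rightarrow> ('c \<Rightarrow> 'i mpoly)) \<Rightarrow> int \<Rightarrow> 'i set set \<Rightarrow>
   ('i set \<Rightarrow> ('b \<Rightarrow> 'i mpoly) \<Rightarrow> ('c \<Rightarrow> 'i mpoly)) \<Rightarrow> bool" where
  "framed_mor W B dg r B' dg' r' k U \<phi> \<longleftrightarrow>
     (\<forall>x\<in>U. \<forall>f\<in>free_mod (W x) (B x). \<phi> x f \<in> free_mod (W x) (B' x)) \<and>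
     (\<forall>x\<in>U. \<forall>f\<in>free_mod (W x) (B x). \<forall>g\<in>free_mod (W x) (B x). \<phi> x (f + g) = \<phi> x f + \<phi> x g) \<and>
     (\<forall>x\<in>U. \<forall>a\<in>Sym (W x). \<forall>f\<in>free_mod (W x) (B x). \<phi> x (smul a f) = smul a (\<phi> x f)) \<and>
     (\<forall>x\<in>U. \<forall>f\<in>free_mod (W x) (B x). \<forall>d. fhom (dg x) d f \<longrightarrow> fhom (dg' x) (d + k) (\<phi> x f)) \<and>
     (\<forall>x\<in>U. \<forall>y\<in>U. y \<subseteq> x \<longrightarrow> (\<forall>f\<in>free_mod (W x) (B x). r' x y (\<phi> x f) = \<phi> y (r x y f)))"

lemma framed_morD:
  assumes "framed_mor W B dg r B' dg' r' k U \<phi>" "x \<in> U" "f \<in> free_mod (W x) (B x)"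
  shows "\<phi> x f \<in> free_mod (W x) (B' x)"
    and "g \<in> free_mod (W x) (B x) \<Longrightarrow> \<phi> x (f + g) = \<phi> x f + \<phi> x g"
    and "a \<in> Sym (W x) \<Longrightarrow> \<phi> x (smul a f) = smul a (\<phi> x f)"
    and "fhom (dg x) d f \<Longrightarrow> fhom (dg' x) (d + k) (\<phi> x f)"
    and "y \<in> U \<Longrightarrow> y \<subseteq> x \<Longrightarrow> r' x y (\<phi> x f) = \<phi> y (r x y f)"
  using assms unfolding framed_mor_def by (simp_all only:)

lemma framed_mor_sum:
  assumes "framed_mor W B dg r B' dg' r' k U \<phi>" "x \<in> U" "\<And>s. s \<in> S \<Longrightarrow> g s \<in> free_mod (W x) (B x)"
  shows "\<phi> x (sum g S) = (\<Sum>s\<in>S. \<phi> x (g s))"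
proof -
  have z: "\<phi> x 0 = 0" using framed_morD(3)[OF assms(1,2) free_mod_closed(1) Sym_0] by (simp only: smul_simps)
  show ?thesis
    using assms(3)
  proof (induction S rule: infinite_finite_induct)
    case (insert s S)
    then have "\<phi> x (g s + sum g S) = \<phi> x (g s) + \<phi> x (sum g S)"
      by (intro framed_morD(2)[OF assms(1,2)] free_mod_sum) simp_all
    with insert show ?case by simp
  qed (simp_all add: z)
qed

text \<open>This is the universal property of a free module in coordinates: the vectors
  \<open>u b\<close> are the prescribed images of the basis, and the degree condition on them is
  inherited by the map.\<close>

lemma linear_combination_map:
  assumes B: "finite B" and u: "\<And>b. b \<in> B \<Longrightarrow> u b \<in> free_mod W B'"
  defines "\<phi> \<equiv> \<lambda>f. \<Sum>b\<in>B. smul (f b) (u b)"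
  shows "f \<in> free_mod W B \<Longrightarrow> \<phi> f \<in> free_mod W B'"
    and "\<phi> (f + g) = \<phi> f + \<phi> g"
    and "\<phi> (smul a f) = smul a (\<phi> f)"
    and "(\<And>b. b \<in> B \<Longrightarrow> fhom dg' (dg b + k) (u b)) \<Longrightarrow> fhom dg d f \<Longrightarrow> fhom dg' (d + k) (\<phi> f)"
    and "b \<in> B \<Longrightarrow> \<phi> (unitv b) = u b"
proof -
  show "f \<in> free_mod W B \<Longrightarrow> \<phi> f \<in> free_mod W B'"
    unfolding \<phi>_def by (intro free_mod_sum free_mod_closed(4) u free_mod_Sym)
  show "\<phi> (f + g) = \<phi> f + \<phi> g" by (simp add: \<phi>_def smul_distrib sum.distrib fun_apply)
  show "\<phi> (smul a f) = smul a (\<phi> f)" by (simp add: \<phi>_def smul_sum fun_apply)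
  show "fhom dg' (d + k) (\<phi> f)" if "\<And>b. b \<in> B \<Longrightarrow> fhom dg' (dg b + k) (u b)" "fhom dg d f"
    unfolding \<phi>_def
    by (intro fhom_sum fhom_smul'[where d = "dg _ + k"]) (use that in \<open>auto simp: fhom_def\<close>)
  show "b \<in> B \<Longrightarrow> \<phi> (unitv b) = u b"
    unfolding \<phi>_def unitv_def using B by (simp add: if_distrib[of "\<lambda>x. smul x _"] cong: if_cong)
qed

text \<open>Morphisms out of a sheaf with free stalks into a flabby sheaf extend: going up the poset, the
  images of the basis elements are lifted through the surjection onto sections over the boundary.\<close>

lemma morphism_extension:
  assumes M: "framed_sheaf P W B dg r" and N: "framed_sheaf P W B' dg' r'"
    and F: "F \<in> P" and u: "\<And>b. b \<in> B F \<Longrightarrow> u b \<in> free_mod (W F) (B' F)"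
    "\<And>b. b \<in> B F \<Longrightarrow> fhom (dg' F) (dg F b + k) (u b)"
    "\<And>b y. b \<in> B F \<Longrightarrow> y \<in> P \<Longrightarrow> y \<subset> F \<Longrightarrow> r' F y (u b) = 0"
  shows "\<exists>\<phi>. framed_mor W B dg r B' dg' r' k P \<phi> \<and>
     (\<forall>f. \<phi> F f = (\<Sum>b\<in>B F. smul (f b) (u b))) \<and> (\<forall>x\<in>P. \<not> F \<subseteq> x \<longrightarrow> (\<forall>f. \<phi> x f = 0))"
proof -
  interpret M: framed_sheaf P W B dg r by fact
  interpret N: framed_sheaf P W B' dg' r' by fact
  \<comment> \<open>This is the largest open set in which \<open>F\<close> is maximal. There the map
    given by \<open>u\<close> at \<open>F\<close> and 0 elsewhere is already compatible with
    restriction, because \<open>u\<close> vanishes on everything below \<open>F\<close>.\<close>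
  define U0 where "U0 = {x \<in> P. \<not> F \<subset> x}"
  have "\<exists>\<phi>. framed_mor W B dg r B' dg' r' k U \<phi> \<and>
     (\<forall>f. \<phi> F f = (\<Sum>b\<in>B F. smul (f b) (u b))) \<and> (\<forall>x\<in>P. \<not> F \<subseteq> x \<longrightarrow> (\<forall>f. \<phi> x f = 0))"
    if "U0 \<subseteq> U" "U \<subseteq> P" "\<And>x y. x \<in> U \<Longrightarrow> y \<in> P \<Longrightarrow> y \<subseteq> x \<Longrightarrow> y \<in> U" for U
    using that
  proof (induction "card U" arbitrary: U rule: less_induct)
    case less
    show ?case
    proof (cases "U = U0")
      case True
      define \<phi> where "\<phi> x f = (if x = F then \<Sum>b\<in>B F. smul (f b) (u b) else 0)" for x f
      note L = linear_combination_map[where u = u, OF M.fin[OF F] u(1)]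
      have "framed_mor W B dg r B' dg' r' k U \<phi>"
        unfolding framed_mor_def
      proof (intro conjI ballI allI impI)
        fix x y f assume x: "x \<in> U" "y \<in> U" "y \<subseteq> x" and f: "f \<in> M.fm x"
        have P: "x \<in> P" "y \<in> P" using x less.prems by auto
        show "r' x y (\<phi> x f) = \<phi> y (r x y f)"
        proof (cases "x = F")
          case True
          show ?thesis
          proof (cases "y = F")
            case False
            have "r' F y (\<Sum>b\<in>B F. smul (f b) (u b)) = (\<Sum>b\<in>B F. r' F y (smul (f b) (u b)))"
              using True P x f by (intro N.r_sum) (auto intro: free_mod_closed(4)[OF free_mod_Sym u(1)])
            also have "\<dots> = 0"
              using True P x f False
              by (intro sum.neutral ballI) (simp add: N.r_smul[OF _ _ _ free_mod_Sym u(1)] u(3) psubset_eq)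
            finally show ?thesis using True False by (simp add: \<phi>_def)
          next
            case y: True
            then show ?thesis using True f F L(1)[where f = f] by (simp add: \<phi>_def N.r_id M.r_id)
          qed
        next
          case False
          then have "y \<noteq> F" using x True by (auto simp: U0_def)
          then show ?thesis using False P x by (simp add: \<phi>_def N.r_zero)
        qed
      next
        fix x f assume "x \<in> U" "f \<in> M.fm x"
        then show "\<phi> x f \<in> N.fm x" using L(1)[where f = f] by (auto simp: \<phi>_def free_mod_closed)
      next
        fix x f g assume "f \<in> M.fm x" "g \<in> M.fm x"
        show "\<phi> x (f + g) = \<phi> x f + \<phi> x g" using L(2)[where f = f and g = g] by (simp add: \<phi>_def)
      next
        fix x a f assume "f \<in> M.fm x"
        show "\<phi> x (smul a f) = smul a (\<phi> x f)" using L(3)[where f = f and a = a] by (simp add: \<phi>_def)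
      next
        fix x f d assume "f \<in> M.fm x" "fhom (dg x) d f"
        then show "fhom (dg' x) (d + k) (\<phi> x f)" using L(4)[OF _ u(2), where f = f and d = d] by (auto simp: \<phi>_def)
      qed
      moreover have "\<forall>f. \<phi> F f = (\<Sum>b\<in>B F. smul (f b) (u b))" by (simp only: \<phi>_def if_True simp_thms)
      moreover have "\<phi> x f = 0" if "\<not> F \<subseteq> x" for x f
        using that unfolding \<phi>_def by (metis order_refl)
      ultimately show ?thesis by (intro exI[of _ \<phi>] conjI ballI impI allI) simp_all
    next
      case False
      have finU: "finite (U - U0)" by simp
      moreover have "U - U0 \<noteq> {}" using False less.prems by blast
      \<comment> \<open>A set of largest size in the difference is maximal in \<open>U\<close>, so
        removing it leaves an open set.\<close>
      ultimately obtain x where x: "x \<in> U - U0" "\<And>z. z \<in> U - U0 \<Longrightarrow> card z \<le> card x"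
        using obtains_MAX[of "U - U0" card] by (metis Max_ge finite_imageI imageI)
      have xP: "x \<in> P" and Fx: "F \<subset> x" and xU: "x \<in> U" using x(1) less.prems by (auto simp: U0_def)
      have top: "\<not> x \<subset> z" if "z \<in> U" for z
      proof
        assume "x \<subset> z"
        then have "z \<in> U - U0" using that Fx by (auto simp: U0_def)
        then have "card z \<le> card x" using x(2) by blast
        moreover have "card x < card z" using \<open>x \<subset> z\<close> by (intro psubset_card_mono) auto
        ultimately show False by simp
      qed
      have "card (U - {x}) < card U" using xU by (intro psubset_card_mono) auto
      moreover have "U0 \<subseteq> U - {x}" "U - {x} \<subseteq> P" using x less.prems by auto
      moreover have "z \<in> U - {x}" if "y \<in> U - {x}" "z \<in> P" "z \<subseteq> y" for y z
        using that less.prems(3)[of y z] top[of y] by auto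
      ultimately obtain \<phi> where \<phi>: "framed_mor W B dg r B' dg' r' k (U - {x}) \<phi>"
        "\<forall>f. \<phi> F f = (\<Sum>b\<in>B F. smul (f b) (u b))" "\<forall>x\<in>P. \<not> F \<subseteq> x \<longrightarrow> (\<forall>f. \<phi> x f = 0)"
        using less.hyps[of "U - {x}"] by blast
      have low: "y \<in> U - {x}" if "y \<in> P" "y \<subset> x" for y
        using less.prems(3)[OF xU that(1)] that(2) by blast
      have "\<exists>v\<in>N.fm x. fhom (dg' x) (dg x b + k) v \<and> (\<forall>y\<in>P. y \<subset> x \<longrightarrow> r' x y v = \<phi> y (r x y (unitv b)))"
        if b: "b \<in> B x" for b
      proof (rule N.flab_hom[OF xP])
        note e = free_mod_closed(6)[OF b, of "W x"]
        fix y assume y: "y \<in> P" "y \<subset> x"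
        note ry = M.r_in[OF xP y(1) psubset_imp_subset[OF y(2)] e]
        show "\<phi> y (r x y (unitv b)) \<in> N.fm y"
          by (rule framed_morD(1)[OF \<phi>(1) low[OF y] ry])
        show "fhom (dg' y) (dg x b + k) (\<phi> y (r x y (unitv b)))"
          by (rule framed_morD(4)[OF \<phi>(1) low[OF y] ry M.r_hom[OF xP y(1) psubset_imp_subset[OF y(2)] e fhom_unitv]])
        fix z assume z: "z \<in> P" "z \<subseteq> y"
        then have "z \<subset> x" using y by auto
        have "r' y z (\<phi> y (r x y (unitv b))) = \<phi> z (r y z (r x y (unitv b)))"
          by (rule framed_morD(5)[OF \<phi>(1) low[OF y] ry low[OF z(1) \<open>z \<subset> x\<close>] z(2)])
        then show "r' y z (\<phi> y (r x y (unitv b))) = \<phi> z (r x z (unitv b))"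
          using M.r_comp[OF xP y(1) z(1) z(2) psubset_imp_subset[OF y(2)] e] by simp
      qed
      then obtain v where v: "\<And>b. b \<in> B x \<Longrightarrow> v b \<in> N.fm x" "\<And>b. b \<in> B x \<Longrightarrow> fhom (dg' x) (dg x b + k) (v b)"
        "\<And>b y. b \<in> B x \<Longrightarrow> y \<in> P \<Longrightarrow> y \<subset> x \<Longrightarrow> r' x y (v b) = \<phi> y (r x y (unitv b))"
        by metis
      define \<psi> where "\<psi> = \<phi>(x := \<lambda>f. \<Sum>b\<in>B x. smul (f b) (v b))"
      note L = linear_combination_map[where u = v, OF M.fin[OF xP] v(1)]
      note \<phi>' = framed_morD[OF \<phi>(1)]
      note \<phi>sum = framed_mor_sum[OF \<phi>(1)]
      have "framed_mor W B dg r B' dg' r' k U \<psi>"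
        unfolding framed_mor_def
      proof (intro conjI ballI allI impI)
        fix z y f assume z: "z \<in> U" "y \<in> U" "y \<subseteq> z" and f: "f \<in> M.fm z"
        show "r' z y (\<psi> z f) = \<psi> y (r z y f)"
        proof (cases "z = x")
          case True
          show ?thesis
          proof (cases "y = x")
            case y: True
            then show ?thesis using True f xP L(1)[where f = f] by (simp add: \<psi>_def N.r_id M.r_id)
          next
            case False
            have f: "f \<in> M.fm x" and y: "y \<in> P" "y \<subset> x" using f True False z less.prems by auto
            note yx = psubset_imp_subset[OF y(2)] and yU = low[OF y]
            have e: "r x y (unitv b) \<in> M.fm y" if b: "b \<in> B x" for b
              by (rule M.r_in[OF xP y(1) yx free_mod_closed(6)[OF b]])
            have fb: "trunc (Pow y) (f b) \<in> Sym (W y)" for b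
              using M.trunc_Sym[OF xP y(1) yx free_mod_Sym[OF f]] .
            have "r' x y (\<Sum>b\<in>B x. smul (f b) (v b)) = (\<Sum>b\<in>B x. r' x y (smul (f b) (v b)))"
              using f by (intro N.r_sum[OF xP y(1) yx]) (auto intro: free_mod_closed(4)[OF free_mod_Sym v(1)])
            also have "\<dots> = (\<Sum>b\<in>B x. smul (trunc (Pow y) (f b)) (\<phi> y (r x y (unitv b))))"
              by (intro sum.cong refl) (simp add: N.r_smul[OF xP y(1) yx free_mod_Sym[OF f] v(1)] v(3) y)
            also have "\<dots> = (\<Sum>b\<in>B x. \<phi> y (r x y (smul (f b) (unitv b))))"
              by (intro sum.cong refl)
                (simp add: M.r_smul[OF xP y(1) yx free_mod_Sym[OF f] free_mod_closed(6)] \<phi>'(3)[OF yU e fb])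
            also have "\<dots> = \<phi> y (\<Sum>b\<in>B x. r x y (smul (f b) (unitv b)))"
              by (rule \<phi>sum[OF yU, symmetric])
                (rule M.r_in[OF xP y(1) yx free_mod_closed(4)[OF free_mod_Sym[OF f] free_mod_closed(6)]])
            also have "(\<Sum>b\<in>B x. r x y (smul (f b) (unitv b))) = r x y (\<Sum>b\<in>B x. smul (f b) (unitv b))"
              by (rule M.r_sum[OF xP y(1) yx, symmetric])
                (rule free_mod_closed(4)[OF free_mod_Sym[OF f] free_mod_closed(6)])
            also have "(\<Sum>b\<in>B x. smul (f b) (unitv b)) = f"
              by (rule free_mod_expand[OF M.fin[OF xP] f, symmetric])
            finally show ?thesis using True False by (simp add: \<psi>_def)
          qed
        next
          case False
          then have "y \<noteq> x" using z top[of z] by auto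
          then show ?thesis using False z f \<phi>'(5)[of z f y] by (simp add: \<psi>_def)
        qed
      next
        fix z f assume "z \<in> U" "f \<in> M.fm z"
        then show "\<psi> z f \<in> N.fm z" using L(1)[where f = f] \<phi>'(1)[of z f] by (cases "z = x") (simp_all add: \<psi>_def)
      next
        fix z f g assume "z \<in> U" "f \<in> M.fm z" "g \<in> M.fm z"
        then show "\<psi> z (f + g) = \<psi> z f + \<psi> z g" using L(2)[where f = f and g = g] \<phi>'(2)[of z f g] by (cases "z = x") (simp_all add: \<psi>_def)
      next
        fix z a f assume "z \<in> U" "a \<in> Sym (W z)" "f \<in> M.fm z"
        then show "\<psi> z (smul a f) = smul a (\<psi> z f)" using L(3)[where f = f and a = a] \<phi>'(3)[of z f a] by (cases "z = x") (simp_all add: \<psi>_def)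
      next
        fix z f d assume "z \<in> U" "f \<in> M.fm z" "fhom (dg z) d f"
        then show "fhom (dg' z) (d + k) (\<psi> z f)" using L(4)[OF _ v(2), where f = f and d = d] \<phi>'(4)[of z f d] by (cases "z = x") (simp_all add: \<psi>_def)
      qed
      moreover have "F \<noteq> x" "\<And>z. \<not> F \<subseteq> z \<Longrightarrow> z \<noteq> x" using Fx by auto
      then have "\<psi> F = \<phi> F" "\<And>z. \<not> F \<subseteq> z \<Longrightarrow> \<psi> z = \<phi> z" by (simp_all add: \<psi>_def)
      ultimately show ?thesis using \<phi>(2,3) by (intro exI[of _ \<psi>] conjI ballI impI allI) simp_all
    qed
  qed
  from this[of P] show ?thesis by (auto simp: U0_def)
qed

subsection \<open>Fitting decomposition\<close>

context vector_space
begin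

text \<open>If the chain never stabilised, vectors \<open>v n\<close> in \<open>U n\<close> outside
  \<open>U (Suc n)\<close> would exist; any block of consecutive ones is independent, since the
  first lies outside a subspace containing the others. Long blocks contradict the finite spanning
  set.\<close>

lemma descending_chain_stable:
  assumes S: "finite S" and U: "\<And>n. subspace (U n)" "\<And>n. U n \<subseteq> span S" "\<And>n. U (Suc n) \<subseteq> U n"
  shows "\<exists>n::nat. U (Suc n) = U n"
proof (rule ccontr)
  assume "\<nexists>n. U (Suc n) = U n"
  then have "\<exists>v. v \<in> U n \<and> v \<notin> U (Suc n)" for n using U(3) by blast
  then obtain v where v: "\<And>n. v n \<in> U n" "\<And>n. v n \<notin> U (Suc n)" by metis
  have "independent (v ` {n..<n + k}) \<and> card (v ` {n..<n + k}) = k \<and> v ` {n..<n + k} \<subseteq> U n" for n k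
  proof (induction k arbitrary: n)
    case (Suc k)
    let ?T = "v ` {Suc n..<Suc n + k}"
    have T: "independent ?T" "card ?T = k" "?T \<subseteq> U (Suc n)" using Suc[of "Suc n"] by auto
    have "span ?T \<subseteq> U (Suc n)" by (rule span_minimal[OF T(3) U(1)])
    then have n: "v n \<notin> span ?T" using v(2) by blast
    have "v n \<notin> ?T" using n span_base by blast
    moreover have eq: "v ` {n..<n + Suc k} = insert (v n) ?T"
      by (simp add: atLeastLessThanSuc_atLeastAtMost flip: image_insert) (metis Suc_le_eq add_Suc atLeastLessThanSuc_atLeastAtMost le_add1 atLeastAtMost_insertL)
    ultimately show ?case
      unfolding eq using T U(3)[of n] v(1)[of n] independent_insertI[OF n T(1)] by auto
  qed (simp add: independent_empty)
  note * = this[of 0 "Suc (card S)"]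
  then have "v ` {0..<0 + Suc (card S)} \<subseteq> span S" using U(2)[of 0] by (meson order_trans)
  from independent_span_bound[OF S _ this] * show False by simp
qed

lemma ascending_chain_stable:
  assumes S: "finite S" and U: "\<And>n. subspace (U n)" "\<And>n. U n \<subseteq> span S" "\<And>n. U n \<subseteq> U (Suc n)"
  shows "\<exists>n::nat. U (Suc n) = U n"
proof (rule ccontr)
  assume "\<nexists>n. U (Suc n) = U n"
  then have "\<exists>v. v \<in> U (Suc n) \<and> v \<notin> U n" for n using U(3) by blast
  then obtain v where v: "\<And>n. v n \<in> U (Suc n)" "\<And>n. v n \<notin> U n" by metis
  have "independent (v ` {..<k}) \<and> card (v ` {..<k}) = k \<and> v ` {..<k} \<subseteq> U k" for k
  proof (induction k)
    case (Suc k)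
    let ?T = "v ` {..<k}"
    have T: "independent ?T" "card ?T = k" "?T \<subseteq> U k" using Suc by auto
    have "span ?T \<subseteq> U k" by (rule span_minimal[OF T(3) U(1)])
    then have n: "v k \<notin> span ?T" using v(2) by blast
    have nT: "v k \<notin> ?T" using n span_superset[of ?T] by (rule contra_subsetD[rotated])
    have eq: "v ` {..<Suc k} = insert (v k) ?T" by (simp add: lessThan_Suc)
    show ?case
      unfolding eq
    proof (intro conjI)
      show "independent (insert (v k) ?T)" by (rule independent_insertI[OF n T(1)])
      show "card (insert (v k) ?T) = Suc k" using nT T(2) by simp
      show "insert (v k) ?T \<subseteq> U (Suc k)" using T(3) U(3)[of k] v(1)[of k] by (meson insert_subset order_trans)
    qed
  qed (simp add: independent_empty)
  note * = this[of "Suc (card S)"]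
  then have "v ` {..<Suc (card S)} \<subseteq> span S" using U(2)[of "Suc (card S)"] by (meson order_trans)
  from independent_span_bound[OF S _ this] * show False by simp
qed

text \<open>Kernels and images of the iterates stabilise, and the stable kernel and stable image are
  complementary. Exponents are quantified rather than fixed, because different degrees of a graded
  module may stabilise at different exponents.\<close>

lemma fitting:
  assumes S: "finite S" and X: "subspace X" "X \<subseteq> span S"
    and \<phi>: "\<And>x. x \<in> X \<Longrightarrow> \<phi> x \<in> X" "\<And>x y. x \<in> X \<Longrightarrow> y \<in> X \<Longrightarrow> \<phi> (x + y) = \<phi> x + \<phi> y"
      "\<And>c x. x \<in> X \<Longrightarrow> \<phi> (scale c x) = scale c (\<phi> x)"
  shows "x \<in> X \<Longrightarrow> \<exists>k\<in>X. \<exists>j\<in>X. x = k + j \<and> (\<exists>n. (\<phi> ^^ n) k = 0) \<and> (\<forall>n. \<exists>y\<in>X. (\<phi> ^^ n) y = j)"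
    and "x \<in> X \<Longrightarrow> (\<phi> ^^ n) x = 0 \<Longrightarrow> (\<And>n. \<exists>y\<in>X. (\<phi> ^^ n) y = x) \<Longrightarrow> x = 0"
proof -
  have p1: "(\<phi> ^^ n) x \<in> X" if "x \<in> X" for n x
    using that by (induction n) (auto simp: \<phi>(1))
  have p2: "(\<phi> ^^ n) (x + y) = (\<phi> ^^ n) x + (\<phi> ^^ n) y" if "x \<in> X" "y \<in> X" for n x y
    using that by (induction n) (auto simp: \<phi>(2) p1)
  have p3: "(\<phi> ^^ n) (scale c x) = scale c ((\<phi> ^^ n) x)" if "x \<in> X" for n x c
    using that by (induction n) (auto simp: \<phi>(3) p1)
  have p0: "(\<phi> ^^ n) 0 = 0" for n using p3[of 0 n 0] X(1) by (simp add: subspace_0)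
  define I where "I n = (\<phi> ^^ n) ` X" for n
  define K where "K n = {x \<in> X. (\<phi> ^^ n) x = 0}" for n
  have Isub: "subspace (I n)" for n
  proof (rule subspaceI)
    show "0 \<in> I n" unfolding I_def by (rule image_eqI[of _ _ 0]) (simp_all add: p0 subspace_0[OF X(1)])
    fix x y assume "x \<in> I n" "y \<in> I n"
    then obtain a b where "a \<in> X" "b \<in> X" "x = (\<phi> ^^ n) a" "y = (\<phi> ^^ n) b" by (auto simp: I_def)
    then show "x + y \<in> I n"
      unfolding I_def by (intro image_eqI[of _ _ "a + b"]) (auto simp: p2 subspace_add[OF X(1)])
  next
    fix c x assume "x \<in> I n"
    then obtain a where "a \<in> X" "x = (\<phi> ^^ n) a" by (auto simp: I_def)
    then show "scale c x \<in> I n"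
      unfolding I_def by (intro image_eqI[of _ _ "scale c a"]) (auto simp: p3 subspace_scale[OF X(1)])
  qed
  have Ksub: "subspace (K n)" for n
    by (rule subspaceI) (auto simp: K_def p0 p2 p3 subspace_0[OF X(1)] subspace_add[OF X(1)] subspace_scale[OF X(1)])
  have Idec: "I (Suc n) \<subseteq> I n" for n
  proof
    fix x assume "x \<in> I (Suc n)"
    then obtain a where "a \<in> X" "x = (\<phi> ^^ n) (\<phi> a)" by (auto simp: I_def funpow_swap1)
    then show "x \<in> I n" using \<phi>(1) by (auto simp: I_def)
  qed
  have "I n \<subseteq> X" "K n \<subseteq> X" for n using p1 by (auto simp: I_def K_def)
  then have IX: "I n \<subseteq> span S" and KX: "K n \<subseteq> span S" for n using X(2) by blast+
  have \<phi>0: "\<phi> 0 = 0" using p0[of 1] by simp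
  have Kinc: "K n \<subseteq> K (Suc n)" for n by (auto simp: K_def \<phi>0)
  obtain a where a: "I (Suc a) = I a" using descending_chain_stable[where U = I, OF S Isub IX Idec] by blast
  obtain b where b: "K (Suc b) = K b" using ascending_chain_stable[where U = K, OF S Ksub KX Kinc] by blast
  have Im: "I m = I a" if "a \<le> m" for m
    using that
  proof (induction m rule: dec_induct)
    case (step m)
    have "I (Suc m) = \<phi> ` I m" "I (Suc a) = \<phi> ` I a" by (auto simp: I_def image_image)
    then show ?case using step a by simp
  qed simp
  have Km: "K m = K b" if "b \<le> m" for m
    using that
  proof (induction m rule: dec_induct)
    case (step m)
    have "x \<in> K m" if x: "x \<in> K (Suc m)" for x
    proof -
      \<comment> \<open>Iterating m - b times moves x into the kernel of exponent b + 1, which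
        equals the kernel of exponent b.\<close>
      have "(\<phi> ^^ Suc b) ((\<phi> ^^ (m - b)) x) = (\<phi> ^^ Suc m) x"
        using step(1) by (simp add: funpow_add[symmetric, THEN fun_cong, unfolded o_def])
      then have "(\<phi> ^^ (m - b)) x \<in> K (Suc b)" using x p1 by (simp add: K_def)
      then have "(\<phi> ^^ (m - b)) x \<in> K b" unfolding b .
      then have "(\<phi> ^^ b) ((\<phi> ^^ (m - b)) x) = 0" by (simp add: K_def)
      then have "(\<phi> ^^ m) x = 0"
        using step(1) by (simp add: funpow_add[symmetric, THEN fun_cong, unfolded o_def])
      then show ?thesis using x by (simp add: K_def)
    qed
    then show ?case using Kinc[of m] step by blast
  qed simp
  define N where "N = max a b"
  have IN: "I m = I N" if "N \<le> m" for m using Im[of m] Im[of N] that by (simp add: N_def)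
  have KN: "K m = K N" if "N \<le> m" for m using Km[of m] Km[of N] that by (simp add: N_def)
  have padd: "(\<phi> ^^ (m + n)) x = (\<phi> ^^ m) ((\<phi> ^^ n) x)" for m n x by (simp add: funpow_add)
  show "\<exists>k\<in>X. \<exists>j\<in>X. x = k + j \<and> (\<exists>n. (\<phi> ^^ n) k = 0) \<and> (\<forall>n. \<exists>y\<in>X. (\<phi> ^^ n) y = j)" if x: "x \<in> X"
  proof -
    \<comment> \<open>Images are constant from N on, so the N-th iterate of x is also the 2N-th
      iterate of some y; the N-th iterate of y is the component of x in the stable image.\<close>
    have "(\<phi> ^^ N) x \<in> I (N + N)" using x IN[of "N + N"] by (auto simp: I_def)
    then obtain y where y: "y \<in> X" "(\<phi> ^^ N) x = (\<phi> ^^ (N + N)) y" by (auto simp: I_def)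
    let ?j = "(\<phi> ^^ N) y"
    have j: "?j \<in> X" using p1 y by simp
    have k: "x - ?j \<in> X" using subspace_diff[OF X(1)] x j by simp
    have "(\<phi> ^^ N) (x - ?j) + (\<phi> ^^ N) ?j = (\<phi> ^^ N) x" using p2[OF k j, of N] by simp
    then have "(\<phi> ^^ N) (x - ?j) = 0" using y(2) padd[of N N y] by simp
    moreover have "\<exists>z\<in>X. (\<phi> ^^ n) z = ?j" for n
    proof (cases "n \<le> N")
      case True
      then have "?j = (\<phi> ^^ n) ((\<phi> ^^ (N - n)) y)" using padd[of n "N - n" y] by simp
      then show ?thesis using p1[OF y(1)] by metis
    next
      case False
      then have "?j \<in> I n" using IN[of n] y(1) by (auto simp: I_def)
      then show ?thesis by (auto simp: I_def)
    qed
    moreover have "x = (x - ?j) + ?j" by simp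
    ultimately show ?thesis using k j by blast
  qed
  show "x = 0" if x: "x \<in> X" "(\<phi> ^^ n) x = 0" "\<And>n. \<exists>y\<in>X. (\<phi> ^^ n) y = x"
  proof -
    obtain y where y: "y \<in> X" "(\<phi> ^^ N) y = x" using x(3) by blast
    \<comment> \<open>Since x is the N-th iterate of y and is killed by the n-th iterate, y lies in
      a kernel of exponent at least N, and all of these coincide with \<open>K N\<close>.\<close>
    then have "y \<in> K (n + N)" using x(2) by (simp add: K_def padd)
    then have "y \<in> K N" using KN[of "n + N"] by simp
    then show ?thesis using y by (simp add: K_def)
  qed
qed

end

section \<open>Fitting decomposition of an endomorphism of a framed sheaf\<close>

lemma vector_space_smul: "vector_space (\<lambda>c (f :: 'b \<Rightarrow> 'i mpoly). smul (const_poly c) f)"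
  by standard (auto simp: smul_distrib const_poly_add const_poly_mult)

text \<open>There are only finitely many monomials of each degree and finitely many basis elements.
  This is the finiteness that Fitting's lemma needs, and it holds one degree at a time.\<close>

lemma homogeneous_span:
  fixes W :: "(real ^ 'i::finite) set" and B :: "'b set"
  assumes "finite B"
  shows "\<exists>S. finite S \<and> {f \<in> free_mod W B. fhom dg d f} \<subseteq>
    module.span (\<lambda>c (f :: 'b \<Rightarrow> 'i mpoly). smul (const_poly c) f) S"
proof -
  interpret vector_space "\<lambda>c (f :: 'b \<Rightarrow> 'i mpoly). smul (const_poly c) f" by (rule vector_space_smul)
  define S :: "('b \<Rightarrow> 'i mpoly) set" where
    "S = (\<Union>b\<in>B. (\<lambda>m. smul (Poly_Mapping.single m 1) (unitv b)) ` {m. mdeg m = d - dg b})"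
  have "finite S" using assms finite_mdeg by (auto simp: S_def)
  moreover have "f \<in> span S" if f: "f \<in> free_mod W B" "fhom dg d f" for f
  proof -
    have "smul (f b) (unitv b) \<in> span S" if b: "b \<in> B" for b
    proof -
      have "f b = (\<Sum>m\<in>Poly_Mapping.keys (f b). const_poly (Poly_Mapping.lookup (f b) m) * Poly_Mapping.single m 1)"
        by (rule poly_mapping_eqI)
          (auto simp: lookup_sum const_poly_def mult_single lookup_single when_def in_keys_iff cong: if_cong)
      then have eq: "smul (f b) (unitv b) = (\<Sum>m\<in>Poly_Mapping.keys (f b).
          smul (const_poly (Poly_Mapping.lookup (f b) m)) (smul (Poly_Mapping.single m 1) (unitv b)))"
        by (simp add: smul_sum(2)[symmetric])
      have "smul (Poly_Mapping.single m 1) (unitv b) \<in> S" if "m \<in> Poly_Mapping.keys (f b)" for m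
        using f(2) b that by (auto simp: S_def fhom_def homog_def)
      then show ?thesis by (subst eq) (intro span_sum span_scale span_base)
    qed
    then show ?thesis using free_mod_expand[OF assms f(1)] span_sum[of B "\<lambda>b. smul (f b) (unitv b)" S] by metis
  qed
  ultimately show ?thesis by blast
qed

lemma framed_mor_funpow:
  assumes M: "framed_sheaf P W B dg r" and \<phi>: "framed_mor W B dg r B dg r 0 P \<phi>"
  shows "framed_mor W B dg r B dg r 0 P (\<lambda>x. \<phi> x ^^ n)"
proof (induction n)
  case 0
  show ?case unfolding framed_mor_def by simp
next
  case (Suc n)
  interpret framed_sheaf P W B dg r by fact
  show ?case
    unfolding framed_mor_def
  proof (intro conjI ballI allI impI)
    fix x f assume f: "x \<in> P" "f \<in> fm x"
    note n = framed_morD[OF Suc f]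
    note m = framed_morD[OF \<phi> f(1) n(1)]
    show "(\<phi> x ^^ Suc n) f \<in> fm x" using m(1) by simp
    show "(\<phi> x ^^ Suc n) (f + g) = (\<phi> x ^^ Suc n) f + (\<phi> x ^^ Suc n) g" if g: "g \<in> fm x" for g
      using m(2)[OF framed_morD(1)[OF Suc f(1) g]] n(2)[OF g] by simp
    show "(\<phi> x ^^ Suc n) (smul a f) = smul a ((\<phi> x ^^ Suc n) f)" if a: "a \<in> Sym (W x)" for a
      using m(3)[OF a] n(3)[OF a] by simp
    show "fhom (dg x) (d + 0) ((\<phi> x ^^ Suc n) f)" if d: "fhom (dg x) d f" for d
      using m(4)[of d] n(4)[OF d] by simp
    show "r x y ((\<phi> x ^^ Suc n) f) = (\<phi> y ^^ Suc n) (r x y f)" if y: "y \<in> P" "y \<subseteq> x" for y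
      using m(5)[OF y] n(5)[OF y] by simp
  qed
qed

context framed_sheaf
begin

text \<open>Closure under \<open>homcomp\<close> is what makes the subsheaf graded; negatives come
  from multiplication by constants.\<close>

definition framed_sub :: "('i set \<Rightarrow> ('b \<Rightarrow> 'i mpoly) set) \<Rightarrow> bool" where
  "framed_sub N \<longleftrightarrow>
     (\<forall>x\<in>P. N x \<subseteq> fm x \<and> 0 \<in> N x \<and> (\<forall>f\<in>N x. \<forall>g\<in>N x. f + g \<in> N x) \<and>
        (\<forall>a\<in>Sym (W x). \<forall>f\<in>N x. smul a f \<in> N x) \<and> (\<forall>d. \<forall>f\<in>N x. homcomp (dg x) d f \<in> N x)) \<and>
     (\<forall>x\<in>P. \<forall>y\<in>P. y \<subseteq> x \<longrightarrow> (\<forall>f\<in>N x. r x y f \<in> N y))"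

definition framed_indecomposable :: bool where
  "framed_indecomposable \<longleftrightarrow> (\<forall>N N'. framed_sub N \<longrightarrow> framed_sub N' \<longrightarrow>
     (\<forall>x\<in>P. N x \<inter> N' x = {0} \<and> (\<forall>f\<in>fm x. \<exists>k\<in>N x. \<exists>j\<in>N' x. f = k + j)) \<longrightarrow>
     (\<forall>x\<in>P. N x = {0}) \<or> (\<forall>x\<in>P. N' x = {0}))"

definition nil_part :: "('i set \<Rightarrow> ('b \<Rightarrow> 'i mpoly) \<Rightarrow> 'b \<Rightarrow> 'i mpoly) \<Rightarrow> 'i set \<Rightarrow> ('b \<Rightarrow> 'i mpoly) set" where
  "nil_part \<phi> x = {f \<in> fm x. \<exists>n. (\<phi> x ^^ n) f = 0}"

definition unit_part :: "('i set \<Rightarrow> ('b \<Rightarrow> 'i mpoly) \<Rightarrow> 'b \<Rightarrow> 'i mpoly) \<Rightarrow> 'i set \<Rightarrow> ('b \<Rightarrow> 'i mpoly) set" where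
  "unit_part \<phi> x = {f \<in> fm x. \<forall>n. \<exists>g\<in>fm x. (\<phi> x ^^ n) g = f}"

text \<open>Iterates of a morphism respect addition, scalars, components and restriction, so both
  parts are graded subsheaves. That they are complementary is checked on homogeneous components,
  where the dimension is finite, and reassembled from the finitely many components of f.\<close>

lemma fitting_parts:
  assumes \<phi>: "framed_mor W B dg r B dg r 0 P \<phi>"
  shows "framed_sub (nil_part \<phi>)" and "framed_sub (unit_part \<phi>)"
    and "x \<in> P \<Longrightarrow> nil_part \<phi> x \<inter> unit_part \<phi> x = {0}"
    and "x \<in> P \<Longrightarrow> f \<in> fm x \<Longrightarrow> \<exists>k\<in>nil_part \<phi> x. \<exists>j\<in>unit_part \<phi> x. f = k + j"
proof -
  note pw = framed_mor_funpow[OF framed_sheaf_axioms \<phi>]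
  have p0: "(\<phi> x ^^ n) 0 = 0" if "x \<in> P" for x n
    using framed_morD(3)[OF pw[of n] that free_mod_closed(1) Sym_0] by (simp only: smul_simps)
  have phc: "(\<phi> x ^^ n) (homcomp (dg x) d f) = homcomp (dg x) d ((\<phi> x ^^ n) f)" if "x \<in> P" "f \<in> fm x" for x f d n
    using homcomp_commute[OF fin[OF that(1)] that(2), of "\<phi> x ^^ n" "dg x" "dg x" 0 d]
      framed_morD(2,4)[OF pw[of n] that(1)] by simp
  \<comment> \<open>Kernels of iterates increase with the exponent, so two exponents may be replaced
    by their sum.\<close>
  have lift: "(\<phi> x ^^ (m + n)) f = 0" if "(\<phi> x ^^ n) f = 0" "x \<in> P" for x f n m
    using that by (simp add: funpow_add p0)
  show sub1: "framed_sub (nil_part \<phi>)"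
    unfolding framed_sub_def
  proof (intro conjI ballI allI impI)
    fix x assume x: "x \<in> P"
    show "nil_part \<phi> x \<subseteq> fm x" by (auto simp: nil_part_def)
    show "0 \<in> nil_part \<phi> x" using p0[OF x] by (auto simp: nil_part_def free_mod_closed)
    fix f assume "f \<in> nil_part \<phi> x"
    then obtain n where f: "f \<in> fm x" "(\<phi> x ^^ n) f = 0" by (auto simp: nil_part_def)
    show "f + g \<in> nil_part \<phi> x" if g': "g \<in> nil_part \<phi> x" for g
    proof -
      obtain m where g: "g \<in> fm x" "(\<phi> x ^^ m) g = 0" using g' by (auto simp: nil_part_def)
      have "(\<phi> x ^^ (m + n)) (f + g) = 0"
        using framed_morD(2)[OF pw[of "m + n"] x f(1) g(1)] lift[OF f(2) x, of m] lift[OF g(2) x, of n]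
        by (simp add: add.commute)
      then show ?thesis using f g by (auto simp: nil_part_def free_mod_closed)
    qed
    show "smul a f \<in> nil_part \<phi> x" if "a \<in> Sym (W x)" for a
    proof -
      have "(\<phi> x ^^ n) (smul a f) = 0" using framed_morD(3)[OF pw[of n] x f(1) that] f(2) by simp
      then show ?thesis using f that by (auto simp: nil_part_def free_mod_closed)
    qed
    show "homcomp (dg x) d f \<in> nil_part \<phi> x" for d
    proof -
      have "(\<phi> x ^^ n) (homcomp (dg x) d f) = 0" using phc[OF x f(1), of n d] f(2) by simp
      then show ?thesis using f by (auto simp: nil_part_def free_mod_closed)
    qed
    show "r x y f \<in> nil_part \<phi> y" if y: "y \<in> P" "y \<subseteq> x" for y
    proof -
      have "(\<phi> y ^^ n) (r x y f) = 0"
        using framed_morD(5)[OF pw[of n] x f(1) y] f(2) r_zero[OF x y] by simp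
      then show ?thesis using r_in[OF x y f(1)] by (auto simp: nil_part_def)
    qed
  qed
  show sub2: "framed_sub (unit_part \<phi>)"
    unfolding framed_sub_def
  proof (intro conjI ballI allI impI)
    fix x assume x: "x \<in> P"
    show "unit_part \<phi> x \<subseteq> fm x" by (auto simp: unit_part_def)
    have "\<exists>g\<in>fm x. (\<phi> x ^^ n) g = 0" for n using p0[OF x] free_mod_closed(1) by (intro bexI)
    then show "0 \<in> unit_part \<phi> x" by (simp add: unit_part_def free_mod_closed)
    fix f assume fu: "f \<in> unit_part \<phi> x"
    then have f: "f \<in> fm x" by (simp add: unit_part_def)
    have ex: "\<exists>g\<in>fm x. (\<phi> x ^^ n) g = f'" if "f' \<in> unit_part \<phi> x" for f' n
      using that by (simp add: unit_part_def)
    have uI: "h \<in> unit_part \<phi> z" if "h \<in> fm z" "\<And>n. \<exists>g\<in>fm z. (\<phi> z ^^ n) g = h" for h z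
      using that by (simp add: unit_part_def)
    show "f + g \<in> unit_part \<phi> x" if g: "g \<in> unit_part \<phi> x" for g
    proof (rule uI)
      show "f + g \<in> fm x" using f g by (simp add: unit_part_def free_mod_closed)
      fix n
      obtain f' g' where "f' \<in> fm x" "(\<phi> x ^^ n) f' = f" "g' \<in> fm x" "(\<phi> x ^^ n) g' = g"
        using ex[OF fu, of n] ex[OF g, of n] by (elim bexE)
      then show "\<exists>h\<in>fm x. (\<phi> x ^^ n) h = f + g"
        using framed_morD(2)[OF pw[of n] x] by (intro bexI[of _ "f' + g'"]) (simp_all add: free_mod_closed)
    qed
    show "smul a f \<in> unit_part \<phi> x" if a: "a \<in> Sym (W x)" for a
    proof (rule uI)
      show "smul a f \<in> fm x" using f a by (simp add: free_mod_closed)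
      fix n
      obtain f' where "f' \<in> fm x" "(\<phi> x ^^ n) f' = f" using ex[OF fu, of n] by (elim bexE)
      then show "\<exists>h\<in>fm x. (\<phi> x ^^ n) h = smul a f"
        using framed_morD(3)[OF pw[of n] x _ a] a by (intro bexI[of _ "smul a f'"]) (simp_all add: free_mod_closed)
    qed
    show "homcomp (dg x) d f \<in> unit_part \<phi> x" for d
    proof (rule uI)
      show "homcomp (dg x) d f \<in> fm x" using f by (simp add: free_mod_closed)
      fix n
      obtain f' where "f' \<in> fm x" "(\<phi> x ^^ n) f' = f" using ex[OF fu, of n] by (elim bexE)
      then show "\<exists>h\<in>fm x. (\<phi> x ^^ n) h = homcomp (dg x) d f"
        using phc[OF x] by (intro bexI[of _ "homcomp (dg x) d f'"]) (simp_all add: free_mod_closed)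
    qed
    show "r x y f \<in> unit_part \<phi> y" if y: "y \<in> P" "y \<subseteq> x" for y
    proof (rule uI)
      show "r x y f \<in> fm y" by (rule r_in[OF x y f])
      fix n
      obtain f' where f': "f' \<in> fm x" "(\<phi> x ^^ n) f' = f" using ex[OF fu, of n] by (elim bexE)
      have "(\<phi> y ^^ n) (r x y f') = r x y f" using framed_morD(5)[OF pw[of n] x f'(1) y] f'(2) by simp
      then show "\<exists>h\<in>fm y. (\<phi> y ^^ n) h = r x y f" by (rule bexI[OF _ r_in[OF x y f'(1)]])
    qed
  qed
  interpret vs: vector_space "\<lambda>c (f :: 'b \<Rightarrow> 'i mpoly). smul (const_poly c) f" by (rule vector_space_smul)
  fix x assume x: "x \<in> P"
  define X where "X d = {f \<in> fm x. fhom (dg x) d f}" for d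
  have Xsub: "vs.subspace (X d)" for d
    by (rule vs.subspaceI)
      (auto simp: X_def free_mod_closed Sym_const fhom_add intro: fhom_smul'[OF homog_const])
  have X1: "\<phi> x f \<in> X d" if "f \<in> X d" for f d
    using framed_morD(1,4)[OF \<phi> x, of f] that by (simp add: X_def)
  have X2: "\<phi> x (f + g) = \<phi> x f + \<phi> x g" if "f \<in> X d" "g \<in> X d" for f g d
    using framed_morD(2)[OF \<phi> x, of f g] that by (simp add: X_def)
  have X3: "\<phi> x (smul (const_poly c) f) = smul (const_poly c) (\<phi> x f)" if "f \<in> X d" for f c d
    using framed_morD(3)[OF \<phi> x _ Sym_const, of f] that by (simp add: X_def)
  have fit1: "\<exists>k\<in>X d. \<exists>j\<in>X d. f = k + j \<and> (\<exists>n. (\<phi> x ^^ n) k = 0) \<and> (\<forall>n. \<exists>y\<in>X d. (\<phi> x ^^ n) y = j)"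
    if "f \<in> X d" for d f
  proof -
    obtain S where S: "finite S" "X d \<subseteq> vs.span S" using homogeneous_span[OF fin[OF x]] unfolding X_def by blast
    show ?thesis by (rule vs.fitting(1)[OF S(1) Xsub S(2) X1 X2 X3 that])
  qed
  have fit2: "f = 0" if f: "f \<in> X d" "(\<phi> x ^^ n) f = 0" "\<And>n. \<exists>y\<in>X d. (\<phi> x ^^ n) y = f" for d f n
  proof -
    obtain S where S: "finite S" "X d \<subseteq> vs.span S" using homogeneous_span[OF fin[OF x]] unfolding X_def by blast
    show ?thesis by (rule vs.fitting(2)[OF S(1) Xsub S(2) X1 X2 X3 f])
  qed
  show "nil_part \<phi> x \<inter> unit_part \<phi> x = {0}"
  proof (intro equalityI subsetI)
    fix f assume f: "f \<in> nil_part \<phi> x \<inter> unit_part \<phi> x"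
    have fm: "f \<in> fm x" using f by (auto simp: nil_part_def)
    have "homcomp (dg x) d f = 0" for d
    proof -
      have c: "homcomp (dg x) d f \<in> nil_part \<phi> x" "homcomp (dg x) d f \<in> unit_part \<phi> x"
        using sub1 sub2 f x unfolding framed_sub_def by auto
      obtain n where n: "(\<phi> x ^^ n) (homcomp (dg x) d f) = 0" using c(1) by (auto simp: nil_part_def)
      show ?thesis
      proof (rule fit2[OF _ n])
        show "homcomp (dg x) d f \<in> X d" using fm by (simp add: X_def free_mod_closed)
        fix m
        obtain g where g: "g \<in> fm x" "(\<phi> x ^^ m) g = homcomp (dg x) d f"
          using c(2) unfolding unit_part_def by auto
        \<comment> \<open>The preimage g need not be homogeneous, but its degree d component is a
          preimage as well and lies in \<open>X d\<close>.\<close>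
        have "(\<phi> x ^^ m) (homcomp (dg x) d g) = homcomp (dg x) d f"
          using phc[OF x g(1), of m d] g(2) by (simp add: homcomp_fhom[OF fhom_homcomp])
        then show "\<exists>y\<in>X d. (\<phi> x ^^ m) y = homcomp (dg x) d f"
          using g(1) by (intro bexI[of _ "homcomp (dg x) d g"]) (simp_all add: X_def free_mod_closed)
      qed
    qed
    then have "f = 0" using sum_homcomp[of "{}" "dg x" f] by simp
    then show "f \<in> {0}" by simp
  next
    fix f assume "f \<in> ({0} :: ('b \<Rightarrow> 'i mpoly) set)"
    then show "f \<in> nil_part \<phi> x \<inter> unit_part \<phi> x" using sub1 sub2 x unfolding framed_sub_def by auto
  qed
  show "\<exists>k\<in>nil_part \<phi> x. \<exists>j\<in>unit_part \<phi> x. f = k + j" if f: "f \<in> fm x" for f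
  proof -
    have "homcomp (dg x) d f \<in> X d" for d using f by (simp add: X_def free_mod_closed)
    from fit1[OF this] obtain k j where kj: "\<And>d. k d \<in> X d" "\<And>d. j d \<in> X d" "\<And>d. homcomp (dg x) d f = k d + j d"
      "\<And>d. \<exists>n. (\<phi> x ^^ n) (k d) = 0" "\<And>d. \<forall>n. \<exists>y\<in>X d. (\<phi> x ^^ n) y = j d" by metis
    have k: "k d \<in> nil_part \<phi> x" for d using kj(1,4)[of d] by (simp add: nil_part_def X_def)
    have j: "j d \<in> unit_part \<phi> x" for d
      using kj(2,5)[of d] unfolding unit_part_def X_def by (simp add: Bex_def conj_ac) metis
    define D where "D = {d. homcomp (dg x) d f \<noteq> 0}"
    have D: "finite D" using homcomp_finite[OF fin[OF x] f] by (simp add: D_def)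
    have sumin: "sum g D \<in> N x" if "framed_sub N" "\<And>d. g d \<in> N x" for N and g :: "int \<Rightarrow> 'b \<Rightarrow> 'i mpoly"
      using D by (induction D rule: finite_induct) (use that x in \<open>auto simp: framed_sub_def\<close>)
    have "f = sum k D + sum j D"
      using sum_homcomp[OF D, of "dg x" f] by (simp add: D_def kj(3) sum.distrib)
    then show ?thesis using sumin[where g = k, OF sub1 k] sumin[where g = j, OF sub2 j] by blast
  qed
qed

end

subsection \<open>Minimality and the decomposition\<close>

text \<open>A section vanishing on the boundary of \<open>F\<close> with a unit among its coordinates spans a direct
  summand of the stalk at \<open>F\<close>; the projection onto it extends to an endomorphism that is zero at
  \<open>E\<close> and not nilpotent.\<close>

lemma (in framed_sheaf) const_term_rel_section:
  assumes ind: framed_indecomposable and E: "E \<in> P" "B E \<noteq> {}" and F: "F \<in> P" "\<not> F \<subseteq> E"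
    and f: "f \<in> fm F" and rel: "\<And>y. y \<in> P \<Longrightarrow> y \<subset> F \<Longrightarrow> r F y f = 0"
  shows "const_term (f b0) = 0"
proof (rule ccontr)
  define c where "c = const_term (f b0)"
  assume "const_term (f b0) \<noteq> 0"
  then have c: "c \<noteq> 0" by (simp add: c_def)
  have b0: "b0 \<in> B F"
  proof (rule ccontr)
    assume "b0 \<notin> B F"
    then have "f b0 = 0" using f by (simp add: free_mod_def)
    with c show False by (simp add: c_def)
  qed
  \<comment> \<open>In the degree of \<open>b0\<close> the coefficient at \<open>b0\<close> is a
    constant, so that it can be inverted.\<close>
  define g where "g = homcomp (dg F) (dg F b0) f"
  have g: "g \<in> fm F" using f by (simp add: g_def free_mod_closed)
  have gb0: "g b0 = const_poly c"
    using homog_0_const[OF homog_hcomp[of 0 "f b0"]] by (simp add: g_def homcomp_def lookup_hcomp mdeg_eq_0_iff c_def)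
  \<comment> \<open>All other basis elements go to 0. The resulting endomorphism at \<open>F\<close>
    multiplies g / c by the coordinate at \<open>b0\<close>, hence fixes g.\<close>
  define u where "u b = (if b = b0 then smul (const_poly (1 / c)) g else 0)" for b
  have u1: "u b \<in> fm F" for b using g by (simp add: u_def free_mod_closed Sym_const)
  have u2: "fhom (dg F) (dg F b + 0) (u b)" for b
    by (simp add: u_def g_def fhom_smul'[OF homog_const fhom_homcomp])
  have gy: "r F y g = 0" if y: "y \<in> P" "y \<subset> F" for y
    using r_homcomp[OF F(1) y(1) psubset_imp_subset[OF y(2)] f] rel[OF y] by (simp add: g_def)
  have u3: "r F y (u b) = 0" if y: "y \<in> P" "y \<subset> F" for y b
    using r_smul[OF F(1) y(1) psubset_imp_subset[OF y(2)] Sym_const g, of "1 / c"] gy[OF y]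
      r_zero[OF F(1) y(1) psubset_imp_subset[OF y(2)]] by (simp add: u_def)
  have "\<exists>\<phi>. framed_mor W B dg r B dg r 0 P \<phi> \<and>
     (\<forall>f. \<phi> F f = (\<Sum>b\<in>B F. smul (f b) (u b))) \<and> (\<forall>x\<in>P. \<not> F \<subseteq> x \<longrightarrow> (\<forall>f. \<phi> x f = 0))"
    by (rule morphism_extension[OF framed_sheaf_axioms framed_sheaf_axioms F(1) u1 u2 u3])
  then obtain \<phi> where \<phi>: "framed_mor W B dg r B dg r 0 P \<phi>"
    "\<forall>f. \<phi> F f = (\<Sum>b\<in>B F. smul (f b) (u b))" "\<forall>x\<in>P. \<not> F \<subseteq> x \<longrightarrow> (\<forall>f. \<phi> x f = 0)"
    by (elim exE conjE)
  have "(\<Sum>b\<in>B F. smul (g b) (u b)) = (\<Sum>b\<in>B F. if b = b0 then smul (g b0) (u b0) else 0)"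
    by (rule sum.cong) (simp_all add: u_def)
  also have "\<dots> = smul (const_poly c * const_poly (1 / c)) g" using fin[OF F(1)] b0 by (simp add: u_def gb0)
  also have "\<dots> = g" using c by (simp flip: const_poly_mult)
  finally have "\<phi> F g = g" using \<phi>(2) by simp
  then have "(\<phi> F ^^ n) g = g" for n by (induction n) auto
  then have gu: "g \<in> unit_part \<phi> F" using g unfolding unit_part_def by (intro CollectI conjI allI bexI)
  have g0: "g \<noteq> 0"
  proof
    assume "g = 0"
    then have "g b0 = 0" by (simp add: zero_fun_apply)
    then have "const_term (g b0) = 0" by simp
    with c show False unfolding gb0 by simp
  qed
  obtain b where b: "b \<in> B E" using E by blast
  have "\<phi> E (unitv b) = 0" using \<phi>(3) E F by blast
  then have "(\<phi> E ^^ 1) (unitv b) = 0" by simp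
  then have eu: "unitv b \<in> nil_part \<phi> E"
    unfolding nil_part_def using b free_mod_closed(6) by (intro CollectI conjI exI)
  note p = fitting_parts[OF \<phi>(1)]
  \<comment> \<open>The endomorphism is 0 at \<open>E\<close>, so the nilpotent summand contains the
    nonzero stalk there, while g lies in the other summand at \<open>F\<close>. Neither summand
    vanishes, against indecomposability.\<close>
  have "\<forall>x\<in>P. nil_part \<phi> x \<inter> unit_part \<phi> x = {0} \<and> (\<forall>f\<in>fm x. \<exists>k\<in>nil_part \<phi> x. \<exists>j\<in>unit_part \<phi> x. f = k + j)"
    by (intro ballI conjI p(3,4))
  with ind p(1,2) have "(\<forall>x\<in>P. nil_part \<phi> x = {0}) \<or> (\<forall>x\<in>P. unit_part \<phi> x = {0})"
    unfolding framed_indecomposable_def by (elim allE impE) assumption+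
  then show False
  proof
    assume "\<forall>x\<in>P. nil_part \<phi> x = {0}"
    then have "nil_part \<phi> E = {0}" using E by simp
    with eu show False by (simp add: unitv_neq_0)
  next
    assume "\<forall>x\<in>P. unit_part \<phi> x = {0}"
    then have "unit_part \<phi> F = {0}" using F by simp
    with gu g0 show False by simp
  qed
qed

text \<open>\<open>rho\<close> is the top degree at each element of the poset and \<open>e F\<close>
  labels the generator of the stalk of L_F at \<open>F\<close>. By \<open>E_top\<close> the basis
  elements of top degree vanish on the boundary, and by \<open>E_low\<close> nothing nonzero and
  homogeneous of smaller degree does; \<open>L_min\<close> is the minimality of the
  summands.\<close>

locale framed_decomposition =
  E: framed_sheaf P W BE dgE rE
  for P :: "'i::finite set set" and W :: "'i set \<Rightarrow> (real ^ 'i) set"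
    and BE :: "'i set \<Rightarrow> 'c set" and dgE rE +
  fixes BL :: "'i set \<Rightarrow> 'i set \<Rightarrow> 'm set" and dgL :: "'i set \<Rightarrow> 'i set \<Rightarrow> 'm \<Rightarrow> int"
    and rL :: "'i set \<Rightarrow> 'i set \<Rightarrow> 'i set \<Rightarrow> ('m \<Rightarrow> 'i mpoly) \<Rightarrow> ('m \<Rightarrow> 'i mpoly)"
    and e :: "'i set \<Rightarrow> 'm" and rho :: "'i set \<Rightarrow> int"
  assumes L: "F \<in> P \<Longrightarrow> framed_sheaf P W (BL F) (dgL F) (rL F)"
    and L_supp: "F \<in> P \<Longrightarrow> x \<in> P \<Longrightarrow> \<not> F \<subseteq> x \<Longrightarrow> BL F x = {}"
    and L_gen: "F \<in> P \<Longrightarrow> BL F F = {e F}" "F \<in> P \<Longrightarrow> dgL F F (e F) = 0"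
    and L_min: "F \<in> P \<Longrightarrow> x \<in> P \<Longrightarrow> F \<subset> x \<Longrightarrow> g \<in> free_mod (W x) (BL F x) \<Longrightarrow>
      (\<And>y. y \<in> P \<Longrightarrow> y \<subset> x \<Longrightarrow> rL F x y g = 0) \<Longrightarrow> const_term (g m) = 0"
    and E_deg: "x \<in> P \<Longrightarrow> b \<in> BE x \<Longrightarrow> dgE x b \<le> rho x"
    and E_top: "x \<in> P \<Longrightarrow> b \<in> BE x \<Longrightarrow> dgE x b = rho x \<Longrightarrow> y \<in> P \<Longrightarrow> y \<subset> x \<Longrightarrow> rE x y (unitv b) = 0"
    and E_low: "x \<in> P \<Longrightarrow> f \<in> free_mod (W x) (BE x) \<Longrightarrow> (\<And>y. y \<in> P \<Longrightarrow> y \<subset> x \<Longrightarrow> rE x y f = 0) \<Longrightarrow>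
      fhom (dgE x) d f \<Longrightarrow> d < rho x \<Longrightarrow> f = 0"
begin

text \<open>There is one index for each copy of L_F: a basis element of top degree at
  \<open>F\<close>, standing for a basis vector of the top degree part of the reduced stalk.\<close>

definition J :: "('i set \<times> 'c) set" where
  "J = {j. fst j \<in> P \<and> snd j \<in> BE (fst j) \<and> dgE (fst j) (snd j) = rho (fst j)}"

abbreviation "fmL F x \<equiv> free_mod (W x) (BL F x)"

lemma finite_J: "finite J"
proof (rule finite_subset)
  show "J \<subseteq> (SIGMA F : P. BE F)" by (auto simp: J_def)
  show "finite (SIGMA F : P. BE F)" by (intro finite_SigmaI) (auto intro: E.fin)
qed

definition is_phi :: "'i set \<times> 'c \<Rightarrow> ('i set \<Rightarrow> ('m \<Rightarrow> 'i mpoly) \<Rightarrow> 'c \<Rightarrow> 'i mpoly) \<Rightarrow> bool" where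
  "is_phi j \<phi> \<longleftrightarrow> framed_mor W (BL (fst j)) (dgL (fst j)) (rL (fst j)) BE dgE rE (rho (fst j)) P \<phi> \<and>
     (\<forall>f. \<phi> (fst j) f = smul (f (e (fst j))) (unitv (snd j)))"

definition phi where "phi j = (SOME \<phi>. is_phi j \<phi>)"

lemma phi: assumes j: "j \<in> J" shows "is_phi j (phi j)"
proof -
  have F: "fst j \<in> P" "snd j \<in> BE (fst j)" "dgE (fst j) (snd j) = rho (fst j)" using j by (auto simp: J_def)
  have "\<exists>\<phi>. framed_mor W (BL (fst j)) (dgL (fst j)) (rL (fst j)) BE dgE rE (rho (fst j)) P \<phi> \<and>
     (\<forall>f. \<phi> (fst j) f = (\<Sum>b\<in>BL (fst j) (fst j). smul (f b) (unitv (snd j)))) \<and>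
     (\<forall>x\<in>P. \<not> fst j \<subseteq> x \<longrightarrow> (\<forall>f. \<phi> x f = 0))"
  proof (rule morphism_extension[OF L[OF F(1)] E.framed_sheaf_axioms F(1)])
    show "unitv (snd j) \<in> free_mod (W (fst j)) (BE (fst j))" by (rule free_mod_closed(6)[OF F(2)])
    show "rE (fst j) y (unitv (snd j)) = 0" if "y \<in> P" "y \<subset> fst j" for y by (rule E_top[OF F that])
    fix b assume "b \<in> BL (fst j) (fst j)"
    then have "dgL (fst j) (fst j) b + rho (fst j) = dgE (fst j) (snd j)" using L_gen[OF F(1)] F(3) by simp
    then show "fhom (dgE (fst j)) (dgL (fst j) (fst j) b + rho (fst j)) (unitv (snd j))" by (simp add: fhom_unitv)
  qed
  then have "\<exists>\<phi>. is_phi j \<phi>" unfolding is_phi_def L_gen(1)[OF F(1)] by (elim exE conjE) (intro exI conjI, assumption, simp)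
  then show ?thesis unfolding phi_def by (rule someI_ex)
qed

lemma phi_mor: "j \<in> J \<Longrightarrow> framed_mor W (BL (fst j)) (dgL (fst j)) (rL (fst j)) BE dgE rE (rho (fst j)) P (phi j)"
  using phi by (simp add: is_phi_def)

lemma phi_base: "j \<in> J \<Longrightarrow> phi j (fst j) f = smul (f (e (fst j))) (unitv (snd j))"
  using phi by (simp add: is_phi_def)

lemma fst_J: "j \<in> J \<Longrightarrow> fst j \<in> P" by (simp add: J_def)

text \<open>This is the stalk at x of the direct sum over \<open>J\<close> of the sheaves L_F; the
  shift of the summand j by \<open>rho (fst j)\<close> is built into \<open>shom\<close> and
  \<open>scomp\<close>.\<close>

definition fam :: "'i set \<Rightarrow> ('i set \<times> 'c \<Rightarrow> 'm \<Rightarrow> 'i mpoly) set" where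
  "fam x = {s. (\<forall>j\<in>J. s j \<in> fmL (fst j) x) \<and> (\<forall>j. j \<notin> J \<longrightarrow> s j = 0)}"

definition shom :: "'i set \<Rightarrow> int \<Rightarrow> ('i set \<times> 'c \<Rightarrow> 'm \<Rightarrow> 'i mpoly) \<Rightarrow> bool" where
  "shom x d s \<longleftrightarrow> (\<forall>j\<in>J. fhom (dgL (fst j) x) (d - rho (fst j)) (s j))"

definition scomp :: "'i set \<Rightarrow> int \<Rightarrow> ('i set \<times> 'c \<Rightarrow> 'm \<Rightarrow> 'i mpoly) \<Rightarrow> 'i set \<times> 'c \<Rightarrow> 'm \<Rightarrow> 'i mpoly" where
  "scomp x d s = (\<lambda>j. homcomp (dgL (fst j) x) (d - rho (fst j)) (s j))"

definition ssmul :: "'i mpoly \<Rightarrow> ('i set \<times> 'c \<Rightarrow> 'm \<Rightarrow> 'i mpoly) \<Rightarrow> 'i set \<times> 'c \<Rightarrow> 'm \<Rightarrow> 'i mpoly" where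
  "ssmul a s = (\<lambda>j. smul a (s j))"

definition sres :: "'i set \<Rightarrow> 'i set \<Rightarrow> ('i set \<times> 'c \<Rightarrow> 'm \<Rightarrow> 'i mpoly) \<Rightarrow> 'i set \<times> 'c \<Rightarrow> 'm \<Rightarrow> 'i mpoly" where
  "sres x y s = (\<lambda>j. if j \<in> J then rL (fst j) x y (s j) else 0)"

definition ssingle :: "'i set \<times> 'c \<Rightarrow> ('m \<Rightarrow> 'i mpoly) \<Rightarrow> 'i set \<times> 'c \<Rightarrow> 'm \<Rightarrow> 'i mpoly" where
  "ssingle j f = (\<lambda>j'. if j' = j then f else 0)"

definition alpha :: "'i set \<Rightarrow> ('i set \<times> 'c \<Rightarrow> 'm \<Rightarrow> 'i mpoly) \<Rightarrow> 'c \<Rightarrow> 'i mpoly" where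
  "alpha x s = (\<Sum>j\<in>J. phi j x (s j))"

lemma famD: "s \<in> fam x \<Longrightarrow> j \<in> J \<Longrightarrow> s j \<in> fmL (fst j) x"
  by (simp add: fam_def)

lemma fam_0: "s \<in> fam x \<Longrightarrow> j \<notin> J \<Longrightarrow> s j = 0"
  unfolding fam_def by blast

lemma fam_closed:
  "0 \<in> fam x"
  "s \<in> fam x \<Longrightarrow> t \<in> fam x \<Longrightarrow> s + t \<in> fam x"
  "s \<in> fam x \<Longrightarrow> t \<in> fam x \<Longrightarrow> s - t \<in> fam x"
  "a \<in> Sym (W x) \<Longrightarrow> s \<in> fam x \<Longrightarrow> ssmul a s \<in> fam x"
  "s \<in> fam x \<Longrightarrow> scomp x d s \<in> fam x"
  "j \<in> J \<Longrightarrow> f \<in> fmL (fst j) x \<Longrightarrow> ssingle j f \<in> fam x"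
  by (auto simp: fam_def ssmul_def scomp_def ssingle_def free_mod_closed plus_fun_apply minus_apply zero_fun_apply)

lemma fam_sum: "(\<And>i. i \<in> S \<Longrightarrow> g i \<in> fam x) \<Longrightarrow> sum g S \<in> fam x"
  by (induction S rule: infinite_finite_induct) (simp_all add: fam_closed)

lemma sres_fam:
  assumes "x \<in> P" "y \<in> P" "y \<subseteq> x" "s \<in> fam x"
  shows "sres x y s \<in> fam y"
  unfolding fam_def sres_def
  using framed_sheaf.r_in[OF L[OF fst_J] assms(1-3)] famD[OF assms(4)] by auto

lemma alpha_in: "x \<in> P \<Longrightarrow> s \<in> fam x \<Longrightarrow> alpha x s \<in> E.fm x"
  unfolding alpha_def by (rule free_mod_sum) (rule framed_morD(1)[OF phi_mor _ famD])

lemma alpha_add: "x \<in> P \<Longrightarrow> s \<in> fam x \<Longrightarrow> t \<in> fam x \<Longrightarrow> alpha x (s + t) = alpha x s + alpha x t"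
  unfolding alpha_def sum.distrib[symmetric] plus_fun_apply[of s t]
  by (rule sum.cong[OF refl]) (rule framed_morD(2)[OF phi_mor _ famD famD])

lemma alpha_ssmul: "x \<in> P \<Longrightarrow> s \<in> fam x \<Longrightarrow> a \<in> Sym (W x) \<Longrightarrow> alpha x (ssmul a s) = smul a (alpha x s)"
  unfolding alpha_def ssmul_def smul_sum
  by (rule sum.cong[OF refl]) (rule framed_morD(3)[OF phi_mor _ famD])

lemma alpha_zero: "x \<in> P \<Longrightarrow> alpha x 0 = 0"
  using alpha_ssmul[OF _ fam_closed(1) Sym_0, of x] by (simp add: ssmul_def zero_fun_def[symmetric])

lemma alpha_diff: "x \<in> P \<Longrightarrow> s \<in> fam x \<Longrightarrow> t \<in> fam x \<Longrightarrow> alpha x (s - t) = alpha x s - alpha x t"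
  using alpha_add[of x "s - t" t] by (simp add: fam_closed)

lemma alpha_sum:
  assumes "x \<in> P" "\<And>i. i \<in> S \<Longrightarrow> g i \<in> fam x"
  shows "alpha x (sum g S) = (\<Sum>i\<in>S. alpha x (g i))"
  using assms(2)
  by (induction S rule: infinite_finite_induct) (simp_all add: alpha_zero assms(1) alpha_add fam_sum)

lemma alpha_hom: "x \<in> P \<Longrightarrow> s \<in> fam x \<Longrightarrow> shom x d s \<Longrightarrow> fhom (dgE x) d (alpha x s)"
  unfolding alpha_def
proof (rule fhom_sum)
  fix j assume a: "x \<in> P" "s \<in> fam x" "shom x d s" and j: "j \<in> J"
  have "fhom (dgL (fst j) x) (d - rho (fst j)) (s j)" using a(3) j by (simp add: shom_def)
  from framed_morD(4)[OF phi_mor[OF j] a(1) famD[OF a(2) j] this]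
  show "fhom (dgE x) d (phi j x (s j))" by simp
qed

lemma alpha_res:
  assumes "x \<in> P" "y \<in> P" "y \<subseteq> x" "s \<in> fam x"
  shows "rE x y (alpha x s) = alpha y (sres x y s)"
proof -
  have "rE x y (alpha x s) = (\<Sum>j\<in>J. rE x y (phi j x (s j)))"
    unfolding alpha_def by (rule E.r_sum[OF assms(1-3)]) (rule framed_morD(1)[OF phi_mor assms(1) famD[OF assms(4)]])
  also have "\<dots> = alpha y (sres x y s)"
    unfolding alpha_def
  proof (rule sum.cong[OF refl])
    fix j assume j: "j \<in> J"
    show "rE x y (phi j x (s j)) = phi j y (sres x y s j)"
      using framed_morD(5)[OF phi_mor[OF j] assms(1) famD[OF assms(4) j] assms(2,3)] j by (simp add: sres_def)
  qed
  finally show ?thesis .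
qed

lemma alpha_scomp:
  assumes "x \<in> P" "s \<in> fam x"
  shows "alpha x (scomp x d s) = homcomp (dgE x) d (alpha x s)"
  unfolding alpha_def homcomp_sum
proof (rule sum.cong[OF refl])
  fix j assume j: "j \<in> J"
  interpret Lj: framed_sheaf P W "BL (fst j)" "dgL (fst j)" "rL (fst j)" by (rule L[OF fst_J[OF j]])
  have "phi j x (homcomp (dgL (fst j) x) (d - rho (fst j)) (s j))
    = homcomp (dgE x) (d - rho (fst j) + rho (fst j)) (phi j x (s j))"
    by (rule homcomp_commute[OF Lj.fin[OF assms(1)] famD[OF assms(2) j]])
      (rule framed_morD[OF phi_mor[OF j] assms(1)]; assumption)+
  then show "phi j x (scomp x d s j) = homcomp (dgE x) d (phi j x (s j))" by (simp add: scomp_def)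
qed

lemma alpha_ssingle:
  assumes "x \<in> P" "j \<in> J"
  shows "alpha x (ssingle j f) = phi j x f"
proof -
  have z: "phi j' x 0 = 0" if "j' \<in> J" for j'
    using framed_morD(3)[OF phi_mor[OF that] assms(1) free_mod_closed(1) Sym_0] by (simp only: smul_simps)
  have "alpha x (ssingle j f) = (\<Sum>j'\<in>J. if j' = j then phi j x f else 0)"
    unfolding alpha_def by (rule sum.cong[OF refl]) (simp add: ssingle_def z)
  then show ?thesis using assms finite_J by simp
qed

lemma shom_scomp: "shom x d (scomp x d s)"
  by (simp add: shom_def scomp_def)

lemma shom_diff: "shom x d s \<Longrightarrow> shom x d t \<Longrightarrow> shom x d (s - t)"
  by (simp add: shom_def fhom_diff minus_apply)

lemma shom_sum: "(\<And>i. i \<in> S \<Longrightarrow> shom x d (g i)) \<Longrightarrow> shom x d (sum g S)"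
  by (auto simp: shom_def sum_fun_apply intro: fhom_sum)

lemma shom_ssmul: "homog k a \<Longrightarrow> shom x d s \<Longrightarrow> shom x (k + d) (ssmul a s)"
  unfolding shom_def ssmul_def by (auto intro: fhom_smul')

lemma fam_zero_if_comps:
  assumes x: "x \<in> P" and s: "s \<in> fam x" and z: "\<And>d. scomp x d s = 0"
  shows "s = 0"
proof
  fix j
  have "homcomp (dgL (fst j) x) d (s j) = 0" for d
    using fun_cong[OF z[of "d + rho (fst j)"], of j] unfolding scomp_def zero_fun_apply[of j] by simp
  then have "s j = 0" using sum_homcomp[of "{}" "dgL (fst j) x" "s j"] by simp
  then show "s j = 0 j" unfolding zero_fun_apply[of j] .
qed

context
  fixes x
  assumes x: "x \<in> P" and IH: "\<And>y. y \<in> P \<Longrightarrow> y \<subset> x \<Longrightarrow> bij_betw (alpha y) (fam y) (E.fm y)"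
begin

text \<open>In top degree the summand indexed by the basis element itself supplies a preimage.
  Otherwise the restrictions to the boundary have unique preimages by induction; uniqueness glues
  them, flabbiness of each summand extends them to x, and the error vanishes on the boundary in a
  degree where only 0 does.\<close>

lemma basis_lift:
  assumes b: "b \<in> BE x"
  shows "\<exists>s\<in>fam x. shom x (dgE x b) s \<and> alpha x s = unitv b"
proof (cases "dgE x b = rho x")
  case True
  have j: "(x, b) \<in> J" using True b x by (simp add: J_def)
  have ex: "unitv (e x) \<in> fmL x x" using L_gen(1)[OF x] by (intro free_mod_closed(6)) simp
  have "ssingle (x, b) (unitv (e x)) \<in> fam x" using fam_closed(6)[OF j, of "unitv (e x)" x] ex by simp
  moreover have "fhom (dgL x x) 0 (unitv (e x))" using fhom_unitv[of "dgL x x" "e x"] L_gen(2)[OF x] by simp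
  then have "shom x (dgE x b) (ssingle (x, b) (unitv (e x)))"
    using True by (auto simp: shom_def ssingle_def)
  moreover have "alpha x (ssingle (x, b) (unitv (e x))) = unitv b"
    using alpha_ssingle[OF x j] phi_base[OF j] by (simp add: unitv_def)
  ultimately show ?thesis by blast
next
  case False
  then have low: "dgE x b < rho x" using E_deg[OF x b] by simp
  have ub: "unitv b \<in> E.fm x" by (rule free_mod_closed(6)[OF b])
  define t where "t y = the_inv_into (fam y) (alpha y) (rE x y (unitv b))" for y
  have t: "t y \<in> fam y" "alpha y (t y) = rE x y (unitv b)" if y: "y \<in> P" "y \<subset> x" for y
  proof -
    have "rE x y (unitv b) \<in> E.fm y" by (rule E.r_in[OF x y(1) psubset_imp_subset[OF y(2)] ub])
    then have im: "rE x y (unitv b) \<in> alpha y ` fam y" and inj: "inj_on (alpha y) (fam y)"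
      using IH[OF y] unfolding bij_betw_def by simp_all
    show "t y \<in> fam y" unfolding t_def by (rule the_inv_into_into[OF inj im order_refl])
    show "alpha y (t y) = rE x y (unitv b)" unfolding t_def by (rule f_the_inv_into_f[OF inj im])
  qed
  have tr: "sres y z (t y) = t z" if y: "y \<in> P" "y \<subset> x" and z: "z \<in> P" "z \<subseteq> y" for y z
  proof -
    have zx: "z \<subset> x" using y z by auto
    have "alpha z (sres y z (t y)) = rE y z (alpha y (t y))"
      using alpha_res[OF y(1) z t(1)[OF y]] by simp
    also have "\<dots> = alpha z (t z)"
      unfolding t(2)[OF y] t(2)[OF z(1) zx] by (rule E.r_comp[OF x y(1) z psubset_imp_subset[OF y(2)] ub])
    finally show ?thesis
      using IH[OF z(1) zx] sres_fam[OF y(1) z t(1)[OF y]] t(1)[OF z(1) zx]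
      unfolding bij_betw_def by (auto dest: inj_onD)
  qed
  have "\<exists>f\<in>fmL (fst j) x. \<forall>y\<in>P. y \<subset> x \<longrightarrow> rL (fst j) x y f = t y j" if j: "j \<in> J" for j
  proof (rule framed_sheaf.flab[OF L[OF fst_J[OF j]] x])
    show "t y j \<in> fmL (fst j) y" if "y \<in> P" "y \<subset> x" for y by (rule famD[OF t(1)[OF that] j])
    show "rL (fst j) y z (t y j) = t z j" if "y \<in> P" "z \<in> P" "y \<subset> x" "z \<subseteq> y" for y z
      using fun_cong[OF tr[OF that(1,3,2,4)], of j] j unfolding sres_def by simp
  qed
  then obtain s0 where s0: "\<And>j. j \<in> J \<Longrightarrow> s0 j \<in> fmL (fst j) x"
    "\<And>j y. j \<in> J \<Longrightarrow> y \<in> P \<Longrightarrow> y \<subset> x \<Longrightarrow> rL (fst j) x y (s0 j) = t y j" by metis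
  define s where "s j = (if j \<in> J then s0 j else 0)" for j
  have s: "s \<in> fam x" using s0 by (simp add: fam_def s_def)
  have sr: "sres x y s = t y" if y: "y \<in> P" "y \<subset> x" for y
  proof
    fix j show "sres x y s j = t y j"
      using s0(2)[OF _ y] fam_0[OF t(1)[OF y]] by (cases "j \<in> J") (simp_all add: sres_def s_def)
  qed
  define f where "f = alpha x s - unitv b"
  have f: "f \<in> E.fm x" using alpha_in[OF x s] ub by (simp add: f_def free_mod_closed)
  have fy: "rE x y f = 0" if y: "y \<in> P" "y \<subset> x" for y
    unfolding f_def
    using E.r_diff[OF x y(1) psubset_imp_subset[OF y(2)] alpha_in[OF x s] ub]
      alpha_res[OF x y(1) psubset_imp_subset[OF y(2)] s] sr[OF y] t(2)[OF y] by simp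
  let ?d = "dgE x b"
  \<comment> \<open>The extension s was chosen without regard to degrees, so only the component in
    the degree of b is controlled; s is accordingly replaced by \<open>scomp x ?d s\<close>
    below.\<close>
  have "homcomp (dgE x) ?d f = 0"
  proof (rule E_low[OF x _ _ fhom_homcomp low])
    show "homcomp (dgE x) ?d f \<in> E.fm x" using f by (rule free_mod_closed)
    fix y assume y: "y \<in> P" "y \<subset> x"
    show "rE x y (homcomp (dgE x) ?d f) = 0"
      using E.r_homcomp[OF x y(1) psubset_imp_subset[OF y(2)] f, of ?d] fy[OF y] by simp
  qed
  moreover have "homcomp (dgE x) ?d (unitv b) = unitv b" using fhom_unitv fhom_iff_homcomp by metis
  ultimately have "alpha x (scomp x ?d s) = unitv b"
    using alpha_scomp[OF x s, of ?d] by (simp add: f_def homcomp_diff)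
  then show ?thesis using fam_closed(5)[OF s] shom_scomp by blast
qed

text \<open>Injectivity below x makes a kernel element vanish on the boundary. For summands with F
  different from x, minimality or the support condition then removes the constant terms. For F = x
  the stalk has rank one, and its constant term appears alone in one coordinate of the image, since
  the other summands contribute nothing constant there.\<close>

lemma kernel_in_max:
  assumes k: "k \<in> fam x" "alpha x k = 0" and j: "j \<in> J"
  shows "const_term (k j b) = 0"
proof -
  have kr: "rL (fst j) x y (k j) = 0" if y: "y \<in> P" "y \<subset> x" and j: "j \<in> J" for y j
  proof -
    note yx = psubset_imp_subset[OF y(2)]
    have "alpha y (sres x y k) = alpha y 0"
      using alpha_res[OF x y(1) yx k(1)] E.r_zero[OF x y(1) yx] alpha_zero[OF y(1)] k(2) by simp
    then have "sres x y k = 0"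
      using IH[OF y] sres_fam[OF x y(1) yx k(1)] fam_closed(1) unfolding bij_betw_def by (auto dest: inj_onD)
    from fun_cong[OF this, of j] have "sres x y k j = 0" unfolding zero_fun_apply[of j] .
    then show ?thesis using j by (simp add: sres_def)
  qed
  have off: "const_term (k j b) = 0" if j: "j \<in> J" "fst j \<noteq> x" for j b
  proof (cases "fst j \<subseteq> x")
    case True
    then have "fst j \<subset> x" using j(2) by auto
    from L_min[OF fst_J[OF j(1)] x this famD[OF k(1) j(1)] kr[OF _ _ j(1)]] show ?thesis by simp
  next
    case False
    then have "k j b = 0" using famD[OF k(1) j(1)] L_supp[OF fst_J[OF j(1)] x False] by (simp add: free_mod_def)
    then show ?thesis by simp
  qed
  show ?thesis
  proof (cases "fst j = x \<and> b = e x")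
    case False
    then show ?thesis
    proof (cases "fst j = x")
      case True
      then have "k j b = 0" using False famD[OF k(1) j] L_gen(1)[OF x] by (simp add: free_mod_def)
      then show ?thesis by simp
    qed (use off[OF j] in simp)
  next
    case True
    have ct: "const_term (phi j' x (k j') (snd j)) = (if j' = j then const_term (k j (e x)) else 0)" if j': "j' \<in> J" for j'
    proof (cases "fst j' = x")
      case True
      then have "j' = j \<longleftrightarrow> snd j = snd j'" using \<open>fst j = x \<and> b = e x\<close> by (auto simp: prod_eq_iff)
      then show ?thesis using phi_base[OF j', of "k j'"] unfolding True by (auto simp: unitv_def smul_apply)
    next
      case False
      interpret Lj: framed_sheaf P W "BL (fst j')" "dgL (fst j')" "rL (fst j')" by (rule L[OF fst_J[OF j']])
      note kj = famD[OF k(1) j']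
      have e: "unitv b \<in> Lj.fm x" if "b \<in> BL (fst j') x" for b by (rule free_mod_closed(6)[OF that])
      have "phi j' x (k j') = phi j' x (\<Sum>b\<in>BL (fst j') x. smul (k j' b) (unitv b))"
        using free_mod_expand[OF Lj.fin[OF x] kj] by simp
      also have "\<dots> = (\<Sum>b\<in>BL (fst j') x. phi j' x (smul (k j' b) (unitv b)))"
        by (rule framed_mor_sum[OF phi_mor[OF j'] x]) (rule free_mod_closed(4)[OF free_mod_Sym[OF kj] e])
      also have "\<dots> = (\<Sum>b\<in>BL (fst j') x. smul (k j' b) (phi j' x (unitv b)))"
        by (rule sum.cong[OF refl]) (rule framed_morD(3)[OF phi_mor[OF j'] x e free_mod_Sym[OF kj]])
      finally show ?thesis
        using False \<open>fst j = x \<and> b = e x\<close>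
        by (auto simp: sum_fun_apply smul_apply lookup_sum const_term_mult off[OF j' False])
    qed
    have "0 = const_term (alpha x k (snd j))" using k(2) by (simp add: zero_fun_apply)
    also have "\<dots> = (\<Sum>j'\<in>J. if j' = j then const_term (k j (e x)) else 0)"
      unfolding alpha_def sum_fun_apply lookup_sum by (rule sum.cong[OF refl]) (rule ct)
    also have "\<dots> = const_term (k j (e x))" using finite_J j by simp
    finally show ?thesis using True by simp
  qed
qed

text \<open>A section of the surjection \<open>alpha x\<close>; by Nakayama's lemma it is surjective, because the
  kernel of \<open>alpha x\<close> lies in the irrelevant ideal times the module.\<close>

lemma alpha_bij_step: "bij_betw (alpha x) (fam x) (E.fm x)"
proof -
  obtain S where S: "\<And>b. b \<in> BE x \<Longrightarrow> S b \<in> fam x" "\<And>b. b \<in> BE x \<Longrightarrow> shom x (dgE x b) (S b)"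
    "\<And>b. b \<in> BE x \<Longrightarrow> alpha x (S b) = unitv b"
    using basis_lift by metis
  define sigma where "sigma f = (\<Sum>b\<in>BE x. ssmul (f b) (S b))" for f
  have sig_in: "sigma f \<in> fam x" if "f \<in> E.fm x" for f
    unfolding sigma_def by (rule fam_sum) (rule fam_closed(4)[OF free_mod_Sym[OF that] S(1)])
  have alpha_sig: "alpha x (sigma f) = f" if f: "f \<in> E.fm x" for f
  proof -
    have "alpha x (sigma f) = (\<Sum>b\<in>BE x. alpha x (ssmul (f b) (S b)))"
      unfolding sigma_def by (rule alpha_sum[OF x]) (rule fam_closed(4)[OF free_mod_Sym[OF f] S(1)])
    also have "\<dots> = (\<Sum>b\<in>BE x. smul (f b) (unitv b))"
      by (rule sum.cong[OF refl]) (simp add: alpha_ssmul[OF x S(1) free_mod_Sym[OF f]] S(3))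
    also have "\<dots> = f" by (rule free_mod_expand[OF E.fin[OF x] f, symmetric])
    finally show ?thesis .
  qed
  have sig_eq: "sigma f j m = (\<Sum>b\<in>BE x. f b * S b j m)" for f j m
    by (simp add: sigma_def ssmul_def sum_fun_apply smul_apply)
  have sig_add: "sigma (f + g) = sigma f + sigma g" for f g
    by (rule ext, rule ext) (simp add: sig_eq plus_fun_apply distrib_right sum.distrib)
  have sig_smul: "sigma (smul a f) = ssmul a (sigma f)" for a f
    by (rule ext, rule ext) (simp add: sig_eq ssmul_def smul_apply sum_distrib_left mult.assoc)
  have sig_hom: "shom x d (sigma f)" if "fhom (dgE x) d f" for f d
    unfolding sigma_def
  proof (rule shom_sum)
    fix b assume b: "b \<in> BE x"
    have "homog (d - dgE x b) (f b)" using that by (simp add: fhom_def)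
    from shom_ssmul[OF this S(2)[OF b]] show "shom x d (ssmul (f b) (S b))" by simp
  qed
  \<comment> \<open>The section \<open>sigma\<close> splits \<open>alpha x\<close>, so its image
    meets the kernel only in 0. It remains to show that the image is everything.\<close>
  define R where "R = sigma ` E.fm x"
  have R_add: "s + t \<in> R" if "s \<in> R" "t \<in> R" for s t
    using that unfolding R_def by (auto simp: sig_add[symmetric] intro!: imageI free_mod_closed(2))
  have R_smul: "ssmul a s \<in> R" if "a \<in> Sym (W x)" "s \<in> R" for s a
    using that unfolding R_def by (auto simp: sig_smul[symmetric] intro!: imageI free_mod_closed(4))
  have "sigma 0 = 0" by (rule ext, rule ext) (simp add: sig_eq zero_fun_apply)
  then have R_0: "0 \<in> R" unfolding R_def using free_mod_closed(1) by (metis imageI)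
  have R_sum: "sum g T \<in> R" if "\<And>i. i \<in> T \<Longrightarrow> g i \<in> R" for g :: "_ \<Rightarrow> 'i set \<times> 'c \<Rightarrow> 'm \<Rightarrow> 'i mpoly" and T
    using that by (induction T rule: infinite_finite_induct) (simp_all add: R_0 R_add)
  define Idx where "Idx = (SIGMA j : J. BL (fst j) x)"
  have fin_Idx: "finite Idx"
    unfolding Idx_def by (intro finite_SigmaI finite_J) (rule framed_sheaf.fin[OF L[OF fst_J] x])
  define deg where "deg i = dgL (fst (fst i)) x (snd i) + rho (fst (fst i))" for i :: "('i set \<times> 'c) \<times> 'm"
  \<comment> \<open>Degrees are integers, so a lower bound for the degrees of the generators is
    needed to make the difference a measure for induction; the 0 covers an empty index set.\<close>
  obtain m0 where m0: "\<And>i. i \<in> Idx \<Longrightarrow> m0 \<le> deg i"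
  proof
    show "Min (insert 0 (deg ` Idx)) \<le> deg i" if "i \<in> Idx" for i using that fin_Idx by (intro Min_le) auto
  qed
  have expand: "k = (\<Sum>i\<in>Idx. ssmul (k (fst i) (snd i)) (ssingle (fst i) (unitv (snd i))))" if k: "k \<in> fam x" for k
  proof (rule ext)
    fix j
    have "(\<Sum>i\<in>Idx. ssmul (k (fst i) (snd i)) (ssingle (fst i) (unitv (snd i)))) j
      = (\<Sum>i\<in>Idx. if fst i = j then smul (k j (snd i)) (unitv (snd i)) else 0)"
      unfolding sum_fun_apply[where x = j] by (rule sum.cong[OF refl]) (auto simp: ssmul_def ssingle_def)
    also have "\<dots> = (\<Sum>j'\<in>J. \<Sum>b\<in>BL (fst j') x. if j' = j then smul (k j b) (unitv b) else 0)"
      unfolding Idx_def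
      by (subst sum.Sigma) (auto simp: finite_J case_prod_beta intro: framed_sheaf.fin[OF L[OF fst_J] x])
    also have "\<dots> = (\<Sum>j'\<in>J. if j' = j then \<Sum>b\<in>BL (fst j) x. smul (k j b) (unitv b) else 0)"
      by (rule sum.cong) auto
    also have "\<dots> = (if j \<in> J then \<Sum>b\<in>BL (fst j) x. smul (k j b) (unitv b) else 0)"
      using finite_J by simp
    also have "\<dots> = k j"
    proof (cases "j \<in> J")
      case True
      then show ?thesis
        using free_mod_expand[OF framed_sheaf.fin[OF L[OF fst_J[OF True]] x] famD[OF k True]] by simp
    qed (use fam_0[OF k] in simp)
    finally show "k j = (\<Sum>i\<in>Idx. ssmul (k (fst i) (snd i)) (ssingle (fst i) (unitv (snd i)))) j" by simp
  qed
  have nak: "s \<in> R" if "s \<in> fam x" "shom x d s" for s d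
    using that
  proof (induction "nat (d - m0)" arbitrary: d s rule: less_induct)
    case less
    define k where "k = s - sigma (alpha x s)"
    note as = alpha_in[OF x less.prems(1)]
    have k: "k \<in> fam x" unfolding k_def by (rule fam_closed(3)[OF less.prems(1) sig_in[OF as]])
    have khom: "shom x d k"
      unfolding k_def by (rule shom_diff[OF less.prems(2) sig_hom[OF alpha_hom[OF x less.prems]]])
    have k0: "alpha x k = 0"
      unfolding k_def using alpha_diff[OF x less.prems(1) sig_in[OF as]] alpha_sig[OF as] by simp
    have "ssmul (k (fst i) (snd i)) (ssingle (fst i) (unitv (snd i))) \<in> R" if i: "i \<in> Idx" for i
    proof (cases "k (fst i) (snd i) = 0")
      case True
      have "ssmul 0 (ssingle (fst i) (unitv (snd i))) = 0" by (simp add: ssmul_def fun_eq_iff zero_fun_apply)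
      then show ?thesis using True R_0 by simp
    next
      case False
      have ij: "fst i \<in> J" "snd i \<in> BL (fst (fst i)) x" using i by (auto simp: Idx_def)
      have h: "homog (d - deg i) (k (fst i) (snd i))"
        using khom ij(1) by (auto simp: shom_def fhom_def deg_def algebra_simps)
      \<comment> \<open>A nonzero coefficient has degree at least 0, and in degree 0 it would be a
        nonzero constant, which a kernel element cannot have. Only generators of smaller degree
        occur, and these are in \<open>R\<close> by induction.\<close>
      have "deg i < d"
      proof (rule ccontr)
        assume "\<not> deg i < d"
        moreover have "\<not> d - deg i < 0" using homog_neg[OF h] False by blast
        ultimately have "d - deg i = 0" by simp
        then have "k (fst i) (snd i) = const_poly (const_term (k (fst i) (snd i)))"
          using homog_0_const h by simp
        then show False using False kernel_in_max[OF k k0 ij(1)] by simp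
      qed
      then have lt: "nat (deg i - m0) < nat (d - m0)" using m0[OF i] by simp
      have u: "unitv (snd i) \<in> fmL (fst (fst i)) x" by (rule free_mod_closed(6)[OF ij(2)])
      have "ssingle (fst i) (unitv (snd i)) \<in> R"
      proof (rule less.hyps[OF lt])
        show "ssingle (fst i) (unitv (snd i)) \<in> fam x" by (rule fam_closed(6)[OF ij(1) u])
        show "shom x (deg i) (ssingle (fst i) (unitv (snd i)))"
          by (auto simp: shom_def ssingle_def deg_def fhom_unitv)
      qed
      then show ?thesis by (rule R_smul[OF free_mod_Sym[OF famD[OF k ij(1)]]])
    qed
    then have "k \<in> R" by (subst expand[OF k]) (rule R_sum)
    moreover have "sigma (alpha x s) \<in> R" unfolding R_def by (rule imageI[OF as])
    moreover have "s = k + sigma (alpha x s)" by (simp add: k_def)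
    ultimately show ?case using R_add by metis
  qed
  have ker: "s = 0" if s: "s \<in> fam x" "alpha x s = 0" for s
  proof (rule fam_zero_if_comps[OF x s(1)])
    fix d
    have "scomp x d s \<in> R" by (rule nak[OF fam_closed(5)[OF s(1)] shom_scomp])
    then obtain f where f: "f \<in> E.fm x" "scomp x d s = sigma f" by (auto simp: R_def)
    have "f = alpha x (scomp x d s)" using alpha_sig[OF f(1)] f(2) by simp
    also have "\<dots> = 0" using alpha_scomp[OF x s(1), of d] s(2) by simp
    finally show "scomp x d s = 0" using f(2) \<open>sigma 0 = 0\<close> by simp
  qed
  show ?thesis
    unfolding bij_betw_def
  proof
    show "inj_on (alpha x) (fam x)"
    proof (rule inj_onI)
      fix s t assume st: "s \<in> fam x" "t \<in> fam x" "alpha x s = alpha x t"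
      have "s - t = 0" by (rule ker[OF fam_closed(3)[OF st(1,2)]]) (simp add: alpha_diff[OF x st(1,2)] st(3))
      then show "s = t" by simp
    qed
    show "alpha x ` fam x = E.fm x"
    proof
      show "alpha x ` fam x \<subseteq> E.fm x" using alpha_in[OF x] by auto
      show "E.fm x \<subseteq> alpha x ` fam x"       proof
        fix f assume f: "f \<in> E.fm x"
        show "f \<in> alpha x ` fam x" using sig_in[OF f] alpha_sig[OF f] by (intro image_eqI[of _ _ "sigma f"]) simp_all
      qed
    qed
  qed
qed

end

lemma alpha_bij: "x \<in> P \<Longrightarrow> bij_betw (alpha x) (fam x) (E.fm x)"
proof (induction "card x" arbitrary: x rule: less_induct)
  case less
  show ?case
    by (rule alpha_bij_step[OF less.prems], rule less.hyps) (auto intro: psubset_card_mono)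
qed

text \<open>A preimage of a homogeneous element may be replaced by its component in the same degree,
  because \<open>alpha x\<close> commutes with taking components.\<close>

lemma alpha_hom_image:
  assumes x: "x \<in> P"
  shows "alpha x ` {s \<in> fam x. shom x d s} = {f \<in> E.fm x. fhom (dgE x) d f}"
proof
  show "alpha x ` {s \<in> fam x. shom x d s} \<subseteq> {f \<in> E.fm x. fhom (dgE x) d f}"
    using alpha_in[OF x] alpha_hom[OF x] by auto
  show "{f \<in> E.fm x. fhom (dgE x) d f} \<subseteq> alpha x ` {s \<in> fam x. shom x d s}"
  proof
    fix f assume "f \<in> {f \<in> E.fm x. fhom (dgE x) d f}"
    then have f: "f \<in> E.fm x" "homcomp (dgE x) d f = f" by (auto simp: fhom_iff_homcomp)
    obtain s where s: "s \<in> fam x" "alpha x s = f" using alpha_bij[OF x] f(1) unfolding bij_betw_def by (metis imageE)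
    have "f = alpha x (scomp x d s)" using alpha_scomp[OF x s(1), of d] s(2) f(2) by simp
    then show "f \<in> alpha x ` {s \<in> fam x. shom x d s}" using fam_closed(5)[OF s(1)] shom_scomp by blast
  qed
qed

end

section \<open>Graded modules in coordinates\<close>

lemma Sym_ring_simps [simp]:
  "carrier (Sym_ring W) = Sym W" "\<zero>\<^bsub>Sym_ring W\<^esub> = 0" "\<one>\<^bsub>Sym_ring W\<^esub> = 1"
  "a \<oplus>\<^bsub>Sym_ring W\<^esub> b = a + b" "a \<otimes>\<^bsub>Sym_ring W\<^esub> b = a * b" "rgr (Sym_ring W) d = Sym_degree W d"
  by (simp_all add: Sym_ring_def)

lemma cring_Sym_ring: "cring (Sym_ring W)"
proof (rule cringI)
  show "abelian_group (Sym_ring W)"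
  proof (rule abelian_groupI)
    fix x assume "x \<in> carrier (Sym_ring W)"
    then show "\<exists>y\<in>carrier (Sym_ring W). y \<oplus>\<^bsub>Sym_ring W\<^esub> x = \<zero>\<^bsub>Sym_ring W\<^esub>"
      by (intro bexI[of _ "- x"]) (auto simp: Sym_uminus)
  qed (auto intro: Sym_add simp: algebra_simps)
  show "Group.comm_monoid (Sym_ring W)"
    by (rule comm_monoidI) (auto intro: Sym_mult simp: algebra_simps)
qed (auto simp: algebra_simps)

text \<open>This is an isomorphism of graded modules from a shifted free module in coordinates. The
  module axioms for \<open>M\<close> are not presupposed, so a frame can be built for a record given
  by bare formulas.\<close>

definition frame :: "(real ^ 'i::finite) set \<Rightarrow> ('i mpoly, 'm) gr_module \<Rightarrow> 'b set \<Rightarrow> ('b \<Rightarrow> int) \<Rightarrow>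
    (('b \<Rightarrow> 'i mpoly) \<Rightarrow> 'm) \<Rightarrow> bool" where
  "frame W M B dg h \<longleftrightarrow> finite B \<and> bij_betw h (free_mod W B) (carrier M) \<and> h 0 = \<zero>\<^bsub>M\<^esub> \<and>
     (\<forall>f\<in>free_mod W B. \<forall>g\<in>free_mod W B. h (f + g) = h f \<oplus>\<^bsub>M\<^esub> h g) \<and>
     (\<forall>a\<in>Sym W. \<forall>f\<in>free_mod W B. h (smul a f) = a \<odot>\<^bsub>M\<^esub> h f) \<and>
     (\<forall>d. gr M d = h ` {f \<in> free_mod W B. fhom dg d f})"

lemma frameD:
  assumes "frame W M B dg h"
  shows "finite B" "bij_betw h (free_mod W B) (carrier M)" "h 0 = \<zero>\<^bsub>M\<^esub>"
    "f \<in> free_mod W B \<Longrightarrow> g \<in> free_mod W B \<Longrightarrow> h (f + g) = h f \<oplus>\<^bsub>M\<^esub> h g"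
    "a \<in> Sym W \<Longrightarrow> f \<in> free_mod W B \<Longrightarrow> h (smul a f) = a \<odot>\<^bsub>M\<^esub> h f"
    "gr M d = h ` {f \<in> free_mod W B. fhom dg d f}"
    "f \<in> free_mod W B \<Longrightarrow> h f \<in> carrier M"
    "carrier M = h ` free_mod W B"
    "f \<in> free_mod W B \<Longrightarrow> g \<in> free_mod W B \<Longrightarrow> h f = h g \<longleftrightarrow> f = g"
proof -
  note A = assms[unfolded frame_def]
  show "finite B" "bij_betw h (free_mod W B) (carrier M)" "h 0 = \<zero>\<^bsub>M\<^esub>"
    "f \<in> free_mod W B \<Longrightarrow> g \<in> free_mod W B \<Longrightarrow> h (f + g) = h f \<oplus>\<^bsub>M\<^esub> h g"
    "a \<in> Sym W \<Longrightarrow> f \<in> free_mod W B \<Longrightarrow> h (smul a f) = a \<odot>\<^bsub>M\<^esub> h f"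
    "gr M d = h ` {f \<in> free_mod W B. fhom dg d f}" using A by simp_all
  show im: "carrier M = h ` free_mod W B" using A by (simp add: bij_betw_def)
  show "f \<in> free_mod W B \<Longrightarrow> h f \<in> carrier M" unfolding im by (rule imageI)
  show "f \<in> free_mod W B \<Longrightarrow> g \<in> free_mod W B \<Longrightarrow> h f = h g \<longleftrightarrow> f = g"
    using A inj_on_eq_iff unfolding bij_betw_def by metis
qed

definition unframe :: "(real ^ 'i::finite) set \<Rightarrow> 'b set \<Rightarrow> (('b \<Rightarrow> 'i mpoly) \<Rightarrow> 'm) \<Rightarrow> 'm \<Rightarrow> ('b \<Rightarrow> 'i mpoly)" where
  "unframe W B h = the_inv_into (free_mod W B) h"

lemma unframe:
  assumes fr: "frame W M B dg h"
  shows "m \<in> carrier M \<Longrightarrow> unframe W B h m \<in> free_mod W B"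
    and "m \<in> carrier M \<Longrightarrow> h (unframe W B h m) = m"
    and "f \<in> free_mod W B \<Longrightarrow> unframe W B h (h f) = f"
proof -
  have inj: "inj_on h (free_mod W B)" and im: "h ` free_mod W B = carrier M"
    using frameD(2)[OF fr] by (simp_all add: bij_betw_def)
  show "m \<in> carrier M \<Longrightarrow> unframe W B h m \<in> free_mod W B"
    unfolding unframe_def im[symmetric] by (rule the_inv_into_into[OF inj _ order_refl])
  show "m \<in> carrier M \<Longrightarrow> h (unframe W B h m) = m"
    unfolding unframe_def im[symmetric] by (rule f_the_inv_into_f[OF inj])
  show "f \<in> free_mod W B \<Longrightarrow> unframe W B h (h f) = f"
    unfolding unframe_def by (rule the_inv_into_f_f[OF inj])
qed

lemma gr_finsum:
  assumes M: "abelian_group M" and g: "additive_subgroup N M"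
    and f: "finite A" "\<And>a. a \<in> A \<Longrightarrow> f a \<in> N"
  shows "finsum M f A \<in> N"
proof -
  interpret abelian_group M by fact
  interpret additive_subgroup N M by fact
  show ?thesis
    using f
  proof (induction A rule: finite_induct)
    case (insert a A)
    then have "f \<in> A \<rightarrow> carrier M" "f a \<in> carrier M" using a_subset by auto
    with insert show ?case by (simp add: finsum_insert a_closed)
  qed (simp add: zero_closed)
qed

lemma ex1_same: "\<exists>!x. Q x \<Longrightarrow> Q a \<Longrightarrow> Q b \<Longrightarrow> a = b"
  by blast

text \<open>Finitely many generators involve only finitely many basis elements, collected in
  \<open>U\<close>. These generate the module, and uniqueness of coordinates then forces every basis
  element into \<open>U\<close>.\<close>

lemma finite_basis:
  assumes M: "Module.module (Sym_ring W) M" and fg: "finitely_generated (Sym_ring W) M"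
    and B: "is_basis (Sym_ring W) M B"
  shows "finite B"
proof -
  interpret Module.module "Sym_ring W" M by fact
  note sc = smult_closed[unfolded Sym_ring_simps]
  have BM: "B \<subseteq> carrier M" using B by (simp add: is_basis_def)
  obtain S where S: "finite S" "S \<subseteq> carrier M"
    "\<forall>m\<in>carrier M. \<exists>c\<in>S \<rightarrow> Sym W. m = (\<Oplus>\<^bsub>M\<^esub>b\<in>S. c b \<odot>\<^bsub>M\<^esub> b)"
    using fg unfolding finitely_generated_def by auto
  have rep: "\<exists>c. c \<in> B \<rightarrow>\<^sub>E Sym W \<and> finite {b \<in> B. c b \<noteq> 0} \<and> m = (\<Oplus>\<^bsub>M\<^esub>b\<in>{b \<in> B. c b \<noteq> 0}. c b \<odot>\<^bsub>M\<^esub> b)"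
    if "m \<in> carrier M" for m
    using B that unfolding is_basis_def by (simp add: ex1_implies_ex)
  have "\<forall>s\<in>S. \<exists>c. c \<in> B \<rightarrow>\<^sub>E Sym W \<and> finite {b \<in> B. c b \<noteq> 0} \<and> s = (\<Oplus>\<^bsub>M\<^esub>b\<in>{b \<in> B. c b \<noteq> 0}. c b \<odot>\<^bsub>M\<^esub> b)"
    using rep S(2) by blast
  from bchoice[OF this] obtain c where cc: "\<forall>s\<in>S. c s \<in> B \<rightarrow>\<^sub>E Sym W \<and> finite {b \<in> B. c s b \<noteq> 0} \<and>
      s = (\<Oplus>\<^bsub>M\<^esub>b\<in>{b \<in> B. c s b \<noteq> 0}. c s b \<odot>\<^bsub>M\<^esub> b)" by (elim exE)
  have c: "c s \<in> B \<rightarrow>\<^sub>E Sym W" "finite {b \<in> B. c s b \<noteq> 0}"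
    "s = (\<Oplus>\<^bsub>M\<^esub>b\<in>{b \<in> B. c s b \<noteq> 0}. c s b \<odot>\<^bsub>M\<^esub> b)" if "s \<in> S" for s
    using bspec[OF cc that] by - (elim conjE, assumption)+
  define U where "U = (\<Union>s\<in>S. {b \<in> B. c s b \<noteq> 0})"
  have U: "finite U" "U \<subseteq> B" using S(1) c(2) by (auto simp: U_def)
  define N where "N = {m. \<exists>d\<in>U \<rightarrow> Sym W. m = (\<Oplus>\<^bsub>M\<^esub>b\<in>U. d b \<odot>\<^bsub>M\<^esub> b)}"
  have UM: "b \<in> U \<Longrightarrow> b \<in> carrier M" for b using U BM by auto
  have ext: "(\<Oplus>\<^bsub>M\<^esub>b\<in>{b \<in> B. d b \<noteq> 0}. d b \<odot>\<^bsub>M\<^esub> b) = (\<Oplus>\<^bsub>M\<^esub>b\<in>U. d b \<odot>\<^bsub>M\<^esub> b)"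
    if "{b \<in> B. d b \<noteq> 0} \<subseteq> U" "\<And>b. b \<in> U \<Longrightarrow> d b \<in> Sym W" for d
  proof (rule M.add.finprod_mono_neutral_cong_left[OF U(1) that(1)])
    fix b assume "b \<in> U - {b \<in> B. d b \<noteq> 0}"
    then have "d b = 0" "b \<in> carrier M" using U UM by auto
    then show "d b \<odot>\<^bsub>M\<^esub> b = \<zero>\<^bsub>M\<^esub>" using smult_l_null[of b, unfolded Sym_ring_simps] by simp
  qed (use that UM in \<open>auto intro!: sc\<close>)
  have N0: "\<zero>\<^bsub>M\<^esub> \<in> N"
  proof -
    have "(\<Oplus>\<^bsub>M\<^esub>b\<in>U. \<zero>\<^bsub>Sym_ring W\<^esub> \<odot>\<^bsub>M\<^esub> b) = (\<Oplus>\<^bsub>M\<^esub>b\<in>U. \<zero>\<^bsub>M\<^esub>)"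
      by (rule M.finsum_cong') (use UM smult_l_null[unfolded Sym_ring_simps] in auto)
    then show ?thesis unfolding N_def by (intro CollectI bexI[of _ "\<lambda>_. 0"]) auto
  qed
  have Nadd: "x \<oplus>\<^bsub>M\<^esub> y \<in> N" if "x \<in> N" "y \<in> N" for x y
  proof -
    obtain d d' where d: "d \<in> U \<rightarrow> Sym W" "x = (\<Oplus>\<^bsub>M\<^esub>b\<in>U. d b \<odot>\<^bsub>M\<^esub> b)" "d' \<in> U \<rightarrow> Sym W" "y = (\<Oplus>\<^bsub>M\<^esub>b\<in>U. d' b \<odot>\<^bsub>M\<^esub> b)"
      using \<open>x \<in> N\<close> \<open>y \<in> N\<close> by (auto simp: N_def)
    have "x \<oplus>\<^bsub>M\<^esub> y = (\<Oplus>\<^bsub>M\<^esub>b\<in>U. d b \<odot>\<^bsub>M\<^esub> b \<oplus>\<^bsub>M\<^esub> d' b \<odot>\<^bsub>M\<^esub> b)"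
      unfolding d(2,4) by (rule M.finsum_addf[symmetric]) (use d UM in \<open>auto intro!: sc simp: Pi_iff\<close>)
    also have "\<dots> = (\<Oplus>\<^bsub>M\<^esub>b\<in>U. (d b + d' b) \<odot>\<^bsub>M\<^esub> b)"
    proof (rule M.finsum_cong'[OF refl])
      show "(\<lambda>b. (d b + d' b) \<odot>\<^bsub>M\<^esub> b) \<in> U \<rightarrow> carrier M" using d UM by (auto intro!: sc Sym_add simp: Pi_iff)
      fix b assume "b \<in> U"
      then show "d b \<odot>\<^bsub>M\<^esub> b \<oplus>\<^bsub>M\<^esub> d' b \<odot>\<^bsub>M\<^esub> b = (d b + d' b) \<odot>\<^bsub>M\<^esub> b"
        using smult_l_distr[of "d b" "d' b" b] d UM by (auto simp: Pi_iff)
    qed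
    finally show ?thesis unfolding N_def using d by (intro CollectI bexI[of _ "\<lambda>b. d b + d' b"]) (auto intro: Sym_add)
  qed
  have Nsmul: "a \<odot>\<^bsub>M\<^esub> x \<in> N" if "a \<in> Sym W" "x \<in> N" for a x
  proof -
    obtain d where d: "d \<in> U \<rightarrow> Sym W" "x = (\<Oplus>\<^bsub>M\<^esub>b\<in>U. d b \<odot>\<^bsub>M\<^esub> b)" using \<open>x \<in> N\<close> by (auto simp: N_def)
    have "a \<odot>\<^bsub>M\<^esub> x = (\<Oplus>\<^bsub>M\<^esub>b\<in>U. a \<odot>\<^bsub>M\<^esub> (d b \<odot>\<^bsub>M\<^esub> b))"
      unfolding d(2) by (rule finsum_smult_ldistr) (use d UM U that in \<open>auto intro!: sc simp: Pi_iff\<close>)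
    also have "\<dots> = (\<Oplus>\<^bsub>M\<^esub>b\<in>U. (a * d b) \<odot>\<^bsub>M\<^esub> b)"
    proof (rule M.finsum_cong'[OF refl])
      show "(\<lambda>b. (a * d b) \<odot>\<^bsub>M\<^esub> b) \<in> U \<rightarrow> carrier M" using d UM that by (auto intro!: sc Sym_mult simp: Pi_iff)
      fix b assume "b \<in> U"
      then show "a \<odot>\<^bsub>M\<^esub> (d b \<odot>\<^bsub>M\<^esub> b) = (a * d b) \<odot>\<^bsub>M\<^esub> b"
        using smult_assoc1[of a "d b" b] d UM that by (auto simp: Pi_iff)
    qed
    finally show ?thesis unfolding N_def using d that by (intro CollectI bexI[of _ "\<lambda>b. a * d b"]) (auto intro: Sym_mult)
  qed
  have SN: "s \<in> N" if "s \<in> S" for s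
  proof -
    have cs: "c s b \<in> Sym W" if "b \<in> U" for b using c(1)[OF \<open>s \<in> S\<close>] that U by auto
    have "s = (\<Oplus>\<^bsub>M\<^esub>b\<in>U. c s b \<odot>\<^bsub>M\<^esub> b)"
      using c(3)[OF that] ext[of "c s", OF _ cs] that by (auto simp: U_def)
    then show ?thesis unfolding N_def using cs by (intro CollectI bexI[of _ "c s"]) auto
  qed
  have "m \<in> N" if m: "m \<in> carrier M" for m
  proof -
    obtain a where a: "a \<in> S \<rightarrow> Sym W" "m = (\<Oplus>\<^bsub>M\<^esub>b\<in>S. a b \<odot>\<^bsub>M\<^esub> b)" using S(3) m by blast
    have "(\<Oplus>\<^bsub>M\<^esub>b\<in>T. a b \<odot>\<^bsub>M\<^esub> b) \<in> N" if "T \<subseteq> S" for T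
      using finite_subset[OF that S(1)] that
    proof (induction T rule: finite_induct)
      case (insert t T)
      have "(\<Oplus>\<^bsub>M\<^esub>b\<in>insert t T. a b \<odot>\<^bsub>M\<^esub> b) = a t \<odot>\<^bsub>M\<^esub> t \<oplus>\<^bsub>M\<^esub> (\<Oplus>\<^bsub>M\<^esub>b\<in>T. a b \<odot>\<^bsub>M\<^esub> b)"
        by (rule M.finsum_insert) (use insert a S(2) in \<open>auto intro!: sc simp: Pi_iff\<close>)
      moreover have "a t \<in> Sym W" "t \<in> N" using insert.prems a(1) SN by auto
      ultimately show ?case using insert by (simp add: Nadd Nsmul)
    qed (simp add: N0)
    then show ?thesis using a(2) by blast
  qed
  have "B \<subseteq> U"
  proof
    fix b assume b: "b \<in> B"
    then have bM: "b \<in> carrier M" using BM by blast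
    then obtain d where d: "d \<in> U \<rightarrow> Sym W" "b = (\<Oplus>\<^bsub>M\<^esub>b\<in>U. d b \<odot>\<^bsub>M\<^esub> b)" using \<open>\<And>m. m \<in> carrier M \<Longrightarrow> m \<in> N\<close> by (auto simp: N_def)
    \<comment> \<open>The element b has two coordinate vectors, one supported in \<open>U\<close>
      and one being the unit vector at b; they coincide.\<close>
    define d1 where "d1 = (\<lambda>b'\<in>B. if b' \<in> U then d b' else 0)"
    define d2 where "d2 = (\<lambda>b'\<in>B. if b' = b then 1 else 0 :: 'a mpoly)"
    have sub: "{b \<in> B. d1 b \<noteq> 0} \<subseteq> U" by (auto simp: d1_def split: if_splits)
    have "(\<Oplus>\<^bsub>M\<^esub>b\<in>{b \<in> B. d1 b \<noteq> 0}. d1 b \<odot>\<^bsub>M\<^esub> b) = (\<Oplus>\<^bsub>M\<^esub>b\<in>U. d1 b \<odot>\<^bsub>M\<^esub> b)"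
      by (rule ext[OF sub]) (use d U in \<open>auto simp: d1_def\<close>)
    also have "\<dots> = b"
      unfolding d(2) by (rule M.finsum_cong'[OF refl]) (use d U UM in \<open>auto simp: d1_def Pi_iff intro!: sc\<close>)
    finally have 1: "d1 \<in> B \<rightarrow>\<^sub>E Sym W \<and> finite {b \<in> B. d1 b \<noteq> 0} \<and> b = (\<Oplus>\<^bsub>M\<^esub>b\<in>{b \<in> B. d1 b \<noteq> 0}. d1 b \<odot>\<^bsub>M\<^esub> b)"
      using finite_subset[OF sub U(1)] d by (auto simp: d1_def)
    have s2: "{b \<in> B. d2 b \<noteq> 0} = {b}" using b by (auto simp: d2_def)
    have "1 \<odot>\<^bsub>M\<^esub> b = b" using smult_one[OF bM] by simp
    then have "(\<Oplus>\<^bsub>M\<^esub>b\<in>{b \<in> B. d2 b \<noteq> 0}. d2 b \<odot>\<^bsub>M\<^esub> b) = b"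
      unfolding s2 using b bM M.finsum_insert[of "{}" b "\<lambda>b. d2 b \<odot>\<^bsub>M\<^esub> b"] by (simp add: d2_def)
    then have 2: "d2 \<in> B \<rightarrow>\<^sub>E Sym W \<and> finite {b \<in> B. d2 b \<noteq> 0} \<and> b = (\<Oplus>\<^bsub>M\<^esub>b\<in>{b \<in> B. d2 b \<noteq> 0}. d2 b \<odot>\<^bsub>M\<^esub> b)"
      unfolding s2 by (auto simp: d2_def)
    have "\<exists>!c. c \<in> B \<rightarrow>\<^sub>E Sym W \<and> finite {b \<in> B. c b \<noteq> 0} \<and> b = (\<Oplus>\<^bsub>M\<^esub>b\<in>{b \<in> B. c b \<noteq> 0}. c b \<odot>\<^bsub>M\<^esub> b)"
      using B bM unfolding is_basis_def by simp
    from ex1_same[OF this, OF 1 2] have "d1 = d2" .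
    then have "d1 b = d2 b" by simp
    then show "b \<in> U" using b by (auto simp: d1_def d2_def split: if_splits)
  qed
  then show ?thesis using U(1) finite_subset by blast
qed

text \<open>Coordinates with respect to a homogeneous basis give the isomorphism. That an element of
  degree d has coordinates of the right degrees follows from the uniqueness of homogeneous
  decompositions in \<open>graded_module\<close>.\<close>

lemma frame_of_basis:
  assumes gm: "graded_module (Sym_ring W) M" and fin: "finite B"
    and B: "is_basis (Sym_ring W) M B" and dg: "\<And>b. b \<in> B \<Longrightarrow> b \<in> gr M (dg b)"
  shows "frame W M B dg (\<lambda>f. \<Oplus>\<^bsub>M\<^esub>b\<in>B. f b \<odot>\<^bsub>M\<^esub> b)"
proof -
  have mod: "Module.module (Sym_ring W) M" using gm by (simp add: graded_module_def)
  interpret Module.module "Sym_ring W" M by fact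
  note sc = smult_closed[unfolded Sym_ring_simps]
  have grsub: "additive_subgroup (gr M d) M" for d using gm by (simp add: graded_module_def)
  have grmul: "a \<odot>\<^bsub>M\<^esub> m \<in> gr M (d + e)" if "a \<in> Sym_degree W d" "m \<in> gr M e" for a m d e
    using gm that by (simp add: graded_module_def)
  have BM: "b \<in> B \<Longrightarrow> b \<in> carrier M" for b using B by (auto simp: is_basis_def)
  define h where "h f = (\<Oplus>\<^bsub>M\<^esub>b\<in>B. f b \<odot>\<^bsub>M\<^esub> b)" for f
  have Pi: "(\<lambda>b. f b \<odot>\<^bsub>M\<^esub> b) \<in> B \<rightarrow> carrier M" if "f \<in> free_mod W B" for f
    using BM free_mod_Sym[OF that] by (auto intro!: sc)
  have h_in: "h f \<in> carrier M" if "f \<in> free_mod W B" for f unfolding h_def using Pi[OF that] by simp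
  have h_add: "h (f + g) = h f \<oplus>\<^bsub>M\<^esub> h g" if f: "f \<in> free_mod W B" "g \<in> free_mod W B" for f g
  proof -
    have "h f \<oplus>\<^bsub>M\<^esub> h g = (\<Oplus>\<^bsub>M\<^esub>b\<in>B. f b \<odot>\<^bsub>M\<^esub> b \<oplus>\<^bsub>M\<^esub> g b \<odot>\<^bsub>M\<^esub> b)"
      unfolding h_def by (rule M.finsum_addf[symmetric]) (use Pi f in auto)
    also have "\<dots> = h (f + g)" unfolding h_def
    proof (rule M.finsum_cong'[OF refl Pi[OF free_mod_closed(2)[OF f]]])
      fix b assume b: "b \<in> B"
      show "f b \<odot>\<^bsub>M\<^esub> b \<oplus>\<^bsub>M\<^esub> g b \<odot>\<^bsub>M\<^esub> b = (f + g) b \<odot>\<^bsub>M\<^esub> b"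
        using smult_l_distr[of "f b" "g b" b] free_mod_Sym[OF f(1)] free_mod_Sym[OF f(2)] BM[OF b]
        by (simp add: plus_fun_apply)
    qed
    finally show ?thesis by simp
  qed
  have h_smul: "h (smul a f) = a \<odot>\<^bsub>M\<^esub> h f" if a: "a \<in> Sym W" and f: "f \<in> free_mod W B" for a f
  proof -
    have "a \<odot>\<^bsub>M\<^esub> h f = (\<Oplus>\<^bsub>M\<^esub>b\<in>B. a \<odot>\<^bsub>M\<^esub> (f b \<odot>\<^bsub>M\<^esub> b))"
      unfolding h_def by (rule finsum_smult_ldistr) (use Pi f fin a in auto)
    also have "\<dots> = h (smul a f)" unfolding h_def
    proof (rule M.finsum_cong'[OF refl Pi[OF free_mod_closed(4)[OF a f]]])
      fix b assume b: "b \<in> B"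
      show "a \<odot>\<^bsub>M\<^esub> (f b \<odot>\<^bsub>M\<^esub> b) = smul a f b \<odot>\<^bsub>M\<^esub> b"
        using smult_assoc1[of a "f b" b] free_mod_Sym[OF f] a BM[OF b] by (simp add: smul_apply)
    qed
    finally show ?thesis by simp
  qed
  have h_0: "h 0 = \<zero>\<^bsub>M\<^esub>"
  proof -
    have "h (smul 0 0) = 0 \<odot>\<^bsub>M\<^esub> h 0" by (rule h_smul[OF Sym_0 free_mod_closed(1)])
    then show ?thesis
      using smult_l_null[OF h_in[OF free_mod_closed(1)], unfolded Sym_ring_simps] by (simp only: smul_simps)
  qed
  have supp: "(\<Oplus>\<^bsub>M\<^esub>b\<in>{b \<in> B. c b \<noteq> 0}. c b \<odot>\<^bsub>M\<^esub> b) = h c" if "\<And>b. b \<in> B \<Longrightarrow> c b \<in> Sym W" for c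
    unfolding h_def
  proof (rule M.add.finprod_mono_neutral_cong_left[OF fin])
    fix b assume "b \<in> B - {b \<in> B. c b \<noteq> 0}"
    then have "c b = 0" "b \<in> carrier M" using BM by auto
    then show "c b \<odot>\<^bsub>M\<^esub> b = \<zero>\<^bsub>M\<^esub>" using smult_l_null[of b, unfolded Sym_ring_simps] by simp
  qed (use that BM in \<open>auto intro!: sc\<close>)
  have basis: "\<exists>!c. c \<in> B \<rightarrow>\<^sub>E Sym W \<and> finite {b \<in> B. c b \<noteq> 0} \<and> m = (\<Oplus>\<^bsub>M\<^esub>b\<in>{b \<in> B. c b \<noteq> 0}. c b \<odot>\<^bsub>M\<^esub> b)"
    if "m \<in> carrier M" for m using B that unfolding is_basis_def by simp
  have h_cong: "h c = h c'" if "\<And>b. b \<in> B \<Longrightarrow> c b = c' b" "\<And>b. b \<in> B \<Longrightarrow> c b \<in> Sym W" for c c'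
    unfolding h_def by (rule M.finsum_cong'[OF refl]) (use that BM in \<open>auto intro!: sc simp: Pi_iff\<close>)
  have inj: "inj_on h (free_mod W B)"
  proof (rule inj_onI)
    fix f g assume f: "f \<in> free_mod W B" and g: "g \<in> free_mod W B" and eq: "h f = h g"
    have "restrict k B \<in> B \<rightarrow>\<^sub>E Sym W \<and> finite {b \<in> B. restrict k B b \<noteq> 0} \<and>
      h f = (\<Oplus>\<^bsub>M\<^esub>b\<in>{b \<in> B. restrict k B b \<noteq> 0}. restrict k B b \<odot>\<^bsub>M\<^esub> b)"
      if k: "k \<in> free_mod W B" "h f = h k" for k
    proof -
      have "(\<Oplus>\<^bsub>M\<^esub>b\<in>{b \<in> B. restrict k B b \<noteq> 0}. restrict k B b \<odot>\<^bsub>M\<^esub> b) = h (restrict k B)"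
        using free_mod_Sym[OF k(1)] by (intro supp) simp
      also have "\<dots> = h k" using free_mod_Sym[OF k(1)] by (intro h_cong) simp_all
      finally show ?thesis using fin free_mod_Sym[OF k(1)] k(2) by simp
    qed
    from ex1_same[OF basis[OF h_in[OF f]], OF this[OF f refl] this[OF g eq]] have req: "restrict f B = restrict g B" .
    have "f b = g b" if "b \<in> B" for b using fun_cong[OF req, of b] that by simp
    moreover have "f b = g b" if "b \<notin> B" for b using f g that by (simp add: free_mod_def)
    ultimately show "f = g" by blast
  qed
  have surj: "h ` free_mod W B = carrier M"
  proof (intro equalityI subsetI)
    fix m assume m: "m \<in> carrier M"
    from basis[OF m] obtain c where c: "c \<in> B \<rightarrow>\<^sub>E Sym W" "m = (\<Oplus>\<^bsub>M\<^esub>b\<in>{b \<in> B. c b \<noteq> 0}. c b \<odot>\<^bsub>M\<^esub> b)" by blast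
    have cS: "b \<in> B \<Longrightarrow> c b \<in> Sym W" for b using c(1) by auto
    have "m = h c" using c(2) supp[OF cS] by simp
    also have "\<dots> = h (\<lambda>b. if b \<in> B then c b else 0)" by (rule h_cong) (auto simp: cS)
    finally show "m \<in> h ` free_mod W B" using cS by (auto simp: free_mod_def)
  qed (use h_in in auto)
  have gr1: "h f \<in> gr M d" if f: "f \<in> free_mod W B" "fhom dg d f" for f d
    unfolding h_def
  proof (rule gr_finsum[OF M.abelian_group_axioms grsub fin])
    fix b assume b: "b \<in> B"
    have "f b \<in> Sym_degree W (d - dg b)" using free_mod_Sym[OF f(1)] f(2) by (simp add: Sym_degree_eq fhom_def)
    from grmul[OF this dg[OF b]] show "f b \<odot>\<^bsub>M\<^esub> b \<in> gr M d" by simp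
  qed
  have gr2: "fhom dg d f" if f: "f \<in> free_mod W B" "h f \<in> gr M d" for f d
  proof -
    define D where "D = {e. homcomp dg e f \<noteq> 0}"
    have D: "finite D" using homcomp_finite[OF fin f(1)] by (simp add: D_def)
    have hz: "h (homcomp dg e f) = \<zero>\<^bsub>M\<^esub> \<longleftrightarrow> homcomp dg e f = 0" for e
      using inj_on_eq_iff[OF inj free_mod_closed(5)[OF f(1)] free_mod_closed(1)] h_0 by simp
    have hs: "h (\<Sum>e\<in>T. homcomp dg e f) = (\<Oplus>\<^bsub>M\<^esub>e\<in>T. h (homcomp dg e f))" if "finite T" for T
      using that
    proof (induction T rule: finite_induct)
      case (insert e T)
      have "h (homcomp dg e f + (\<Sum>e\<in>T. homcomp dg e f)) = h (homcomp dg e f) \<oplus>\<^bsub>M\<^esub> h (\<Sum>e\<in>T. homcomp dg e f)"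
        by (intro h_add free_mod_sum free_mod_closed(5) f(1))
      with insert show ?case
        by (simp add: free_mod_closed(5)[OF f(1)] M.finsum_insert h_in Pi_iff)
    qed (simp add: h_0)
    have "(\<Sum>e\<in>D. homcomp dg e f) = f" by (rule sum_homcomp[OF D]) (simp add: D_def)
    with hs[OF D] have "h f = (\<Oplus>\<^bsub>M\<^esub>e\<in>D. h (homcomp dg e f))" by (simp only:)
    then have 1: "(\<forall>e. h (homcomp dg e f) \<in> gr M e) \<and> finite {e. h (homcomp dg e f) \<noteq> \<zero>\<^bsub>M\<^esub>} \<and>
        h f = (\<Oplus>\<^bsub>M\<^esub>e\<in>{e. h (homcomp dg e f) \<noteq> \<zero>\<^bsub>M\<^esub>}. h (homcomp dg e f))"
      using gr1[OF free_mod_closed(5)[OF f(1)] fhom_homcomp] D by (simp add: hz D_def)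
    \<comment> \<open>An element in degree d has two homogeneous decompositions: the images of the
      components of f, and this one concentrated in degree d.\<close>
    define F where "F e = (if e = d then h f else \<zero>\<^bsub>M\<^esub>)" for e
    have F: "finite {e. F e \<noteq> \<zero>\<^bsub>M\<^esub>}" by (rule finite_subset[of _ "{d}"]) (auto simp: F_def)
    have "(\<Oplus>\<^bsub>M\<^esub>e\<in>{e. F e \<noteq> \<zero>\<^bsub>M\<^esub>}. F e) = (\<Oplus>\<^bsub>M\<^esub>e\<in>{d}. F e)"
      by (rule M.add.finprod_mono_neutral_cong_left) (auto simp: F_def h_in[OF f(1)])
    also have "\<dots> = h f" using M.finsum_insert[of "{}" d F] h_in[OF f(1)] by (simp add: F_def)
    finally have 2: "(\<forall>e. F e \<in> gr M e) \<and> finite {e. F e \<noteq> \<zero>\<^bsub>M\<^esub>} \<and> h f = (\<Oplus>\<^bsub>M\<^esub>e\<in>{e. F e \<noteq> \<zero>\<^bsub>M\<^esub>}. F e)"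
      using F f(2) additive_subgroup.zero_closed[OF grsub] by (simp add: F_def)
    have "\<exists>!F. (\<forall>e. F e \<in> gr M e) \<and> finite {e. F e \<noteq> \<zero>\<^bsub>M\<^esub>} \<and> h f = (\<Oplus>\<^bsub>M\<^esub>e\<in>{e. F e \<noteq> \<zero>\<^bsub>M\<^esub>}. F e)"
      using gm h_in[OF f(1)] unfolding graded_module_def by blast
    from ex1_same[OF this, OF 1 2] have "(\<lambda>e. h (homcomp dg e f)) = F" .
    from fun_cong[OF this, of d] have "h (homcomp dg d f) = h f" by (simp add: F_def)
    then have "homcomp dg d f = f" using inj_on_eq_iff[OF inj free_mod_closed(5)[OF f(1)] f(1)] by simp
    then show ?thesis by (simp add: fhom_iff_homcomp)
  qed
  have "gr M d = h ` {f \<in> free_mod W B. fhom dg d f}" for d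
  proof (intro equalityI subsetI)
    fix m assume m: "m \<in> gr M d"
    then have "m \<in> carrier M" using additive_subgroup.a_subset[OF grsub] by blast
    then obtain f where f: "f \<in> free_mod W B" "m = h f" using surj by blast
    then show "m \<in> h ` {f \<in> free_mod W B. fhom dg d f}" using gr2[OF f(1)] m by blast
  qed (use gr1 in auto)
  then have "frame W M B dg h"
    unfolding frame_def bij_betw_def
    by (intro conjI ballI allI fin inj surj h_0 h_add h_smul) simp_all
  then show ?thesis unfolding h_def .
qed

section \<open>Tensor products in coordinates\<close>

definition unit_coord :: "'c \<Rightarrow> 'c \<Rightarrow> real" where
  "unit_coord b = (\<lambda>b'. if b' = b then 1 else 0)"

text \<open>These are coordinates on a real vector space with a finite basis labelled by
  \<open>T\<close>; the top degree part of a reduced stalk will be presented in this way.\<close>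

definition vframe :: "(real, 'w) module \<Rightarrow> 'c set \<Rightarrow> (('c \<Rightarrow> real) \<Rightarrow> 'w) \<Rightarrow> bool" where
  "vframe X T g \<longleftrightarrow> finite T \<and> bij_betw g {c. \<forall>b. b \<notin> T \<longrightarrow> c b = 0} (carrier X) \<and>
     (\<forall>c c'. (\<forall>b. b \<notin> T \<longrightarrow> c b = 0) \<longrightarrow> (\<forall>b. b \<notin> T \<longrightarrow> c' b = 0) \<longrightarrow> g (\<lambda>b. c b + c' b) = g c \<oplus>\<^bsub>X\<^esub> g c') \<and>
     (\<forall>r c. (\<forall>b. b \<notin> T \<longrightarrow> c b = 0) \<longrightarrow> g (\<lambda>b. r * c b) = r \<odot>\<^bsub>X\<^esub> g c)"

text \<open>Only the additive structure and the scalars matter for the module factor: \<open>h\<close> identifies it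
  with an additive subgroup \<open>A\<close> of a type, closed under real scalars.\<close>

definition aframe :: "('i mpoly, 'm) gr_module \<Rightarrow> ('b \<Rightarrow> 'i mpoly) set \<Rightarrow> (('b \<Rightarrow> 'i mpoly) \<Rightarrow> 'm) \<Rightarrow> bool" where
  "aframe M A h \<longleftrightarrow> bij_betw h A (carrier M) \<and> 0 \<in> A \<and>
     (\<forall>f\<in>A. \<forall>g\<in>A. f + g \<in> A \<and> f - g \<in> A \<and> h (f + g) = h f \<oplus>\<^bsub>M\<^esub> h g) \<and>
     (\<forall>r. \<forall>f\<in>A. smul (const_poly r) f \<in> A \<and> h (smul (const_poly r) f) = const_poly r \<odot>\<^bsub>M\<^esub> h f)"

text \<open>A basis of the vector space factor identifies the tensor product with
  \<open>T\<close>-indexed families of elements of the module factor. The locale proves this for the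
  tensor product presented by generators and relations.\<close>

locale tensor_frame =
  fixes X :: "(real, 'w) module" and T :: "'c set" and g :: "('c \<Rightarrow> real) \<Rightarrow> 'w"
    and M :: "('i mpoly, 'm) gr_module" and A :: "('b \<Rightarrow> 'i mpoly) set" and h :: "('b \<Rightarrow> 'i mpoly) \<Rightarrow> 'm"
  assumes vframe: "vframe X T g" and aframe: "aframe M A h"
begin

abbreviation "Z \<equiv> {c :: 'c \<Rightarrow> real. \<forall>b. b \<notin> T \<longrightarrow> c b = 0}"

lemma finT: "finite T" and g_bij: "bij_betw g Z (carrier X)"
  and g_add: "c \<in> Z \<Longrightarrow> c' \<in> Z \<Longrightarrow> g (\<lambda>b. c b + c' b) = g c \<oplus>\<^bsub>X\<^esub> g c'"
  and g_smul: "c \<in> Z \<Longrightarrow> g (\<lambda>b. r * c b) = r \<odot>\<^bsub>X\<^esub> g c"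
  using vframe unfolding vframe_def by simp_all

lemma h_bij: "bij_betw h A (carrier M)" and A_0: "0 \<in> A"
  and A_add: "f \<in> A \<Longrightarrow> f' \<in> A \<Longrightarrow> f + f' \<in> A" and A_diff: "f \<in> A \<Longrightarrow> f' \<in> A \<Longrightarrow> f - f' \<in> A"
  and h_add: "f \<in> A \<Longrightarrow> f' \<in> A \<Longrightarrow> h (f + f') = h f \<oplus>\<^bsub>M\<^esub> h f'"
  and A_smul: "f \<in> A \<Longrightarrow> smul (const_poly r) f \<in> A"
  and h_smul: "f \<in> A \<Longrightarrow> h (smul (const_poly r) f) = const_poly r \<odot>\<^bsub>M\<^esub> h f"
  using aframe unfolding aframe_def by simp_all

lemma A_sum: "(\<And>i. i \<in> S \<Longrightarrow> k i \<in> A) \<Longrightarrow> sum k S \<in> A"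
  by (induction S rule: infinite_finite_induct) (auto simp: A_0 A_add)

lemma g_in: "c \<in> Z \<Longrightarrow> g c \<in> carrier X"
  by (rule bij_betwE[OF g_bij, rule_format])

lemma h_in: "f \<in> A \<Longrightarrow> h f \<in> carrier M"
  by (rule bij_betwE[OF h_bij, rule_format])

definition coord :: "'w \<Rightarrow> 'c \<Rightarrow> real" where "coord = the_inv_into Z g"

definition hinv :: "'m \<Rightarrow> 'b \<Rightarrow> 'i mpoly" where "hinv = the_inv_into A h"

lemma coord: "w \<in> carrier X \<Longrightarrow> coord w \<in> Z" "w \<in> carrier X \<Longrightarrow> g (coord w) = w" "c \<in> Z \<Longrightarrow> coord (g c) = c"
proof -
  have inj: "inj_on g Z" and im: "carrier X = g ` Z" using g_bij by (simp_all add: bij_betw_def)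
  show "w \<in> carrier X \<Longrightarrow> coord w \<in> Z" unfolding coord_def im by (rule the_inv_into_into[OF inj _ order_refl])
  show "w \<in> carrier X \<Longrightarrow> g (coord w) = w" unfolding coord_def im by (rule f_the_inv_into_f[OF inj])
  show "c \<in> Z \<Longrightarrow> coord (g c) = c" unfolding coord_def by (rule the_inv_into_f_f[OF inj])
qed

lemma hinv: "m \<in> carrier M \<Longrightarrow> hinv m \<in> A" "m \<in> carrier M \<Longrightarrow> h (hinv m) = m" "f \<in> A \<Longrightarrow> hinv (h f) = f"
proof -
  have inj: "inj_on h A" and im: "carrier M = h ` A" using h_bij by (simp_all add: bij_betw_def)
  show "m \<in> carrier M \<Longrightarrow> hinv m \<in> A" unfolding hinv_def im by (rule the_inv_into_into[OF inj _ order_refl])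
  show "m \<in> carrier M \<Longrightarrow> h (hinv m) = m" unfolding hinv_def im by (rule f_the_inv_into_f[OF inj])
  show "f \<in> A \<Longrightarrow> hinv (h f) = f" unfolding hinv_def by (rule the_inv_into_f_f[OF inj])
qed

lemma coord_add: "w \<in> carrier X \<Longrightarrow> w' \<in> carrier X \<Longrightarrow> coord (w \<oplus>\<^bsub>X\<^esub> w') = (\<lambda>b. coord w b + coord w' b)"
  using g_add[OF coord(1) coord(1), of w w'] coord(3)[of "\<lambda>b. coord w b + coord w' b"] coord(1,2)[of w] coord(1,2)[of w']
  by simp

lemma coord_smul: "w \<in> carrier X \<Longrightarrow> coord (r \<odot>\<^bsub>X\<^esub> w) = (\<lambda>b. r * coord w b)"
  using g_smul[OF coord(1), of w r] coord(3)[of "\<lambda>b. r * coord w b"] coord(1,2)[of w] by simp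

lemma hinv_add: "m \<in> carrier M \<Longrightarrow> m' \<in> carrier M \<Longrightarrow> hinv (m \<oplus>\<^bsub>M\<^esub> m') = hinv m + hinv m'"
  using h_add[OF hinv(1) hinv(1), of m m'] hinv(3)[OF A_add[OF hinv(1) hinv(1)], of m m'] hinv(2)[of m] hinv(2)[of m']
  by simp

lemma hinv_smul: "m \<in> carrier M \<Longrightarrow> hinv (const_poly r \<odot>\<^bsub>M\<^esub> m) = smul (const_poly r) (hinv m)"
  using h_smul[OF hinv(1), of m r] hinv(3)[OF A_smul[OF hinv(1)], of m r] hinv(2)[of m] by simp

lemma X_closed: "w \<in> carrier X \<Longrightarrow> w' \<in> carrier X \<Longrightarrow> w \<oplus>\<^bsub>X\<^esub> w' \<in> carrier X"
  "w \<in> carrier X \<Longrightarrow> r \<odot>\<^bsub>X\<^esub> w \<in> carrier X"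
proof -
  show "w \<oplus>\<^bsub>X\<^esub> w' \<in> carrier X" if "w \<in> carrier X" "w' \<in> carrier X"
    using g_add[OF coord(1)[OF that(1)] coord(1)[OF that(2)]] g_in[of "\<lambda>b. coord w b + coord w' b"]
      coord(1,2)[OF that(1)] coord(1,2)[OF that(2)] by simp
  show "r \<odot>\<^bsub>X\<^esub> w \<in> carrier X" if "w \<in> carrier X"
    using g_smul[OF coord(1)[OF that], of r] g_in[of "\<lambda>b. r * coord w b"] coord(1,2)[OF that] by simp
qed

lemma M_closed: "m \<in> carrier M \<Longrightarrow> m' \<in> carrier M \<Longrightarrow> m \<oplus>\<^bsub>M\<^esub> m' \<in> carrier M"
  "m \<in> carrier M \<Longrightarrow> const_poly r \<odot>\<^bsub>M\<^esub> m \<in> carrier M"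
proof -
  show "m \<oplus>\<^bsub>M\<^esub> m' \<in> carrier M" if "m \<in> carrier M" "m' \<in> carrier M"
    using h_add[OF hinv(1)[OF that(1)] hinv(1)[OF that(2)]] h_in[OF A_add[OF hinv(1)[OF that(1)] hinv(1)[OF that(2)]]]
      hinv(2)[OF that(1)] hinv(2)[OF that(2)] by simp
  show "const_poly r \<odot>\<^bsub>M\<^esub> m \<in> carrier M" if "m \<in> carrier M"
    using h_smul[OF hinv(1)[OF that], of r] h_in[OF A_smul[OF hinv(1)[OF that]], of r] hinv(2)[OF that] by simp
qed

text \<open>The bilinear map taking (w, m) to the family of multiples of m by the coordinates of w,
  extended additively to formal sums of pairs. Its fibres turn out to be the cosets of the
  relations.\<close>

definition ev :: "(('w \<times> 'm) \<Rightarrow>\<^sub>0 int) \<Rightarrow> 'c \<Rightarrow> 'b \<Rightarrow> 'i mpoly" where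
  "ev c b = (\<Sum>k\<in>Poly_Mapping.keys c. smul (const_poly (of_int (Poly_Mapping.lookup c k) * coord (fst k) b)) (hinv (snd k)))"

lemma ev_add: "ev (c + d) b = ev c b + ev d b"
  unfolding ev_def
  by (rule setsum_keys_plus_distrib) (simp_all add: distrib_right const_poly_add smul_distrib)

lemma ev_zero: "ev 0 b = 0"
  by (simp add: ev_def)

lemma ev_diff: "ev (c - d) b = ev c b - ev d b"
  using ev_add[of "c - d" d b] by simp

lemma ev_uminus: "ev (- c) b = - ev c b"
  using ev_diff[of 0 c b] by (simp add: ev_zero)

lemma ev_frag_of: "ev (frag_of k) b = smul (const_poly (coord (fst k) b)) (hinv (snd k))"
  by (simp add: ev_def keys_frag_of)

lemma ev_sum: "ev (sum k S) b = (\<Sum>i\<in>S. ev (k i) b)"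
  by (induction S rule: infinite_finite_induct) (auto simp: ev_zero ev_add)

abbreviation "TG \<equiv> tensor_group X M"
abbreviation "TN \<equiv> tensor_null X M"

lemma carrier_TG: "c \<in> carrier TG \<longleftrightarrow> Poly_Mapping.keys c \<subseteq> carrier X \<times> carrier M"
  by (simp add: tensor_group_def)

lemma TG_simps [simp]: "\<one>\<^bsub>TG\<^esub> = 0" "c \<otimes>\<^bsub>TG\<^esub> d = c + d"
  by (simp_all add: tensor_group_def)

lemma group_TG: "Group.group TG"
  by (simp add: tensor_group_def)

lemma TG_add: "c \<in> carrier TG \<Longrightarrow> d \<in> carrier TG \<Longrightarrow> c + d \<in> carrier TG"
  using keys_add[of c d] by (auto simp: carrier_TG)

lemma TG_diff: "c \<in> carrier TG \<Longrightarrow> d \<in> carrier TG \<Longrightarrow> c - d \<in> carrier TG"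
  using keys_diff[of c d] by (auto simp: carrier_TG)

lemma TG_frag: "w \<in> carrier X \<Longrightarrow> m \<in> carrier M \<Longrightarrow> frag_of (w, m) \<in> carrier TG"
  by (simp add: carrier_TG keys_frag_of)

lemma TG_sum: "(\<And>i. i \<in> S \<Longrightarrow> k i \<in> carrier TG) \<Longrightarrow> sum k S \<in> carrier TG"
  by (induction S rule: infinite_finite_induct) (auto simp: TG_add carrier_TG[of 0] intro!: TG_add)

lemma ev_A: "c \<in> carrier TG \<Longrightarrow> ev c b \<in> A"
  unfolding ev_def by (rule A_sum) (auto simp: carrier_TG intro!: A_smul hinv)

lemma relators_TG: "tensor_relators X M \<subseteq> carrier TG"
  unfolding tensor_relators_def
  by (auto intro!: TG_diff TG_frag X_closed M_closed)

lemma TN_subgroup: "subgroup TN TG"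
  unfolding tensor_null_def by (rule group.generate_is_subgroup[OF group_TG relators_TG])

lemma TN_0: "0 \<in> TN" and TN_TG: "c \<in> TN \<Longrightarrow> c \<in> carrier TG"
  and TN_add: "c \<in> TN \<Longrightarrow> d \<in> TN \<Longrightarrow> c + d \<in> TN"
  using subgroup.one_closed[OF TN_subgroup] subgroup.mem_carrier[OF TN_subgroup] subgroup.m_closed[OF TN_subgroup] by auto

lemma TN_uminus: assumes "c \<in> TN" shows "- c \<in> TN"
proof -
  have "inv\<^bsub>TG\<^esub> c = - c"
    using TN_TG[OF assms] unfolding carrier_TG unfolding tensor_group_def by (rule inv_free_Abelian_group)
  then show ?thesis using subgroup.m_inv_closed[OF TN_subgroup assms] by simp
qed

lemma TN_diff: "c \<in> TN \<Longrightarrow> d \<in> TN \<Longrightarrow> c - d \<in> TN"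
  using TN_add[OF _ TN_uminus, of c d] by simp

lemma TN_relators: "tensor_relators X M \<subseteq> TN"
  unfolding tensor_null_def by (auto intro: generate.incl)

lemma TN_addl: "w \<in> carrier X \<Longrightarrow> w' \<in> carrier X \<Longrightarrow> m \<in> carrier M \<Longrightarrow>
    frag_of (w \<oplus>\<^bsub>X\<^esub> w', m) - frag_of (w, m) - frag_of (w', m) \<in> TN"
  by (rule subsetD[OF TN_relators]) (auto simp: tensor_relators_def)

lemma TN_addr: "w \<in> carrier X \<Longrightarrow> m \<in> carrier M \<Longrightarrow> m' \<in> carrier M \<Longrightarrow>
    frag_of (w, m \<oplus>\<^bsub>M\<^esub> m') - frag_of (w, m) - frag_of (w, m') \<in> TN"
  by (rule subsetD[OF TN_relators]) (auto simp: tensor_relators_def)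

lemma TN_smul: "w \<in> carrier X \<Longrightarrow> m \<in> carrier M \<Longrightarrow>
    frag_of (r \<odot>\<^bsub>X\<^esub> w, m) - frag_of (w, const_poly r \<odot>\<^bsub>M\<^esub> m) \<in> TN"
  by (rule subsetD[OF TN_relators]) (auto simp: tensor_relators_def)

lemma ev_TN:
  assumes "c \<in> TN" shows "ev c b = 0"
proof -
  have "subgroup {c \<in> carrier TG. \<forall>b. ev c b = 0} TG"
  proof (rule subgroup.intro)
    fix c assume "c \<in> {c \<in> carrier TG. \<forall>b. ev c b = 0}"
    then have c: "c \<in> carrier TG" "\<forall>b. ev c b = 0" by auto
    have "inv\<^bsub>TG\<^esub> c = 0 - c"
      using c(1) unfolding carrier_TG unfolding tensor_group_def by simp
    moreover have "0 - c \<in> carrier TG" using c(1) by (intro TG_diff) (auto simp: carrier_TG)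
    ultimately show "inv\<^bsub>TG\<^esub> c \<in> {c \<in> carrier TG. \<forall>b. ev c b = 0}" using c(2) by (simp add: ev_uminus)
  qed (auto simp: ev_zero ev_add carrier_TG[of 0] intro: TG_add)
  moreover have "tensor_relators X M \<subseteq> {c \<in> carrier TG. \<forall>b. ev c b = 0}"
  proof
    fix c assume c: "c \<in> tensor_relators X M"
    then have "ev c b = 0" for b
      unfolding tensor_relators_def
      by (auto simp: ev_diff ev_frag_of coord_add coord_smul hinv_add hinv_smul const_poly_add smul_distrib
          const_poly_mult mult.commute X_closed M_closed)
    then show "c \<in> {c \<in> carrier TG. \<forall>b. ev c b = 0}" using c relators_TG by auto
  qed
  ultimately have "TN \<subseteq> {c \<in> carrier TG. \<forall>b. ev c b = 0}"
    unfolding tensor_null_def by (intro group.generate_subgroup_incl[OF group_TG])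
  with assms show ?thesis by auto
qed

text \<open>The normal form of a family v: the formal sum of the tensors of the basis vectors with
  the entries of v.\<close>

definition rep :: "('c \<Rightarrow> 'b \<Rightarrow> 'i mpoly) \<Rightarrow> ('w \<times> 'm) \<Rightarrow>\<^sub>0 int" where
  "rep v = (\<Sum>b\<in>T. frag_of (g (unit_coord b), h (v b)))"

lemma unit_coord_Z: "b \<in> T \<Longrightarrow> unit_coord b \<in> Z"
  by (auto simp: unit_coord_def)

definition tfam :: "('c \<Rightarrow> 'b \<Rightarrow> 'i mpoly) set" where
  "tfam = {v. (\<forall>b\<in>T. v b \<in> A) \<and> (\<forall>b. b \<notin> T \<longrightarrow> v b = 0)}"

lemma rep_TG: "v \<in> tfam \<Longrightarrow> rep v \<in> carrier TG"
  unfolding rep_def by (rule TG_sum) (auto simp: tfam_def intro!: TG_frag g_in h_in unit_coord_Z)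

lemma ev_tfam: assumes "c \<in> carrier TG" shows "ev c \<in> tfam"
  unfolding tfam_def
proof (intro CollectI conjI ballI allI impI)
  fix b show "ev c b \<in> A" by (rule ev_A[OF assms])
  assume b: "b \<notin> T"
  show "ev c b = 0"
    unfolding ev_def
  proof (rule sum.neutral, rule ballI)
    fix k assume "k \<in> Poly_Mapping.keys c"
    then have "fst k \<in> carrier X" using assms by (auto simp: carrier_TG)
    then have "coord (fst k) b = 0" using coord(1) b by blast
    then show "smul (const_poly (of_int (Poly_Mapping.lookup c k) * coord (fst k) b)) (hinv (snd k)) = 0" by simp
  qed
qed

lemma ev_rep: assumes v: "v \<in> tfam" shows "ev (rep v) = v"
proof (rule ext)
  fix b
  have "ev (rep v) b = (\<Sum>b'\<in>T. if b' = b then v b else 0)"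
    unfolding rep_def ev_sum
  proof (rule sum.cong[OF refl])
    fix b' assume b': "b' \<in> T"
    then have "hinv (h (v b')) = v b'" using v hinv(3) by (simp add: tfam_def)
    then show "ev (frag_of (g (unit_coord b'), h (v b'))) b = (if b' = b then v b else 0)"
      using coord(3)[OF unit_coord_Z[OF b']] by (auto simp: ev_frag_of unit_coord_def)
  qed
  also have "\<dots> = v b" using v finT by (auto simp: tfam_def)
  finally show "ev (rep v) b = v b" .
qed

lemma frag_zero: "w \<in> carrier X \<Longrightarrow> frag_of (w, h 0) \<in> TN" "m \<in> carrier M \<Longrightarrow> frag_of (g (\<lambda>_. 0), m) \<in> TN"
proof -
  show "frag_of (w, h 0) \<in> TN" if w: "w \<in> carrier X"
  proof -
    have "h 0 \<oplus>\<^bsub>M\<^esub> h 0 = h 0" using h_add[OF A_0 A_0] by simp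
    then have "- frag_of (w, h 0) \<in> TN" using TN_addr[OF w h_in[OF A_0] h_in[OF A_0]] by simp
    then show ?thesis using TN_uminus by force
  qed
  show "frag_of (g (\<lambda>_. 0), m) \<in> TN" if m: "m \<in> carrier M"
  proof -
    have z: "(\<lambda>_. 0) \<in> Z" by simp
    have "g (\<lambda>_. 0) \<oplus>\<^bsub>X\<^esub> g (\<lambda>_. 0) = g (\<lambda>_. 0)" using g_add[OF z z] by simp
    then have "- frag_of (g (\<lambda>_. 0), m) \<in> TN" using TN_addl[OF g_in[OF z] g_in[OF z] m] by simp
    then show ?thesis using TN_uminus by force
  qed
qed

text \<open>Modulo the relations, w can be expanded in the basis by additivity in the first slot,
  and each coordinate moves across to m.\<close>

lemma frag_rep_single:
  assumes w: "w \<in> carrier X" and m: "m \<in> carrier M"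
  shows "frag_of (w, m) - rep (ev (frag_of (w, m))) \<in> TN"
proof -
  have mm: "const_poly r \<odot>\<^bsub>M\<^esub> m \<in> carrier M" for r using M_closed(2)[OF m] .
  \<comment> \<open>Coordinates of w are added one at a time; the empty sum leaves the zero vector,
    which \<open>frag_zero\<close> absorbs.\<close>
  have ind: "frag_of (g (\<lambda>b. if b \<in> S then coord w b else 0), m)
      - (\<Sum>b\<in>S. frag_of (g (unit_coord b), const_poly (coord w b) \<odot>\<^bsub>M\<^esub> m)) \<in> TN" if "finite S" "S \<subseteq> T" for S
    using that
  proof (induction S rule: finite_induct)
    case empty then show ?case using frag_zero(2)[OF m] by simp
  next
    case (insert b S)
    let ?c = "\<lambda>b. if b \<in> S then coord w b else 0" and ?d = "\<lambda>b'. coord w b * unit_coord b b'"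
    have b: "b \<in> T" using insert by simp
    have c: "?c \<in> Z" and d: "?d \<in> Z" using insert by (auto simp: unit_coord_def)
    have eq: "(\<lambda>b'. if b' \<in> insert b S then coord w b' else 0) = (\<lambda>b'. ?c b' + ?d b')"
      using insert by (auto simp: unit_coord_def fun_eq_iff)
    have dX: "g ?d = coord w b \<odot>\<^bsub>X\<^esub> g (unit_coord b)" by (rule g_smul[OF unit_coord_Z[OF b]])
    have 1: "frag_of (g (\<lambda>b'. ?c b' + ?d b'), m) - frag_of (g ?c, m) - frag_of (g ?d, m) \<in> TN"
      unfolding g_add[OF c d] by (rule TN_addl[OF g_in[OF c] g_in[OF d] m])
    have 2: "frag_of (g ?d, m) - frag_of (g (unit_coord b), const_poly (coord w b) \<odot>\<^bsub>M\<^esub> m) \<in> TN"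
      unfolding dX by (rule TN_smul[OF g_in[OF unit_coord_Z[OF b]] m])
    have 3: "frag_of (g ?c, m) - (\<Sum>b\<in>S. frag_of (g (unit_coord b), const_poly (coord w b) \<odot>\<^bsub>M\<^esub> m)) \<in> TN"
      using insert by simp
    have e3: "frag_of (g (\<lambda>b'. ?c b' + ?d b'), m)
      - (\<Sum>b\<in>insert b S. frag_of (g (unit_coord b), const_poly (coord w b) \<odot>\<^bsub>M\<^esub> m))
      = (frag_of (g (\<lambda>b'. ?c b' + ?d b'), m) - frag_of (g ?c, m) - frag_of (g ?d, m))
      + (frag_of (g ?d, m) - frag_of (g (unit_coord b), const_poly (coord w b) \<odot>\<^bsub>M\<^esub> m))
      + (frag_of (g ?c, m) - (\<Sum>b\<in>S. frag_of (g (unit_coord b), const_poly (coord w b) \<odot>\<^bsub>M\<^esub> m)))"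
      using insert(1,2) by simp
    show ?case unfolding eq e3 by (rule TN_add[OF TN_add[OF 1 2] 3])
  qed
  have cw: "(\<lambda>b. if b \<in> T then coord w b else 0) = coord w" using coord(1)[OF w] by auto
  have "rep (ev (frag_of (w, m))) = (\<Sum>b\<in>T. frag_of (g (unit_coord b), const_poly (coord w b) \<odot>\<^bsub>M\<^esub> m))"
    unfolding rep_def
    by (rule sum.cong[OF refl]) (simp add: ev_frag_of h_smul[OF hinv(1)[OF m]] hinv(2)[OF m])
  then show ?thesis using ind[OF finT order_refl] unfolding cw coord(2)[OF w] by simp
qed

text \<open>Additivity of \<open>rep\<close> modulo the relations is stated for differences because
  \<open>frag_induction\<close> builds formal sums by subtraction.\<close>

lemma rep_diff:
  assumes v: "v \<in> tfam" "v' \<in> tfam"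
  shows "rep v - rep v' - rep (\<lambda>b. v b - v' b) \<in> TN"
proof -
  have "frag_of (g (unit_coord b), h (v b)) - frag_of (g (unit_coord b), h (v b - v' b)) - frag_of (g (unit_coord b), h (v' b)) \<in> TN"
    if b: "b \<in> T" for b
  proof -
    have A: "v b \<in> A" "v' b \<in> A" "v b - v' b \<in> A" using v b by (auto simp: tfam_def intro: A_diff)
    have "h (v b) = h (v b - v' b) \<oplus>\<^bsub>M\<^esub> h (v' b)" using h_add[OF A(3,2)] by simp
    then show ?thesis using TN_addr[OF g_in[OF unit_coord_Z[OF b]] h_in[OF A(3)] h_in[OF A(2)]] by simp
  qed
  note t = this
  have "(\<Sum>b\<in>S. frag_of (g (unit_coord b), h (v b)) - frag_of (g (unit_coord b), h (v b - v' b)) - frag_of (g (unit_coord b), h (v' b))) \<in> TN"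
    if "S \<subseteq> T" for S
    using finite_subset[OF that finT] that
    by (induction S rule: finite_induct) (auto simp: TN_0 intro!: TN_add t)
  from this[OF order_refl] show ?thesis by (simp add: rep_def sum_subtractf sum.distrib algebra_simps)
qed

lemma frag_rep:
  assumes c: "c \<in> carrier TG"
  shows "c - rep (ev c) \<in> TN"
proof -
  have "c \<in> carrier TG \<and> c - rep (ev c) \<in> TN"
    using c[unfolded carrier_TG]
  proof (induction rule: frag_induction)
    case zero
    have "(\<Sum>b\<in>S. frag_of (g (unit_coord b), h 0)) \<in> TN" if "S \<subseteq> T" for S
      using finite_subset[OF that finT] that
      by (induction S rule: finite_induct) (auto simp: TN_0 intro!: TN_add frag_zero g_in unit_coord_Z)
    then have "rep (ev 0) \<in> TN" by (simp add: rep_def ev_zero)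
    then show ?case using TN_uminus by (simp add: carrier_TG)
  next
    case (one k)
    then show ?case using frag_rep_single[of "fst k" "snd k"] TG_frag[of "fst k" "snd k"] by auto
  next
    case (diff c d)
    have "ev (c - d) = (\<lambda>b. ev c b - ev d b)" by (simp add: fun_eq_iff ev_diff)
    then have 1: "rep (ev c) - rep (ev d) - rep (ev (c - d)) \<in> TN"
      using rep_diff[OF ev_tfam ev_tfam] diff by simp
    have 2: "(c - rep (ev c)) - (d - rep (ev d)) \<in> TN" by (rule TN_diff) (use diff in simp_all)
    have "((c - rep (ev c)) - (d - rep (ev d))) + (rep (ev c) - rep (ev d) - rep (ev (c - d))) \<in> TN"
      by (rule TN_add[OF 2 1])
    then show ?case using diff TG_diff by (simp add: algebra_simps)
  qed
  then show ?thesis by simp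
qed

definition Cl :: "('c \<Rightarrow> 'b \<Rightarrow> 'i mpoly) \<Rightarrow> (('w \<times> 'm) \<Rightarrow>\<^sub>0 int) set" where
  "Cl v = {c \<in> carrier TG. ev c = v}"

text \<open>Each formal sum is congruent to the normal form of its evaluation, and evaluation kills
  the relations; so the evaluation determines the coset and conversely.\<close>

lemma coset_eq: assumes c: "c \<in> carrier TG" shows "TN #>\<^bsub>TG\<^esub> c = Cl (ev c)"
proof (intro equalityI subsetI)
  fix d assume "d \<in> TN #>\<^bsub>TG\<^esub> c"
  then obtain n where n: "n \<in> TN" "d = n + c" by (auto simp: r_coset_def)
  then show "d \<in> Cl (ev c)"
    using TG_add[OF TN_TG[OF n(1)] c] by (simp add: Cl_def fun_eq_iff ev_add ev_TN)
next
  fix d assume "d \<in> Cl (ev c)"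
  then have d: "d \<in> carrier TG" "ev d = ev c" by (auto simp: Cl_def)
  have "d - c = (d - rep (ev d)) - (c - rep (ev c))" using d by simp
  then have "d - c \<in> TN" using TN_diff[OF frag_rep[OF d(1)] frag_rep[OF c]] by simp
  then show "d \<in> TN #>\<^bsub>TG\<^esub> c" unfolding r_coset_def by (auto intro!: bexI[of _ "d - c"])
qed

lemma rep_in_Cl: "v \<in> tfam \<Longrightarrow> rep v \<in> Cl v"
  by (simp add: Cl_def rep_TG ev_rep)

lemma Cl_bij: "bij_betw Cl tfam (carrier (tensor_module d X M))"
  unfolding bij_betw_def
proof
  show "inj_on Cl tfam"
  proof (rule inj_onI)
    fix v v' assume "v \<in> tfam" "v' \<in> tfam" "Cl v = Cl v'"
    then have "rep v \<in> Cl v'" using rep_in_Cl by blast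
    then show "v = v'" using ev_rep[OF \<open>v \<in> tfam\<close>] by (simp add: Cl_def)
  qed
  have car: "carrier (tensor_module d X M) = (\<lambda>c. TN #>\<^bsub>TG\<^esub> c) ` carrier TG"
    by (auto simp: tensor_module_def RCOSETS_def)
  show "Cl ` tfam = carrier (tensor_module d X M)"
    unfolding car
  proof (intro equalityI subsetI)
    fix C assume "C \<in> Cl ` tfam"
    then obtain v where v: "v \<in> tfam" "C = Cl v" by auto
    then have "C = TN #>\<^bsub>TG\<^esub> rep v" using coset_eq[OF rep_TG[OF v(1)]] ev_rep[OF v(1)] by simp
    then show "C \<in> (\<lambda>c. TN #>\<^bsub>TG\<^esub> c) ` carrier TG" using rep_TG[OF v(1)] by blast
  next
    fix C assume "C \<in> (\<lambda>c. TN #>\<^bsub>TG\<^esub> c) ` carrier TG"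
    then obtain c where c: "c \<in> carrier TG" "C = TN #>\<^bsub>TG\<^esub> c" by auto
    then show "C \<in> Cl ` tfam" using coset_eq[OF c(1)] ev_tfam[OF c(1)] by blast
  qed
qed

lemma Cl_add:
  assumes v: "v \<in> tfam" "v' \<in> tfam"
  shows "Cl v \<oplus>\<^bsub>tensor_module d X M\<^esub> Cl v' = Cl (\<lambda>b. v b + v' b)"
proof -
  have "Cl v \<oplus>\<^bsub>tensor_module d X M\<^esub> Cl v' = (\<Union>c\<in>Cl v. \<Union>c'\<in>Cl v'. {c + c'})"
    by (simp add: tensor_module_def set_mult_def)
  also have "\<dots> = Cl (\<lambda>b. v b + v' b)"
  proof (intro equalityI subsetI)
    fix c assume "c \<in> (\<Union>c\<in>Cl v. \<Union>c'\<in>Cl v'. {c + c'})"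
    then obtain a b where "a \<in> Cl v" "b \<in> Cl v'" "c = a + b" by auto
    then show "c \<in> Cl (\<lambda>b. v b + v' b)" by (auto simp: Cl_def ev_add TG_add)
  next
    fix c assume "c \<in> Cl (\<lambda>b. v b + v' b)"
    then have c: "c \<in> carrier TG" "\<And>b. ev c b = v b + v' b" by (auto simp: Cl_def fun_eq_iff plus_fun_apply)
    have r: "rep v \<in> carrier TG" "ev (rep v) = v" using rep_in_Cl[OF v(1)] by (auto simp: Cl_def)
    have "c - rep v \<in> Cl v'" using TG_diff[OF c(1) r(1)] by (auto simp: Cl_def fun_eq_iff[of _ v'] ev_diff c(2) r(2))
    moreover have "c = rep v + (c - rep v)" by simp
    ultimately show "c \<in> (\<Union>c\<in>Cl v. \<Union>c'\<in>Cl v'. {c + c'})" using rep_in_Cl[OF v(1)] by blast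
  qed
  finally show ?thesis .
qed

text \<open>\<open>H\<close> is the coordinate description of one degree part of the module factor.
  Formal sums with second entries in that part evaluate into \<open>H\<close>, because
  \<open>H\<close> is closed under real combinations; conversely the normal form of a family in
  \<open>H\<close> uses only such entries.\<close>

lemma Cl_gr:
  assumes H: "gr M (e - d) = h ` H" "H \<subseteq> A" "0 \<in> H" "\<And>f f'. f \<in> H \<Longrightarrow> f' \<in> H \<Longrightarrow> f + f' \<in> H"
    "\<And>r f. f \<in> H \<Longrightarrow> smul (const_poly r) f \<in> H"
  shows "gr (tensor_module d X M) e = Cl ` {v \<in> tfam. \<forall>b\<in>T. v b \<in> H}"
proof -
  have Hs: "sum k S \<in> H" if "\<And>i. i \<in> S \<Longrightarrow> k i \<in> H" for k and S :: "('w \<times> 'm) set"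
    using that by (induction S rule: infinite_finite_induct) (auto simp: H)
  have grM: "gr M (e - d) \<subseteq> carrier M" using H(1,2) h_in by auto
  have ho: "hinv m \<in> H" if "m \<in> gr M (e - d)" for m using that H(1,2) hinv(3) by auto
  have cf: "carrier (free_Abelian_group S) = {c. Poly_Mapping.keys c \<subseteq> S}" for S :: "('w \<times> 'm) set" by auto
  have "gr (tensor_module d X M) e
    = (\<lambda>c. TN #>\<^bsub>TG\<^esub> c) ` {c. Poly_Mapping.keys c \<subseteq> carrier X \<times> gr M (e - d)}"
    by (simp add: tensor_module_def cf)
  also have "\<dots> = Cl ` {v \<in> tfam. \<forall>b\<in>T. v b \<in> H}"
  proof (intro equalityI subsetI)
    fix C assume "C \<in> (\<lambda>c. TN #>\<^bsub>TG\<^esub> c) ` {c. Poly_Mapping.keys c \<subseteq> carrier X \<times> gr M (e - d)}"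
    then obtain c where c: "Poly_Mapping.keys c \<subseteq> carrier X \<times> gr M (e - d)" "C = TN #>\<^bsub>TG\<^esub> c" by auto
    have cT: "c \<in> carrier TG" using c(1) grM by (auto simp: carrier_TG)
    have "ev c b \<in> H" for b
      unfolding ev_def by (rule Hs, rule H(5), rule ho) (use c(1) in auto)
    then show "C \<in> Cl ` {v \<in> tfam. \<forall>b\<in>T. v b \<in> H}" using coset_eq[OF cT] ev_tfam[OF cT] c(2) by auto
  next
    fix C assume "C \<in> Cl ` {v \<in> tfam. \<forall>b\<in>T. v b \<in> H}"
    then obtain v where v: "v \<in> tfam" "\<forall>b\<in>T. v b \<in> H" "C = Cl v" by auto
    have "Poly_Mapping.keys (rep v) \<subseteq> (\<Union>b\<in>T. {(g (unit_coord b), h (v b))})"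
      unfolding rep_def using keys_sum[of "\<lambda>b. frag_of (g (unit_coord b), h (v b))" T] by (simp add: keys_frag_of)
    also have "\<dots> \<subseteq> carrier X \<times> gr M (e - d)" using v(2) g_in[OF unit_coord_Z] H(1) by auto
    finally have "Poly_Mapping.keys (rep v) \<subseteq> carrier X \<times> gr M (e - d)" .
    moreover have "C = TN #>\<^bsub>TG\<^esub> rep v" using coset_eq[OF rep_TG[OF v(1)]] ev_rep[OF v(1)] v(3) by simp
    ultimately show "C \<in> (\<lambda>c. TN #>\<^bsub>TG\<^esub> c) ` {c. Poly_Mapping.keys c \<subseteq> carrier X \<times> gr M (e - d)}" by blast
  qed
  finally show ?thesis .
qed

end

text \<open>The map induced on formal sums intertwines the two evaluations, so all members of a
  fibre go to the same coset and the union defining \<open>tensor_map\<close> is that coset. Scalar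
  multiplication and restriction of tensor sheaves are both instances.\<close>

lemma tensor_map_Cl:
  assumes 1: "tensor_frame X T g M A h" and 2: "tensor_frame X T g N A' h'"
    and \<psi>: "\<And>f. f \<in> A \<Longrightarrow> \<psi> f \<in> A'" "\<And>f. f \<in> A \<Longrightarrow> \<phi> (h f) = h' (\<psi> f)"
      "\<And>f f'. f \<in> A \<Longrightarrow> f' \<in> A \<Longrightarrow> \<psi> (f + f') = \<psi> f + \<psi> f'"
      "\<And>r f. f \<in> A \<Longrightarrow> \<psi> (smul (const_poly r) f) = smul (const_poly r) (\<psi> f)"
    and v: "v \<in> tensor_frame.tfam T A"
  shows "tensor_map X N \<phi> (tensor_frame.Cl X T g M A h v) = tensor_frame.Cl X T g N A' h' (\<lambda>b. \<psi> (v b))"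
proof -
  interpret M: tensor_frame X T g M A h by fact
  interpret N: tensor_frame X T g N A' h' by fact
  let ?E = "frag_extend (\<lambda>(w, m). frag_of (w, \<phi> m))"
  have \<psi>0: "\<psi> 0 = 0" using \<psi>(4)[OF M.A_0, of 0] by simp
  have \<psi>d: "\<psi> (f - f') = \<psi> f - \<psi> f'" if "f \<in> A" "f' \<in> A" for f f'
    using \<psi>(3)[OF M.A_diff[OF that] that(2)] by simp
  have E: "?E c \<in> carrier N.TG \<and> (\<forall>b. N.ev (?E c) b = \<psi> (M.ev c b)) \<and> c \<in> carrier M.TG"
    if c: "c \<in> carrier M.TG" for c
    using c[unfolded M.carrier_TG]
  proof (induction rule: frag_induction)
    case zero
    then show ?case by (simp add: N.carrier_TG M.carrier_TG N.ev_zero M.ev_zero \<psi>0)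
  next
    case (one k)
    obtain w m where k: "k = (w, m)" "w \<in> carrier X" "m \<in> carrier M" using one by auto
    have "\<phi> m = h' (\<psi> (M.hinv m))" using \<psi>(2)[OF M.hinv(1)[OF k(3)]] M.hinv(2)[OF k(3)] by simp
    then have "\<phi> m \<in> carrier N" "N.hinv (\<phi> m) = \<psi> (M.hinv m)"
      using N.h_in N.hinv(3) \<psi>(1)[OF M.hinv(1)[OF k(3)]] by simp_all
    then show ?case
      using k by (simp add: N.ev_frag_of M.ev_frag_of N.TG_frag M.TG_frag \<psi>(4)[OF M.hinv(1)]
          N.coord_def M.coord_def)
  next
    case (diff a b)
    then show ?case
      by (simp add: frag_extend_diff N.TG_diff M.TG_diff N.ev_diff M.ev_diff \<psi>d M.ev_A)
  qed
  have "tensor_map X N \<phi> (M.Cl v) = (\<Union>c\<in>M.Cl v. N.TN #>\<^bsub>N.TG\<^esub> ?E c)"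
    by (simp add: tensor_map_def)
  also have "\<dots> = N.Cl (\<lambda>b. \<psi> (v b))"
  proof -
    have "N.TN #>\<^bsub>N.TG\<^esub> ?E c = N.Cl (\<lambda>b. \<psi> (v b))" if "c \<in> M.Cl v" for c
    proof -
      have c: "c \<in> carrier M.TG" "M.ev c = v" using that by (auto simp: M.Cl_def)
      have "N.ev (?E c) = (\<lambda>b. \<psi> (v b))" using E[OF c(1)] c(2) by (simp add: fun_eq_iff[of "N.ev (?E c)"])
      then show ?thesis using N.coset_eq[of "?E c"] E[OF c(1)] by simp
    qed
    then show ?thesis using M.rep_in_Cl[OF v] by (auto simp del: UN_simps)
  qed
  finally show ?thesis .
qed

subsection \<open>The quotient by the irrelevant part\<close>

text \<open>The coset of the irrelevant part that is determined by the constant terms of the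
  coordinates.\<close>

definition const_class :: "(real ^ 'i::finite) set \<Rightarrow> 'b set \<Rightarrow> (('b \<Rightarrow> 'i mpoly) \<Rightarrow> 'm) \<Rightarrow> ('b \<Rightarrow> real) \<Rightarrow> 'm set" where
  "const_class W B h c = h ` {f \<in> free_mod W B. \<forall>b. const_term (f b) = c b}"

text \<open>Coordinate vectors without constant terms form a subgroup containing the generators w m.
  Conversely, for p in \<open>Sym W\<close> the element p minus its constant term maps the module
  into the irrelevant part, by induction on the construction of p.\<close>

lemma irrelevant_part_frame:
  assumes M: "Module.module (Sym_ring W) M" and fr: "frame W M B dg h"
  shows "irrelevant_part W M = const_class W B h (\<lambda>_. 0)"
proof -
  interpret Module.module "Sym_ring W" M by fact
  note fD = frameD[OF fr]
  let ?N = "const_class W B h (\<lambda>_. 0)"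
  let ?G = "{linear_form w \<odot>\<^bsub>M\<^esub> m | w m. w \<in> W \<and> m \<in> carrier M}"
  have sub: "subgroup ?N (add_monoid M)"
  proof (rule subgroup.intro)
    show "?N \<subseteq> carrier (add_monoid M)" using fD(7) by (auto simp: const_class_def)
    show "\<one>\<^bsub>add_monoid M\<^esub> \<in> ?N"
      unfolding const_class_def using fD(3) by (intro image_eqI[of _ _ 0]) (auto simp: free_mod_closed zero_fun_apply)
    fix x assume "x \<in> ?N"
    then obtain f where f: "f \<in> free_mod W B" "\<forall>b. const_term (f b) = 0" "x = h f" by (auto simp: const_class_def)
    {
      fix y assume "y \<in> ?N"
      then obtain f' where f': "f' \<in> free_mod W B" "\<forall>b. const_term (f' b) = 0" "y = h f'" by (auto simp: const_class_def)
      have "x \<otimes>\<^bsub>add_monoid M\<^esub> y = h (f + f')" using fD(4)[OF f(1) f'(1)] f(3) f'(3) by simp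
      then show "x \<otimes>\<^bsub>add_monoid M\<^esub> y \<in> ?N"
        unfolding const_class_def using f f'
        by (intro image_eqI[of _ _ "f + f'"]) (auto simp: free_mod_closed plus_fun_apply lookup_add)
    }
    have nf: "0 - f \<in> free_mod W B" using free_mod_closed(3)[OF free_mod_closed(1) f(1)] .
    have "h (0 - f) \<oplus>\<^bsub>M\<^esub> x = \<zero>\<^bsub>M\<^esub>" using fD(4)[OF nf f(1)] f(3) fD(3) by simp
    then have "\<ominus>\<^bsub>M\<^esub> x = h (0 - f)" using fD(7)[OF nf] fD(7)[OF f(1)] f(3) by (intro M.minus_equality) simp_all
    then have "inv\<^bsub>add_monoid M\<^esub> x = h (0 - f)" by (simp add: a_inv_def)
    then show "inv\<^bsub>add_monoid M\<^esub> x \<in> ?N"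
      unfolding const_class_def using nf f(2)
      by (intro image_eqI[of _ _ "0 - f"]) (auto simp: minus_apply zero_fun_apply lookup_minus)
  qed
  have gens: "?G \<subseteq> ?N"
  proof
    fix x assume "x \<in> ?G"
    then obtain w m where w: "w \<in> W" "m \<in> carrier M" "x = linear_form w \<odot>\<^bsub>M\<^esub> m" by auto
    obtain f where f: "f \<in> free_mod W B" "m = h f" using w(2) fD(8) by auto
    have "x = h (smul (linear_form w) f)" using fD(5)[OF Sym_linear[OF w(1)] f(1)] w(3) f(2) by simp
    moreover have "const_term (smul (linear_form w) f b) = 0" for b
      using const_term_homog[OF homog_linear_form[of w]] by (simp add: smul_apply const_term_mult)
    ultimately show "x \<in> ?N"
      unfolding const_class_def using free_mod_closed(4)[OF Sym_linear[OF w(1)] f(1)] by auto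
  qed
  have le: "irrelevant_part W M \<subseteq> ?N"
    unfolding irrelevant_part_def by (rule group.generate_subgroup_incl[OF M.add.is_group gens sub])
  have irr0: "h 0 \<in> irrelevant_part W M"
    using generate.one[of "add_monoid M" ?G] fD(3) by (simp add: irrelevant_part_def)
  have irr_add: "h (f + f') \<in> irrelevant_part W M"
    if "f \<in> free_mod W B" "f' \<in> free_mod W B" "h f \<in> irrelevant_part W M" "h f' \<in> irrelevant_part W M" for f f'
    using generate.eng[of "h f" "add_monoid M" ?G "h f'"] that fD(4)[OF that(1,2)] by (simp add: irrelevant_part_def)
  have ideal: "h (smul (p - const_poly (const_term p)) f) \<in> irrelevant_part W M" if "p \<in> Sym W" "f \<in> free_mod W B" for p f
    using that
  proof (induction arbitrary: f)
    case (Sym_const r)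
    then show ?case using irr0 by simp
  next
    case (Sym_linear w)
    have "const_term (linear_form w) = 0" using const_term_homog[OF homog_linear_form[of w]] by simp
    then have "h (smul (linear_form w - const_poly (const_term (linear_form w))) f) = linear_form w \<odot>\<^bsub>M\<^esub> h f"
      using fD(5)[OF Sym.Sym_linear[OF Sym_linear(1)] Sym_linear(2)] by simp
    moreover have "linear_form w \<odot>\<^bsub>M\<^esub> h f \<in> ?G" using Sym_linear fD(7) by blast
    ultimately show ?case using generate.incl[of _ ?G "add_monoid M"] by (simp add: irrelevant_part_def)
  next
    case (Sym_add p q)
    have "smul (p + q - const_poly (const_term (p + q))) f
      = smul (p - const_poly (const_term p)) f + smul (q - const_poly (const_term q)) f"
      by (simp add: fun_eq_iff fun_apply lookup_add const_poly_add algebra_simps)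
    then show ?case
      using irr_add[OF _ _ Sym_add.IH(1) Sym_add.IH(2)] Sym_add
      by (simp add: free_mod_closed Sym_diff Sym_const)
  next
    case (Sym_mult p q)
    \<comment> \<open>With p0 and q0 the constant terms, p q - p0 q0 = (p - p0) q + (q - q0) p0, and
      the right-hand factors are absorbed into f.\<close>
    have "smul (p * q - const_poly (const_term (p * q))) f
      = smul (p - const_poly (const_term p)) (smul q f) + smul (q - const_poly (const_term q)) (smul (const_poly (const_term p)) f)"
      by (simp add: fun_eq_iff fun_apply const_term_mult const_poly_mult algebra_simps)
    then show ?case
      using irr_add[OF _ _ Sym_mult.IH(1)[of "smul q f"] Sym_mult.IH(2)[of "smul (const_poly (const_term p)) f"]] Sym_mult
      by (simp only: free_mod_closed Sym_diff Sym_const Sym.Sym_mult)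
  qed
  have ge: "?N \<subseteq> irrelevant_part W M"
  proof
    fix x assume "x \<in> ?N"
    then obtain f where f: "f \<in> free_mod W B" "\<forall>b. const_term (f b) = 0" "x = h f" by (auto simp: const_class_def)
    have "h (\<Sum>b\<in>S. smul (f b) (unitv b)) \<in> irrelevant_part W M" if "finite S" "S \<subseteq> B" for S
      using that
    proof (induction S rule: finite_induct)
      case (insert b S)
      have u: "unitv b \<in> free_mod W B" using insert by (intro free_mod_closed(6)) simp
      have "h (smul (f b - const_poly (const_term (f b))) (unitv b)) \<in> irrelevant_part W M"
        by (rule ideal[OF free_mod_Sym[OF f(1)] u])
      then have "h (smul (f b) (unitv b)) \<in> irrelevant_part W M" using f(2) by simp
      moreover have "(\<Sum>b\<in>S. smul (f b) (unitv b)) \<in> free_mod W B"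
        using insert by (intro free_mod_sum free_mod_closed(4)[OF free_mod_Sym[OF f(1)]] free_mod_closed(6)) auto
      ultimately show ?case
        using insert irr_add[OF free_mod_closed(4)[OF free_mod_Sym[OF f(1)] u]] by simp
    qed (simp add: irr0)
    from this[OF fD(1) order_refl] show "x \<in> irrelevant_part W M"
      using free_mod_expand[OF fD(1) f(1)] f(3) by simp
  qed
  show ?thesis using le ge by blast
qed

lemma coset_frame:
  assumes M: "Module.module (Sym_ring W) M" and fr: "frame W M B dg h" and f: "f \<in> free_mod W B"
  shows "irrelevant_part W M +>\<^bsub>M\<^esub> h f = const_class W B h (\<lambda>b. const_term (f b))"
proof -
  note fD = frameD[OF fr]
  show ?thesis
    unfolding irrelevant_part_frame[OF M fr] a_r_coset_def'
  proof (intro equalityI subsetI)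
    fix x assume "x \<in> (\<Union>k\<in>const_class W B h (\<lambda>_. 0). {k \<oplus>\<^bsub>M\<^esub> h f})"
    then obtain k where k: "k \<in> free_mod W B" "\<forall>b. const_term (k b) = 0" "x = h k \<oplus>\<^bsub>M\<^esub> h f" by (auto simp: const_class_def)
    then have "x = h (k + f)" using fD(4)[OF k(1) f] by simp
    then show "x \<in> const_class W B h (\<lambda>b. const_term (f b))"
      unfolding const_class_def using k f
      by (intro image_eqI[of _ _ "k + f"]) (auto simp: free_mod_closed plus_fun_apply lookup_add)
  next
    fix x assume "x \<in> const_class W B h (\<lambda>b. const_term (f b))"
    then obtain k where k: "k \<in> free_mod W B" "\<forall>b. const_term (k b) = const_term (f b)" "x = h k" by (auto simp: const_class_def)
    have d: "k - f \<in> free_mod W B" using k f by (simp add: free_mod_closed)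
    have "x = h (k - f) \<oplus>\<^bsub>M\<^esub> h f" using fD(4)[OF d f] k(3) by simp
    moreover have "h (k - f) \<in> const_class W B h (\<lambda>_. 0)"
      unfolding const_class_def using d k(2) by (intro image_eqI[of _ _ "k - f"]) (auto simp: minus_apply lookup_minus)
    ultimately show "x \<in> (\<Union>k\<in>const_class W B h (\<lambda>_. 0). {k \<oplus>\<^bsub>M\<^esub> h f})" by blast
  qed
qed

lemma const_class_rep:
  "(\<And>b. b \<notin> B \<Longrightarrow> c b = 0) \<Longrightarrow> (\<lambda>b. const_poly (c b)) \<in> free_mod W B"
  by (simp add: free_mod_def Sym_const)

lemma const_term_fhom: "fhom dg d f \<Longrightarrow> dg b \<noteq> d \<Longrightarrow> const_term (f b) = 0"
  by (rule const_term_homog[of "d - dg b"]) (simp_all add: fhom_def)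

text \<open>A coset is determined by constant terms, and a homogeneous element of degree d can have
  nonzero constant terms only at basis elements of degree d. Each such choice is realised by a
  constant coordinate vector.\<close>

lemma gr_bar_frame:
  assumes M: "Module.module (Sym_ring W) M" and fr: "frame W M B dg h"
  shows "gr (bar W M) d = const_class W B h ` {c. \<forall>b. b \<notin> {b \<in> B. dg b = d} \<longrightarrow> c b = 0}"
proof -
  note fD = frameD[OF fr]
  have "gr (bar W M) d = (\<lambda>m. irrelevant_part W M +>\<^bsub>M\<^esub> m) ` gr M d"
    by (simp add: bar_def quotient_module_def)
  also have "\<dots> = (\<lambda>f. const_class W B h (\<lambda>b. const_term (f b))) ` {f \<in> free_mod W B. fhom dg d f}"
    unfolding fD(6) image_image by (rule image_cong) (auto simp: coset_frame[OF M fr])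
  also have "\<dots> = const_class W B h ` {c. \<forall>b. b \<notin> {b \<in> B. dg b = d} \<longrightarrow> c b = 0}"
  proof (intro equalityI subsetI)
    fix C assume "C \<in> (\<lambda>f. const_class W B h (\<lambda>b. const_term (f b))) ` {f \<in> free_mod W B. fhom dg d f}"
    then obtain f where f: "f \<in> free_mod W B" "fhom dg d f" "C = const_class W B h (\<lambda>b. const_term (f b))" by auto
    have "const_term (f b) = 0" if "b \<notin> {b \<in> B. dg b = d}" for b
      using that f(1) const_term_fhom[OF f(2), of b] by (cases "b \<in> B") (auto simp: free_mod_def)
    then show "C \<in> const_class W B h ` {c. \<forall>b. b \<notin> {b \<in> B. dg b = d} \<longrightarrow> c b = 0}" using f(3) by blast
  next
    fix C assume "C \<in> const_class W B h ` {c. \<forall>b. b \<notin> {b \<in> B. dg b = d} \<longrightarrow> c b = 0}"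
    then obtain c where c: "\<And>b. b \<notin> {b \<in> B. dg b = d} \<Longrightarrow> c b = 0" "C = const_class W B h c" by auto
    have "(\<lambda>b. const_poly (c b)) \<in> free_mod W B" using c(1) by (intro const_class_rep) auto
    moreover have "homog (d - dg b) (const_poly (c b))" for b
      using c(1)[of b] by (cases "b \<in> {b \<in> B. dg b = d}") auto
    ultimately show "C \<in> (\<lambda>f. const_class W B h (\<lambda>b. const_term (f b))) ` {f \<in> free_mod W B. fhom dg d f}"
      using c(2) by (intro image_eqI[of _ _ "\<lambda>b. const_poly (c b)"]) (auto simp: fhom_def)
  qed
  finally show ?thesis .
qed

lemma const_class_inj:
  assumes fr: "frame W M B dg h" and c: "\<And>b. b \<notin> B \<Longrightarrow> c b = 0" and eq: "const_class W B h c = const_class W B h c'"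
  shows "c = c'"
proof -
  have r: "(\<lambda>b. const_poly (c b)) \<in> free_mod W B" by (rule const_class_rep[OF c])
  then have "h (\<lambda>b. const_poly (c b)) \<in> const_class W B h c" unfolding const_class_def by auto
  then obtain f where f: "f \<in> free_mod W B" "\<forall>b. const_term (f b) = c' b" "h (\<lambda>b. const_poly (c b)) = h f"
    unfolding eq by (auto simp: const_class_def)
  have "f = (\<lambda>b. const_poly (c b))" using frameD(9)[OF fr r f(1)] f(3) by simp
  then show ?thesis using f(2) by auto
qed

lemma vframe_degree_space:
  assumes M: "Module.module (Sym_ring W) M" and fr: "frame W M B dg h"
  shows "vframe (degree_space (bar W M) d) {b \<in> B. dg b = d} (const_class W B h)"
proof -
  note fD = frameD[OF fr]
  let ?T = "{b \<in> B. dg b = d}"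
  have Z: "(\<lambda>b. const_poly (c b)) \<in> free_mod W B" if "\<forall>b. b \<notin> ?T \<longrightarrow> c b = 0" for c
    using that by (intro const_class_rep) auto
  show ?thesis
    unfolding vframe_def
  proof (intro conjI allI impI)
    show "finite ?T" using fD(1) by simp
    have "inj_on (const_class W B h) {c. \<forall>b. b \<notin> ?T \<longrightarrow> c b = 0}"
      by (rule inj_onI) (auto intro: const_class_inj[OF fr])
    then show "bij_betw (const_class W B h) {c. \<forall>b. b \<notin> ?T \<longrightarrow> c b = 0} (carrier (degree_space (bar W M) d))"
      by (simp add: bij_betw_def degree_space_def gr_bar_frame[OF M fr])
  next
    fix c c' :: "_ \<Rightarrow> real" assume c: "\<forall>b. b \<notin> ?T \<longrightarrow> c b = 0" and c': "\<forall>b. b \<notin> ?T \<longrightarrow> c' b = 0"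
    have "const_class W B h c \<oplus>\<^bsub>degree_space (bar W M) d\<^esub> const_class W B h c'
      = (\<Union>x\<in>const_class W B h c. \<Union>y\<in>const_class W B h c'. {x \<oplus>\<^bsub>M\<^esub> y})"
      by (simp add: degree_space_def bar_def quotient_module_def set_add_defs)
    also have "\<dots> = const_class W B h (\<lambda>b. c b + c' b)"
    proof (intro equalityI subsetI)
      fix z assume "z \<in> (\<Union>x\<in>const_class W B h c. \<Union>y\<in>const_class W B h c'. {x \<oplus>\<^bsub>M\<^esub> y})"
      then obtain f f' where f: "f \<in> free_mod W B" "\<forall>b. const_term (f b) = c b" "f' \<in> free_mod W B"
        "\<forall>b. const_term (f' b) = c' b" "z = h f \<oplus>\<^bsub>M\<^esub> h f'" by (auto simp: const_class_def)
      then have "z = h (f + f')" using fD(4)[OF f(1,3)] by simp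
      then show "z \<in> const_class W B h (\<lambda>b. c b + c' b)"
        unfolding const_class_def using f
        by (intro image_eqI[of _ _ "f + f'"]) (auto simp: free_mod_closed plus_fun_apply lookup_add)
    next
      fix z assume "z \<in> const_class W B h (\<lambda>b. c b + c' b)"
      then obtain f where f: "f \<in> free_mod W B" "\<forall>b. const_term (f b) = c b + c' b" "z = h f" by (auto simp: const_class_def)
      let ?k = "\<lambda>b. const_poly (c b)"
      have k: "?k \<in> free_mod W B" "f - ?k \<in> free_mod W B" using Z[OF c] f(1) by (auto intro: free_mod_closed)
      have "z = h ?k \<oplus>\<^bsub>M\<^esub> h (f - ?k)" using fD(4)[OF k] f(3) by simp
      moreover have "h ?k \<in> const_class W B h c" unfolding const_class_def using k(1) by auto
      moreover have "h (f - ?k) \<in> const_class W B h c'"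
        unfolding const_class_def using k(2) f(2) by (intro image_eqI[of _ _ "f - ?k"]) (auto simp: minus_apply lookup_minus)
      ultimately show "z \<in> (\<Union>x\<in>const_class W B h c. \<Union>y\<in>const_class W B h c'. {x \<oplus>\<^bsub>M\<^esub> y})" by blast
    qed
    finally show "const_class W B h (\<lambda>b. c b + c' b)
      = const_class W B h c \<oplus>\<^bsub>degree_space (bar W M) d\<^esub> const_class W B h c'" by simp
  next
    fix r and c :: "_ \<Rightarrow> real" assume c: "\<forall>b. b \<notin> ?T \<longrightarrow> c b = 0"
    have "irrelevant_part W M +>\<^bsub>M\<^esub> (const_poly r \<odot>\<^bsub>M\<^esub> x) = const_class W B h (\<lambda>b. r * c b)"
      if xc: "x \<in> const_class W B h c" for x
    proof -
      obtain f where f: "f \<in> free_mod W B" "\<forall>b. const_term (f b) = c b" "x = h f"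
        using xc by (auto simp: const_class_def)
      have "const_poly r \<odot>\<^bsub>M\<^esub> x = h (smul (const_poly r) f)" using fD(5)[OF Sym_const f(1)] f(3) by simp
      then show ?thesis
        using coset_frame[OF M fr free_mod_closed(4)[OF Sym_const[of r] f(1)]] f(2)
        by (simp add: smul_apply const_term_mult)
    qed
    moreover have "h (\<lambda>b. const_poly (c b)) \<in> const_class W B h c" unfolding const_class_def using Z[OF c] by auto
    ultimately have "(\<Union>x\<in>const_class W B h c. irrelevant_part W M +>\<^bsub>M\<^esub> (const_poly r \<odot>\<^bsub>M\<^esub> x)) = const_class W B h (\<lambda>b. r * c b)"
      by (auto simp del: UN_simps)
    then show "const_class W B h (\<lambda>b. r * c b) = r \<odot>\<^bsub>degree_space (bar W M) d\<^esub> const_class W B h c"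
      by (simp add: degree_space_def bar_def quotient_module_def)
  qed
qed

lemma frame_aframe: "frame W M B dg h \<Longrightarrow> aframe M (free_mod W B) h"
  unfolding aframe_def using frameD[of W M B dg h]
  by (auto simp: free_mod_closed Sym_const)

lemma frame_ring:
  assumes iso: "graded_iso (Sym_ring W) M (ring_as_module (Sym_ring W)) k"
    and M: "Module.module (Sym_ring W) M" "\<And>d. additive_subgroup (gr M d) M"
  shows "frame W M {e} (\<lambda>_. 0) (\<lambda>f. the_inv_into (carrier M) k (f e))"
proof -
  interpret Module.module "Sym_ring W" M by fact
  let ?i = "the_inv_into (carrier M) k"
  have k: "bij_betw k (carrier M) (Sym W)" "\<And>m n. m \<in> carrier M \<Longrightarrow> n \<in> carrier M \<Longrightarrow> k (m \<oplus>\<^bsub>M\<^esub> n) = k m + k n"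
    "\<And>a m. a \<in> Sym W \<Longrightarrow> m \<in> carrier M \<Longrightarrow> k (a \<odot>\<^bsub>M\<^esub> m) = a * k m" "\<And>d. k ` gr M d = Sym_degree W d"
    using iso by (simp_all add: graded_iso_def ring_as_module_def)
  have inj: "inj_on k (carrier M)" and im: "k ` carrier M = Sym W" using k(1) by (auto simp: bij_betw_def)
  have i1: "?i p \<in> carrier M" "k (?i p) = p" if "p \<in> Sym W" for p
  proof -
    have p: "p \<in> k ` carrier M" using that im by simp
    show "?i p \<in> carrier M" by (rule the_inv_into_into[OF inj p order_refl])
    show "k (?i p) = p" by (rule f_the_inv_into_f[OF inj p])
  qed
  have i2: "?i (k m) = m" if "m \<in> carrier M" for m by (rule the_inv_into_f_f[OF inj that])
  have fe: "f e \<in> Sym W" if "f \<in> free_mod W {e}" for f by (rule free_mod_Sym[OF that])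
  have single: "(\<lambda>b. if b = e then p else 0) \<in> free_mod W {e}" if "p \<in> Sym W" for p
    using that by (auto simp: free_mod_def)
  have ext: "f = g" if "f \<in> free_mod W {e}" "g \<in> free_mod W {e}" "f e = g e" for f g
  proof
    fix b show "f b = g b" using that by (cases "b = e") (auto simp: free_mod_def)
  qed
  have grM: "gr M d \<subseteq> carrier M" for d using additive_subgroup.a_subset[OF M(2)] .
  show ?thesis
    unfolding frame_def
  proof (intro conjI ballI allI)
    show "bij_betw (\<lambda>f. ?i (f e)) (free_mod W {e}) (carrier M)"
      unfolding bij_betw_def
    proof
      show "inj_on (\<lambda>f. ?i (f e)) (free_mod W {e})"
      proof (rule inj_onI)
        fix f g assume fg: "f \<in> free_mod W {e}" "g \<in> free_mod W {e}" "?i (f e) = ?i (g e)"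
        have "f e = g e" using i1(2)[OF fe[OF fg(1)]] i1(2)[OF fe[OF fg(2)]] unfolding fg(3) by (rule trans[OF sym])
        then show "f = g" by (rule ext[OF fg(1,2)])
      qed
      show "(\<lambda>f. ?i (f e)) ` free_mod W {e} = carrier M"
      proof (intro equalityI subsetI)
        fix m assume m: "m \<in> carrier M"
        then have "k m \<in> Sym W" using im by blast
        then show "m \<in> (\<lambda>f. ?i (f e)) ` free_mod W {e}"
          using i2[OF m] by (intro image_eqI[OF _ single]) auto
      next
        fix m assume "m \<in> (\<lambda>f. ?i (f e)) ` free_mod W {e}"
        then obtain f where "f \<in> free_mod W {e}" "m = ?i (f e)" by blast
        then show "m \<in> carrier M" using i1(1)[OF fe] by simp
      qed
    qed
    have "k \<zero>\<^bsub>M\<^esub> = 0" using k(2)[of "\<zero>\<^bsub>M\<^esub>" "\<zero>\<^bsub>M\<^esub>"] by simp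
    then show "?i (0 e) = \<zero>\<^bsub>M\<^esub>" using i2[of "\<zero>\<^bsub>M\<^esub>"] by (simp add: zero_fun_apply)
    fix f assume f: "f \<in> free_mod W {e}"
    note f1 = i1[OF fe[OF f]]
    show "?i ((f + g) e) = ?i (f e) \<oplus>\<^bsub>M\<^esub> ?i (g e)" if g: "g \<in> free_mod W {e}" for g
    proof -
      note g1 = i1[OF fe[OF g]]
      have "k (?i (f e) \<oplus>\<^bsub>M\<^esub> ?i (g e)) = (f + g) e" using k(2)[OF f1(1) g1(1)] f1(2) g1(2) by (simp add: plus_fun_apply)
      then show ?thesis using i2[of "?i (f e) \<oplus>\<^bsub>M\<^esub> ?i (g e)"] f1(1) g1(1) by simp
    qed
    show "?i (smul a f e) = a \<odot>\<^bsub>M\<^esub> ?i (f e)" if a: "a \<in> Sym W" for a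
    proof -
      have "k (a \<odot>\<^bsub>M\<^esub> ?i (f e)) = smul a f e" using k(3)[OF a f1(1)] f1(2) by (simp add: smul_apply)
      then show ?thesis using i2[of "a \<odot>\<^bsub>M\<^esub> ?i (f e)"] smult_closed[of a "?i (f e)"] f1(1) a by simp
    qed
  next
    fix d
    show "gr M d = (\<lambda>f. ?i (f e)) ` {f \<in> free_mod W {e}. fhom (\<lambda>_. 0) d f}"
    proof (intro equalityI subsetI)
      fix m assume m: "m \<in> gr M d"
      then have p: "k m \<in> Sym_degree W d" and mM: "m \<in> carrier M" using k(4)[of d] grM by auto
      then have kp: "k m \<in> Sym W" "homog d (k m)" by (auto simp: Sym_degree_eq)
      show "m \<in> (\<lambda>f. ?i (f e)) ` {f \<in> free_mod W {e}. fhom (\<lambda>_. 0) d f}"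
        using i2[OF mM] single[OF kp(1)] kp(2)
        by (intro image_eqI[of _ _ "\<lambda>b. if b = e then k m else 0"]) (auto simp: fhom_def)
    next
      fix m assume "m \<in> (\<lambda>f. ?i (f e)) ` {f \<in> free_mod W {e}. fhom (\<lambda>_. 0) d f}"
      then obtain f where f: "f \<in> free_mod W {e}" "fhom (\<lambda>_. 0) d f" "m = ?i (f e)" by auto
      have "f e \<in> Sym_degree W d" using fe[OF f(1)] f(2) by (auto simp: Sym_degree_eq fhom_def)
      then obtain m' where m': "m' \<in> gr M d" "f e = k m'" using k(4)[of d] by blast
      have "m = m'" using f(3) m'(2) i2[OF subsetD[OF grM m'(1)]] by simp
      with m'(1) show "m \<in> gr M d" by simp
    qed
  qed simp
qed

section \<open>Decomposition of sheaves of graded modules\<close>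

text \<open>The conditions on restriction maps are separated from those on stalks, since for the
  push-forward the module structure of the stalks comes from frames.\<close>

definition sheaf_maps :: "'x::order set \<Rightarrow> ('x, 'a) ring_sheaf \<Rightarrow> ('x, 'a, 'm) module_sheaf \<Rightarrow> bool" where
  "sheaf_maps P A M \<longleftrightarrow>
     (\<forall>x\<in>P. \<forall>y\<in>P. y \<le> x \<longrightarrow>
        res M x y \<in> carrier (stalk M x) \<rightarrow> carrier (stalk M y) \<and>
        (\<forall>m\<in>carrier (stalk M x). \<forall>n\<in>carrier (stalk M x).
           res M x y (m \<oplus>\<^bsub>stalk M x\<^esub> n) = res M x y m \<oplus>\<^bsub>stalk M y\<^esub> res M x y n) \<and>
        (\<forall>a\<in>carrier (rstalk A x). \<forall>m\<in>carrier (stalk M x).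
           res M x y (a \<odot>\<^bsub>stalk M x\<^esub> m) = rres A x y a \<odot>\<^bsub>stalk M y\<^esub> res M x y m) \<and>
        (\<forall>d. res M x y ` gr (stalk M x) d \<subseteq> gr (stalk M y) d)) \<and>
     (\<forall>x\<in>P. \<forall>m\<in>carrier (stalk M x). res M x x m = m) \<and>
     (\<forall>x\<in>P. \<forall>y\<in>P. \<forall>z\<in>P. z \<le> y \<longrightarrow> y \<le> x \<longrightarrow>
        (\<forall>m\<in>carrier (stalk M x). res M y z (res M x y m) = res M x z m))"

lemma sheaf_of_modules_iff:
  "sheaf_of_modules P A M \<longleftrightarrow>
     (\<forall>x\<in>P. graded_module (rstalk A x) (stalk M x) \<and> finitely_generated (rstalk A x) (stalk M x)) \<and> sheaf_maps P A M"
  unfolding sheaf_of_modules_def sheaf_maps_def by (rule refl)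

lemma arr_sheaf_simps [simp]:
  "rstalk (arr_sheaf V) x = Sym_ring (local_space V x)" "rres (arr_sheaf V) x y = trunc (Pow y)"
  by (simp_all add: arr_sheaf_def poly_proj_eq_trunc)

definition framed_res where
  "framed_res V M B h x y f = unframe (local_space V y) (B y) (h y) (res M x y (h x f))"

section \<open>Sheaves whose stalks carry frames\<close>

locale sheaf_frames =
  fixes P :: "'i::finite set set" and V :: "(real ^ 'i) set" and M :: "('i set, 'i mpoly, 'm) module_sheaf"
    and B :: "'i set \<Rightarrow> 'b set" and dg :: "'i set \<Rightarrow> 'b \<Rightarrow> int" and h :: "'i set \<Rightarrow> ('b \<Rightarrow> 'i mpoly) \<Rightarrow> 'm"
  assumes frames: "x \<in> P \<Longrightarrow> frame (local_space V x) (stalk M x) (B x) (dg x) (h x)"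
    and maps: "sheaf_maps P (arr_sheaf V) M" and flabby: "flabby P M"
begin

abbreviation "fM x \<equiv> free_mod (local_space V x) (B x)"
abbreviation "rM \<equiv> framed_res V M B h"

lemma res_maps:
  assumes "x \<in> P" "y \<in> P" "y \<subseteq> x"
  shows "m \<in> carrier (stalk M x) \<Longrightarrow> res M x y m \<in> carrier (stalk M y)"
    and "m \<in> carrier (stalk M x) \<Longrightarrow> n \<in> carrier (stalk M x) \<Longrightarrow>
      res M x y (m \<oplus>\<^bsub>stalk M x\<^esub> n) = res M x y m \<oplus>\<^bsub>stalk M y\<^esub> res M x y n"
    and "a \<in> Sym (local_space V x) \<Longrightarrow> m \<in> carrier (stalk M x) \<Longrightarrow>
      res M x y (a \<odot>\<^bsub>stalk M x\<^esub> m) = trunc (Pow y) a \<odot>\<^bsub>stalk M y\<^esub> res M x y m"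
    and "m \<in> gr (stalk M x) d \<Longrightarrow> res M x y m \<in> gr (stalk M y) d"
proof -
  have A: "res M x y \<in> carrier (stalk M x) \<rightarrow> carrier (stalk M y) \<and>
        (\<forall>m\<in>carrier (stalk M x). \<forall>n\<in>carrier (stalk M x).
           res M x y (m \<oplus>\<^bsub>stalk M x\<^esub> n) = res M x y m \<oplus>\<^bsub>stalk M y\<^esub> res M x y n) \<and>
        (\<forall>a\<in>Sym (local_space V x). \<forall>m\<in>carrier (stalk M x).
           res M x y (a \<odot>\<^bsub>stalk M x\<^esub> m) = trunc (Pow y) a \<odot>\<^bsub>stalk M y\<^esub> res M x y m) \<and>
        (\<forall>d. res M x y ` gr (stalk M x) d \<subseteq> gr (stalk M y) d)"
    using maps assms unfolding sheaf_maps_def by simp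
  show "m \<in> carrier (stalk M x) \<Longrightarrow> res M x y m \<in> carrier (stalk M y)" using A by blast
  show "m \<in> carrier (stalk M x) \<Longrightarrow> n \<in> carrier (stalk M x) \<Longrightarrow>
      res M x y (m \<oplus>\<^bsub>stalk M x\<^esub> n) = res M x y m \<oplus>\<^bsub>stalk M y\<^esub> res M x y n" using A by simp
  show "a \<in> Sym (local_space V x) \<Longrightarrow> m \<in> carrier (stalk M x) \<Longrightarrow>
      res M x y (a \<odot>\<^bsub>stalk M x\<^esub> m) = trunc (Pow y) a \<odot>\<^bsub>stalk M y\<^esub> res M x y m" using A by simp
  show "m \<in> gr (stalk M x) d \<Longrightarrow> res M x y m \<in> gr (stalk M y) d" using A by blast
qed

lemma res_id: "x \<in> P \<Longrightarrow> m \<in> carrier (stalk M x) \<Longrightarrow> res M x x m = m"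
  using maps unfolding sheaf_maps_def by simp

lemma res_comp: "x \<in> P \<Longrightarrow> y \<in> P \<Longrightarrow> z \<in> P \<Longrightarrow> z \<subseteq> y \<Longrightarrow> y \<subseteq> x \<Longrightarrow> m \<in> carrier (stalk M x) \<Longrightarrow>
    res M y z (res M x y m) = res M x z m"
  using maps unfolding sheaf_maps_def by simp

lemma h_in: "x \<in> P \<Longrightarrow> f \<in> fM x \<Longrightarrow> h x f \<in> carrier (stalk M x)"
  by (rule frameD(7)[OF frames])

lemma h_rM:
  assumes "x \<in> P" "y \<in> P" "y \<subseteq> x" "f \<in> fM x"
  shows "h y (rM x y f) = res M x y (h x f)" and "rM x y f \<in> fM y"
  unfolding framed_res_def
  using unframe(1,2)[OF frames[OF assms(2)]] res_maps(1)[OF assms(1-3) h_in[OF assms(1,4)]] by simp_all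

lemma h_eq: "x \<in> P \<Longrightarrow> f \<in> fM x \<Longrightarrow> g \<in> fM x \<Longrightarrow> h x f = h x g \<Longrightarrow> f = g"
  using frameD(9)[OF frames] by simp

lemma h_gr: "x \<in> P \<Longrightarrow> f \<in> fM x \<Longrightarrow> h x f \<in> gr (stalk M x) d \<longleftrightarrow> fhom (dg x) d f"
proof
  assume x: "x \<in> P" "f \<in> fM x" and "h x f \<in> gr (stalk M x) d"
  then obtain g where "g \<in> fM x" "fhom (dg x) d g" "h x f = h x g" using frameD(6)[OF frames[OF x(1)]] by auto
  with h_eq[OF x this(1)] show "fhom (dg x) d f" by simp
next
  assume "x \<in> P" "f \<in> fM x" "fhom (dg x) d f"
  then show "h x f \<in> gr (stalk M x) d" using frameD(6)[OF frames[of x]] by auto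
qed

text \<open>Every law is checked after applying the injective coordinate maps, where it becomes a
  law of \<open>M\<close>. For extension from the boundary of x, the boundary is an open set: a
  section over it extends to all of \<open>P\<close>, and its value at x is used.\<close>

lemma framed: "framed_sheaf P (local_space V) B dg rM"
proof
  fix x y :: "'i set" and a assume "x \<in> P" "y \<in> P" "y \<subseteq> x" "a \<in> Sym (local_space V x)"
  then show "trunc (Pow y) a \<in> Sym (local_space V y)" using Sym_trunc_Pow[of a "local_space V x" y] local_space_proj by metis
next
  fix x assume "x \<in> P" then show "finite (B x)" using frameD(1)[OF frames] by simp
next
  fix x y f assume x: "x \<in> P" "y \<in> P" "y \<subseteq> x" and f: "f \<in> fM x"
  show "rM x y f \<in> fM y" by (rule h_rM(2)[OF x f])
  show "rM x y (f + g) = rM x y f + rM x y g" if g: "g \<in> fM x" for g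
  proof (rule h_eq[OF x(2) h_rM(2)[OF x free_mod_closed(2)[OF f g]] free_mod_closed(2)[OF h_rM(2)[OF x f] h_rM(2)[OF x g]]])
    show "h y (rM x y (f + g)) = h y (rM x y f + rM x y g)"
      unfolding h_rM(1)[OF x free_mod_closed(2)[OF f g]] frameD(4)[OF frames[OF x(2)] h_rM(2)[OF x f] h_rM(2)[OF x g]]
        h_rM(1)[OF x f] h_rM(1)[OF x g] frameD(4)[OF frames[OF x(1)] f g]
      by (rule res_maps(2)[OF x h_in[OF x(1) f] h_in[OF x(1) g]])
  qed
  show "rM x y (smul a f) = smul (trunc (Pow y) a) (rM x y f)" if a: "a \<in> Sym (local_space V x)" for a
  proof -
    have ta: "trunc (Pow y) a \<in> Sym (local_space V y)"
      using Sym_trunc_Pow[OF a, of y] local_space_proj[OF x(3), of V] by simp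
    show ?thesis
    proof (rule h_eq[OF x(2) h_rM(2)[OF x free_mod_closed(4)[OF a f]] free_mod_closed(4)[OF ta h_rM(2)[OF x f]]])
      show "h y (rM x y (smul a f)) = h y (smul (trunc (Pow y) a) (rM x y f))"
        unfolding h_rM(1)[OF x free_mod_closed(4)[OF a f]] frameD(5)[OF frames[OF x(2)] ta h_rM(2)[OF x f]]
          h_rM(1)[OF x f] frameD(5)[OF frames[OF x(1)] a f]
        by (rule res_maps(3)[OF x a h_in[OF x(1) f]])
    qed
  qed
  show "fhom (dg y) d (rM x y f)" if "fhom (dg x) d f" for d
    using res_maps(4)[OF x, of "h x f" d] that h_gr[OF x(1) f] h_gr[OF x(2) h_rM(2)[OF x f]] h_rM(1)[OF x f] by simp
next
  fix x f assume x: "x \<in> P" "f \<in> fM x"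
  show "rM x x f = f"
    using h_rM[OF x(1) x(1) order_refl x(2)] res_id[OF x(1) h_in[OF x]] by (intro h_eq[OF x(1) _ x(2)]) simp_all
next
  fix x y z f assume x: "x \<in> P" "y \<in> P" "z \<in> P" "z \<subseteq> y" "y \<subseteq> x" and f: "f \<in> fM x"
  have zx: "z \<subseteq> x" using x by simp
  note 1 = h_rM[OF x(1,2,5) f]
  note 2 = h_rM[OF x(2,3,4) 1(2)]
  note 3 = h_rM[OF x(1,3) zx f]
  show "rM y z (rM x y f) = rM x z f"
    by (rule h_eq[OF x(3) 2(2) 3(2)]) (simp add: 1(1) 2(1) 3(1) res_comp[OF x h_in[OF x(1) f]])
next
  fix x and t :: "'i set \<Rightarrow> 'b \<Rightarrow> 'i mpoly"
  assume x: "x \<in> P" and t: "\<And>y. y \<in> P \<Longrightarrow> y \<subset> x \<Longrightarrow> t y \<in> fM y"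
    and c: "\<And>y z. y \<in> P \<Longrightarrow> z \<in> P \<Longrightarrow> y \<subset> x \<Longrightarrow> z \<subseteq> y \<Longrightarrow> rM y z (t y) = t z"
  let ?U = "{y \<in> P. y \<subset> x}"
  have op: "open_in P ?U" by (auto simp: open_in_def)
  define s where "s = (\<lambda>y\<in>?U. h y (t y))"
  have "res M y z (s y) = s z" if "y \<in> ?U" "z \<in> ?U" "z \<le> y" for y z
    using that h_rM(1)[of y z "t y"] t[of y] c[of y z] by (simp add: s_def)
  moreover have "s \<in> (\<Pi>\<^sub>E y\<in>?U. carrier (stalk M y))" using h_in t by (auto simp: s_def)
  ultimately have sU: "s \<in> sections M ?U" unfolding sections_def by (intro CollectI conjI ballI impI) simp_all
  have "(\<lambda>s. restrict s ?U) ` sections M P = sections M ?U" using flabby op unfolding flabby_def by simp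
  with sU have "s \<in> (\<lambda>s. restrict s ?U) ` sections M P" by simp
  then obtain S where S: "S \<in> sections M P" "restrict S ?U = s" by (elim imageE) simp
  have Sx: "S x \<in> carrier (stalk M x)" and Sr: "\<And>y. y \<in> P \<Longrightarrow> y \<subseteq> x \<Longrightarrow> res M x y (S x) = S y"
    using S(1) x by (auto simp: sections_def)
  define f where "f = unframe (local_space V x) (B x) (h x) (S x)"
  have f: "f \<in> fM x" "h x f = S x" using unframe[OF frames[OF x]] Sx by (simp_all add: f_def)
  have "rM x y f = t y" if y: "y \<in> P" "y \<subset> x" for y
  proof (rule h_eq[OF y(1) h_rM(2)[OF x y(1) psubset_imp_subset[OF y(2)] f(1)] t[OF y]])
    have "h y (rM x y f) = S y"
      using h_rM(1)[OF x y(1) psubset_imp_subset[OF y(2)] f(1)] f(2) Sr[OF y(1) psubset_imp_subset[OF y(2)]] by simp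
    also have "\<dots> = s y" using fun_cong[OF S(2), of y] y by simp
    finally show "h y (rM x y f) = h y (t y)" using y by (simp add: s_def)
  qed
  then show "\<exists>f\<in>fM x. \<forall>y\<in>P. y \<subset> x \<longrightarrow> rM x y f = t y" using f(1) by blast
qed

end

text \<open>Inverses are products with -1. The components of an element of \<open>N\<close> stay in
  \<open>N\<close>, so its unique decomposition in \<open>M\<close> is also the one required in the
  submodule.\<close>

lemma graded_submodule_frame:
  assumes gm: "graded_module (Sym_ring W) M" and fr: "frame W M B dg h"
    and N: "N \<subseteq> free_mod W B" "0 \<in> N" "\<And>f g. f \<in> N \<Longrightarrow> g \<in> N \<Longrightarrow> f + g \<in> N"
      "\<And>a f. a \<in> Sym W \<Longrightarrow> f \<in> N \<Longrightarrow> smul a f \<in> N" "\<And>d f. f \<in> N \<Longrightarrow> homcomp dg d f \<in> N"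
  shows "graded_submodule (Sym_ring W) M (h ` N)"
proof -
  have mod: "Module.module (Sym_ring W) M" using gm by (simp add: graded_module_def)
  interpret Module.module "Sym_ring W" M by fact
  note fD = frameD[OF fr]
  let ?I = "induced_module M (h ` N)"
  have NF: "f \<in> free_mod W B" if "f \<in> N" for f using that N(1) by blast
  have sub: "h ` N \<subseteq> carrier M" using fD(7) NF by auto
  have I [simp]: "carrier ?I = h ` N" "\<zero>\<^bsub>?I\<^esub> = \<zero>\<^bsub>M\<^esub>" "\<And>x y. x \<oplus>\<^bsub>?I\<^esub> y = x \<oplus>\<^bsub>M\<^esub> y" "\<And>a x. a \<odot>\<^bsub>?I\<^esub> x = a \<odot>\<^bsub>M\<^esub> x"
    "\<And>d. gr ?I d = gr M d \<inter> h ` N" by (simp_all add: induced_module_def)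
  have zero: "\<zero>\<^bsub>M\<^esub> \<in> h ` N" using N(2) fD(3) by (metis imageI)
  have add: "x \<oplus>\<^bsub>M\<^esub> y \<in> h ` N" if xy: "x \<in> h ` N" "y \<in> h ` N" for x y
  proof -
    obtain f g where fg: "f \<in> N" "g \<in> N" "x = h f" "y = h g" using xy by blast
    then have "x \<oplus>\<^bsub>M\<^esub> y = h (f + g)" using fD(4)[OF NF NF] by simp
    then show ?thesis using N(3)[OF fg(1,2)] by blast
  qed
  have smul: "a \<odot>\<^bsub>M\<^esub> x \<in> h ` N" if ax: "a \<in> Sym W" "x \<in> h ` N" for a x
  proof -
    obtain f where f: "f \<in> N" "x = h f" using ax by blast
    then have "a \<odot>\<^bsub>M\<^esub> x = h (smul a f)" using fD(5)[OF ax(1) NF] by simp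
    then show ?thesis using N(4)[OF ax(1) f(1)] by blast
  qed
  have inv: "\<exists>y\<in>h ` N. y \<oplus>\<^bsub>M\<^esub> x = \<zero>\<^bsub>M\<^esub>" if xN: "x \<in> h ` N" for x
  proof -
    obtain f where f: "f \<in> N" "x = h f" using xN by blast
    have m: "smul (- 1) f \<in> N" by (rule N(4)[OF Sym_uminus[OF Sym_1] f(1)])
    have "smul (- 1) f + f = 0" by (simp add: fun_eq_iff fun_apply)
    then have "h (smul (- 1) f) \<oplus>\<^bsub>M\<^esub> x = \<zero>\<^bsub>M\<^esub>" using fD(4)[OF NF[OF m] NF[OF f(1)]] f(2) fD(3) by simp
    then show ?thesis using m by blast
  qed
  have car: "x \<in> carrier M" if "x \<in> h ` N" for x using that sub by blast
  have abI: "abelian_group ?I"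
  proof (rule abelian_groupI)
    fix x y assume x: "x \<in> carrier ?I" and y: "y \<in> carrier ?I"
    then have x': "x \<in> h ` N" and y': "y \<in> h ` N" by simp_all
    show "x \<oplus>\<^bsub>?I\<^esub> y \<in> carrier ?I" using add[OF x' y'] by simp
    show "x \<oplus>\<^bsub>?I\<^esub> y = y \<oplus>\<^bsub>?I\<^esub> x" using M.a_comm[OF car[OF x'] car[OF y']] by simp
    show "x \<oplus>\<^bsub>?I\<^esub> y \<oplus>\<^bsub>?I\<^esub> z = x \<oplus>\<^bsub>?I\<^esub> (y \<oplus>\<^bsub>?I\<^esub> z)" if z: "z \<in> carrier ?I" for z
    proof -
      have "z \<in> h ` N" using z by simp
      then show ?thesis using M.a_assoc[OF car[OF x'] car[OF y'] car, of z] by simp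
    qed
  next
    fix x assume "x \<in> carrier ?I"
    then have x': "x \<in> h ` N" by simp
    show "\<zero>\<^bsub>?I\<^esub> \<oplus>\<^bsub>?I\<^esub> x = x" using M.l_zero[OF car[OF x']] by simp
    obtain u where "u \<in> h ` N" "u \<oplus>\<^bsub>M\<^esub> x = \<zero>\<^bsub>M\<^esub>" using inv[OF x'] by (elim bexE)
    then show "\<exists>u\<in>carrier ?I. u \<oplus>\<^bsub>?I\<^esub> x = \<zero>\<^bsub>?I\<^esub>" by (intro bexI[of _ u]) simp_all
  next
    show "\<zero>\<^bsub>?I\<^esub> \<in> carrier ?I" using zero by simp
  qed
  have modI: "Module.module (Sym_ring W) ?I"
  proof (rule moduleI[OF cring_Sym_ring abI], unfold I Sym_ring_simps)
    fix a x assume a: "a \<in> Sym W" and x: "x \<in> h ` N"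
    show "a \<odot>\<^bsub>M\<^esub> x \<in> h ` N" by (rule smul[OF a x])
    show "a \<odot>\<^bsub>M\<^esub> (x \<oplus>\<^bsub>M\<^esub> y) = a \<odot>\<^bsub>M\<^esub> x \<oplus>\<^bsub>M\<^esub> a \<odot>\<^bsub>M\<^esub> y" if y: "y \<in> h ` N" for y
      by (rule smult_r_distr[unfolded Sym_ring_simps, OF a car[OF x] car[OF y]])
    fix b assume b: "b \<in> Sym W"
    show "(a + b) \<odot>\<^bsub>M\<^esub> x = a \<odot>\<^bsub>M\<^esub> x \<oplus>\<^bsub>M\<^esub> b \<odot>\<^bsub>M\<^esub> x"
      by (rule smult_l_distr[unfolded Sym_ring_simps, OF a b car[OF x]])
    show "(a * b) \<odot>\<^bsub>M\<^esub> x = a \<odot>\<^bsub>M\<^esub> (b \<odot>\<^bsub>M\<^esub> x)"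
      by (rule smult_assoc1[unfolded Sym_ring_simps, OF a b car[OF x]])
  next
    fix x assume "x \<in> h ` N"
    then show "1 \<odot>\<^bsub>M\<^esub> x = x" by (rule smult_one[unfolded Sym_ring_simps, OF car])
  qed
  have grsub: "additive_subgroup (gr M d) M" for d using gm by (simp add: graded_module_def)
  have finsum: "finsum ?I k A = finsum M k A" if "finite A" "\<And>a. a \<in> A \<Longrightarrow> k a \<in> h ` N" for k and A :: "int set"
  proof -
    interpret I: abelian_group ?I by (rule abI)
    show ?thesis
      using that
    proof (induction A rule: finite_induct)
      case (insert a A)
      then have "k \<in> A \<rightarrow> carrier ?I" "k a \<in> carrier ?I" "k \<in> A \<rightarrow> carrier M" "k a \<in> carrier M" using sub by auto
      then show ?case using insert I.finsum_insert[OF insert(1,2)] M.finsum_insert[OF insert(1,2)] by simp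
    qed (simp add: I.finsum_empty M.finsum_empty)
  qed
  have grI: "additive_subgroup (gr ?I d) ?I" for d
  proof -
    interpret I: abelian_group ?I by (rule abI)
    interpret G: additive_subgroup "gr M d" M by (rule grsub)
    have "subgroup (gr ?I d) (add_monoid ?I)"
    proof (rule subgroup.intro)
      show "gr ?I d \<subseteq> carrier (add_monoid ?I)" by simp
      show "\<one>\<^bsub>add_monoid ?I\<^esub> \<in> gr ?I d" using G.zero_closed zero by simp
      fix x y assume x: "x \<in> gr ?I d"
      then have x': "x \<in> gr M d" "x \<in> h ` N" by auto
      show "x \<otimes>\<^bsub>add_monoid ?I\<^esub> y \<in> gr ?I d" if "y \<in> gr ?I d" using that x' G.a_closed add by simp
      obtain y where y: "y \<in> h ` N" "y \<oplus>\<^bsub>M\<^esub> x = \<zero>\<^bsub>M\<^esub>" using inv[OF x'(2)] by blast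
      have "\<ominus>\<^bsub>?I\<^esub> x = y" using y x' by (intro I.minus_equality) simp_all
      moreover have "\<ominus>\<^bsub>M\<^esub> x = y" using y x' car by (intro M.minus_equality) simp_all
      moreover have "\<ominus>\<^bsub>M\<^esub> x \<in> gr M d" using G.a_inv_closed[OF x'(1)] .
      ultimately have "\<ominus>\<^bsub>?I\<^esub> x \<in> gr ?I d" using y(1) by simp
      then show "inv\<^bsub>add_monoid ?I\<^esub> x \<in> gr ?I d" unfolding a_inv_def .
    qed
    then show ?thesis by (rule additive_subgroup.intro)
  qed
  have dec: "\<exists>!F. (\<forall>d. F d \<in> gr ?I d) \<and> finite {d. F d \<noteq> \<zero>\<^bsub>?I\<^esub>} \<and> m = (\<Oplus>\<^bsub>?I\<^esub>d\<in>{d. F d \<noteq> \<zero>\<^bsub>?I\<^esub>}. F d)"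
    if m: "m \<in> carrier ?I" for m
  proof -
    obtain f where f: "f \<in> N" "m = h f" using m by auto
    have ex: "\<exists>!F. (\<forall>d. F d \<in> gr M d) \<and> finite {d. F d \<noteq> \<zero>\<^bsub>M\<^esub>} \<and> m = (\<Oplus>\<^bsub>M\<^esub>d\<in>{d. F d \<noteq> \<zero>\<^bsub>M\<^esub>}. F d)"
      using gm car[of m] m unfolding graded_module_def by simp
    define F where "F d = h (homcomp dg d f)" for d
    have FN: "F d \<in> h ` N" for d unfolding F_def using N(5)[OF f(1)] by blast
    have F0: "F d = \<zero>\<^bsub>M\<^esub> \<longleftrightarrow> homcomp dg d f = 0" for d
      using fD(9)[OF free_mod_closed(5)[OF NF[OF f(1)]] free_mod_closed(1)] fD(3) by (simp add: F_def)
    have Fgr: "F d \<in> gr M d" for d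
      unfolding F_def fD(6) by (rule imageI) (simp add: free_mod_closed(5)[OF NF[OF f(1)]])
    have fin: "finite {d. homcomp dg d f \<noteq> 0}" by (rule homcomp_finite[OF fD(1) NF[OF f(1)]])
    have hs: "h (\<Sum>d\<in>D. homcomp dg d f) = (\<Oplus>\<^bsub>M\<^esub>d\<in>D. F d)" if "finite D" for D
      using that
    proof (induction D rule: finite_induct)
      case (insert d D)
      have "h (homcomp dg d f + (\<Sum>d\<in>D. homcomp dg d f)) = F d \<oplus>\<^bsub>M\<^esub> h (\<Sum>d\<in>D. homcomp dg d f)"
        unfolding F_def by (intro fD(4) free_mod_sum free_mod_closed(5) NF f(1))
      moreover have "F \<in> D \<rightarrow> carrier M" "F d \<in> carrier M" using car[OF FN] by auto
      ultimately show ?case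
        by (simp only: sum.insert[OF insert(1,2)] M.finsum_insert[OF insert(1,2)] insert.IH)
    qed (simp only: sum.empty fD(3) M.finsum_empty)
    have Fm: "m = (\<Oplus>\<^bsub>M\<^esub>d\<in>{d. F d \<noteq> \<zero>\<^bsub>M\<^esub>}. F d)"
      using hs[OF fin] sum_homcomp[OF fin order_refl] f(2) by (simp add: F0)
    show ?thesis
    proof (rule ex1I[of _ F])
      show "(\<forall>d. F d \<in> gr ?I d) \<and> finite {d. F d \<noteq> \<zero>\<^bsub>?I\<^esub>} \<and> m = (\<Oplus>\<^bsub>?I\<^esub>d\<in>{d. F d \<noteq> \<zero>\<^bsub>?I\<^esub>}. F d)"
        using Fgr FN fin Fm finsum[of "{d. F d \<noteq> \<zero>\<^bsub>M\<^esub>}" F] by (simp add: F0)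
      fix G assume G: "(\<forall>d. G d \<in> gr ?I d) \<and> finite {d. G d \<noteq> \<zero>\<^bsub>?I\<^esub>} \<and> m = (\<Oplus>\<^bsub>?I\<^esub>d\<in>{d. G d \<noteq> \<zero>\<^bsub>?I\<^esub>}. G d)"
      have 1: "(\<forall>d. G d \<in> gr M d) \<and> finite {d. G d \<noteq> \<zero>\<^bsub>M\<^esub>} \<and> m = (\<Oplus>\<^bsub>M\<^esub>d\<in>{d. G d \<noteq> \<zero>\<^bsub>M\<^esub>}. G d)"
        using G finsum[of "{d. G d \<noteq> \<zero>\<^bsub>M\<^esub>}" G] by simp
      have 2: "(\<forall>d. F d \<in> gr M d) \<and> finite {d. F d \<noteq> \<zero>\<^bsub>M\<^esub>} \<and> m = (\<Oplus>\<^bsub>M\<^esub>d\<in>{d. F d \<noteq> \<zero>\<^bsub>M\<^esub>}. F d)"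
        using Fgr fin Fm by (simp add: F0)
      from ex1_same[OF ex, OF 1 2] show "G = F" .
    qed
  qed
  have gract: "\<forall>d e. \<forall>a\<in>rgr (Sym_ring W) d. \<forall>m\<in>gr ?I e. a \<odot>\<^bsub>?I\<^esub> m \<in> gr ?I (d + e)"
  proof (intro allI ballI)
    fix d e a m assume a: "a \<in> rgr (Sym_ring W) d" and m: "m \<in> gr ?I e"
    have "a \<odot>\<^bsub>M\<^esub> m \<in> gr M (d + e)" using gm a m unfolding graded_module_def by auto
    moreover have "a \<in> Sym W" using a by (simp add: Sym_degree_eq)
    ultimately show "a \<odot>\<^bsub>?I\<^esub> m \<in> gr ?I (d + e)" using smul m by simp
  qed
  show ?thesis
    unfolding graded_submodule_def graded_module_def
    by (intro conjI sub modI gract allI[OF grI] ballI[OF dec])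
qed

text \<open>The coordinate maps turn complementary graded subsheaves in coordinates into
  complementary graded subsheaves of \<open>M\<close>, and detect whether they vanish.\<close>

lemma (in sheaf_frames) framed_indecomposable:
  assumes ind: "indecomposable P (arr_sheaf V) M"
    and gm: "\<And>x. x \<in> P \<Longrightarrow> graded_module (Sym_ring (local_space V x)) (stalk M x)"
  shows "framed_sheaf.framed_indecomposable P (local_space V) B dg rM"
proof -
  interpret F: framed_sheaf P "local_space V" B dg rM by (rule framed)
  have sub: "subsheaf P (arr_sheaf V) M (\<lambda>x. h x ` N x)" if N: "F.framed_sub N" for N
    unfolding subsheaf_def
  proof (intro conjI ballI impI)
    fix x assume x: "x \<in> P"
    have n: "N x \<subseteq> fM x \<and> 0 \<in> N x \<and> (\<forall>f\<in>N x. \<forall>g\<in>N x. f + g \<in> N x) \<and>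
        (\<forall>a\<in>Sym (local_space V x). \<forall>f\<in>N x. smul a f \<in> N x) \<and> (\<forall>d. \<forall>f\<in>N x. homcomp (dg x) d f \<in> N x)"
      using N x unfolding F.framed_sub_def by blast
    show "graded_submodule (rstalk (arr_sheaf V) x) (stalk M x) (h x ` N x)"
      unfolding arr_sheaf_simps
      by (rule graded_submodule_frame[OF gm[OF x] frames[OF x]]) (use n in simp_all)
    fix y assume y: "y \<in> P" "y \<le> x"
    show "res M x y ` h x ` N x \<subseteq> h y ` N y"
    proof clarify
      fix f assume f: "f \<in> N x"
      have "rM x y f \<in> N y" using N x y f unfolding F.framed_sub_def by blast
      moreover have "res M x y (h x f) = h y (rM x y f)" using h_rM(1)[OF x y(1)] y(2) n f by auto
      ultimately show "res M x y (h x f) \<in> h y ` N y" by blast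
    qed
  qed
  show ?thesis
    unfolding F.framed_indecomposable_def
  proof (intro allI impI)
    fix N N' assume N: "F.framed_sub N" "F.framed_sub N'"
      and d: "\<forall>x\<in>P. N x \<inter> N' x = {0} \<and> (\<forall>f\<in>fM x. \<exists>k\<in>N x. \<exists>j\<in>N' x. f = k + j)"
    have NF: "N x \<subseteq> fM x" "N' x \<subseteq> fM x" "0 \<in> N x" "0 \<in> N' x" if "x \<in> P" for x
      using N that unfolding F.framed_sub_def by auto
    have "h x ` N x \<inter> h x ` N' x = {\<zero>\<^bsub>stalk M x\<^esub>} \<and> h x ` N x <+>\<^bsub>stalk M x\<^esub> h x ` N' x = carrier (stalk M x)"
      if x: "x \<in> P" for x
    proof
      note fD = frameD[OF frames[OF x]]
      have inj: "inj_on (h x) (fM x)" using fD(2) by (simp add: bij_betw_def)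
      have "h x ` N x \<inter> h x ` N' x = h x ` (N x \<inter> N' x)"
        by (rule inj_on_image_Int[OF inj NF(1,2)[OF x], symmetric])
      then show "h x ` N x \<inter> h x ` N' x = {\<zero>\<^bsub>stalk M x\<^esub>}" using d x fD(3) by simp
      show "h x ` N x <+>\<^bsub>stalk M x\<^esub> h x ` N' x = carrier (stalk M x)"
      proof (intro equalityI subsetI)
        fix m assume "m \<in> h x ` N x <+>\<^bsub>stalk M x\<^esub> h x ` N' x"
        then obtain f g where fg: "f \<in> N x" "g \<in> N' x" "m = h x f \<oplus>\<^bsub>stalk M x\<^esub> h x g" by (auto simp: set_add_defs)
        have f: "f \<in> fM x" and g: "g \<in> fM x" using fg NF(1,2)[OF x] by auto
        show "m \<in> carrier (stalk M x)"
          using fD(4)[OF f g] fD(7)[OF free_mod_closed(2)[OF f g]] fg(3) by simp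
      next
        fix m assume "m \<in> carrier (stalk M x)"
        then obtain f where f: "f \<in> fM x" "m = h x f" using fD(8) by blast
        then obtain k j where kj: "k \<in> N x" "j \<in> N' x" "f = k + j" using d x by meson
        have "m = h x k \<oplus>\<^bsub>stalk M x\<^esub> h x j"
          unfolding f(2) kj(3) by (rule fD(4)[OF subsetD[OF NF(1)[OF x] kj(1)] subsetD[OF NF(2)[OF x] kj(2)]])
        then show "m \<in> h x ` N x <+>\<^bsub>stalk M x\<^esub> h x ` N' x"
          unfolding set_add_defs UN_iff by (intro bexI[OF _ imageI[OF kj(1)]] bexI[OF _ imageI[OF kj(2)]]) simp
      qed
    qed
    then have "(\<forall>x\<in>P. h x ` N x = {\<zero>\<^bsub>stalk M x\<^esub>}) \<or> (\<forall>x\<in>P. h x ` N' x = {\<zero>\<^bsub>stalk M x\<^esub>})"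
      using conjunct2[OF ind[unfolded indecomposable_def], rule_format, OF sub[OF N(1)] sub[OF N(2)]] by simp
    moreover have "Q = {0}" if x: "x \<in> P" "h x ` Q = {\<zero>\<^bsub>stalk M x\<^esub>}" "Q \<subseteq> fM x" "0 \<in> Q" for x Q
    proof -
      have "f = 0" if "f \<in> Q" for f
      proof (rule h_eq[OF x(1)])
        have "h x f \<in> h x ` Q" by (rule imageI[OF that])
        then have "h x f = \<zero>\<^bsub>stalk M x\<^esub>" unfolding x(2) by simp
        then show "h x f = h x 0" using frameD(3)[OF frames[OF x(1)]] by simp
        show "f \<in> fM x" using that x(3) by blast
        show "0 \<in> fM x" by (rule free_mod_closed(1))
      qed
      then show ?thesis using x(4) by blast
    qed
    ultimately show "(\<forall>x\<in>P. N x = {0}) \<or> (\<forall>x\<in>P. N' x = {0})"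
      by (elim disjE) (rule disjI1 disjI2, rule ballI, simp add: NF)+
  qed
qed

text \<open>Away from \<open>F\<close> the frame comes from a homogeneous basis. At \<open>F\<close>
  the isomorphism with the ring is used instead, which fixes the degree of the generator to be 0.
  The labels have the element type of the stalks because bases are sets of elements; e is a label of
  that type prescribed for the generator.\<close>

lemma minimal_extension_sheaf_frames:
  fixes L :: "('i::finite set, 'i mpoly, 'm) module_sheaf" and e :: 'm
  assumes L: "minimal_extension_sheaf P (arr_sheaf V) F L" and F: "F \<in> P"
  shows "\<exists>(B :: 'i set \<Rightarrow> 'm set) dg h. sheaf_frames P V L B dg h \<and> B F = {e} \<and> dg F e = 0 \<and>
     (\<forall>x\<in>P. \<not> F \<subseteq> x \<longrightarrow> B x = {}) \<and> framed_sheaf.framed_indecomposable P (local_space V) B dg (framed_res V L B h)"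
proof -
  have pure: "pure P (arr_sheaf V) L" and ind: "indecomposable P (arr_sheaf V) L"
    and zero: "\<And>x. x \<in> P \<Longrightarrow> \<not> F \<subseteq> x \<Longrightarrow> carrier (stalk L x) = {\<zero>\<^bsub>stalk L x\<^esub>}"
    and ring: "\<exists>k. graded_iso (Sym_ring (local_space V F)) (stalk L F) (ring_as_module (Sym_ring (local_space V F))) k"
    using L unfolding minimal_extension_sheaf_def by simp_all
  have gm: "graded_module (Sym_ring (local_space V x)) (stalk L x)"
    and fg: "finitely_generated (Sym_ring (local_space V x)) (stalk L x)"
    and free: "free_graded (Sym_ring (local_space V x)) (stalk L x)" if "x \<in> P" for x
    using pure that unfolding pure_def sheaf_of_modules_iff by simp_all
  have maps: "sheaf_maps P (arr_sheaf V) L" and flab: "flabby P L"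
    using pure unfolding pure_def sheaf_of_modules_iff by simp_all
  have mod: "Module.module (Sym_ring (local_space V x)) (stalk L x)" if "x \<in> P" for x
    using gm[OF that] by (simp add: graded_module_def)
  have "\<exists>B (dg :: 'm \<Rightarrow> int) h. frame (local_space V x) (stalk L x) B dg h \<and> (x = F \<longrightarrow> B = {e} \<and> dg e = 0)"
    if x: "x \<in> P" for x
  proof (cases "x = F")
    case True
    obtain k where "graded_iso (Sym_ring (local_space V F)) (stalk L F) (ring_as_module (Sym_ring (local_space V F))) k"
      using ring by blast
    moreover have "\<And>d. additive_subgroup (gr (stalk L F) d) (stalk L F)" using gm[OF F] by (simp add: graded_module_def)
    ultimately have "frame (local_space V F) (stalk L F) {e} (\<lambda>_. 0) (\<lambda>f. the_inv_into (carrier (stalk L F)) k (f e))"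
      by (intro frame_ring mod[OF F])
    then show ?thesis using True by blast
  next
    case False
    obtain B where B: "is_basis (Sym_ring (local_space V x)) (stalk L x) B" "\<forall>b\<in>B. \<exists>d. b \<in> gr (stalk L x) d"
      using free[OF x] unfolding free_graded_def by blast
    obtain dg where dg: "\<forall>b\<in>B. b \<in> gr (stalk L x) (dg b)" using bchoice[OF B(2)] by blast
    have "frame (local_space V x) (stalk L x) B dg (\<lambda>f. \<Oplus>\<^bsub>stalk L x\<^esub>b\<in>B. f b \<odot>\<^bsub>stalk L x\<^esub> b)"
      by (rule frame_of_basis[OF gm[OF x] finite_basis[OF mod[OF x] fg[OF x] B(1)] B(1)]) (use dg in blast)
    then show ?thesis using False by blast
  qed
  then have "\<forall>x\<in>P. \<exists>t. frame (local_space V x) (stalk L x) (fst t) (fst (snd t) :: 'm \<Rightarrow> int) (snd (snd t)) \<and>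
      (x = F \<longrightarrow> fst t = {e} \<and> fst (snd t) e = 0)" by simp
  from bchoice[OF this] obtain t where t: "\<forall>x\<in>P. frame (local_space V x) (stalk L x) (fst (t x)) (fst (snd (t x)) :: 'm \<Rightarrow> int) (snd (snd (t x))) \<and>
      (x = F \<longrightarrow> fst (t x) = {e} \<and> fst (snd (t x)) e = 0)" by (elim exE)
  define B where "B x = fst (t x)" for x
  define dg where "dg x = fst (snd (t x))" for x
  define h where "h x = snd (snd (t x))" for x
  have fr: "frame (local_space V x) (stalk L x) (B x) (dg x) (h x)" if "x \<in> P" for x
    using t that by (simp add: B_def dg_def h_def)
  have BF: "B F = {e}" "dg F e = 0" using t F by (simp_all add: B_def dg_def)
  have BE: "B x = {}" if x: "x \<in> P" "\<not> F \<subseteq> x" for x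
  proof (rule ccontr)
    assume "B x \<noteq> {}"
    then obtain b where b: "b \<in> B x" by blast
    note u = free_mod_closed(6)[OF b, of "local_space V x"]
    have "h x (unitv b) = h x 0" using frameD(7)[OF fr[OF x(1)] u] zero[OF x] frameD(3)[OF fr[OF x(1)]] by simp
    then have "unitv b = (0 :: 'm \<Rightarrow> 'i mpoly)" using frameD(9)[OF fr[OF x(1)] u free_mod_closed(1)] by simp
    then show False by (simp add: unitv_neq_0)
  qed
  have sf: "sheaf_frames P V L B dg h" by (rule sheaf_frames.intro[OF fr maps flab])
  show ?thesis
    by (rule exI[of _ B], rule exI[of _ dg], rule exI[of _ h])
      (intro conjI ballI impI sf BF BE sheaf_frames.framed_indecomposable[OF sf ind gm])
qed

text \<open>Both modules are parametrised by one set \<open>S\<close> compatibly with the operations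
  and the degree parts, so the isomorphism passes through \<open>S\<close> and linearity is checked
  only for the two parametrisations.\<close>

lemma graded_iso_common:
  assumes K: "bij_betw K S (carrier M)" and Psi: "bij_betw Psi S (carrier N)"
    and pl: "\<And>s t. s \<in> S \<Longrightarrow> t \<in> S \<Longrightarrow> pl s t \<in> S"
      "\<And>s t. s \<in> S \<Longrightarrow> t \<in> S \<Longrightarrow> K (pl s t) = K s \<oplus>\<^bsub>M\<^esub> K t"
      "\<And>s t. s \<in> S \<Longrightarrow> t \<in> S \<Longrightarrow> Psi (pl s t) = Psi s \<oplus>\<^bsub>N\<^esub> Psi t"
    and sm: "\<And>a s. a \<in> carrier R \<Longrightarrow> s \<in> S \<Longrightarrow> sm a s \<in> S"
      "\<And>a s. a \<in> carrier R \<Longrightarrow> s \<in> S \<Longrightarrow> K (sm a s) = a \<odot>\<^bsub>M\<^esub> K s"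
      "\<And>a s. a \<in> carrier R \<Longrightarrow> s \<in> S \<Longrightarrow> Psi (sm a s) = a \<odot>\<^bsub>N\<^esub> Psi s"
    and gr: "\<And>d. Sd d \<subseteq> S" "\<And>d. gr M d = K ` Sd d" "\<And>d. gr N d = Psi ` Sd d"
  shows "graded_iso R M N (\<lambda>m. Psi (the_inv_into S K m))"
    and "s \<in> S \<Longrightarrow> Psi (the_inv_into S K (K s)) = Psi s"
proof -
  have inj: "inj_on K S" and im: "K ` S = carrier M" using K by (auto simp: bij_betw_def)
  have inv: "the_inv_into S K (K s) = s" if "s \<in> S" for s by (rule the_inv_into_f_f[OF inj that])
  show "s \<in> S \<Longrightarrow> Psi (the_inv_into S K (K s)) = Psi s" by (simp add: inv)
  show "graded_iso R M N (\<lambda>m. Psi (the_inv_into S K m))"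
    unfolding graded_iso_def
  proof (intro conjI ballI allI)
    have "bij_betw (the_inv_into S K) (carrier M) S" by (rule bij_betw_the_inv_into[OF K])
    from bij_betw_trans[OF this Psi] show "bij_betw (\<lambda>m. Psi (the_inv_into S K m)) (carrier M) (carrier N)"
      by (simp add: o_def)
    fix m assume "m \<in> carrier M"
    then obtain s where s: "s \<in> S" "m = K s" using im by blast
    show "Psi (the_inv_into S K (m \<oplus>\<^bsub>M\<^esub> n)) = Psi (the_inv_into S K m) \<oplus>\<^bsub>N\<^esub> Psi (the_inv_into S K n)"
      if n: "n \<in> carrier M" for n
    proof -
      obtain t where t: "t \<in> S" "n = K t" using n im by blast
      show ?thesis unfolding s(2) t(2) pl(2)[OF s(1) t(1), symmetric] by (simp only: inv pl(1,3) s(1) t(1))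
    qed
    show "Psi (the_inv_into S K (a \<odot>\<^bsub>M\<^esub> m)) = a \<odot>\<^bsub>N\<^esub> Psi (the_inv_into S K m)" if a: "a \<in> carrier R" for a
      unfolding s(2) sm(2)[OF a s(1), symmetric] by (simp only: inv sm(1,3) s(1) a)
  next
    fix d
    show "(\<lambda>m. Psi (the_inv_into S K m)) ` gr M d = gr N d"
      unfolding gr(2,3) image_image by (rule image_cong[OF refl]) (use gr(1)[of d] inv in auto)
  qed
qed

text \<open>The framed decomposition parametrises the stalks of \<open>E\<close> by families indexed
  by \<open>J\<close>. Grouping a family by the first component of its index presents it as an
  element of the direct sum of tensor products, one factor being the top degree part of a reduced
  stalk.\<close>

theorem pure_sheaf_decomposition:
  fixes P :: "'i::finite set set" and E :: "('i set, 'i mpoly, 'e) module_sheaf" and BE :: "'i set \<Rightarrow> 'c set"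
    and L :: "'i set \<Rightarrow> ('i set, 'i mpoly, 'm) module_sheaf"
  assumes sfE: "sheaf_frames P V E BE dgE hE"
    and modE: "\<And>x. x \<in> P \<Longrightarrow> Module.module (Sym_ring (local_space V x)) (stalk E x)"
    and deg: "\<And>x b. x \<in> P \<Longrightarrow> b \<in> BE x \<Longrightarrow> dgE x b \<le> rho x"
    and top: "\<And>x y b. x \<in> P \<Longrightarrow> b \<in> BE x \<Longrightarrow> dgE x b = rho x \<Longrightarrow> y \<in> P \<Longrightarrow> y \<subset> x \<Longrightarrow>
      res E x y (hE x (unitv b)) = \<zero>\<^bsub>stalk E y\<^esub>"
    and low: "\<And>x m d. x \<in> P \<Longrightarrow> m \<in> gr (stalk E x) d \<Longrightarrow> (\<And>y. y \<in> P \<Longrightarrow> y \<subset> x \<Longrightarrow> res E x y m = \<zero>\<^bsub>stalk E y\<^esub>) \<Longrightarrow>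
      d < rho x \<Longrightarrow> m = \<zero>\<^bsub>stalk E x\<^esub>"
    and L: "\<And>F. F \<in> P \<Longrightarrow> minimal_extension_sheaf P (arr_sheaf V) F (L F)"
  shows "sheaf_iso P (arr_sheaf V) E (direct_sum P (\<lambda>F. tensor_sheaf (rho F)
      (degree_space (bar (local_space V F) (stalk E F)) (rho F)) (L F)))"
proof -
  interpret E: sheaf_frames P V E BE dgE hE by (rule sfE)
  \<comment> \<open>Any value serves as the common label of the generators.\<close>
  define e :: 'm where "e = undefined"
  have "\<forall>F\<in>P. \<exists>t. sheaf_frames P V (L F) (fst t :: 'i set \<Rightarrow> 'm set) (fst (snd t)) (snd (snd t)) \<and> fst t F = {e} \<and> fst (snd t) F e = 0 \<and>
     (\<forall>x\<in>P. \<not> F \<subseteq> x \<longrightarrow> fst t x = {}) \<and>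
     framed_sheaf.framed_indecomposable P (local_space V) (fst t) (fst (snd t)) (framed_res V (L F) (fst t) (snd (snd t)))"
    using minimal_extension_sheaf_frames[OF L, where e = e] by simp
  from bchoice[OF this] obtain t where t: "\<forall>F\<in>P. sheaf_frames P V (L F) (fst (t F) :: 'i set \<Rightarrow> 'm set) (fst (snd (t F))) (snd (snd (t F))) \<and>
     fst (t F) F = {e} \<and> fst (snd (t F)) F e = 0 \<and> (\<forall>x\<in>P. \<not> F \<subseteq> x \<longrightarrow> fst (t F) x = {}) \<and>
     framed_sheaf.framed_indecomposable P (local_space V) (fst (t F)) (fst (snd (t F))) (framed_res V (L F) (fst (t F)) (snd (snd (t F))))"
    by (elim exE)
  define BL where "BL F = fst (t F)" for F
  define dgL where "dgL F = fst (snd (t F))" for F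
  define hL where "hL F = snd (snd (t F))" for F
  note tF = bspec[OF t, folded BL_def dgL_def hL_def]
  have sfL: "sheaf_frames P V (L F) (BL F) (dgL F) (hL F)" and LF: "BL F F = {e}" "dgL F F e = 0"
    and Lsupp: "\<And>x. x \<in> P \<Longrightarrow> \<not> F \<subseteq> x \<Longrightarrow> BL F x = {}"
    and Lind: "framed_sheaf.framed_indecomposable P (local_space V) (BL F) (dgL F) (framed_res V (L F) (BL F) (hL F))"
    if "F \<in> P" for F
    using tF[OF that] by simp_all
  define rE where "rE = framed_res V E BE hE"
  define rL where "rL F = framed_res V (L F) (BL F) (hL F)" for F
  have Lfr: "framed_sheaf P (local_space V) (BL F) (dgL F) (rL F)" if "F \<in> P" for F
    unfolding rL_def by (rule sheaf_frames.framed[OF sfL[OF that]])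
  interpret D: framed_decomposition P "local_space V" BE dgE rE BL dgL rL "\<lambda>_. e" rho
  proof (rule framed_decomposition.intro)
    show "framed_sheaf P (local_space V) BE dgE rE" unfolding rE_def by (rule E.framed)
    show "framed_decomposition_axioms P (local_space V) BE dgE rE BL dgL rL (\<lambda>_. e) rho"
    proof (rule framed_decomposition_axioms.intro)
      fix F x g m assume F: "F \<in> P" "x \<in> P" "F \<subset> x" and g: "g \<in> free_mod (local_space V x) (BL F x)"
        and rel: "\<And>y. y \<in> P \<Longrightarrow> y \<subset> x \<Longrightarrow> rL F x y g = 0"
      show "const_term (g m) = 0"
      \<comment> \<open>The lemma is applied with \<open>F\<close> as the place where L_F is nonzero
        and x as the place of the relative section; x is not contained in \<open>F\<close>.\<close>
      proof (rule framed_sheaf.const_term_rel_section[OF Lfr[OF F(1)] _ F(1) _ F(2) _ g rel])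
        show "framed_sheaf.framed_indecomposable P (local_space V) (BL F) (dgL F) (rL F)"
          unfolding rL_def by (rule Lind[OF F(1)])
      qed (use LF(1)[OF F(1)] F(3) in auto)
    next
      fix x b y assume x: "x \<in> P" "b \<in> BE x" "dgE x b = rho x" and y: "y \<in> P" "y \<subset> x"
      note u = free_mod_closed(6)[OF x(2), of "local_space V x"] and yx = psubset_imp_subset[OF y(2)]
      show "rE x y (unitv b) = 0"
        unfolding rE_def
        by (rule E.h_eq[OF y(1) E.h_rM(2)[OF x(1) y(1) yx u] free_mod_closed(1)])
          (simp only: E.h_rM(1)[OF x(1) y(1) yx u] top[OF x y] frameD(3)[OF E.frames[OF y(1)]])
    next
      fix x f d assume x: "x \<in> P" and f: "f \<in> free_mod (local_space V x) (BE x)"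
        and rel: "\<And>y. y \<in> P \<Longrightarrow> y \<subset> x \<Longrightarrow> rE x y f = 0" and d: "fhom (dgE x) d f" "d < rho x"
      have "hE x f = \<zero>\<^bsub>stalk E x\<^esub>"
      proof (rule low[OF x _ _ d(2)])
        show "hE x f \<in> gr (stalk E x) d" using E.h_gr[OF x f] d(1) by simp
        fix y assume y: "y \<in> P" "y \<subset> x"
        have "res E x y (hE x f) = hE y (rE x y f)"
          unfolding rE_def by (rule E.h_rM(1)[OF x y(1) psubset_imp_subset[OF y(2)] f, symmetric])
        then show "res E x y (hE x f) = \<zero>\<^bsub>stalk E y\<^esub>" using rel[OF y] frameD(3)[OF E.frames[OF y(1)]] by simp
      qed
      then show "f = 0" using E.h_eq[OF x f free_mod_closed(1)] frameD(3)[OF E.frames[OF x]] by simp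
    qed (simp_all add: Lfr Lsupp LF deg)
  qed
  define X where "X F = degree_space (bar (local_space V F) (stalk E F)) (rho F)" for F
  define T where "T F = {b \<in> BE F. dgE F b = rho F}" for F
  define g where "g F = const_class (local_space V F) (BE F) (hE F)" for F
  define Cl where "Cl F x = tensor_frame.Cl (X F) (T F) (g F) (stalk (L F) x) (D.fmL F x) (hL F x)" for F x
  have tf: "tensor_frame (X F) (T F) (g F) (stalk (L F) x) (D.fmL F x) (hL F x)" if "F \<in> P" "x \<in> P" for F x
    unfolding X_def T_def g_def
    by (rule tensor_frame.intro[OF vframe_degree_space[OF modE[OF that(1)] E.frames[OF that(1)]]
          frame_aframe[OF sheaf_frames.frames[OF sfL[OF that(1)] that(2)]]])
  have JT: "(F, b) \<in> D.J \<longleftrightarrow> F \<in> P \<and> b \<in> T F" for F b by (auto simp: D.J_def T_def)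
  have part: "(\<lambda>b. s (F, b)) \<in> tensor_frame.tfam (T F) (D.fmL F x)" if "F \<in> P" "x \<in> P" "s \<in> D.fam x" for F x s
    unfolding tensor_frame.tfam_def[OF tf[OF that(1,2)]]
    using D.famD[OF that(3), of "(F, _)"] D.fam_0[OF that(3), of "(F, _)"] JT that(1) by simp
  define S where "S = direct_sum P (\<lambda>F. tensor_sheaf (rho F) (X F) (L F))"
  \<comment> \<open>\<open>K\<close> is the parametrisation by the sum of the morphisms,
    \<open>Psi\<close> the one by regrouping coordinates over each \<open>F\<close>.\<close>
  define K where "K x s = hE x (D.alpha x s)" for x s
  define Psi where "Psi x s = (\<lambda>F\<in>P. Cl F x (\<lambda>b. s (F, b)))" for x s
  define Sd where "Sd x d = {s \<in> D.fam x. D.shom x d s}" for x d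
  have Kbij: "bij_betw (K x) (D.fam x) (carrier (stalk E x))" if x: "x \<in> P" for x
    using bij_betw_trans[OF D.alpha_bij[OF x] frameD(2)[OF E.frames[OF x]]] by (simp add: K_def[abs_def] o_def)
  have carS: "carrier (stalk S x) = (\<Pi>\<^sub>E F\<in>P. carrier (tensor_module (rho F) (X F) (stalk (L F) x)))" for x
    by (simp add: S_def direct_sum_def tensor_sheaf_def)
  have Cl_in: "Cl F x v \<in> carrier (tensor_module (rho F) (X F) (stalk (L F) x))"
    if "F \<in> P" "x \<in> P" "v \<in> tensor_frame.tfam (T F) (D.fmL F x)" for F x v
    using bij_betwE[OF tensor_frame.Cl_bij[OF tf[OF that(1,2)]]] that(3) by (simp add: Cl_def)
  have Cl_inj: "v = v'" if "F \<in> P" "x \<in> P" "v \<in> tensor_frame.tfam (T F) (D.fmL F x)"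
    "v' \<in> tensor_frame.tfam (T F) (D.fmL F x)" "Cl F x v = Cl F x v'" for F x v v'
    by (rule inj_onD[OF bij_betw_imp_inj_on[OF tensor_frame.Cl_bij[OF tf[OF that(1,2)]]] that(5)[unfolded Cl_def] that(3,4)])
  have fam_of: "(\<lambda>j. if fst j \<in> P then v (fst j) (snd j) else 0) \<in> D.fam x"
    if "x \<in> P" "\<And>F. F \<in> P \<Longrightarrow> v F \<in> tensor_frame.tfam (T F) (D.fmL F x)" for v x
  proof -
    have v: "(\<forall>b\<in>T F. v F b \<in> D.fmL F x) \<and> (\<forall>b. b \<notin> T F \<longrightarrow> v F b = 0)" if F: "F \<in> P" for F
      using \<open>\<And>F. F \<in> P \<Longrightarrow> v F \<in> tensor_frame.tfam (T F) (D.fmL F x)\<close>[OF F]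
      unfolding tensor_frame.tfam_def[OF tf[OF F \<open>x \<in> P\<close>]] by simp
    show ?thesis
      unfolding D.fam_def
    proof (intro CollectI conjI ballI allI impI)
      fix j assume "j \<in> D.J"
      then have "fst j \<in> P" "snd j \<in> T (fst j)" using JT[of "fst j" "snd j"] by auto
      then show "(if fst j \<in> P then v (fst j) (snd j) else 0) \<in> D.fmL (fst j) x" using v by simp
    next
      fix j assume "j \<notin> D.J"
      then have "fst j \<in> P \<Longrightarrow> snd j \<notin> T (fst j)" using JT[of "fst j" "snd j"] by auto
      then show "(if fst j \<in> P then v (fst j) (snd j) else 0) = 0" using v by simp
    qed
  qed
  have Psibij: "bij_betw (Psi x) (D.fam x) (carrier (stalk S x))" if x: "x \<in> P" for x
    unfolding bij_betw_def
  proof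
    show "inj_on (Psi x) (D.fam x)"
    proof (rule inj_onI)
      fix s s' assume s: "s \<in> D.fam x" "s' \<in> D.fam x" "Psi x s = Psi x s'"
      show "s = s'"
      proof (rule ext)
        fix j :: "'i set \<times> 'c"
        obtain F b where j: "j = (F, b)" by (cases j)
        show "s j = s' j"
        proof (cases "F \<in> P")
          case True
          have "Cl F x (\<lambda>b. s (F, b)) = Cl F x (\<lambda>b. s' (F, b))" using fun_cong[OF s(3), of F] True by (simp add: Psi_def)
          from fun_cong[OF Cl_inj[OF True x part[OF True x s(1)] part[OF True x s(2)] this], of b] show ?thesis by (simp add: j)
        next
          case False
          then show ?thesis using D.fam_0[OF s(1), of j] D.fam_0[OF s(2), of j] JT j by simp
        qed
      qed
    qed
    show "Psi x ` D.fam x = carrier (stalk S x)"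
    proof (intro equalityI subsetI)
      fix C assume "C \<in> Psi x ` D.fam x"
      then obtain s where s: "s \<in> D.fam x" "C = Psi x s" by blast
      show "C \<in> carrier (stalk S x)" unfolding carS s(2) Psi_def by (intro restrict_PiE_iff[THEN iffD2] ballI Cl_in[OF _ x part[OF _ x s(1)]])
    next
      fix C assume C: "C \<in> carrier (stalk S x)"
      have "\<forall>F\<in>P. \<exists>v. v \<in> tensor_frame.tfam (T F) (D.fmL F x) \<and> C F = Cl F x v"
      proof
        fix F assume F: "F \<in> P"
        have "C F \<in> carrier (tensor_module (rho F) (X F) (stalk (L F) x))" by (rule PiE_mem[OF C[unfolded carS] F])
        then have "C F \<in> Cl F x ` tensor_frame.tfam (T F) (D.fmL F x)"
          using bij_betw_imp_surj_on[OF tensor_frame.Cl_bij[OF tf[OF F x]]] unfolding Cl_def by blast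
        then show "\<exists>v. v \<in> tensor_frame.tfam (T F) (D.fmL F x) \<and> C F = Cl F x v" by blast
      qed
      from bchoice[OF this] obtain v where v: "\<forall>F\<in>P. v F \<in> tensor_frame.tfam (T F) (D.fmL F x) \<and> C F = Cl F x (v F)" by (elim exE)
      let ?s = "\<lambda>j. if fst j \<in> P then v (fst j) (snd j) else 0"
      have "?s \<in> D.fam x" by (rule fam_of[OF x]) (use v in simp)
      moreover have "C = Psi x ?s"
      proof (rule ext)
        fix F show "C F = Psi x ?s F"
        proof (cases "F \<in> P")
          case True then show ?thesis using v by (simp add: Psi_def)
        next
          case False then show ?thesis using PiE_arb[OF C[unfolded carS] False] by (simp add: Psi_def)
        qed
      qed
      ultimately show "C \<in> Psi x ` D.fam x" by blast
    qed
  qed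
  have smulCl: "tensor_map (X F) (stalk (L F) x) (\<lambda>m. a \<odot>\<^bsub>stalk (L F) x\<^esub> m) (Cl F x v) = Cl F x (\<lambda>b. smul a (v b))"
    if F: "F \<in> P" "x \<in> P" and a: "a \<in> Sym (local_space V x)" and v: "v \<in> tensor_frame.tfam (T F) (D.fmL F x)" for F x a v
    unfolding Cl_def
  proof (rule tensor_map_Cl[OF tf[OF F] tf[OF F] _ _ _ _ v])
    fix f assume f: "f \<in> D.fmL F x"
    show "smul a f \<in> D.fmL F x" by (rule free_mod_closed(4)[OF a f])
    show "a \<odot>\<^bsub>stalk (L F) x\<^esub> hL F x f = hL F x (smul a f)"
      using frameD(5)[OF sheaf_frames.frames[OF sfL[OF F(1)] F(2)] a f] by simp
  qed (simp_all add: smul_distrib mult.commute)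
  have resCl: "tensor_map (X F) (stalk (L F) y) (res (L F) x y) (Cl F x v) = Cl F y (\<lambda>b. rL F x y (v b))"
    if F: "F \<in> P" "x \<in> P" and y: "y \<in> P" "y \<subseteq> x" and v: "v \<in> tensor_frame.tfam (T F) (D.fmL F x)" for F x y v
    unfolding Cl_def
  proof (rule tensor_map_Cl[OF tf[OF F] tf[OF F(1) y(1)] _ _ _ _ v])
    interpret Lf: framed_sheaf P "local_space V" "BL F" "dgL F" "rL F" by (rule Lfr[OF F(1)])
    fix f assume f: "f \<in> D.fmL F x"
    show "rL F x y f \<in> D.fmL F y" by (rule Lf.r_in[OF F(2) y f])
    show "res (L F) x y (hL F x f) = hL F y (rL F x y f)"
      unfolding rL_def by (rule sheaf_frames.h_rM(1)[OF sfL[OF F(1)] F(2) y f, symmetric])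
    show "rL F x y (f + f') = rL F x y f + rL F x y f'" if "f' \<in> D.fmL F x" for f'
      by (rule Lf.r_add[OF F(2) y f that])
    show "rL F x y (smul (const_poly r) f) = smul (const_poly r) (rL F x y f)" for r
      using Lf.r_smul[OF F(2) y Sym_const f, of r] by simp
  qed
  have grS: "gr (stalk S x) d = Psi x ` Sd x d" if x: "x \<in> P" for x d
  proof -
    define H where "H F = {f \<in> D.fmL F x. fhom (dgL F x) (d - rho F) f}" for F
    have grT: "gr (tensor_module (rho F) (X F) (stalk (L F) x)) d
      = Cl F x ` {v \<in> tensor_frame.tfam (T F) (D.fmL F x). \<forall>b\<in>T F. v b \<in> H F}" if F: "F \<in> P" for F
      unfolding Cl_def
    proof (rule tensor_frame.Cl_gr[OF tf[OF F x]])
      show "gr (stalk (L F) x) (d - rho F) = hL F x ` H F"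
        unfolding H_def by (rule frameD(6)[OF sheaf_frames.frames[OF sfL[OF F] x]])
    qed (auto simp: H_def free_mod_closed fhom_add Sym_const intro: fhom_smul'[OF homog_const])
    have "gr (stalk S x) d = (\<Pi>\<^sub>E F\<in>P. gr (tensor_module (rho F) (X F) (stalk (L F) x)) d)"
      by (simp add: S_def direct_sum_def tensor_sheaf_def)
    also have "\<dots> = Psi x ` Sd x d"
    proof (intro equalityI subsetI)
      fix C assume "C \<in> Psi x ` Sd x d"
      then obtain s where s: "s \<in> D.fam x" "D.shom x d s" "C = Psi x s" by (auto simp: Sd_def)
      have "Cl F x (\<lambda>b. s (F, b)) \<in> gr (tensor_module (rho F) (X F) (stalk (L F) x)) d" if F: "F \<in> P" for F
        unfolding grT[OF F]
      proof (intro imageI CollectI conjI ballI)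
        show "(\<lambda>b. s (F, b)) \<in> tensor_frame.tfam (T F) (D.fmL F x)" by (rule part[OF F x s(1)])
        fix b assume "b \<in> T F"
        then have "(F, b) \<in> D.J" using F JT by simp
        then show "s (F, b) \<in> H F" using D.famD[OF s(1)] s(2) unfolding D.shom_def H_def by fastforce
      qed
      then show "C \<in> (\<Pi>\<^sub>E F\<in>P. gr (tensor_module (rho F) (X F) (stalk (L F) x)) d)" unfolding s(3) Psi_def by (intro restrict_PiE_iff[THEN iffD2] ballI)
    next
      fix C assume C: "C \<in> (\<Pi>\<^sub>E F\<in>P. gr (tensor_module (rho F) (X F) (stalk (L F) x)) d)"
      have "\<forall>F\<in>P. \<exists>v. (v \<in> tensor_frame.tfam (T F) (D.fmL F x) \<and> (\<forall>b\<in>T F. v b \<in> H F)) \<and> C F = Cl F x v"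
      proof
        fix F assume F: "F \<in> P"
        have "C F \<in> gr (tensor_module (rho F) (X F) (stalk (L F) x)) d" by (rule PiE_mem[OF C F])
        then show "\<exists>v. (v \<in> tensor_frame.tfam (T F) (D.fmL F x) \<and> (\<forall>b\<in>T F. v b \<in> H F)) \<and> C F = Cl F x v"
          unfolding grT[OF F] by blast
      qed
      from bchoice[OF this] obtain v where v: "\<forall>F\<in>P. (v F \<in> tensor_frame.tfam (T F) (D.fmL F x) \<and> (\<forall>b\<in>T F. v F b \<in> H F)) \<and> C F = Cl F x (v F)"
        by (elim exE)
      let ?s = "\<lambda>j. if fst j \<in> P then v (fst j) (snd j) else 0"
      have "?s \<in> D.fam x" by (rule fam_of[OF x]) (use v in simp)
      moreover have "D.shom x d ?s"
        unfolding D.shom_def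
      proof
        fix j assume "j \<in> D.J"
        then have "fst j \<in> P" "snd j \<in> T (fst j)" using JT[of "fst j" "snd j"] by auto
        then show "fhom (dgL (fst j) x) (d - rho (fst j)) (?s j)" using v by (simp add: H_def)
      qed
      moreover have "C = Psi x ?s"
      proof (rule ext)
        fix F show "C F = Psi x ?s F"
        proof (cases "F \<in> P")
          case True then show ?thesis using v by (simp add: Psi_def)
        next
          case False then show ?thesis using PiE_arb[OF C False] by (simp add: Psi_def)
        qed
      qed
      ultimately show "C \<in> Psi x ` Sd x d" by (auto simp: Sd_def)
    qed
    finally show ?thesis .
  qed
  have grE: "gr (stalk E x) d = K x ` Sd x d" if x: "x \<in> P" for x d
    unfolding frameD(6)[OF E.frames[OF x]] D.alpha_hom_image[OF x, symmetric] Sd_def K_def image_image ..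
  have iso: "graded_iso (Sym_ring (local_space V x)) (stalk E x) (stalk S x) (\<lambda>m. Psi x (the_inv_into (D.fam x) (K x) m))"
    and K_back: "\<And>s. s \<in> D.fam x \<Longrightarrow> Psi x (the_inv_into (D.fam x) (K x) (K x s)) = Psi x s" if x: "x \<in> P" for x
  proof -
    note common = graded_iso_common[OF Kbij[OF x] Psibij[OF x], where pl = "(+)" and sm = D.ssmul and Sd = "Sd x"
        and R = "Sym_ring (local_space V x)"]
    have 1: "s + t \<in> D.fam x" "K x (s + t) = K x s \<oplus>\<^bsub>stalk E x\<^esub> K x t" "Psi x (s + t) = Psi x s \<oplus>\<^bsub>stalk S x\<^esub> Psi x t"
      if s: "s \<in> D.fam x" and t: "t \<in> D.fam x" for s t
    proof -
      show "s + t \<in> D.fam x" by (rule D.fam_closed(2)[OF s t])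
      show "K x (s + t) = K x s \<oplus>\<^bsub>stalk E x\<^esub> K x t"
        unfolding K_def D.alpha_add[OF x s t] by (rule frameD(4)[OF E.frames[OF x] D.alpha_in[OF x s] D.alpha_in[OF x t]])
      have "Cl F x (\<lambda>b. s (F, b)) \<oplus>\<^bsub>tensor_module (rho F) (X F) (stalk (L F) x)\<^esub> Cl F x (\<lambda>b. t (F, b))
        = Cl F x (\<lambda>b. (s + t) (F, b))" if F: "F \<in> P" for F
        unfolding Cl_def plus_fun_apply[of s t]
        by (rule tensor_frame.Cl_add[OF tf[OF F x] part[OF F x s] part[OF F x t]])
      then show "Psi x (s + t) = Psi x s \<oplus>\<^bsub>stalk S x\<^esub> Psi x t"
        by (auto simp: S_def direct_sum_def tensor_sheaf_def Psi_def intro!: restrict_ext)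
    qed
    have 2: "D.ssmul a s \<in> D.fam x" "K x (D.ssmul a s) = a \<odot>\<^bsub>stalk E x\<^esub> K x s" "Psi x (D.ssmul a s) = a \<odot>\<^bsub>stalk S x\<^esub> Psi x s"
      if "a \<in> carrier (Sym_ring (local_space V x))" and s: "s \<in> D.fam x" for a s
    proof -
      have a: "a \<in> Sym (local_space V x)" using that by simp
      show "D.ssmul a s \<in> D.fam x" by (rule D.fam_closed(4)[OF a s])
      show "K x (D.ssmul a s) = a \<odot>\<^bsub>stalk E x\<^esub> K x s"
        unfolding K_def D.alpha_ssmul[OF x s a] by (rule frameD(5)[OF E.frames[OF x] a D.alpha_in[OF x s]])
      have "Cl F x (\<lambda>b. D.ssmul a s (F, b)) = tensor_map (X F) (stalk (L F) x) (\<lambda>m. a \<odot>\<^bsub>stalk (L F) x\<^esub> m) (Cl F x (\<lambda>b. s (F, b)))"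
        if F: "F \<in> P" for F
        unfolding smulCl[OF F x a part[OF F x s]] D.ssmul_def ..
      then show "Psi x (D.ssmul a s) = a \<odot>\<^bsub>stalk S x\<^esub> Psi x s"
        by (auto simp: S_def direct_sum_def tensor_sheaf_def tensor_module_def Psi_def intro!: restrict_ext)
    qed
    have 3: "Sd x d \<subseteq> D.fam x" for d by (auto simp: Sd_def)
    show "graded_iso (Sym_ring (local_space V x)) (stalk E x) (stalk S x) (\<lambda>m. Psi x (the_inv_into (D.fam x) (K x) m))"
      by (rule common(1)[OF 1 2 3 grE[OF x] grS[OF x]])
    show "Psi x (the_inv_into (D.fam x) (K x) (K x s)) = Psi x s" if "s \<in> D.fam x" for s
      using the_inv_into_f_f[OF bij_betw_imp_inj_on[OF Kbij[OF x]] that] by simp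
  qed
  have "sheaf_iso P (arr_sheaf V) E S"
    unfolding sheaf_iso_def
  proof (intro exI conjI ballI impI)
    fix x assume x: "x \<in> P"
    show "graded_iso (rstalk (arr_sheaf V) x) (stalk E x) (stalk S x) (\<lambda>m. Psi x (the_inv_into (D.fam x) (K x) m))"
      unfolding arr_sheaf_simps by (rule iso[OF x])
    fix y m assume y: "y \<in> P" "y \<le> x" and "m \<in> carrier (stalk E x)"
    then obtain s where s: "s \<in> D.fam x" "m = K x s" using bij_betw_imp_surj_on[OF Kbij[OF x]] by blast
    have r: "D.sres x y s \<in> D.fam y" by (rule D.sres_fam[OF x y s(1)])
    have "res E x y (K x s) = hE y (rE x y (D.alpha x s))"
      unfolding K_def by (rule E.h_rM(1)[OF x y, folded rE_def, OF D.alpha_in[OF x s(1)], symmetric])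
    also have "\<dots> = K y (D.sres x y s)" unfolding D.alpha_res[OF x y s(1)] K_def ..
    finally have res: "res E x y (K x s) = K y (D.sres x y s)" .
    have "Cl F y (\<lambda>b. D.sres x y s (F, b)) = tensor_map (X F) (stalk (L F) y) (res (L F) x y) (Cl F x (\<lambda>b. s (F, b)))"
      if F: "F \<in> P" for F
    proof -
      have "D.sres x y s (F, b) = rL F x y (s (F, b))" for b
        using D.fam_0[OF s(1), of "(F, b)"] framed_sheaf.r_zero[OF Lfr[OF F] x y]
        by (cases "(F, b) \<in> D.J") (simp_all add: D.sres_def)
      then show ?thesis unfolding resCl[OF F x y part[OF F x s(1)]] by simp
    qed
    then have "Psi y (D.sres x y s) = res S x y (Psi x s)"
      by (auto simp: S_def direct_sum_def tensor_sheaf_def Psi_def intro!: restrict_ext)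
    then show "Psi y (the_inv_into (D.fam y) (K y) (res E x y m)) = res S x y (Psi x (the_inv_into (D.fam x) (K x) m))"
      unfolding s(2) res K_back[OF y(1) r] K_back[OF x s(1)] .
  qed
  then show ?thesis unfolding S_def X_def .
qed

text \<open>Each axiom is a polynomial identity between coordinate vectors, transported by
  \<open>h\<close>. This supplies the module axioms for the stalks of the push-forward and for its
  relative sections.\<close>

lemma frame_module:
  assumes fr: "frame W M B dg h"
  shows "Module.module (Sym_ring W) M"
proof -
  note fD = frameD[OF fr]
  have ex: "\<exists>f. f \<in> free_mod W B \<and> x = h f" if "x \<in> carrier M" for x using that fD(8) by blast
  have ab: "abelian_group M"
  proof (rule abelian_groupI)
    fix x y assume "x \<in> carrier M" "y \<in> carrier M"
    then obtain f g where f: "f \<in> free_mod W B" "x = h f" and g: "g \<in> free_mod W B" "y = h g" using ex by meson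
    show "x \<oplus>\<^bsub>M\<^esub> y \<in> carrier M"
      unfolding f(2) g(2) fD(4)[OF f(1) g(1), symmetric] by (rule fD(7)[OF free_mod_closed(2)[OF f(1) g(1)]])
    show "x \<oplus>\<^bsub>M\<^esub> y = y \<oplus>\<^bsub>M\<^esub> x"
      unfolding f(2) g(2) fD(4)[OF f(1) g(1), symmetric] fD(4)[OF g(1) f(1), symmetric] by (simp add: add.commute)
    fix z assume "z \<in> carrier M"
    then obtain k where k: "k \<in> free_mod W B" "z = h k" using ex by meson
    show "x \<oplus>\<^bsub>M\<^esub> y \<oplus>\<^bsub>M\<^esub> z = x \<oplus>\<^bsub>M\<^esub> (y \<oplus>\<^bsub>M\<^esub> z)"
      unfolding f(2) g(2) k(2) fD(4)[OF f(1) g(1), symmetric] fD(4)[OF g(1) k(1), symmetric]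
        fD(4)[OF free_mod_closed(2)[OF f(1) g(1)] k(1), symmetric] fD(4)[OF f(1) free_mod_closed(2)[OF g(1) k(1)], symmetric]
      by (simp add: add.assoc)
  next
    show "\<zero>\<^bsub>M\<^esub> \<in> carrier M" unfolding fD(3)[symmetric] by (rule fD(7)[OF free_mod_closed(1)])
    fix x assume "x \<in> carrier M"
    then obtain f where f: "f \<in> free_mod W B" "x = h f" using ex by meson
    show "\<zero>\<^bsub>M\<^esub> \<oplus>\<^bsub>M\<^esub> x = x"
      unfolding fD(3)[symmetric] f(2) fD(4)[OF free_mod_closed(1) f(1), symmetric] by simp
    have m: "0 - f \<in> free_mod W B" by (rule free_mod_closed(3)[OF free_mod_closed(1) f(1)])
    have "h (0 - f) \<oplus>\<^bsub>M\<^esub> x = \<zero>\<^bsub>M\<^esub>"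
      unfolding fD(3)[symmetric] f(2) fD(4)[OF m f(1), symmetric] by simp
    then show "\<exists>y\<in>carrier M. y \<oplus>\<^bsub>M\<^esub> x = \<zero>\<^bsub>M\<^esub>" by (rule bexI[OF _ fD(7)[OF m]])
  qed
  show ?thesis
  proof (rule moduleI[OF cring_Sym_ring ab], unfold Sym_ring_simps)
    fix a x assume a: "a \<in> Sym W" and "x \<in> carrier M"
    then obtain f where f: "f \<in> free_mod W B" "x = h f" using ex by meson
    note af = free_mod_closed(4)[OF a f(1)]
    show "a \<odot>\<^bsub>M\<^esub> x \<in> carrier M" unfolding f(2) fD(5)[OF a f(1), symmetric] by (rule fD(7)[OF af])
    show "a \<odot>\<^bsub>M\<^esub> (x \<oplus>\<^bsub>M\<^esub> y) = a \<odot>\<^bsub>M\<^esub> x \<oplus>\<^bsub>M\<^esub> a \<odot>\<^bsub>M\<^esub> y" if "y \<in> carrier M" for y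
    proof -
      obtain g where g: "g \<in> free_mod W B" "y = h g" using ex[OF \<open>y \<in> carrier M\<close>] by (elim exE conjE) (rule that)
      show ?thesis
        unfolding f(2) g(2) fD(4)[OF f(1) g(1), symmetric] fD(5)[OF a f(1), symmetric] fD(5)[OF a g(1), symmetric]
          fD(5)[OF a free_mod_closed(2)[OF f(1) g(1)], symmetric] fD(4)[OF af free_mod_closed(4)[OF a g(1)], symmetric]
          smul_distrib ..
    qed
    fix b assume b: "b \<in> Sym W"
    note bf = free_mod_closed(4)[OF b f(1)]
    show "(a + b) \<odot>\<^bsub>M\<^esub> x = a \<odot>\<^bsub>M\<^esub> x \<oplus>\<^bsub>M\<^esub> b \<odot>\<^bsub>M\<^esub> x"
      unfolding f(2) fD(5)[OF a f(1), symmetric] fD(5)[OF b f(1), symmetric] fD(5)[OF Sym_add[OF a b] f(1), symmetric]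
        fD(4)[OF af bf, symmetric] smul_distrib ..
    have "smul (a * b) f = smul a (smul b f)" by (simp add: smul_def mult.assoc)
    then show "(a * b) \<odot>\<^bsub>M\<^esub> x = a \<odot>\<^bsub>M\<^esub> (b \<odot>\<^bsub>M\<^esub> x)"
      unfolding f(2) fD(5)[OF b f(1), symmetric] fD(5)[OF Sym_mult[OF a b] f(1), symmetric] fD(5)[OF a bf, symmetric]
      by (rule arg_cong)
  next
    fix x assume "x \<in> carrier M"
    then obtain f where f: "f \<in> free_mod W B" "x = h f" using ex by meson
    have "smul 1 f = f" by (simp add: smul_def)
    then show "1 \<odot>\<^bsub>M\<^esub> x = x" unfolding f(2) fD(5)[OF Sym_1 f(1), symmetric] by (rule arg_cong)
  qed
qed

lemma frame_finsum:
  assumes fr: "frame W M B dg h" and S: "finite S" "\<And>i. i \<in> S \<Longrightarrow> k i \<in> free_mod W B"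
  shows "h (\<Sum>i\<in>S. k i) = (\<Oplus>\<^bsub>M\<^esub>i\<in>S. h (k i))"
proof -
  interpret Module.module "Sym_ring W" M by (rule frame_module[OF fr])
  note fD = frameD[OF fr]
  show ?thesis
    using S
  proof (induction S rule: finite_induct)
    case (insert i S)
    have "h (k i + (\<Sum>i\<in>S. k i)) = h (k i) \<oplus>\<^bsub>M\<^esub> h (\<Sum>i\<in>S. k i)"
      by (rule fD(4)) (auto intro: insert free_mod_sum)
    moreover have "h (\<Sum>i\<in>S. k i) = (\<Oplus>\<^bsub>M\<^esub>i\<in>S. h (k i))" using insert by simp
    moreover have "(\<lambda>i. h (k i)) \<in> S \<rightarrow> carrier M" "h (k i) \<in> carrier M" using fD(7) insert by auto
    ultimately show ?case by (simp only: sum.insert[OF insert(1,2)] M.finsum_insert[OF insert(1,2)])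
  qed (simp only: sum.empty fD(3) M.finsum_empty)
qed

text \<open>Coordinates labelled by \<open>B\<close> have to be rewritten as coordinates labelled by
  the basis elements themselves, because \<open>is_basis\<close> speaks of subsets of the module.
  Injectivity of the labelling makes the two equivalent.\<close>

lemma frame_basis:
  fixes h :: "('b \<Rightarrow> 'i::finite mpoly) \<Rightarrow> 'm"
  assumes fr: "frame W M B dg h"
  shows "inj_on (\<lambda>b. h (unitv b)) B" and "is_basis (Sym_ring W) M ((\<lambda>b. h (unitv b)) ` B)"
proof -
  interpret Module.module "Sym_ring W" M by (rule frame_module[OF fr])
  note fD = frameD[OF fr]
  define k where "k b = h (unitv b)" for b
  have kM: "k b \<in> carrier M" if "b \<in> B" for b unfolding k_def by (rule fD(7)[OF free_mod_closed(6)[OF that]])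
  show "inj_on (\<lambda>b. h (unitv b)) B"
  proof (rule inj_onI)
    fix b b' assume b: "b \<in> B" "b' \<in> B" "h (unitv b) = h (unitv b')"
    have "unitv b = (unitv b' :: 'b \<Rightarrow> 'i mpoly)"
      using fD(9)[OF free_mod_closed(6)[OF b(1)] free_mod_closed(6)[OF b(2)]] b(3) by simp
    from fun_cong[OF this, of b] show "b = b'" by (simp add: unitv_def split: if_splits)
  qed
  then have kinj: "inj_on k B" by (simp add: k_def[abs_def])
  define g where "g c b = (if b \<in> B then c (k b) else 0)" for c :: "'m \<Rightarrow> 'i mpoly" and b
  have g: "g c \<in> free_mod W B" "h (g c) = (\<Oplus>\<^bsub>M\<^esub>x\<in>{x \<in> k ` B. c x \<noteq> 0}. c x \<odot>\<^bsub>M\<^esub> x)"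
    if c: "c \<in> k ` B \<rightarrow> Sym W" for c
  proof -
    show gc: "g c \<in> free_mod W B" using c by (auto simp: free_mod_def g_def)
    let ?S = "{b \<in> B. c (k b) \<noteq> 0}"
    have S: "finite ?S" using fD(1) by simp
    have u: "unitv b \<in> free_mod W B" "c (k b) \<in> Sym W" if "b \<in> ?S" for b
      using that c by (auto intro: free_mod_closed(6))
    have "g c = (\<Sum>b\<in>B. smul (g c b) (unitv b))" by (rule free_mod_expand[OF fD(1) gc])
    also have "\<dots> = (\<Sum>b\<in>?S. smul (c (k b)) (unitv b))"
      by (rule sum.mono_neutral_cong_right[OF fD(1)]) (auto simp: g_def smul_def zero_fun_def)
    finally have "h (g c) = (\<Oplus>\<^bsub>M\<^esub>b\<in>?S. h (smul (c (k b)) (unitv b)))"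
      using frame_finsum[OF fr S free_mod_closed(4)[OF u(2) u(1)]] by simp
    also have "\<dots> = (\<Oplus>\<^bsub>M\<^esub>b\<in>?S. c (k b) \<odot>\<^bsub>M\<^esub> k b)"
      unfolding k_def
    proof (rule M.finsum_cong')
      show "(\<lambda>b. c (h (unitv b)) \<odot>\<^bsub>M\<^esub> h (unitv b)) \<in> {b \<in> B. c (h (unitv b)) \<noteq> 0} \<rightarrow> carrier M"
        using u kM smult_closed[unfolded Sym_ring_simps] by (auto simp: k_def)
      fix b assume "b \<in> {b \<in> B. c (h (unitv b)) \<noteq> 0}"
      then show "h (smul (c (h (unitv b))) (unitv b)) = c (h (unitv b)) \<odot>\<^bsub>M\<^esub> h (unitv b)"
        using u[unfolded k_def] by (intro fD(5)) simp_all
    qed simp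
    also have "\<dots> = (\<Oplus>\<^bsub>M\<^esub>x\<in>k ` ?S. c x \<odot>\<^bsub>M\<^esub> x)"
      by (rule M.finsum_reindex[symmetric])
        (use u kM smult_closed[unfolded Sym_ring_simps] in \<open>auto intro: inj_on_subset[OF kinj]\<close>)
    also have "k ` ?S = {x \<in> k ` B. c x \<noteq> 0}" by auto
    finally show "h (g c) = (\<Oplus>\<^bsub>M\<^esub>x\<in>{x \<in> k ` B. c x \<noteq> 0}. c x \<odot>\<^bsub>M\<^esub> x)" .
  qed
  have "is_basis (Sym_ring W) M (k ` B)"
    unfolding is_basis_def Sym_ring_simps
  proof (intro conjI ballI)
    show "k ` B \<subseteq> carrier M" using kM by auto
    fix m assume "m \<in> carrier M"
    then obtain f where f: "f \<in> free_mod W B" "m = h f" using fD(8) by blast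
    let ?c = "\<lambda>x\<in>k ` B. f (the_inv_into B k x)"
    have cE: "?c \<in> k ` B \<rightarrow>\<^sub>E Sym W" using free_mod_Sym[OF f(1)] by auto
    have gf: "g ?c = f"
    proof
      fix b show "g ?c b = f b"
        using f(1) by (cases "b \<in> B") (simp_all add: g_def the_inv_into_f_f[OF kinj] free_mod_def)
    qed
    show "\<exists>!c. c \<in> k ` B \<rightarrow>\<^sub>E Sym W \<and> finite {x \<in> k ` B. c x \<noteq> 0} \<and> m = (\<Oplus>\<^bsub>M\<^esub>x\<in>{x \<in> k ` B. c x \<noteq> 0}. c x \<odot>\<^bsub>M\<^esub> x)"
    proof (rule ex1I[of _ ?c])
      have "?c \<in> k ` B \<rightarrow> Sym W" by (rule Pi_I) (rule PiE_mem[OF cE])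
      from g(2)[OF this] show "?c \<in> k ` B \<rightarrow>\<^sub>E Sym W \<and> finite {x \<in> k ` B. ?c x \<noteq> 0} \<and>
          m = (\<Oplus>\<^bsub>M\<^esub>x\<in>{x \<in> k ` B. ?c x \<noteq> 0}. ?c x \<odot>\<^bsub>M\<^esub> x)"
        unfolding gf f(2) using cE fD(1) by (intro conjI) simp_all
      fix c assume c: "c \<in> k ` B \<rightarrow>\<^sub>E Sym W \<and> finite {x \<in> k ` B. c x \<noteq> 0} \<and>
          m = (\<Oplus>\<^bsub>M\<^esub>x\<in>{x \<in> k ` B. c x \<noteq> 0}. c x \<odot>\<^bsub>M\<^esub> x)"
      have c': "c \<in> k ` B \<rightarrow> Sym W" by (rule Pi_I) (rule PiE_mem[OF conjunct1[OF c]])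
      have "m = h (g c)" unfolding g(2)[OF c'] by (rule conjunct2[OF conjunct2[OF c]])
      then have "h (g c) = h f" unfolding f(2) by (rule sym)
      then have gc: "g c = f" unfolding fD(9)[OF g(1)[OF c'] f(1)] .
      show "c = ?c"
      proof (rule PiE_ext[OF conjunct1[OF c] cE])
        fix x assume "x \<in> k ` B"
        then obtain b where b: "b \<in> B" "x = k b" by blast
        have "g c b = g ?c b" unfolding gc gf ..
        then show "c x = ?c x" using b by (simp add: g_def)
      qed
    qed
  qed
  then show "is_basis (Sym_ring W) M ((\<lambda>b. h (unitv b)) ` B)" by (simp add: k_def[abs_def])
qed

text \<open>Generators for the submodule are among those for \<open>M\<close>. The generated
  subgroups are formed in different groups, so the unit and the inverses have to be compared;
  inverses agree because they solve the same equation in \<open>M\<close>.\<close>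

lemma irrelevant_part_submodule:
  assumes M: "Module.module (Sym_ring W) M" and R: "Module.module (Sym_ring W) (induced_module M N)"
    and N: "N \<subseteq> carrier M"
  shows "irrelevant_part W (induced_module M N) \<subseteq> irrelevant_part W M"
proof
  let ?R = "induced_module M N"
  interpret M: Module.module "Sym_ring W" M by fact
  interpret R: Module.module "Sym_ring W" ?R by fact
  have I: "carrier ?R = N" "\<zero>\<^bsub>?R\<^esub> = \<zero>\<^bsub>M\<^esub>" "\<And>x y. x \<oplus>\<^bsub>?R\<^esub> y = x \<oplus>\<^bsub>M\<^esub> y" "\<And>a x. a \<odot>\<^bsub>?R\<^esub> x = a \<odot>\<^bsub>M\<^esub> x"
    by (simp_all add: induced_module_def)
  let ?G = "{linear_form w \<odot>\<^bsub>?R\<^esub> m | w m. w \<in> W \<and> m \<in> carrier ?R}"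
  have G: "x \<in> {linear_form w \<odot>\<^bsub>M\<^esub> m | w m. w \<in> W \<and> m \<in> carrier M}" "x \<in> N" if x: "x \<in> ?G" for x
  proof -
    obtain w m where w: "w \<in> W" "m \<in> N" "x = linear_form w \<odot>\<^bsub>M\<^esub> m" using x unfolding I by (elim CollectE exE conjE) simp
    then show "x \<in> {linear_form w \<odot>\<^bsub>M\<^esub> m | w m. w \<in> W \<and> m \<in> carrier M}" using N by (intro CollectI exI conjI) auto
    show "x \<in> N" using R.smult_closed[unfolded Sym_ring_simps I, OF Sym_linear[OF w(1)] w(2)] w(3) by simp
  qed
  fix x assume "x \<in> irrelevant_part W ?R"
  then have "x \<in> generate (add_monoid ?R) ?G" by (simp only: irrelevant_part_def)
  then show "x \<in> irrelevant_part W M"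
    unfolding irrelevant_part_def
  proof induction
    case one
    have "\<one>\<^bsub>add_monoid ?R\<^esub> = \<one>\<^bsub>add_monoid M\<^esub>" using I(2) by simp
    then show ?case using generate.one[of "add_monoid M"] by (simp only:)
  next
    case (incl x)
    show ?case by (rule generate.incl[OF G(1)[OF incl]])
  next
    case (inv x)
    have xN: "x \<in> N" by (rule G(2)[OF inv])
    have y: "\<ominus>\<^bsub>?R\<^esub> x \<in> N" using R.a_inv_closed[of x, unfolded I, OF xN] .
    have "\<ominus>\<^bsub>?R\<^esub> x \<oplus>\<^bsub>M\<^esub> x = \<zero>\<^bsub>M\<^esub>" using R.l_neg[of x, unfolded I, OF xN] .
    then have "\<ominus>\<^bsub>M\<^esub> x = \<ominus>\<^bsub>?R\<^esub> x" using y xN N by (intro M.minus_equality) auto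
    then have "inv\<^bsub>add_monoid ?R\<^esub> x = inv\<^bsub>add_monoid M\<^esub> x" by (simp only: a_inv_def)
    then show ?case using generate.inv[OF G(1)[OF inv], of "add_monoid M"] by (simp only:)
  next
    case (eng x y)
    have "x \<otimes>\<^bsub>add_monoid ?R\<^esub> y = x \<otimes>\<^bsub>add_monoid M\<^esub> y" using I(3)[of x y] by simp
    then show ?case using generate.eng[OF eng.IH] by (simp only:)
  qed
qed

lemma homog_sqfree_mon: "homog (2 * int (card G)) (sqfree_mon G)"
  using homog_single[of "sqfree_exp G" 1] by (simp add: mdeg_sqfree_exp)

section \<open>The push-forward of the structure sheaf\<close>

definition restrict_poly :: "'i::finite set set \<Rightarrow> 'i mpoly \<Rightarrow> 'i set \<Rightarrow> 'i mpoly" where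
  "restrict_poly C p = (\<lambda>G\<in>C. trunc (Pow G) p)"

lemma lookup_supported: "p \<in> supported C \<Longrightarrow> Poly_Mapping.keys m \<notin> C \<Longrightarrow> Poly_Mapping.lookup p m = 0"
  unfolding supported_iff_trunc using lookup_trunc[of C p m] by simp

lemma supportedI: "(\<And>m. Poly_Mapping.keys m \<notin> C \<Longrightarrow> Poly_Mapping.lookup p m = 0) \<Longrightarrow> p \<in> supported C"
  unfolding supported_iff_trunc by (rule poly_mapping_eqI) (simp add: lookup_trunc)

lemma lookup_trunc_Pow_keys: "Poly_Mapping.keys m \<subseteq> G \<Longrightarrow> Poly_Mapping.lookup (trunc (Pow G) p) m = Poly_Mapping.lookup p m"
  by (simp add: lookup_trunc)

text \<open>The coefficient of a monomial can be read off at the member of \<open>C\<close> that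
  equals its support.\<close>

lemma restrict_poly_inj:
  assumes "p \<in> supported C" "q \<in> supported C" and eq: "restrict_poly C p = restrict_poly C q"
  shows "p = q"
proof (rule poly_mapping_eqI)
  fix m show "Poly_Mapping.lookup p m = Poly_Mapping.lookup q m"
  proof (cases "Poly_Mapping.keys m \<in> C")
    case True
    have "trunc (Pow (Poly_Mapping.keys m)) p = trunc (Pow (Poly_Mapping.keys m)) q"
      using fun_cong[OF eq, of "Poly_Mapping.keys m"] True by (simp add: restrict_poly_def)
    then show ?thesis using lookup_trunc_Pow_keys[of m "Poly_Mapping.keys m"] by (metis order_refl)
  next
    case False
    show ?thesis unfolding lookup_supported[OF assms(1) False] lookup_supported[OF assms(2) False] ..
  qed
qed

lemma restrict_poly_trunc:
  assumes "\<And>G H. G \<in> C \<Longrightarrow> H \<subseteq> G \<Longrightarrow> H \<in> D"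
  shows "restrict_poly C (trunc D p) = restrict_poly C p"
  unfolding restrict_poly_def trunc_trunc
proof (rule restrict_ext)
  fix G assume "G \<in> C"
  then have "Pow G \<inter> D = Pow G" using assms by auto
  then show "trunc (Pow G \<inter> D) p = trunc (Pow G) p" by simp
qed

lemma restrict_restrict_poly: "D \<subseteq> C \<Longrightarrow> restrict (restrict_poly C p) D = restrict_poly D p"
  by (simp add: restrict_poly_def Int_absorb1)

text \<open>Taking \<open>D\<close> to be \<open>C\<close> treats all sections over
  \<open>C\<close>; taking \<open>D\<close> to be a fibre treats those vanishing on the boundary.
  The condition \<open>eq\<close> ensures that on multiples of the generators the truncations to
  \<open>C\<close> and \<open>D\<close> agree.\<close>

lemma restrict_poly_frame:
  fixes C :: "'i::finite set set" and M :: "('i mpoly, 'i set \<Rightarrow> 'i mpoly) gr_module"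
  assumes down: "\<And>G H. G \<in> C \<Longrightarrow> H \<subseteq> G \<Longrightarrow> H \<in> C" and D: "D \<subseteq> C" and basis: "sqfree_basis W D B"
    and eq: "\<And>a b. b \<in> B \<Longrightarrow> trunc C (a * sqfree_mon b) = trunc D (a * sqfree_mon b)"
    and M: "carrier M = restrict_poly C ` supported D" "\<zero>\<^bsub>M\<^esub> = (\<lambda>G\<in>C. 0)"
      "\<And>s t. s \<oplus>\<^bsub>M\<^esub> t = (\<lambda>G\<in>C. s G + t G)" "\<And>a s. a \<odot>\<^bsub>M\<^esub> s = (\<lambda>G\<in>C. trunc (Pow G) a * s G)"
      "\<And>d. gr M d = {s \<in> carrier M. \<forall>G\<in>C. homog d (s G)}"
  shows "frame W M B (\<lambda>b. 2 * int (card b)) (\<lambda>f. restrict_poly C (\<Sum>b\<in>B. f b * sqfree_mon b))"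
proof -
  define T where "T f = (\<Sum>b\<in>B. f b * sqfree_mon b)" for f :: "'i set \<Rightarrow> 'i mpoly"
  have fin: "finite B" by simp
  have T_trunc: "trunc C (T f) = (\<Sum>b\<in>B. trunc D (f b * sqfree_mon b))" for f
    unfolding T_def trunc_sum by (rule sum.cong[OF refl]) (rule eq)
  have T_supp: "trunc C (T f) \<in> supported D" for f
    unfolding T_trunc trunc_sum[symmetric] by (rule trunc_supported)
  have tr: "restrict_poly C (trunc C p) = restrict_poly C p" for p by (rule restrict_poly_trunc) (rule down)
  have bij: "bij_betw (\<lambda>f. restrict_poly C (T f)) (free_mod W B) (carrier M)"
    unfolding bij_betw_def
  proof
    show "inj_on (\<lambda>f. restrict_poly C (T f)) (free_mod W B)"
    proof (rule inj_onI)
      fix f g assume f: "f \<in> free_mod W B" and g: "g \<in> free_mod W B" and fg: "restrict_poly C (T f) = restrict_poly C (T g)"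
      have "restrict_poly C (trunc C (T f)) = restrict_poly C (trunc C (T g))" unfolding tr by (rule fg)
      then have "trunc C (T f) = trunc C (T g)" by (rule restrict_poly_inj[OF trunc_supported trunc_supported])
      then have z: "(\<Sum>b\<in>B. trunc D ((f b - g b) * sqfree_mon b)) = 0"
        unfolding T_trunc by (simp add: left_diff_distrib trunc_diff sum_subtractf)
      have d: "\<forall>b\<in>B. f b - g b \<in> Sym W" by (intro ballI Sym_diff free_mod_Sym[OF f] free_mod_Sym[OF g])
      have "\<forall>b\<in>B. f b - g b = 0"
        by (rule conjunct2[OF conjunct2[OF basis[unfolded sqfree_basis_def]], THEN spec[of _ "\<lambda>b. f b - g b"], THEN mp, OF d, THEN mp, OF z])
      then show "f = g"
        using f g by (intro ext) (auto simp: free_mod_def)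
    qed
    show "(\<lambda>f. restrict_poly C (T f)) ` free_mod W B = carrier M"
    proof (intro equalityI subsetI)
      fix s assume "s \<in> (\<lambda>f. restrict_poly C (T f)) ` free_mod W B"
      then obtain f where "s = restrict_poly C (T f)" by blast
      then have "s = restrict_poly C (trunc C (T f))" by (simp add: tr)
      then show "s \<in> carrier M" unfolding M(1) using T_supp by blast
    next
      fix s assume "s \<in> carrier M"
      then obtain p where p: "p \<in> supported D" "s = restrict_poly C p" unfolding M(1) by blast
      obtain a where a: "\<forall>G\<in>B. a G \<in> Sym W" "p = (\<Sum>G\<in>B. trunc D (a G * sqfree_mon G))"
        using basis p(1) unfolding sqfree_basis_def by meson
      let ?f = "\<lambda>b. if b \<in> B then a b else 0"
      have "trunc C (T ?f) = p" unfolding T_trunc a(2) by (rule sum.cong) auto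
      then have "s = restrict_poly C (T ?f)" using tr[where p = "T ?f"] p(2) by simp
      moreover have "?f \<in> free_mod W B" using a(1) by (auto simp: free_mod_def)
      ultimately show "s \<in> (\<lambda>f. restrict_poly C (T f)) ` free_mod W B" by blast
    qed
  qed
  have T_homcomp: "T (homcomp (\<lambda>b. 2 * int (card b)) d f) = hcomp d (T f)" for d f
    unfolding T_def hcomp_sum
  proof (rule sum.cong[OF refl])
    fix b
    have "hcomp (2 * int (card b) + (d - 2 * int (card b))) (sqfree_mon b * f b) = sqfree_mon b * hcomp (d - 2 * int (card b)) (f b)"
      by (rule hcomp_mult_homog[OF homog_sqfree_mon])
    then show "homcomp (\<lambda>b. 2 * int (card b)) d f b * sqfree_mon b = hcomp d (f b * sqfree_mon b)"
      by (simp add: homcomp_def mult.commute)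
  qed
  have gr: "gr M d = (\<lambda>f. restrict_poly C (T f)) ` {f \<in> free_mod W B. fhom (\<lambda>b. 2 * int (card b)) d f}" for d
  proof (intro equalityI subsetI)
    fix s assume "s \<in> gr M d"
    then have s: "s \<in> carrier M" "\<And>G. G \<in> C \<Longrightarrow> homog d (s G)" unfolding M(5) by auto
    obtain f where f: "f \<in> free_mod W B" "s = restrict_poly C (T f)"
      using s(1) bij_betw_imp_surj_on[OF bij] by blast
    have "restrict_poly C (hcomp d (T f)) = s"
    proof
      fix G show "restrict_poly C (hcomp d (T f)) G = s G"
        using hcomp_homog[OF s(2), of G d] f(2) by (cases "G \<in> C") (simp_all add: restrict_poly_def hcomp_trunc[symmetric])
    qed
    then have "s = restrict_poly C (T (homcomp (\<lambda>b. 2 * int (card b)) d f))" unfolding T_homcomp ..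
    then show "s \<in> (\<lambda>f. restrict_poly C (T f)) ` {f \<in> free_mod W B. fhom (\<lambda>b. 2 * int (card b)) d f}"
      by (rule image_eqI[where x = "homcomp (\<lambda>b. 2 * int (card b)) d f"]) (simp add: free_mod_closed(5)[OF f(1)])
  next
    fix s assume "s \<in> (\<lambda>f. restrict_poly C (T f)) ` {f \<in> free_mod W B. fhom (\<lambda>b. 2 * int (card b)) d f}"
    then obtain f where f: "f \<in> free_mod W B" "fhom (\<lambda>b. 2 * int (card b)) d f" "s = restrict_poly C (T f)" by blast
    have "homog d (f b * sqfree_mon b)" for b
      using homog_mult[OF _ homog_sqfree_mon, of "d - 2 * int (card b)" "f b" b] f(2) by (simp add: fhom_def)
    then have "homog d (T f)" unfolding T_def by (intro homog_sum)
    then have "\<forall>G\<in>C. homog d (s G)" unfolding f(3) restrict_poly_def by (simp add: homog_trunc)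
    moreover have "s \<in> carrier M" unfolding f(3) by (rule bij_betwE[OF bij, rule_format, OF f(1)])
    ultimately show "s \<in> gr M d" unfolding M(5) by simp
  qed
  have T0: "T 0 = 0" by (simp add: T_def zero_fun_apply)
  have Tadd: "T (f + g) = T f + T g" for f g by (simp add: T_def plus_fun_apply distrib_right sum.distrib)
  have Tsm: "T (smul a f) = a * T f" for a f by (simp add: T_def smul_def sum_distrib_left mult.assoc)
  have "frame W M B (\<lambda>b. 2 * int (card b)) (\<lambda>f. restrict_poly C (T f))"
    unfolding frame_def T0 Tadd Tsm M(2-4)
  proof (intro conjI ballI allI fin bij gr)
    show "restrict_poly C 0 = (\<lambda>G\<in>C. 0)" by (simp add: restrict_poly_def)
    show "restrict_poly C (T f + T g) = (\<lambda>G\<in>C. restrict_poly C (T f) G + restrict_poly C (T g) G)" for f g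
      unfolding restrict_poly_def by (rule restrict_ext) (simp add: trunc_add)
    show "restrict_poly C (a * T f) = (\<lambda>G\<in>C. trunc (Pow G) a * restrict_poly C (T f) G)" for a f
      unfolding restrict_poly_def by (rule restrict_ext) (simp add: trunc_Pow_mult)
  qed
  then show ?thesis by (simp only: T_def)
qed

lemma Collect_conjD1: "x \<in> {x. P x \<and> S x} \<Longrightarrow> P x" and Collect_conjD2: "x \<in> {x. P x \<and> S x} \<Longrightarrow> S x"
  by simp_all

section \<open>Faces of a flat and sections over them\<close>

context simplified_arrangement
begin

abbreviation "Q \<equiv> structure_module (arr_sheaf V')"
abbreviation "E \<equiv> push_sheaf I V V'"
abbreviation "fibre \<equiv> flat_fibre I V V'"

definition faces :: "'i set \<Rightarrow> 'i set set" where
  "faces F = {G \<in> flats I V'. flat_closure I V G \<le> F}"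

lemma faces_eq:
  assumes F: "F \<in> flats I V"
  shows "faces F = {G \<in> flats I V'. G \<subseteq> F}"
  unfolding faces_def by (rule Collect_cong, rule conj_cong[OF refl], rule flat_closure(2)[OF _ F])

lemma facesD: "G \<in> faces F \<Longrightarrow> G \<in> flats I V'" "G \<in> faces F \<Longrightarrow> flat_closure I V G \<subseteq> F"
  by (simp_all add: faces_def)

lemma faces_down:
  assumes F: "F \<in> flats I V" and G: "G \<in> faces F" and H: "H \<subseteq> G"
  shows "H \<in> faces F"
proof -
  have G': "G \<in> flats I V'" "G \<subseteq> F" using G unfolding faces_eq[OF F] by simp_all
  show ?thesis
    unfolding faces_eq[OF F] using subset_flats_V'[OF G'(1) H] order_trans[OF H G'(2)] by (intro CollectI conjI)
qed

lemma face_closure: "G \<in> flats I V' \<Longrightarrow> G \<in> faces (flat_closure I V G)"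
  by (simp add: faces_def)

lemma faces_mono: "E' \<subseteq> F \<Longrightarrow> faces E' \<subseteq> faces F"
  unfolding faces_def by (rule Collect_mono) (rule impI, elim conjE, rule conjI, assumption, rule order_trans)

lemma card_face: "F \<in> flats I V \<Longrightarrow> G \<in> faces F \<Longrightarrow> int (card G) \<le> rk V F"
  by (rule card_le_rk) (simp_all add: faces_eq)

lemma fibre_iff: "F \<in> flats I V \<Longrightarrow> G \<in> fibre F \<longleftrightarrow> G \<in> faces F \<and> int (card G) = rk V F"
  by (simp add: flat_fibre_eq faces_eq)

lemma fibre_faces: "F \<in> flats I V \<Longrightarrow> fibre F \<subseteq> faces F"
  by (rule subsetI) (simp add: fibre_iff)

lemma fibre_maximal:
  assumes F: "F \<in> flats I V" and G: "G \<in> fibre F" and H: "H \<in> faces F" "G \<subseteq> H"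
  shows "H = G"
proof -
  have "int (card H) \<le> int (card G)" using card_face[OF F H(1)] G unfolding fibre_iff[OF F] by simp
  then have "card H \<le> card G" by simp
  from card_seteq[OF finite H(2) this] show ?thesis ..
qed

text \<open>For independent \<open>G\<close> the space V(G) is all of R^G, so the stalk is the full
  polynomial ring in the variables of \<open>G\<close>.\<close>

lemma Sym_stalk: "G \<in> flats I V' \<Longrightarrow> Sym (local_space V' G) = supported (Pow G)"
proof -
  assume "G \<in> flats I V'"
  then have "coord_proj G ` direction V = coord_subspace G" unfolding flats_V' indep_def by simp
  then show ?thesis unfolding local_space_def direction_V' by (simp add: Sym_coord_subspace)
qed

lemma Q_simps:
  "carrier (stalk Q G) = Sym (local_space V' G)" "\<zero>\<^bsub>stalk Q G\<^esub> = 0" "x \<oplus>\<^bsub>stalk Q G\<^esub> y = x + y"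
  "a \<odot>\<^bsub>stalk Q G\<^esub> x = a * x" "gr (stalk Q G) d = Sym_degree (local_space V' G) d" "res Q G H = trunc (Pow H)"
  by (simp_all add: structure_module_def ring_as_module_def)

text \<open>Compatible polynomials on the faces of a simplicial complex glue to a single polynomial.
  The coefficient of a monomial is taken from the face equal to its support, and compatibility makes
  all larger faces agree with it.\<close>

lemma sections_Q:
  assumes C: "C \<subseteq> flats I V'" and down: "\<And>G H. G \<in> C \<Longrightarrow> H \<subseteq> G \<Longrightarrow> H \<in> C"
  shows "sections Q C = restrict_poly C ` supported C"
proof (intro equalityI subsetI)
  fix s assume "s \<in> sections Q C"
  then have "s \<in> (\<Pi>\<^sub>E G\<in>C. Sym (local_space V' G)) \<and> (\<forall>G\<in>C. \<forall>H\<in>C. H \<subseteq> G \<longrightarrow> trunc (Pow H) (s G) = s H)"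
    unfolding sections_def Q_simps by (rule CollectD)
  note s = conjunct1[OF this] conjunct2[OF this]
  have sG: "s G \<in> supported (Pow G)" if "G \<in> C" for G
    using PiE_mem[OF s(1) that] Sym_stalk[OF subsetD[OF C that]] by simp
  \<comment> \<open>Only monomials whose support is exactly G are taken from the value at G, so none
    is counted twice.\<close>
  define p where "p = (\<Sum>G\<in>C. trunc {G} (s G))"
  have lp: "Poly_Mapping.lookup p m = (if Poly_Mapping.keys m \<in> C then Poly_Mapping.lookup (s (Poly_Mapping.keys m)) m else 0)" for m
  proof -
    have "Poly_Mapping.lookup p m = (\<Sum>G\<in>C. if Poly_Mapping.keys m = G then Poly_Mapping.lookup (s G) m else 0)"
      unfolding p_def lookup_sum by (rule sum.cong[OF refl]) (simp add: lookup_trunc)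
    also have "\<dots> = (if Poly_Mapping.keys m \<in> C then Poly_Mapping.lookup (s (Poly_Mapping.keys m)) m else 0)"
      by (rule sum.delta'[OF finite])
    finally show ?thesis .
  qed
  have tG: "trunc (Pow G) p = s G" if G: "G \<in> C" for G
  proof (rule poly_mapping_eqI)
    fix m
    show "Poly_Mapping.lookup (trunc (Pow G) p) m = Poly_Mapping.lookup (s G) m"
    proof (cases "Poly_Mapping.keys m \<subseteq> G")
      case True
      have H: "Poly_Mapping.keys m \<in> C" by (rule down[OF G True])
      have "trunc (Pow (Poly_Mapping.keys m)) (s G) = s (Poly_Mapping.keys m)" using s(2) G H True by simp
      then have "Poly_Mapping.lookup (s (Poly_Mapping.keys m)) m = Poly_Mapping.lookup (s G) m"
        using lookup_trunc_Pow_keys[OF order_refl, of m "s G"] by simp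
      then show ?thesis unfolding lookup_trunc_Pow_keys[OF True] lp using H by simp
    next
      case False
      then have "Poly_Mapping.keys m \<notin> Pow G" by simp
      from lookup_supported[OF sG[OF G] this] this show ?thesis unfolding lookup_trunc by simp
    qed
  qed
  have "s = restrict_poly C p"
  proof
    fix G show "s G = restrict_poly C p G"
      using tG[of G] PiE_arb[OF s(1), of G] by (cases "G \<in> C") (simp_all add: restrict_poly_def)
  qed
  moreover have "p \<in> supported C" by (rule supportedI) (simp add: lp)
  ultimately show "s \<in> restrict_poly C ` supported C" by (rule image_eqI)
next
  fix s assume "s \<in> restrict_poly C ` supported C"
  then obtain p where p: "s = restrict_poly C p" by blast
  show "s \<in> sections Q C"
    unfolding sections_def Q_simps p
  proof (intro CollectI conjI ballI impI)
    show "restrict_poly C p \<in> (\<Pi>\<^sub>E G\<in>C. Sym (local_space V' G))"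
      unfolding restrict_poly_def
    proof (intro restrict_PiE_iff[THEN iffD2] ballI)
      fix G assume "G \<in> C"
      show "trunc (Pow G) p \<in> Sym (local_space V' G)"
        unfolding Sym_stalk[OF subsetD[OF C \<open>G \<in> C\<close>]] by (rule trunc_supported)
    qed
    fix G H assume G: "G \<in> C" and H: "H \<in> C" "H \<le> G"
    have "Pow H \<inter> Pow G = Pow H" using H(2) by auto
    then show "trunc (Pow H) (restrict_poly C p G) = restrict_poly C p H"
      using G H(1) by (simp add: restrict_poly_def trunc_trunc)
  qed
qed

lemma E_simps:
  "carrier (stalk E F) = sections Q (faces F)" "\<zero>\<^bsub>stalk E F\<^esub> = (\<lambda>G\<in>faces F. 0)"
  "s \<oplus>\<^bsub>stalk E F\<^esub> t = (\<lambda>G\<in>faces F. s G + t G)" "a \<odot>\<^bsub>stalk E F\<^esub> s = (\<lambda>G\<in>faces F. trunc (Pow G) a * s G)"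
  "gr (stalk E F) d = {s \<in> sections Q (faces F). \<forall>G\<in>faces F. s G \<in> Sym_degree (local_space V' G) d}"
  "res E F F' s = restrict s (faces F')"
  unfolding push_sheaf_def pushforward_def section_module_def faces_def poly_proj_eq_trunc
  by (simp_all add: Q_simps)

lemma E_carrier: "F \<in> flats I V \<Longrightarrow> carrier (stalk E F) = restrict_poly (faces F) ` supported (faces F)"
  unfolding E_simps by (rule sections_Q[OF subsetI[OF facesD(1)] faces_down])

lemma restrict_poly_E: "F \<in> flats I V \<Longrightarrow> restrict_poly (faces F) p \<in> carrier (stalk E F)"
proof -
  assume F: "F \<in> flats I V"
  have "restrict_poly (faces F) (trunc (faces F) p) = restrict_poly (faces F) p"
    by (rule restrict_poly_trunc) (rule faces_down[OF F])
  then show ?thesis unfolding E_carrier[OF F] using trunc_supported[of "faces F" p] by (intro image_eqI) (rule sym)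
qed

lemma E_gr: "gr (stalk E F) d = {s \<in> carrier (stalk E F). \<forall>G\<in>faces F. homog d (s G)}"
  unfolding E_simps
proof (rule Collect_cong, rule conj_cong[OF refl], rule ball_cong[OF refl])
  fix s G assume s: "s \<in> sections Q (faces F)" and G: "G \<in> faces F"
  have "s \<in> (\<Pi>\<^sub>E G\<in>faces F. Sym (local_space V' G))" using s unfolding sections_def Q_simps by (rule Collect_conjD1)
  from PiE_mem[OF this G] show "(s G \<in> Sym_degree (local_space V' G) d) = homog d (s G)" by (simp add: Sym_degree_eq)
qed

section \<open>Square-free bases of the stalks of the push-forward\<close>

definition basis :: "'i set \<Rightarrow> 'i set set" where
  "basis F = (SOME B. sqfree_basis (local_space V F) (faces F) B)"

definition coords :: "'i set \<Rightarrow> ('i set \<Rightarrow> 'i mpoly) \<Rightarrow> 'i set \<Rightarrow> 'i mpoly" where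
  "coords F f = restrict_poly (faces F) (\<Sum>b\<in>basis F. f b * sqfree_mon b)"

definition fibre_coords :: "'i set \<Rightarrow> ('i set \<Rightarrow> 'i mpoly) \<Rightarrow> 'i set \<Rightarrow> 'i mpoly" where
  "fibre_coords F f = restrict_poly (faces F) (\<Sum>b\<in>fibre F. f b * sqfree_mon b)"

text \<open>Deletion and contraction are applied to V(F) with empty lower bound and upper bound
  \<open>F\<close>; a vector of V(F) is determined by its coordinates in \<open>F\<close>, which is
  the spanning condition.\<close>

lemma basis: "F \<in> flats I V \<Longrightarrow> sqfree_basis (local_space V F) (faces F) (basis F)"
proof -
  assume F: "F \<in> flats I V"
  have "G \<in> faces F \<longleftrightarrow> G \<in> indep_between (local_space V F) {} F" for G
    using indep_local_space[of G F V] flat_subset[OF F] unfolding faces_eq[OF F] flats_V' indep_between_def by auto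
  then have faces: "faces F = indep_between (local_space V F) {} F" by (rule Set.set_eqI)
  have sub: "subspace (local_space V F)" by (rule subspace_local_space[OF V])
  have "{} \<in> flats I V'"
  proof -
    obtain y where "y \<in> V'" using V'(2) by blast
    then have "zeros I y \<in> flats I V'" unfolding flats_eq by (rule imageI)
    from subset_flats_V'[OF this empty_subsetI] show ?thesis .
  qed
  then have e: "indep (local_space V F) {}" unfolding indep_local_space[OF empty_subsetI] flats_V' by simp
  have sp: "w = 0" if w: "w \<in> local_space V F" "\<And>i. i \<in> F \<Longrightarrow> w $ i = 0" for w
  proof -
    obtain v where "w = coord_proj F v" using w(1) by (auto simp: local_space_def)
    then show ?thesis using w(2) by (simp add: coord_proj_def vec_eq_iff)
  qed
  have "\<exists>B. sqfree_basis (local_space V F) (faces F) B"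
    unfolding faces by (rule sqfree_basis_exists[OF sub e empty_subsetI sp])
  then show ?thesis unfolding basis_def by (rule someI_ex)
qed

lemma basis_face: "F \<in> flats I V \<Longrightarrow> b \<in> basis F \<Longrightarrow> b \<in> faces F"
  by (rule subsetD[OF conjunct1[OF basis[unfolded sqfree_basis_def]]])

lemma E_frame: "F \<in> flats I V \<Longrightarrow> frame (local_space V F) (stalk E F) (basis F) (\<lambda>b. 2 * int (card b)) (coords F)"
proof -
  assume F: "F \<in> flats I V"
  show ?thesis
    unfolding coords_def[abs_def]
  proof (rule restrict_poly_frame[where D = "faces F"])
    show "\<And>G H. G \<in> faces F \<Longrightarrow> H \<subseteq> G \<Longrightarrow> H \<in> faces F" by (rule faces_down[OF F])
    show "sqfree_basis (local_space V F) (faces F) (basis F)" by (rule basis[OF F])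
    show "carrier (stalk E F) = restrict_poly (faces F) ` supported (faces F)" by (rule E_carrier[OF F])
    show "gr (stalk E F) d = {s \<in> carrier (stalk E F). \<forall>G\<in>faces F. homog d (s G)}" for d by (rule E_gr)
  qed (simp_all only: E_simps order_refl)
qed

text \<open>Members of the fibre are maximal faces, so only the part of a coefficient in the
  variables of \<open>G\<close> survives, whichever of the three families is used for
  truncation.\<close>

lemma trunc_mult_fibre:
  assumes F: "F \<in> flats I V" and G: "G \<in> fibre F"
  shows "trunc (faces F) (a * sqfree_mon G) = trunc (Pow G) a * sqfree_mon G"
    and "trunc (fibre F) (a * sqfree_mon G) = trunc (Pow G) a * sqfree_mon G"
    and "trunc {G} (a * sqfree_mon G) = trunc (Pow G) a * sqfree_mon G"
proof -
  note m = fibre_maximal[OF F G]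
  note GF = subsetD[OF fibre_faces[OF F]]
  show "trunc (faces F) (a * sqfree_mon G) = trunc (Pow G) a * sqfree_mon G"
    by (rule trunc_mult_sqfree_mon[OF finite GF[OF G] m])
  show "trunc (fibre F) (a * sqfree_mon G) = trunc (Pow G) a * sqfree_mon G"
    by (rule trunc_mult_sqfree_mon[OF finite G m[OF GF]])
  show "trunc {G} (a * sqfree_mon G) = trunc (Pow G) a * sqfree_mon G"
    by (rule trunc_mult_sqfree_mon[OF finite]) simp_all
qed

text \<open>Monomials with distinct supports do not interact, so the module splits into the pieces
  \<open>supported {G}\<close>. Each is free of rank one, because a vector of V(F) that vanishes on
  \<open>G\<close> vanishes on the closure \<open>F\<close> of \<open>G\<close>.\<close>

lemma sqfree_basis_fibre:
  assumes F: "F \<in> flats I V"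
  shows "sqfree_basis (local_space V F) (fibre F) (fibre F)"
proof -
  have single: "sqfree_basis (local_space V F) {G} {G}" if G: "G \<in> fibre F" for G
  proof (rule sqfree_basis_singleton)
    have G': "G \<in> flats I V'" "flat_closure I V G = F" using G unfolding flat_fibre_def by simp_all
    have GF: "G \<subseteq> F" using flat_closure(4)[OF G'(1)] G'(2) by simp
    show "subspace (local_space V F)" by (rule subspace_local_space[OF V])
    show "indep (local_space V F) G" unfolding indep_local_space[OF GF] using G'(1) unfolding flats_V' by simp
    fix w assume w: "w \<in> local_space V F" "\<And>i. i \<in> G \<Longrightarrow> w $ i = 0"
    obtain v where v: "v \<in> direction V" "w = coord_proj F v" using w(1) unfolding local_space_def by (elim imageE) (rule that)
    have v0: "v $ i = 0" if "i \<in> G" for i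
      using w(2)[OF that] subsetD[OF GF that] by (simp add: v(2) coord_proj_def)
    have "v $ i = 0" if "i \<in> F" for i
      by (rule flat_closure(3)[OF G'(1) v(1) v0]) (simp_all add: G'(2) that)
    then show "w = 0" by (simp add: v(2) coord_proj_def vec_eq_iff)
  qed
  have tr: "trunc (fibre F) (a * sqfree_mon G) = trunc {G} (a * sqfree_mon G)" if "G \<in> fibre F" for a G
    unfolding trunc_mult_fibre(2,3)[OF F that] ..
  show ?thesis
    unfolding sqfree_basis_def
  proof (intro conjI ballI allI impI order_refl)
    fix p assume p: "p \<in> supported (fibre F)"
    have "\<exists>a. a \<in> Sym (local_space V F) \<and> trunc {G} p = trunc {G} (a * sqfree_mon G)" if G: "G \<in> fibre F" for G
    proof -
      have "\<forall>q\<in>supported {G}. \<exists>a. (\<forall>H\<in>{G}. a H \<in> Sym (local_space V F)) \<and> q = (\<Sum>H\<in>{G}. trunc {G} (a H * sqfree_mon H))"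
        using single[OF G] unfolding sqfree_basis_def by (elim conjE)
      from bspec[OF this trunc_supported[of "{G}" p]] obtain a where
        "\<forall>H\<in>{G}. a H \<in> Sym (local_space V F)" "trunc {G} p = (\<Sum>H\<in>{G}. trunc {G} (a H * sqfree_mon H))" by (elim exE conjE)
      then show ?thesis by (intro exI[of _ "a G"]) simp
    qed
    then have "\<forall>G\<in>fibre F. \<exists>a. a \<in> Sym (local_space V F) \<and> trunc {G} p = trunc {G} (a * sqfree_mon G)" by (intro ballI)
    from bchoice[OF this] obtain a where
      a: "\<forall>G\<in>fibre F. a G \<in> Sym (local_space V F) \<and> trunc {G} p = trunc {G} (a G * sqfree_mon G)" by (elim exE)
    have "p = (\<Sum>G\<in>fibre F. trunc {G} p)"
    proof (rule poly_mapping_eqI)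
      fix m
      have "Poly_Mapping.lookup (\<Sum>G\<in>fibre F. trunc {G} p) m
        = (\<Sum>G\<in>fibre F. if Poly_Mapping.keys m = G then Poly_Mapping.lookup p m else 0)"
        unfolding lookup_sum by (rule sum.cong[OF refl]) (simp add: lookup_trunc)
      also have "\<dots> = (if Poly_Mapping.keys m \<in> fibre F then Poly_Mapping.lookup p m else 0)" by (rule sum.delta'[OF finite])
      also have "\<dots> = Poly_Mapping.lookup p m" using lookup_supported[OF p, of m] by (cases "Poly_Mapping.keys m \<in> fibre F") simp_all
      finally show "Poly_Mapping.lookup p m = Poly_Mapping.lookup (\<Sum>G\<in>fibre F. trunc {G} p) m" by (rule sym)
    qed
    also have "\<dots> = (\<Sum>G\<in>fibre F. trunc (fibre F) (a G * sqfree_mon G))"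
      by (rule sum.cong[OF refl]) (simp only: tr a[THEN bspec, THEN conjunct2])
    finally show "\<exists>a. (\<forall>G\<in>fibre F. a G \<in> Sym (local_space V F)) \<and> p = (\<Sum>G\<in>fibre F. trunc (fibre F) (a G * sqfree_mon G))"
      using a by (intro exI[of _ a] conjI ballI) simp_all
  next
    fix a G assume a: "\<forall>G\<in>fibre F. a G \<in> Sym (local_space V F)" and z: "(\<Sum>G\<in>fibre F. trunc (fibre F) (a G * sqfree_mon G)) = 0"
      and G: "G \<in> fibre F"
    have "trunc {G} (trunc (fibre F) (a H * sqfree_mon H)) = (if H = G then trunc {G} (a G * sqfree_mon G) else 0)"
      if H: "H \<in> fibre F" for H
    proof (cases "H = G")
      case True then show ?thesis by (simp add: tr[OF G] trunc_trunc)
    next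
      case False
      then have "{G} \<inter> {H} = {}" by simp
      then have "trunc {G} (trunc {H} (a H * sqfree_mon H)) = trunc {} (a H * sqfree_mon H)" unfolding trunc_trunc by simp
      also have "\<dots> = 0" by (rule poly_mapping_eqI) (simp add: lookup_trunc)
      finally show ?thesis using False by (simp add: tr[OF H])
    qed
    then have "trunc {G} (\<Sum>H\<in>fibre F. trunc (fibre F) (a H * sqfree_mon H)) = (\<Sum>H\<in>fibre F. if H = G then trunc {G} (a G * sqfree_mon G) else 0)"
      unfolding trunc_sum by (intro sum.cong[OF refl])
    also have "\<dots> = trunc {G} (a G * sqfree_mon G)" using G by simp
    finally have z': "(\<Sum>H\<in>{G}. trunc {G} (a H * sqfree_mon H)) = 0" unfolding z by simp
    have "\<forall>a. (\<forall>H\<in>{G}. a H \<in> Sym (local_space V F)) \<longrightarrow> (\<Sum>H\<in>{G}. trunc {G} (a H * sqfree_mon H)) = 0 \<longrightarrow> (\<forall>H\<in>{G}. a H = 0)"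
      using single[OF G] unfolding sqfree_basis_def by (elim conjE)
    from this[THEN spec[of _ a], THEN mp, THEN mp, OF _ z'] have "\<forall>H\<in>{G}. a H = 0" using bspec[OF a G] by simp
    then show "a G = 0" by simp
  qed
qed

section \<open>Sections vanishing on the boundary of a flat\<close>

abbreviation "R F \<equiv> rel_sections (flats I V) E F"

lemma R_simps:
  "\<zero>\<^bsub>R F\<^esub> = \<zero>\<^bsub>stalk E F\<^esub>" "s \<oplus>\<^bsub>R F\<^esub> t = s \<oplus>\<^bsub>stalk E F\<^esub> t" "a \<odot>\<^bsub>R F\<^esub> s = a \<odot>\<^bsub>stalk E F\<^esub> s"
  "gr (R F) d = gr (stalk E F) d \<inter> carrier (R F)" "R F = induced_module (stalk E F) (carrier (R F))"
  "carrier (R F) = {m \<in> carrier (stalk E F). \<forall>y\<in>flats I V. y < F \<longrightarrow> res E F y m = \<zero>\<^bsub>stalk E y\<^esub>}"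
  unfolding rel_sections_def by (simp_all add: induced_module_def)

text \<open>A monomial whose support has closure smaller than \<open>F\<close> is visible at that
  closure, so its coefficient must vanish. Conversely, no face of a smaller flat contains a set with
  closure \<open>F\<close>.\<close>

lemma R_carrier:
  assumes F: "F \<in> flats I V"
  shows "carrier (R F) = restrict_poly (faces F) ` supported (fibre F)"
proof (intro equalityI subsetI)
  fix s assume "s \<in> carrier (R F)"
  then have "s \<in> carrier (stalk E F) \<and> (\<forall>y\<in>flats I V. y < F \<longrightarrow> restrict s (faces y) = (\<lambda>G\<in>faces y. 0))"
    unfolding R_simps(6) E_simps(2,6) by (rule CollectD)
  note s = conjunct1[OF this] conjunct2[OF this]
  obtain p where p: "p \<in> supported (faces F)" "s = restrict_poly (faces F) p" using s(1) unfolding E_carrier[OF F] by blast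
  have "p \<in> supported (fibre F)"
  proof (rule supportedI)
    fix m :: "'i \<Rightarrow>\<^sub>0 nat" assume m: "Poly_Mapping.keys m \<notin> fibre F"
    show "Poly_Mapping.lookup p m = 0"
    proof (cases "Poly_Mapping.keys m \<in> faces F")
      case True
      define G where "G = Poly_Mapping.keys m"
      have G: "G \<in> flats I V'" "flat_closure I V G \<subseteq> F" using facesD[OF True] by (simp_all add: G_def)
      have ne: "flat_closure I V G \<noteq> F" using m G(1) unfolding flat_fibre_def G_def by simp
      have "restrict s (faces (flat_closure I V G)) G = 0"
        using s(2) flat_closure(1)[OF G(1)] psubsetI[OF G(2) ne] face_closure[OF G(1)] by simp
      then have "trunc (Pow G) p = 0" using face_closure[OF G(1)] True by (simp add: p(2) restrict_poly_def G_def)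
      then show ?thesis using lookup_trunc_Pow_keys[of m G p] by (simp add: G_def)
    qed (rule lookup_supported[OF p(1)])
  qed
  then show "s \<in> restrict_poly (faces F) ` supported (fibre F)" unfolding p(2) by (rule imageI)
next
  fix s assume "s \<in> restrict_poly (faces F) ` supported (fibre F)"
  then obtain p where p: "p \<in> supported (fibre F)" "s = restrict_poly (faces F) p" by blast
  show "s \<in> carrier (R F)"
    unfolding R_simps(6) E_simps(2,6)
  proof (intro CollectI conjI ballI impI)
    show "s \<in> carrier (stalk E F)" unfolding p(2) by (rule restrict_poly_E[OF F])
    fix y assume y: "y \<in> flats I V" "y < F"
    have "trunc (Pow G) p = 0" if G: "G \<in> faces y" for G
    proof (rule poly_mapping_eqI)
      fix m :: "'i \<Rightarrow>\<^sub>0 nat"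
      have "Poly_Mapping.keys m \<notin> fibre F" if "Poly_Mapping.keys m \<subseteq> G"
      proof
        assume "Poly_Mapping.keys m \<in> fibre F"
        then have "flat_closure I V (Poly_Mapping.keys m) = F" by (simp add: flat_fibre_def)
        moreover have "flat_closure I V (Poly_Mapping.keys m) \<subseteq> y" by (rule facesD(2)[OF faces_down[OF y(1) G that]])
        ultimately show False using y(2) by simp
      qed
      then show "Poly_Mapping.lookup (trunc (Pow G) p) m = Poly_Mapping.lookup 0 m"
        using lookup_supported[OF p(1), of m] by (cases "Poly_Mapping.keys m \<subseteq> G") (simp_all add: lookup_trunc)
    qed
    then show "restrict s (faces y) = (\<lambda>G\<in>faces y. 0)"
      unfolding p(2) restrict_restrict_poly[OF faces_mono[OF psubset_imp_subset[OF y(2)]]]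
      unfolding restrict_poly_def by (rule restrict_ext)
  qed
qed

lemma R_frame: "F \<in> flats I V \<Longrightarrow> frame (local_space V F) (R F) (fibre F) (\<lambda>b. 2 * int (card b)) (fibre_coords F)"
proof -
  assume F: "F \<in> flats I V"
  have sub: "carrier (R F) \<subseteq> carrier (stalk E F)" unfolding R_simps(6) by (rule Collect_restrict)
  show ?thesis
    unfolding fibre_coords_def[abs_def]
  proof (rule restrict_poly_frame[where D = "fibre F"])
    show "\<And>G H. G \<in> faces F \<Longrightarrow> H \<subseteq> G \<Longrightarrow> H \<in> faces F" by (rule faces_down[OF F])
    show "fibre F \<subseteq> faces F" by (rule fibre_faces[OF F])
    show "sqfree_basis (local_space V F) (fibre F) (fibre F)" by (rule sqfree_basis_fibre[OF F])
    show "trunc (faces F) (a * sqfree_mon b) = trunc (fibre F) (a * sqfree_mon b)" if "b \<in> fibre F" for a b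
      unfolding trunc_mult_fibre(1,2)[OF F that] ..
    show "carrier (R F) = restrict_poly (faces F) ` supported (fibre F)" by (rule R_carrier[OF F])
    show "gr (R F) d = {s \<in> carrier (R F). \<forall>G\<in>faces F. homog d (s G)}" for d
      unfolding R_simps(4) E_gr using sub by auto
  qed (simp_all only: R_simps(1-3) E_simps)
qed

text \<open>Maximality of \<open>G\<close> among the faces makes x_G truncate to 0 at every other
  face, so the section of the monomial is concentrated on \<open>G\<close>.\<close>

lemma fibre_element_eq:
  assumes F: "F \<in> flats I V" and G: "G \<in> fibre F"
  shows "fibre_element I V V' F G = fibre_coords F (unitv G)"
proof -
  have "(\<Sum>b\<in>fibre F. unitv G b * sqfree_mon b) = (\<Sum>b\<in>fibre F. if b = G then sqfree_mon b else 0)"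
    by (rule sum.cong) (auto simp: unitv_def)
  also have "\<dots> = sqfree_mon G" using G by simp
  finally have s: "(\<Sum>b\<in>fibre F. unitv G b * sqfree_mon b) = sqfree_mon G" .
  have "trunc (Pow G') (sqfree_mon G) = (if G' = G then sqfree_mon G else 0)" if G': "G' \<in> faces F" for G'
    using fibre_maximal[OF F G G'] by (auto simp: trunc_single)
  then show ?thesis
    unfolding fibre_element_def fibre_coords_def s restrict_poly_def faces_def[symmetric] prod_var_poly[OF finite]
    by (intro restrict_ext) simp
qed

lemma fibre_basis:
  assumes F: "F \<in> flats I V"
  shows "inj_on (fibre_element I V V' F) (fibre F)"
    and "is_basis (rstalk (arr_sheaf V) F) (R F) (fibre_element I V V' F ` fibre F)"
    and "fibre_element I V V' F ` fibre F \<subseteq> gr (R F) (2 * rk V F)"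
proof -
  note fr = R_frame[OF F]
  have inj: "inj_on (fibre_element I V V' F) (fibre F) \<longleftrightarrow> inj_on (\<lambda>G. fibre_coords F (unitv G)) (fibre F)"
    by (rule inj_on_cong) (rule fibre_element_eq[OF F])
  have im: "fibre_element I V V' F ` fibre F = (\<lambda>G. fibre_coords F (unitv G)) ` fibre F"
    by (rule image_cong[OF refl]) (rule fibre_element_eq[OF F])
  show "inj_on (fibre_element I V V' F) (fibre F)"
    unfolding inj by (rule frame_basis(1)[OF fr])
  show "is_basis (rstalk (arr_sheaf V) F) (R F) (fibre_element I V V' F ` fibre F)"
    unfolding arr_sheaf_simps im by (rule frame_basis(2)[OF fr])
  show "fibre_element I V V' F ` fibre F \<subseteq> gr (R F) (2 * rk V F)"
  proof (rule image_subsetI)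
    fix G assume G: "G \<in> fibre F"
    have d: "2 * int (card G) = 2 * rk V F" using G unfolding fibre_iff[OF F] by simp
    have "fhom (\<lambda>b. 2 * int (card b)) (2 * rk V F) (unitv G :: 'i set \<Rightarrow> 'i mpoly)"
      using fhom_unitv[of "\<lambda>b. 2 * int (card b)" G] unfolding d .
    then show "fibre_element I V V' F G \<in> gr (R F) (2 * rk V F)"
      unfolding fibre_element_eq[OF F G] frameD(6)[OF fr] using free_mod_closed(6)[OF G]
      by (intro imageI CollectI conjI)
  qed
qed

text \<open>With constant coefficients no new supports arise, and a basis monomial of top degree has
  a member of the fibre as support. Constant combinations of these therefore lift top degree classes
  to sections vanishing on the boundary.\<close>

lemma coords_top:
  assumes F: "F \<in> flats I V" and c: "\<And>b. b \<in> basis F \<Longrightarrow> int (card b) \<noteq> rk V F \<Longrightarrow> c b = 0"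
  shows "coords F (\<lambda>b. const_poly (c b)) \<in> carrier (R F)"
proof -
  have "trunc (fibre F) (\<Sum>b\<in>basis F. const_poly (c b) * sqfree_mon b) = (\<Sum>b\<in>basis F. const_poly (c b) * sqfree_mon b)"
    unfolding trunc_sum
  proof (rule sum.cong[OF refl])
    fix b assume b: "b \<in> basis F"
    show "trunc (fibre F) (const_poly (c b) * sqfree_mon b) = const_poly (c b) * sqfree_mon b"
    proof (cases "int (card b) = rk V F")
      case True
      then have "b \<in> fibre F" using basis_face[OF F b] unfolding fibre_iff[OF F] by simp
      then show ?thesis by (simp add: const_poly_def mult_single trunc_single)
    next
      case False
      then have "const_poly (c b) = (0 :: 'i mpoly)" using c[OF b] by (simp add: const_poly_def)
      then show ?thesis by simp
    qed
  qed
  then show ?thesis unfolding R_carrier[OF F] coords_def supported_iff_trunc[symmetric] by (rule imageI)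
qed

text \<open>A class in the reduced stalk depends only on the constant terms of the coordinates. In
  top degree the representative with exactly these constants as coordinates vanishes on the
  boundary.\<close>

lemma bar_top:
  assumes F: "F \<in> flats I V"
  shows "bar_inclusion (local_space V F) (stalk E F) ` gr (bar (local_space V F) (R F)) (2 * rk V F)
    = gr (bar (local_space V F) (stalk E F)) (2 * rk V F)"
proof -
  let ?W = "local_space V F" and ?M = "stalk E F" and ?d = "2 * rk V F" and ?dg = "\<lambda>b. 2 * int (card b)"
  note fr = E_frame[OF F] and M = frame_module[OF E_frame[OF F]] and R = frame_module[OF R_frame[OF F]]
  have sub: "carrier (R F) \<subseteq> carrier ?M" unfolding R_simps(6) by (rule Collect_restrict)
  have R': "Module.module (Sym_ring ?W) (induced_module ?M (carrier (R F)))"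
    by (rule subst[of "R F" _ "\<lambda>X. Module.module (Sym_ring ?W) X", OF R_simps(5) R])
  have "irrelevant_part ?W (induced_module ?M (carrier (R F))) \<subseteq> irrelevant_part ?W ?M"
    by (rule irrelevant_part_submodule[OF M R' sub])
  then have irr: "irrelevant_part ?W (R F) \<subseteq> irrelevant_part ?W ?M" unfolding R_simps(5)[of F, symmetric] .
  have incl: "bar_inclusion ?W ?M (irrelevant_part ?W (R F) +>\<^bsub>R F\<^esub> m) = irrelevant_part ?W ?M +>\<^bsub>?M\<^esub> m"
    if m: "m \<in> carrier (R F)" for m
    unfolding bar_inclusion_def
  proof (rule SUP_eq_const)
    have "\<one>\<^bsub>add_monoid (R F)\<^esub> \<in> irrelevant_part ?W (R F)" unfolding irrelevant_part_def by (rule generate.one)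
    then show "irrelevant_part ?W (R F) +>\<^bsub>R F\<^esub> m \<noteq> {}" unfolding a_r_coset_def' by blast
    obtain f where f: "f \<in> free_mod ?W (basis F)" "m = coords F f" using subsetD[OF sub m] frameD(8)[OF fr] by blast
    fix x assume "x \<in> irrelevant_part ?W (R F) +>\<^bsub>R F\<^esub> m"
    then obtain i where i: "i \<in> irrelevant_part ?W (R F)" "x = i \<oplus>\<^bsub>?M\<^esub> m" unfolding a_r_coset_def' R_simps(2) by blast
    have "i \<in> const_class ?W (basis F) (coords F) (\<lambda>_. 0)"
      using subsetD[OF irr i(1)] unfolding irrelevant_part_frame[OF M fr] .
    then obtain g where g: "g \<in> free_mod ?W (basis F)" "\<forall>b. const_term (g b) = 0" "i = coords F g" unfolding const_class_def by blast
    have x: "x = coords F (g + f)" unfolding i(2) g(3) f(2) frameD(4)[OF fr g(1) f(1)] ..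
    have "(\<lambda>b. const_term ((g + f) b)) = (\<lambda>b. const_term (f b))" using g(2) by (simp add: plus_fun_apply[of g f] lookup_add)
    then show "irrelevant_part ?W ?M +>\<^bsub>?M\<^esub> x = irrelevant_part ?W ?M +>\<^bsub>?M\<^esub> m"
      unfolding x f(2) coset_frame[OF M fr free_mod_closed(2)[OF g(1) f(1)]] coset_frame[OF M fr f(1)] by (rule arg_cong)
  qed
  have "gr (bar ?W (R F)) ?d = (\<lambda>m. irrelevant_part ?W (R F) +>\<^bsub>R F\<^esub> m) ` gr (R F) ?d"
    unfolding bar_def quotient_module_def by simp
  then have "bar_inclusion ?W ?M ` gr (bar ?W (R F)) ?d = (\<lambda>m. bar_inclusion ?W ?M (irrelevant_part ?W (R F) +>\<^bsub>R F\<^esub> m)) ` gr (R F) ?d"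
    by (simp only: image_image)
  also have "\<dots> = (\<lambda>m. irrelevant_part ?W ?M +>\<^bsub>?M\<^esub> m) ` gr (R F) ?d"
    by (rule image_cong[OF refl incl]) (simp only: R_simps(4) Int_iff)
  also have "\<dots> = (\<lambda>m. irrelevant_part ?W ?M +>\<^bsub>?M\<^esub> m) ` gr ?M ?d"
  proof (intro equalityI image_subsetI)
    fix m assume "m \<in> gr (R F) ?d"
    then have "m \<in> gr ?M ?d" unfolding R_simps(4) by (rule IntD1)
    then show "irrelevant_part ?W ?M +>\<^bsub>?M\<^esub> m \<in> (\<lambda>m. irrelevant_part ?W ?M +>\<^bsub>?M\<^esub> m) ` gr ?M ?d" by (rule imageI)
  next
    fix m assume "m \<in> gr ?M ?d"
    then obtain f where f: "f \<in> free_mod ?W (basis F)" "fhom ?dg ?d f" "m = coords F f" unfolding frameD(6)[OF fr] by blast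
    \<comment> \<open>Replacing each coordinate by its constant term changes the element only by a
      member of the irrelevant part; homogeneity leaves constants at top degree basis elements
      alone.\<close>
    define k :: "'i set \<Rightarrow> 'i mpoly" where "k = (\<lambda>b. const_poly (const_term (f b)))"
    have z: "const_term (f b) = 0" if "int (card b) \<noteq> rk V F" for b
      by (rule const_term_fhom[OF f(2)]) (use that in simp)
    have k: "k \<in> free_mod ?W (basis F)"
      unfolding k_def by (rule const_class_rep) (use f(1) in \<open>simp add: free_mod_def\<close>)
    have "homog (?d - ?dg b) (k b)" for b
    proof (cases "int (card b) = rk V F")
      case True then show ?thesis by (simp add: k_def)
    next
      case False
      have "k b = 0" unfolding k_def z[OF False] by (simp add: const_poly_def)
      then show ?thesis by simp
    qed
    then have "fhom ?dg ?d k" unfolding fhom_def by (rule allI)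
    then have "coords F k \<in> gr ?M ?d" unfolding frameD(6)[OF fr] using k by (intro imageI CollectI conjI)
    moreover have "coords F k \<in> carrier (R F)" unfolding k_def by (rule coords_top[OF F z])
    ultimately have kR: "coords F k \<in> gr (R F) ?d" unfolding R_simps(4) by (rule IntI)
    have "(\<lambda>b. const_term (f b)) = (\<lambda>b. const_term (k b))" by (simp add: k_def)
    then have "irrelevant_part ?W ?M +>\<^bsub>?M\<^esub> m = irrelevant_part ?W ?M +>\<^bsub>?M\<^esub> coords F k"
      unfolding f(3) coset_frame[OF M fr f(1)] coset_frame[OF M fr k] by (rule arg_cong)
    then show "irrelevant_part ?W ?M +>\<^bsub>?M\<^esub> m \<in> (\<lambda>m. irrelevant_part ?W ?M +>\<^bsub>?M\<^esub> m) ` gr (R F) ?d"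
      using kR by (rule image_eqI)
  qed
  also have "\<dots> = gr (bar ?W ?M) ?d" unfolding bar_def quotient_module_def by simp
  finally show ?thesis .
qed

text \<open>Basis monomials are supported on faces of \<open>F\<close>, whose size is at most the
  rank, so no basis element has a degree beyond twice the rank.\<close>

lemma bar_high:
  assumes F: "F \<in> flats I V" and d: "d > 2 * rk V F"
  shows "gr (bar (local_space V F) (stalk E F)) d = {\<zero>\<^bsub>bar (local_space V F) (stalk E F)\<^esub>}"
proof -
  note fr = E_frame[OF F] and M = frame_module[OF E_frame[OF F]]
  have e: "b \<notin> {b \<in> basis F. 2 * int (card b) = d}" for b
  proof
    assume "b \<in> {b \<in> basis F. 2 * int (card b) = d}"
    then have "b \<in> basis F" "2 * int (card b) = d" by simp_all
    then show False using card_face[OF F basis_face[OF F], of b] d by simp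
  qed
  have "{c :: 'i set \<Rightarrow> real. \<forall>b. b \<notin> {b \<in> basis F. 2 * int (card b) = d} \<longrightarrow> c b = 0} = {\<lambda>_. 0}"
    using e by (intro equalityI subsetI) (simp_all add: fun_eq_iff)
  then have "gr (bar (local_space V F) (stalk E F)) d = {const_class (local_space V F) (basis F) (coords F) (\<lambda>_. 0)}"
    unfolding gr_bar_frame[OF M fr] by simp
  also have "\<dots> = {irrelevant_part (local_space V F) (stalk E F)}" unfolding irrelevant_part_frame[OF M fr] ..
  also have "\<dots> = {\<zero>\<^bsub>bar (local_space V F) (stalk E F)\<^esub>}" unfolding bar_def quotient_module_def by simp
  finally show ?thesis .
qed

section \<open>Sheaf axioms, flabbiness and decomposition of the push-forward\<close>

lemma E_maps: "sheaf_maps (flats I V) (arr_sheaf V) E"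
  unfolding sheaf_maps_def arr_sheaf_simps Sym_ring_simps
proof (intro conjI ballI impI allI)
  fix x y assume x: "x \<in> flats I V" and y: "y \<in> flats I V" "y \<le> x"
  have yx: "faces y \<subseteq> faces x" by (rule faces_mono[OF y(2)])
  have car: "res E x y s \<in> carrier (stalk E y)" if s: "s \<in> carrier (stalk E x)" for s
  proof -
    obtain p where "s = restrict_poly (faces x) p" using s unfolding E_carrier[OF x] by blast
    then show ?thesis unfolding E_simps(6) using restrict_restrict_poly[OF yx, of p] restrict_poly_E[OF y(1), of p] by simp
  qed
  then show "res E x y \<in> carrier (stalk E x) \<rightarrow> carrier (stalk E y)" by (rule Pi_I)
  show "res E x y (m \<oplus>\<^bsub>stalk E x\<^esub> n) = res E x y m \<oplus>\<^bsub>stalk E y\<^esub> res E x y n" for m n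
    unfolding E_simps(3,6) restrict_restrict Int_absorb1[OF yx] by (rule restrict_ext) simp
  show "res E x y (a \<odot>\<^bsub>stalk E x\<^esub> m) = trunc (Pow y) a \<odot>\<^bsub>stalk E y\<^esub> res E x y m" for a m
    unfolding E_simps(4,6) restrict_restrict Int_absorb1[OF yx]
  proof (rule restrict_ext)
    fix G assume G: "G \<in> faces y"
    have "Pow G \<inter> Pow y = Pow G" using G unfolding faces_eq[OF y(1)] by auto
    then show "trunc (Pow G) a * m G = trunc (Pow G) (trunc (Pow y) a) * restrict m (faces y) G"
      using G by (simp add: trunc_trunc)
  qed
  show "res E x y ` gr (stalk E x) d \<subseteq> gr (stalk E y) d" for d
  proof (rule image_subsetI)
    fix s assume "s \<in> gr (stalk E x) d"
    then have s: "s \<in> carrier (stalk E x)" "\<forall>G\<in>faces x. homog d (s G)" unfolding E_gr by simp_all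
    have "\<forall>G\<in>faces y. homog d (res E x y s G)" using s(2) yx by (auto simp: E_simps(6))
    then show "res E x y s \<in> gr (stalk E y) d" unfolding E_gr using car[OF s(1)] by (intro CollectI conjI)
  qed
next
  fix x m assume x: "x \<in> flats I V" and "m \<in> carrier (stalk E x)"
  then obtain p where "m = restrict_poly (faces x) p" unfolding E_carrier[OF x] by blast
  then show "res E x x m = m" unfolding E_simps(6) using restrict_restrict_poly[OF order_refl, of "faces x" p] by simp
next
  fix x y z m assume "z \<le> (y :: 'i set)"
  then show "res E y z (res E x y m) = res E x z m"
    unfolding E_simps(6) restrict_restrict by (simp only: Int_absorb1[OF faces_mono])
qed

text \<open>A section over an open set is again given by a single polynomial, with supports among
  the faces whose closure lies in that set. The same polynomial defines a section over all
  flats.\<close>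

lemma E_flabby: "flabby (flats I V) E"
  unfolding flabby_def
proof (intro allI impI equalityI subsetI)
  fix U t assume U: "open_in (flats I V) U"
  then have UP: "U \<subseteq> flats I V" and Ud: "\<And>x y. x \<in> U \<Longrightarrow> y \<in> flats I V \<Longrightarrow> y \<subseteq> x \<Longrightarrow> y \<in> U"
    unfolding open_in_def by simp_all
  {
    assume "t \<in> (\<lambda>s. restrict s U) ` sections E (flats I V)"
    then obtain s where s: "s \<in> sections E (flats I V)" "t = restrict s U" by blast
    have s1: "s \<in> (\<Pi>\<^sub>E x\<in>flats I V. carrier (stalk E x))" "\<forall>x\<in>flats I V. \<forall>y\<in>flats I V. y \<le> x \<longrightarrow> res E x y (s x) = s y"
      using s(1) unfolding sections_def by simp_all
    show "t \<in> sections E U"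
      unfolding sections_def s(2)
    proof (intro CollectI conjI ballI impI restrict_PiE_iff[THEN iffD2])
      fix x assume x: "x \<in> U"
      show "s x \<in> carrier (stalk E x)" by (rule PiE_mem[OF s1(1) subsetD[OF UP x]])
      fix y assume y: "y \<in> U" "y \<le> x"
      have "res E x y (s x) = s y" using s1(2) subsetD[OF UP x] subsetD[OF UP y(1)] y(2) by simp
      then show "res E x y (restrict s U x) = restrict s U y" using x y(1) by simp
    qed
  next
    assume "t \<in> sections E U"
    then have t: "t \<in> (\<Pi>\<^sub>E x\<in>U. carrier (stalk E x))" "\<forall>x\<in>U. \<forall>y\<in>U. y \<le> x \<longrightarrow> restrict (t x) (faces y) = t y"
      unfolding sections_def E_simps(6) by simp_all
    let ?c = "flat_closure I V"
    define D where "D = {G \<in> flats I V'. ?c G \<in> U}"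
    \<comment> \<open>The coefficient of a monomial with support G is taken at the closure of G, the
      smallest flat at which it is visible.\<close>
    define p where "p = (\<Sum>G\<in>D. trunc {G} (t (?c G) G))"
    have lp: "Poly_Mapping.lookup p m = (if Poly_Mapping.keys m \<in> D then Poly_Mapping.lookup (t (?c (Poly_Mapping.keys m)) (Poly_Mapping.keys m)) m else 0)" for m
    proof -
      have "Poly_Mapping.lookup p m = (\<Sum>G\<in>D. if Poly_Mapping.keys m = G then Poly_Mapping.lookup (t (?c G) G) m else 0)"
        unfolding p_def lookup_sum by (rule sum.cong[OF refl]) (simp add: lookup_trunc)
      also have "\<dots> = (if Poly_Mapping.keys m \<in> D then Poly_Mapping.lookup (t (?c (Poly_Mapping.keys m)) (Poly_Mapping.keys m)) m else 0)"
        by (rule sum.delta'[OF finite])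
      finally show ?thesis .
    qed
    have tp: "restrict_poly (faces x) p = t x" if x: "x \<in> U" for x
    proof -
      have xP: "x \<in> flats I V" by (rule subsetD[OF UP x])
      obtain q where q: "t x = restrict_poly (faces x) q" using PiE_mem[OF t(1) x] unfolding E_carrier[OF xP] by blast
      have "trunc (Pow G) p = trunc (Pow G) q" if G: "G \<in> faces x" for G
      proof (rule poly_mapping_eqI)
        fix m
        show "Poly_Mapping.lookup (trunc (Pow G) p) m = Poly_Mapping.lookup (trunc (Pow G) q) m"
        proof (cases "Poly_Mapping.keys m \<subseteq> G")
          case True
          define H where "H = Poly_Mapping.keys m"
          have Hx: "H \<in> faces x" using faces_down[OF xP G True] by (simp add: H_def)
          have cH: "?c H \<in> U" by (rule Ud[OF x flat_closure(1)[OF facesD(1)[OF Hx]] facesD(2)[OF Hx]])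
          have HD: "H \<in> D" using facesD(1)[OF Hx] cH by (simp add: D_def)
          have "t (?c H) = restrict (t x) (faces (?c H))" using t(2) x cH facesD(2)[OF Hx] by simp
          then have "t (?c H) H = trunc (Pow H) q"
            using face_closure[OF facesD(1)[OF Hx]] Hx by (simp add: q restrict_poly_def)
          then have "Poly_Mapping.lookup p m = Poly_Mapping.lookup q m"
            using HD lookup_trunc_Pow_keys[of m H q] unfolding lp by (simp add: H_def)
          then show ?thesis unfolding lookup_trunc_Pow_keys[OF True] .
        qed (simp add: lookup_trunc)
      qed
      then show ?thesis unfolding q restrict_poly_def by (rule restrict_ext)
    qed
    define s where "s = (\<lambda>x\<in>flats I V. restrict_poly (faces x) p)"
    have "s \<in> sections E (flats I V)"
      unfolding sections_def E_simps(6)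
    proof (intro CollectI conjI ballI impI)
      show "s \<in> (\<Pi>\<^sub>E x\<in>flats I V. carrier (stalk E x))"
        unfolding s_def by (intro restrict_PiE_iff[THEN iffD2] ballI restrict_poly_E)
      fix x y assume x: "x \<in> flats I V" and y: "y \<in> flats I V" "y \<le> x"
      show "restrict (s x) (faces y) = s y"
        using x y(1) restrict_restrict_poly[OF faces_mono[OF y(2)], of p] by (simp add: s_def)
    qed
    moreover have "t = restrict s U"
    proof
      fix x show "t x = restrict s U x"
        using tp[of x] subsetD[OF UP, of x] PiE_arb[OF t(1), of x] by (cases "x \<in> U") (simp_all add: s_def)
    qed
    ultimately show "t \<in> (\<lambda>s. restrict s U) ` sections E (flats I V)" by (intro image_eqI[of t _ s])
  }
qed

lemma E_sheaf_frames: "sheaf_frames (flats I V) V E basis (\<lambda>F b. 2 * int (card b)) coords"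
  by (rule sheaf_frames.intro[OF E_frame E_maps E_flabby])

text \<open>Basis elements of top degree vanish on the boundary by \<open>coords_top\<close>. A
  section vanishing there has coordinates over the fibre, all of whose generators have degree twice
  the rank, so below that degree it is 0.\<close>

lemma E_decomposition:
  fixes L :: "'i set \<Rightarrow> ('i set, 'i mpoly, 'm) module_sheaf"
  assumes L: "\<And>F. F \<in> flats I V \<Longrightarrow> minimal_extension_sheaf (flats I V) (arr_sheaf V) F (L F)"
  shows "sheaf_iso (flats I V) (arr_sheaf V) E (direct_sum (flats I V)
     (\<lambda>F. tensor_sheaf (2 * rk V F) (degree_space (bar (local_space V F) (stalk E F)) (2 * rk V F)) (L F)))"
proof (rule pure_sheaf_decomposition[OF E_sheaf_frames frame_module[OF E_frame] _ _ _ L])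
  fix x b assume x: "x \<in> flats I V" and b: "b \<in> basis x"
  show "2 * int (card b) \<le> 2 * rk V x" using card_face[OF x basis_face[OF x b]] by simp
  fix y assume d: "2 * int (card b) = 2 * rk V x" and y: "y \<in> flats I V" "y \<subset> x"
  have u: "unitv b = (\<lambda>b'. const_poly (if b' = b then 1 else 0) :: 'i mpoly)"
    by (rule ext) (simp add: unitv_def const_poly_def)
  have "coords x (unitv b) \<in> carrier (R x)" unfolding u by (rule coords_top[OF x]) (use d in auto)
  then have "\<forall>y\<in>flats I V. y < x \<longrightarrow> res E x y (coords x (unitv b)) = \<zero>\<^bsub>stalk E y\<^esub>"
    unfolding R_simps(6) by (rule Collect_conjD2)
  then show "res E x y (coords x (unitv b)) = \<zero>\<^bsub>stalk E y\<^esub>" using y by simp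
next
  fix x m d assume x: "x \<in> flats I V" and m: "m \<in> gr (stalk E x) d"
    and rel: "\<And>y. y \<in> flats I V \<Longrightarrow> y \<subset> x \<Longrightarrow> res E x y m = \<zero>\<^bsub>stalk E y\<^esub>" and d: "d < 2 * rk V x"
  have "m \<in> carrier (stalk E x)" using m unfolding E_gr by (rule Collect_conjD1)
  then have "m \<in> carrier (R x)" unfolding R_simps(6) using rel by (intro CollectI conjI ballI impI)
  then have "m \<in> gr (R x) d" unfolding R_simps(4) using m by (intro IntI)
  then obtain g where g: "g \<in> free_mod (local_space V x) (fibre x)" "fhom (\<lambda>b. 2 * int (card b)) d g" "m = fibre_coords x g"
    unfolding frameD(6)[OF R_frame[OF x]] by blast
  have "g = 0"
  proof
    fix b show "g b = 0 b"
    proof (cases "b \<in> fibre x")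
      case True
      then have "d - 2 * int (card b) < 0" using d unfolding fibre_iff[OF x] by simp
      then show ?thesis using g(2) homog_neg[of "d - 2 * int (card b)" "g b"] unfolding fhom_def by (simp add: zero_fun_apply)
    next
      case False
      then show ?thesis using g(1) by (simp add: free_mod_def zero_fun_apply)
    qed
  qed
  then show "m = \<zero>\<^bsub>stalk E x\<^esub>" using g(3) frameD(3)[OF R_frame[OF x]] unfolding R_simps(1) by simp
qed

end

theorem lemma3p5:
  fixes I :: "'i::finite set" and V V' :: "(real ^ 'i) set"
  assumes "arrangement I V"
    and "simplification I V V'"
  shows
    "(\<forall>F\<in>flats I V.
        inj_on (fibre_element I V V' F) (flat_fibre I V V' F) \<and>
        is_basis (rstalk (arr_sheaf V) F) (rel_sections (flats I V) (push_sheaf I V V') F)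
          (fibre_element I V V' F ` flat_fibre I V V' F) \<and>
        fibre_element I V V' F ` flat_fibre I V V' F
          \<subseteq> gr (rel_sections (flats I V) (push_sheaf I V V') F) (2 * rk V F)) \<and>
     (\<forall>F\<in>flats I V.
        bar_inclusion (local_space V F) (stalk (push_sheaf I V V') F) `
            gr (bar (local_space V F) (rel_sections (flats I V) (push_sheaf I V V') F)) (2 * rk V F)
          = gr (bar (local_space V F) (stalk (push_sheaf I V V') F)) (2 * rk V F) \<and>
        (\<forall>d > 2 * rk V F.
           gr (bar (local_space V F) (stalk (push_sheaf I V V') F)) d
             = {\<zero>\<^bsub>bar (local_space V F) (stalk (push_sheaf I V V') F)\<^esub>})) \<and>
     (\<forall>L :: 'i set \<Rightarrow> ('i set, 'i mpoly, 'm) module_sheaf.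
        (\<forall>F\<in>flats I V. minimal_extension_sheaf (flats I V) (arr_sheaf V) F (L F)) \<longrightarrow>
        sheaf_iso (flats I V) (arr_sheaf V) (push_sheaf I V V')
          (direct_sum (flats I V)
             (\<lambda>F. tensor_sheaf (2 * rk V F)
                (degree_space (bar (local_space V F) (stalk (push_sheaf I V V') F)) (2 * rk V F))
                (L F))))"
proof -
  interpret simplified_arrangement I V V' by (rule simplified_arrangement.intro[OF assms])
  show ?thesis
  proof (intro conjI ballI allI impI)
    fix F assume F: "F \<in> flats I V"
    show "inj_on (fibre_element I V V' F) (flat_fibre I V V' F)"
      "is_basis (rstalk (arr_sheaf V) F) (rel_sections (flats I V) (push_sheaf I V V') F)
          (fibre_element I V V' F ` flat_fibre I V V' F)"
      "fibre_element I V V' F ` flat_fibre I V V' F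
          \<subseteq> gr (rel_sections (flats I V) (push_sheaf I V V') F) (2 * rk V F)"
      by (rule fibre_basis[OF F])+
    show "bar_inclusion (local_space V F) (stalk (push_sheaf I V V') F) `
            gr (bar (local_space V F) (rel_sections (flats I V) (push_sheaf I V V') F)) (2 * rk V F)
          = gr (bar (local_space V F) (stalk (push_sheaf I V V') F)) (2 * rk V F)" by (rule bar_top[OF F])
    show "gr (bar (local_space V F) (stalk (push_sheaf I V V') F)) d
             = {\<zero>\<^bsub>bar (local_space V F) (stalk (push_sheaf I V V') F)\<^esub>}" if "d > 2 * rk V F" for d
      by (rule bar_high[OF F that])
  next
    fix L :: "'i set \<Rightarrow> ('i set, 'i mpoly, 'm) module_sheaf"
    assume "\<forall>F\<in>flats I V. minimal_extension_sheaf (flats I V) (arr_sheaf V) F (L F)"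
    then show "sheaf_iso (flats I V) (arr_sheaf V) (push_sheaf I V V')
          (direct_sum (flats I V)
             (\<lambda>F. tensor_sheaf (2 * rk V F)
                (degree_space (bar (local_space V F) (stalk (push_sheaf I V V') F)) (2 * rk V F))
                (L F)))" by (intro E_decomposition) simp
  qed
qed

end
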